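(* Let $R$ be a finite $P_W$-algebra and let $L$ be an $R$-module with a free rank filtration $0 = F_{i+1}\subset F_i\subset\dots\subset F_0 = L$. Then the Krull dimension of $L/F_s$ is less than $s$. If in addition $R$ is connected and $F_{s+1}\neq F_s$, then $\operatorname{depth} F_s \ge s$.
   Context: Fix a prime $p$. All rings are graded commutative $\mathbb{F}_p$-algebras and all modules are graded; $\Sigma^d$ denotes suspension. For a finite dimensional $\mathbb{F}_p$-vector space $V$, $P_V$ is the symmetric algebra on $V^*$ with $V^*$ placed in degree $1$ if $p=2$ and degree $2$ if $p$ is odd; an inclusion $V\subset W$ induces a map $P_W\to P_V$. Fix a finite dimensional $\mathbb{F}_p$-vector space $W$. A finite $P_W$-algebra is a graded $\mathbb{F}_p$-algebra $R$ with a graded algebra map $P_W\to R$ making $R$ a finitely generated $P_W$-module. A graded algebra is connected if it is nonnegatively graded with degree $0$ part $\mathbb{F}_p$. An $R$-module is $j$-free if it is a suspension of an $R$-algebra of the form $P_V\otimes N$, where $V\subset W$ is a $j$-dimensional subspace, $N$ is a bounded (nonzero in only finitely many degrees) connected $\mathbb{F}_p$-algebra, and the composite $P_W\to R\to P_V\otimes N\to P_V$ (the last map using the augmentation $N\to\mathbb{F}_p$) is the map induced by $V\subset W$. A free rank filtration of an $R$-module $L$ is a descending filtration by $R$-submodules $0=F_{i+1}\subset F_i\subset\dots\subset F_0=L$ together with, for each $j$, a decomposition of $F_j/F_{j+1}$ as a finite direct sum of $j$-free modules. The Krull dimension of the zero module is taken to be negative (say $-\infty$). Depth is with respect to the ideal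 of positive degree elements of $R$. *)

theory Defs
  imports
    "HOL-Library.Poly_Mapping"
    "HOL-Library.Multiset"
    "HOL-Library.Extended_Real"
    "HOL-Library.Extended_Nat"
    "Berlekamp_Zassenhaus.Finite_Field"
    "HOL-Algebra.Algebra"
begin

hide_const (open) Multiset.mult Polynomial.smult Wellorder_Constructions.zero
  Ring_Hom.ring_hom

text \<open>
  The field with \<open>p\<close> elements is \<open>'p mod_ring\<close> for \<open>'p :: prime_card\<close>, with \<open>p = CARD('p)\<close>.
  All gradings are indexed by the integers.
\<close>

section \<open>Graded algebras and graded modules\<close>

text \<open>
  One record type serves for graded algebras over a field (\<^const>\<open>smult\<close> is the action of the
  field) and for graded modules over a graded ring (\<^const>\<open>smult\<close> is the action of the ring, and
  the fields \<^const>\<open>mult\<close> and \<^const>\<open>one\<close> are ignored, as usual for \<^type>\<open>module_ext\<close>).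
\<close>

record ('a, 'b) graded = "('a, 'b) module" +
  gpart :: "int \<Rightarrow> 'b set"

text \<open>
  The abelian group \<open>M\<close> is the internal direct sum of the subgroups \<open>A i\<close>, \<open>i \<in> I\<close>.
\<close>

definition internal_direct_sum ::
    "('b, 'z) ring_scheme \<Rightarrow> ('i \<Rightarrow> 'b set) \<Rightarrow> 'i set \<Rightarrow> bool" where
  "internal_direct_sum M A I \<longleftrightarrow>
     (\<forall>i\<in>I. additive_subgroup (A i) M) \<and>
     (\<forall>x\<in>carrier M. \<exists>!f. (\<forall>i\<in>I. f i \<in> A i) \<and> (\<forall>i. i \<notin> I \<longrightarrow> f i = \<zero>\<^bsub>M\<^esub>) \<and>
        finite {i. f i \<noteq> \<zero>\<^bsub>M\<^esub>} \<and> x = (\<Oplus>\<^bsub>M\<^esub>i\<in>{i. f i \<noteq> \<zero>\<^bsub>M\<^esub>}. f i))"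

text \<open>The field itself, as a graded algebra concentrated in degree 0.\<close>

definition base_field :: "('k::field, 'k) graded" where
  "base_field = \<lparr>carrier = UNIV, mult = (*), one = 1, zero = 0, add = (+), smult = (*),
     gpart = (\<lambda>n. if n = 0 then UNIV else {0})\<rparr>"

locale graded_commutative_algebra =
  ring A + scalars: Module.module base_field A
  for A :: "('k::field, 'a) graded" (structure) +
  assumes smult_mult_left:
      "\<lbrakk>x \<in> carrier A; y \<in> carrier A\<rbrakk> \<Longrightarrow> (c \<odot> x) \<otimes> y = c \<odot> (x \<otimes> y)"
    and smult_mult_right:
      "\<lbrakk>x \<in> carrier A; y \<in> carrier A\<rbrakk> \<Longrightarrow> x \<otimes> (c \<odot> y) = c \<odot> (x \<otimes> y)"
    and grading: "internal_direct_sum A (gpart A) UNIV"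
    and gpart_smult: "x \<in> gpart A n \<Longrightarrow> c \<odot> x \<in> gpart A n"
    and gpart_one: "\<one> \<in> gpart A 0"
    and gpart_mult: "\<lbrakk>x \<in> gpart A m; y \<in> gpart A n\<rbrakk> \<Longrightarrow> x \<otimes> y \<in> gpart A (m + n)"
    and graded_commute:
      "\<lbrakk>x \<in> gpart A m; y \<in> gpart A n\<rbrakk> \<Longrightarrow>
         x \<otimes> y = (if odd m \<and> odd n then \<ominus> (y \<otimes> x) else y \<otimes> x)"

definition connected_algebra :: "('k::field, 'a) graded \<Rightarrow> bool" where
  "connected_algebra A \<longleftrightarrow>
     (\<forall>n<0. gpart A n = {\<zero>\<^bsub>A\<^esub>}) \<and>
     gpart A 0 = range (\<lambda>c. c \<odot>\<^bsub>A\<^esub> \<one>\<^bsub>A\<^esub>) \<and> \<one>\<^bsub>A\<^esub> \<noteq> \<zero>\<^bsub>A\<^esub>"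

definition bounded_algebra :: "('k::field, 'a) graded \<Rightarrow> bool" where
  "bounded_algebra A \<longleftrightarrow> finite {n. gpart A n \<noteq> {\<zero>\<^bsub>A\<^esub>}}"

definition graded_algebra_hom ::
    "('k::field, 'a) graded \<Rightarrow> ('k, 'b) graded \<Rightarrow> ('a \<Rightarrow> 'b) set" where
  "graded_algebra_hom A B = {h \<in> ring_hom A B.
     (\<forall>c. \<forall>x\<in>carrier A. h (c \<odot>\<^bsub>A\<^esub> x) = c \<odot>\<^bsub>B\<^esub> h x) \<and>
     (\<forall>n. h ` gpart A n \<subseteq> gpart B n)}"

text \<open>
  Left modules over a graded commutative algebra, which need not be commutative as a ring;
  hence the library locale for modules over commutative rings does not apply.
\<close>

locale graded_module =
  R?: graded_commutative_algebra R + M?: abelian_group M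
  for R :: "('k::field, 'r) graded" (structure) and M :: "('r, 'm) graded" (structure) +
  assumes smult_closed:
      "\<lbrakk>a \<in> carrier R; x \<in> carrier M\<rbrakk> \<Longrightarrow> a \<odot>\<^bsub>M\<^esub> x \<in> carrier M"
    and smult_l_distr:
      "\<lbrakk>a \<in> carrier R; b \<in> carrier R; x \<in> carrier M\<rbrakk> \<Longrightarrow>
         (a \<oplus>\<^bsub>R\<^esub> b) \<odot>\<^bsub>M\<^esub> x = (a \<odot>\<^bsub>M\<^esub> x) \<oplus>\<^bsub>M\<^esub> (b \<odot>\<^bsub>M\<^esub> x)"
    and smult_r_distr:
      "\<lbrakk>a \<in> carrier R; x \<in> carrier M; y \<in> carrier M\<rbrakk> \<Longrightarrow>
         a \<odot>\<^bsub>M\<^esub> (x \<oplus>\<^bsub>M\<^esub> y) = (a \<odot>\<^bsub>M\<^esub> x) \<oplus>\<^bsub>M\<^esub> (a \<odot>\<^bsub>M\<^esub> y)"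
    and smult_assoc1:
      "\<lbrakk>a \<in> carrier R; b \<in> carrier R; x \<in> carrier M\<rbrakk> \<Longrightarrow>
         (a \<otimes>\<^bsub>R\<^esub> b) \<odot>\<^bsub>M\<^esub> x = a \<odot>\<^bsub>M\<^esub> (b \<odot>\<^bsub>M\<^esub> x)"
    and smult_one: "x \<in> carrier M \<Longrightarrow> \<one>\<^bsub>R\<^esub> \<odot>\<^bsub>M\<^esub> x = x"
    and module_grading: "internal_direct_sum M (gpart M) UNIV"
    and gpart_module_smult:
      "\<lbrakk>a \<in> gpart R m; x \<in> gpart M n\<rbrakk> \<Longrightarrow> a \<odot>\<^bsub>M\<^esub> x \<in> gpart M (m + n)"

definition restrict_to :: "('a, 'm) graded \<Rightarrow> 'm set \<Rightarrow> ('a, 'm) graded" where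
  "restrict_to M H = M\<lparr>carrier := H, gpart := (\<lambda>n. H \<inter> gpart M n)\<rparr>"

text \<open>
  The second conjunct says that a graded submodule contains the homogeneous components of its
  elements.
\<close>

definition graded_submodule ::
    "('k::field, 'r) graded \<Rightarrow> ('r, 'm) graded \<Rightarrow> 'm set \<Rightarrow> bool" where
  "graded_submodule R M H \<longleftrightarrow> submodule H R M \<and>
     internal_direct_sum (restrict_to M H) (gpart (restrict_to M H)) UNIV"

text \<open>
  Quotient of a graded algebra by a homogeneous ideal, or of a graded module by a graded submodule
  (in which case the field \<^const>\<open>mult\<close> of the result is again meaningless).
\<close>

definition graded_quotient :: "('a, 'b) graded \<Rightarrow> 'b set \<Rightarrow> ('a, 'b set) graded" where
  "graded_quotient M H =
    \<lparr>carrier = a_rcosets\<^bsub>M\<^esub> H, mult = rcoset_mult M H, one = H +>\<^bsub>M\<^esub> \<one>\<^bsub>M\<^esub>, zero = H,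
     add = set_add M, smult = (\<lambda>a C. H <+>\<^bsub>M\<^esub> ((\<lambda>x. a \<odot>\<^bsub>M\<^esub> x) ` C)),
     gpart = (\<lambda>n. (\<lambda>x. H +>\<^bsub>M\<^esub> x) ` gpart M n)\<rparr>"

definition graded_module_iso ::
    "('k::field, 'r) graded \<Rightarrow> ('r, 'm) graded \<Rightarrow> ('r, 'n) graded \<Rightarrow> ('m \<Rightarrow> 'n) set" where
  "graded_module_iso R M N = {h. bij_betw h (carrier M) (carrier N) \<and>
     (\<forall>x\<in>carrier M. \<forall>y\<in>carrier M. h (x \<oplus>\<^bsub>M\<^esub> y) = h x \<oplus>\<^bsub>N\<^esub> h y) \<and>
     (\<forall>a\<in>carrier R. \<forall>x\<in>carrier M. h (a \<odot>\<^bsub>M\<^esub> x) = a \<odot>\<^bsub>N\<^esub> h x) \<and>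
     (\<forall>n. h ` gpart M n = gpart N n)}"

text \<open>
  No sign is put into the action on the suspension.  Twisting the action by
  \<open>a \<mapsto> (-1)\<^sup>|\<^sup>a\<^sup>|a\<close> gives a module isomorphic to the original one via
  \<open>x \<mapsto> (-1)\<^sup>|\<^sup>x\<^sup>|x\<close>, so the sign convention does not affect the isomorphism class.
\<close>

definition suspension :: "int \<Rightarrow> ('a, 'm) graded \<Rightarrow> ('a, 'm) graded" where
  "suspension d M = M\<lparr>gpart := (\<lambda>n. gpart M (n - d))\<rparr>"

definition module_via :: "('r \<Rightarrow> 'a) \<Rightarrow> ('k, 'a) graded \<Rightarrow> ('r, 'a) graded" where
  "module_via \<phi> A = \<lparr>carrier = carrier A, mult = mult A, one = one A, zero = zero A, add = add A,
     smult = (\<lambda>r x. \<phi> r \<otimes>\<^bsub>A\<^esub> x), gpart = gpart A\<rparr>"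


section \<open>Symmetric algebras and tensor products\<close>

text \<open>
  The monoid algebra of \<open>M\<close>: finitely supported functions on \<^term>\<open>carrier M\<close> with convolution,
  graded by a relation \<open>wt m n\<close>, to be read as \<open>m\<close> has degree \<open>n\<close>.
\<close>

definition monoid_algebra ::
    "('m, 'z) monoid_scheme \<Rightarrow> ('m \<Rightarrow> int \<Rightarrow> bool) \<Rightarrow> ('k::field, 'm \<Rightarrow>\<^sub>0 'k) graded" where
  "monoid_algebra M wt =
    \<lparr>carrier = {u. Poly_Mapping.keys u \<subseteq> carrier M},
     mult = (\<lambda>u v. \<Sum>x\<in>Poly_Mapping.keys u. \<Sum>y\<in>Poly_Mapping.keys v.
        Poly_Mapping.single (x \<otimes>\<^bsub>M\<^esub> y) (Poly_Mapping.lookup u x * Poly_Mapping.lookup v y)),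
     one = Poly_Mapping.single \<one>\<^bsub>M\<^esub> 1, zero = 0, add = (+),
     smult = (\<lambda>c. Poly_Mapping.map ((*) c)),
     gpart = (\<lambda>n. {u. Poly_Mapping.keys u \<subseteq> carrier M \<and>
        (\<forall>m\<in>Poly_Mapping.keys u. wt m n)})\<rparr>"

text \<open>
  Linear functionals on a subspace \<open>V\<close>, encoded as functions vanishing outside \<open>V\<close>.
\<close>

definition dual_space :: "('k::field \<Rightarrow> 'w::ab_group_add \<Rightarrow> 'w) \<Rightarrow> 'w set \<Rightarrow> ('w \<Rightarrow> 'k) set" where
  "dual_space scale V = {f. (\<forall>x\<in>V. \<forall>y\<in>V. f (x + y) = f x + f y) \<and>
     (\<forall>c. \<forall>x\<in>V. f (scale c x) = c * f x) \<and> (\<forall>x. x \<notin> V \<longrightarrow> f x = 0)}"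

definition restrict_functional :: "'w set \<Rightarrow> ('w \<Rightarrow> 'k::zero) \<Rightarrow> 'w \<Rightarrow> 'k" where
  "restrict_functional V f = (\<lambda>x. if x \<in> V then f x else 0)"

text \<open>
  The symmetric algebra on \<open>V\<^sup>*\<close> is the polynomial ring with one variable for every element of
  \<open>V\<^sup>*\<close> (monomials are multisets over \<open>V\<^sup>*\<close>), modulo the ideal making the variables depend
  linearly on the elements of \<open>V\<^sup>*\<close>.
\<close>

definition free_polynomials ::
    "('p::prime_card mod_ring \<Rightarrow> 'w::ab_group_add \<Rightarrow> 'w) \<Rightarrow> 'w set \<Rightarrow>
     ('p mod_ring, ('w \<Rightarrow> 'p mod_ring) multiset \<Rightarrow>\<^sub>0 'p mod_ring) graded" where
  "free_polynomials scale V =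
     monoid_algebra \<lparr>carrier = {m. set_mset m \<subseteq> dual_space scale V}, mult = (+), one = {#}\<rparr>
       (\<lambda>m n. n = (if CARD('p) = 2 then 1 else 2) * int (size m))"

definition linear_relations ::
    "('p::prime_card mod_ring \<Rightarrow> 'w::ab_group_add \<Rightarrow> 'w) \<Rightarrow> 'w set \<Rightarrow>
     (('w \<Rightarrow> 'p mod_ring) multiset \<Rightarrow>\<^sub>0 'p mod_ring) set" where
  "linear_relations scale V =
     {Poly_Mapping.single {#\<lambda>x. f x + g x#} 1
        - Poly_Mapping.single {#f#} 1 - Poly_Mapping.single {#g#} 1
      | f g. f \<in> dual_space scale V \<and> g \<in> dual_space scale V} \<union>
     {Poly_Mapping.single {#\<lambda>x. c * f x#} 1 - Poly_Mapping.single {#f#} c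
      | c f. f \<in> dual_space scale V}"

definition symmetric_ideal ::
    "('p::prime_card mod_ring \<Rightarrow> 'w::ab_group_add \<Rightarrow> 'w) \<Rightarrow> 'w set \<Rightarrow>
     (('w \<Rightarrow> 'p mod_ring) multiset \<Rightarrow>\<^sub>0 'p mod_ring) set" where
  "symmetric_ideal scale V = Idl\<^bsub>free_polynomials scale V\<^esub> (linear_relations scale V)"

definition symmetric_algebra ::
    "('p::prime_card mod_ring \<Rightarrow> 'w::ab_group_add \<Rightarrow> 'w) \<Rightarrow> 'w set \<Rightarrow>
     ('p mod_ring, (('w \<Rightarrow> 'p mod_ring) multiset \<Rightarrow>\<^sub>0 'p mod_ring) set) graded" where
  "symmetric_algebra scale V =
     graded_quotient (free_polynomials scale V) (symmetric_ideal scale V)"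

definition symmetric_generator ::
    "('p::prime_card mod_ring \<Rightarrow> 'w::ab_group_add \<Rightarrow> 'w) \<Rightarrow> 'w set \<Rightarrow> ('w \<Rightarrow> 'p mod_ring) \<Rightarrow>
     (('w \<Rightarrow> 'p mod_ring) multiset \<Rightarrow>\<^sub>0 'p mod_ring) set" where
  "symmetric_generator scale V f =
     symmetric_ideal scale V +>\<^bsub>free_polynomials scale V\<^esub> Poly_Mapping.single {#f#} 1"

text \<open>
  \<open>h\<close> is the map of symmetric algebras induced by the inclusion of \<open>V\<close> in \<open>W\<close>, that is, the algebra
  map extending the restriction of functionals.  It is only constrained on the carrier, where it is
  unique since the functionals generate the symmetric algebra.
\<close>

definition is_induced_map ::
    "('p::prime_card mod_ring \<Rightarrow> 'w::ab_group_add \<Rightarrow> 'w) \<Rightarrow> 'w set \<Rightarrow> 'w set \<Rightarrow>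
     ((('w \<Rightarrow> 'p mod_ring) multiset \<Rightarrow>\<^sub>0 'p mod_ring) set \<Rightarrow>
      (('w \<Rightarrow> 'p mod_ring) multiset \<Rightarrow>\<^sub>0 'p mod_ring) set) \<Rightarrow> bool" where
  "is_induced_map scale V W h \<longleftrightarrow>
     h \<in> graded_algebra_hom (symmetric_algebra scale W) (symmetric_algebra scale V) \<and>
     (\<forall>f\<in>dual_space scale W. h (symmetric_generator scale W f) =
        symmetric_generator scale V (restrict_functional V f))"

text \<open>
  The tensor product of algebras is the vector space on \<open>A \<times> B\<close> modulo the bilinearity relations.
  The vector space is multiplied as a monoid algebra, and the span of the relations is then an
  ideal.  The sign in \<open>(a \<otimes> b)(a' \<otimes> b') = (-1)\<^sup>|\<^sup>b\<^sup>|\<^sup>|\<^sup>a\<^sup>'\<^sup>| aa' \<otimes> bb'\<close> is omitted: this is only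
  correct in characteristic 2 or when one of the factors is concentrated in even degrees, which
  includes the case of \<open>A\<close> a symmetric algebra as above.
\<close>

definition tensor_free ::
    "('k::field, 'a) graded \<Rightarrow> ('k, 'b) graded \<Rightarrow> ('k, ('a \<times> 'b) \<Rightarrow>\<^sub>0 'k) graded" where
  "tensor_free A B = monoid_algebra (A \<times>\<times> B)
     (\<lambda>(a, b) n. \<exists>i j. a \<in> gpart A i \<and> b \<in> gpart B j \<and> n = i + j)"

definition bilinear_relations ::
    "('k::field, 'a) graded \<Rightarrow> ('k, 'b) graded \<Rightarrow> (('a \<times> 'b) \<Rightarrow>\<^sub>0 'k) set" where
  "bilinear_relations A B =
     {Poly_Mapping.single (a \<oplus>\<^bsub>A\<^esub> a', b) 1
        - Poly_Mapping.single (a, b) 1 - Poly_Mapping.single (a', b) 1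
      | a a' b. a \<in> carrier A \<and> a' \<in> carrier A \<and> b \<in> carrier B} \<union>
     {Poly_Mapping.single (a, b \<oplus>\<^bsub>B\<^esub> b') 1
        - Poly_Mapping.single (a, b) 1 - Poly_Mapping.single (a, b') 1
      | a b b'. a \<in> carrier A \<and> b \<in> carrier B \<and> b' \<in> carrier B} \<union>
     {Poly_Mapping.single (c \<odot>\<^bsub>A\<^esub> a, b) 1 - Poly_Mapping.single (a, b) c
      | a b c. a \<in> carrier A \<and> b \<in> carrier B} \<union>
     {Poly_Mapping.single (a, c \<odot>\<^bsub>B\<^esub> b) 1 - Poly_Mapping.single (a, b) c
      | a b c. a \<in> carrier A \<and> b \<in> carrier B}"

definition tensor_ideal ::
    "('k::field, 'a) graded \<Rightarrow> ('k, 'b) graded \<Rightarrow> (('a \<times> 'b) \<Rightarrow>\<^sub>0 'k) set" where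
  "tensor_ideal A B = Idl\<^bsub>tensor_free A B\<^esub> (bilinear_relations A B)"

definition tensor_algebra ::
    "('k::field, 'a) graded \<Rightarrow> ('k, 'b) graded \<Rightarrow> ('k, (('a \<times> 'b) \<Rightarrow>\<^sub>0 'k) set) graded" where
  "tensor_algebra A B = graded_quotient (tensor_free A B) (tensor_ideal A B)"

definition pure_tensor ::
    "('k::field, 'a) graded \<Rightarrow> ('k, 'b) graded \<Rightarrow> 'a \<Rightarrow> 'b \<Rightarrow> (('a \<times> 'b) \<Rightarrow>\<^sub>0 'k) set" where
  "pure_tensor A B a b = tensor_ideal A B +>\<^bsub>tensor_free A B\<^esub> Poly_Mapping.single (a, b) 1"

text \<open>
  \<open>\<pi>\<close> is the map from \<open>A \<otimes> N\<close> to \<open>A\<close> induced by the augmentation of the connected algebra \<open>N\<close>.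
  The augmentation \<open>\<epsilon>\<close> is the unique map of graded algebras to the base field; it kills all nonzero
  degrees because it preserves degrees.
\<close>

definition is_tensor_augmentation ::
    "('k::field, 'a) graded \<Rightarrow> ('k, 'b) graded \<Rightarrow> ((('a \<times> 'b) \<Rightarrow>\<^sub>0 'k) set \<Rightarrow> 'a) \<Rightarrow> bool" where
  "is_tensor_augmentation A N \<pi> \<longleftrightarrow>
     \<pi> \<in> graded_algebra_hom (tensor_algebra A N) A \<and>
     (\<exists>\<epsilon> \<in> graded_algebra_hom N base_field.
        \<forall>a\<in>carrier A. \<forall>x\<in>carrier N. \<pi> (pure_tensor A N a x) = \<epsilon> x \<odot>\<^bsub>A\<^esub> a)"


section \<open>Finite algebras and free rank filtrations\<close>

text \<open>The ambient vector space \<open>W\<close> is the whole type \<open>'w\<close>.\<close>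

definition finite_PW_algebra ::
    "('p::prime_card mod_ring \<Rightarrow> 'w::ab_group_add \<Rightarrow> 'w) \<Rightarrow> ('p mod_ring, 'r) graded \<Rightarrow>
     ((('w \<Rightarrow> 'p mod_ring) multiset \<Rightarrow>\<^sub>0 'p mod_ring) set \<Rightarrow> 'r) \<Rightarrow> bool" where
  "finite_PW_algebra scale R \<eta> \<longleftrightarrow>
     graded_commutative_algebra R \<and>
     \<eta> \<in> graded_algebra_hom (symmetric_algebra scale UNIV) R \<and>
     (\<exists>S. finite S \<and> S \<subseteq> carrier R \<and>
        (\<forall>r\<in>carrier R. \<exists>a. (\<forall>s\<in>S. a s \<in> carrier (symmetric_algebra scale UNIV)) \<and>
           r = (\<Oplus>\<^bsub>R\<^esub>s\<in>S. \<eta> (a s) \<otimes>\<^bsub>R\<^esub> s)))"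

text \<open>
  The algebra \<open>N\<close> is taken on the type of the elements of \<open>M\<close>.  This is no restriction, since \<open>N\<close>
  embeds into \<open>P\<^sub>V \<otimes> N\<close>, which is in bijection with \<open>M\<close>.
\<close>

definition j_free ::
    "('p::prime_card mod_ring \<Rightarrow> 'w::ab_group_add \<Rightarrow> 'w) \<Rightarrow> ('p mod_ring, 'r) graded \<Rightarrow>
     ((('w \<Rightarrow> 'p mod_ring) multiset \<Rightarrow>\<^sub>0 'p mod_ring) set \<Rightarrow> 'r) \<Rightarrow>
     nat \<Rightarrow> ('r, 'm) graded \<Rightarrow> bool" where
  "j_free scale R \<eta> j M \<longleftrightarrow>
     (\<exists>V (N :: ('p mod_ring, 'm) graded) \<phi> \<pi> d h.
        module.subspace scale V \<and> vector_space.dim scale V = j \<and>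
        graded_commutative_algebra N \<and> connected_algebra N \<and> bounded_algebra N \<and>
        \<phi> \<in> graded_algebra_hom R (tensor_algebra (symmetric_algebra scale V) N) \<and>
        is_tensor_augmentation (symmetric_algebra scale V) N \<pi> \<and>
        is_induced_map scale V UNIV (\<pi> \<circ> \<phi> \<circ> \<eta>) \<and>
        h \<in> graded_module_iso R M
          (suspension d (module_via \<phi> (tensor_algebra (symmetric_algebra scale V) N))))"

definition free_rank_filtration ::
    "('p::prime_card mod_ring \<Rightarrow> 'w::ab_group_add \<Rightarrow> 'w) \<Rightarrow> ('p mod_ring, 'r) graded \<Rightarrow>
     ((('w \<Rightarrow> 'p mod_ring) multiset \<Rightarrow>\<^sub>0 'p mod_ring) set \<Rightarrow> 'r) \<Rightarrow>
     ('r, 'm) graded \<Rightarrow> nat \<Rightarrow> (nat \<Rightarrow> 'm set) \<Rightarrow> bool" where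
  "free_rank_filtration scale R \<eta> L i F \<longleftrightarrow>
     F 0 = carrier L \<and> F (i + 1) = {\<zero>\<^bsub>L\<^esub>} \<and>
     (\<forall>j\<le>i + 1. graded_submodule R L (F j)) \<and>
     (\<forall>j\<le>i. F (j + 1) \<subseteq> F j) \<and>
     (\<forall>j\<le>i. \<exists>(n::nat) D.
        let Q = graded_quotient (restrict_to L (F j)) (F (j + 1)) in
        internal_direct_sum Q D {..<n} \<and>
        (\<forall>a<n. graded_submodule R Q (D a) \<and> j_free scale R \<eta> j (restrict_to Q (D a))))"


section \<open>Krull dimension and depth\<close>

text \<open>
  In a graded commutative algebra over a field of odd characteristic elements of odd degree square
  to zero, so every prime ideal contains them and there is no difference between prime and
  completely prime two-sided ideals.
\<close>

definition is_prime_ideal :: "('r, 'z) ring_scheme \<Rightarrow> 'r set \<Rightarrow> bool" where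
  "is_prime_ideal R P \<longleftrightarrow> ideal P R \<and> P \<noteq> carrier R \<and>
     (\<forall>a\<in>carrier R. \<forall>b\<in>carrier R. a \<otimes>\<^bsub>R\<^esub> b \<in> P \<longrightarrow> a \<in> P \<or> b \<in> P)"

definition annihilator :: "('r, 'z) ring_scheme \<Rightarrow> ('r, 'm) graded \<Rightarrow> 'r set" where
  "annihilator R M = {r \<in> carrier R. \<forall>x\<in>carrier M. r \<odot>\<^bsub>M\<^esub> x = \<zero>\<^bsub>M\<^esub>}"

text \<open>
  The Krull dimension of \<open>R / annihilator R M\<close>; its prime ideals are the prime ideals of \<open>R\<close>
  containing the annihilator.  The supremum of the empty set is \<open>-\<infinity>\<close>, the value for \<open>M = 0\<close>.
\<close>

definition krull_dimension :: "('r, 'z) ring_scheme \<Rightarrow> ('r, 'm) graded \<Rightarrow> ereal" where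
  "krull_dimension R M = Sup {ereal (real n) | n. \<exists>P :: nat \<Rightarrow> 'r set.
     (\<forall>i\<le>n. is_prime_ideal R (P i) \<and> annihilator R M \<subseteq> P i) \<and> (\<forall>i<n. P i \<subset> P (Suc i))}"

text \<open>The submodule \<open>YM\<close>.\<close>

definition multiples_submodule ::
    "('k::field, 'r) graded \<Rightarrow> ('r, 'm) graded \<Rightarrow> 'r set \<Rightarrow> 'm set" where
  "multiples_submodule R M Y =
     \<Inter>{H. submodule H R M \<and> {x \<odot>\<^bsub>M\<^esub> m | x m. x \<in> Y \<and> m \<in> carrier M} \<subseteq> H}"

definition regular_sequence ::
    "('k::field, 'r) graded \<Rightarrow> ('r, 'm) graded \<Rightarrow> 'r list \<Rightarrow> bool" where
  "regular_sequence R M xs \<longleftrightarrow>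
     (\<forall>i<length xs. \<forall>m\<in>carrier M.
        (xs ! i) \<odot>\<^bsub>M\<^esub> m \<in> multiples_submodule R M (set (take i xs)) \<longrightarrow>
        m \<in> multiples_submodule R M (set (take i xs))) \<and>
     multiples_submodule R M (set xs) \<noteq> carrier M"

text \<open>
  Depth with respect to the ideal of elements of positive degree.  As usual in the graded setting,
  regular sequences consist of homogeneous elements.  The value for \<open>M = 0\<close>, which has no regular
  sequences in the above sense, is not meaningful.
\<close>

definition depth :: "('k::field, 'r) graded \<Rightarrow> ('r, 'm) graded \<Rightarrow> enat" where
  "depth R M = Sup {enat (length xs) | xs.
     set xs \<subseteq> (\<Union>n\<in>{n. n > 0}. gpart R n) \<and> regular_sequence R M xs}"

end

theory Submission
  imports Defs "Berlekamp_Zassenhaus.Berlekamp_Type_Based"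
begin

text \<open>
  Write \<open>n = dim W\<close>, and let a summand of \<open>F\<^sub>k / F\<^sub>k\<^sub>+\<^sub>1\<close> be \<open>P\<^sub>V \<otimes> N\<close> with \<open>dim V = k\<close>.  Choosing a basis of \<open>V\<close>
  makes \<open>P\<^sub>V\<close> a polynomial ring in \<open>k\<close> variables over the field with \<open>p\<close> elements
  (\<open>polynomial_algebra\<close>).

  \<^bold>\<open>Krull dimension.\<close>  A prime \<open>P\<close> of \<open>R\<close> containing the annihilator of \<open>L / F\<^sub>s\<close> contains the
  annihilator of some summand \<open>P\<^sub>V \<otimes> N\<close> with \<open>dim V < s\<close>: otherwise a product of elements outside \<open>P\<close>,
  one for each summand, would annihilate \<open>L / F\<^sub>s\<close>.  That annihilator is the kernel of
  \<open>\<phi> : R \<rightarrow> P\<^sub>V \<otimes> N\<close>.  Since \<open>N\<close> is bounded, the kernel of \<open>P\<^sub>V \<otimes> N \<rightarrow> P\<^sub>V\<close> is nilpotent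
  (\<open>kernel_nilpotent\<close>), and since \<open>P\<^sub>W \<rightarrow> P\<^sub>V\<close> is onto, so is \<open>R \<rightarrow> P\<^sub>V\<close>.  Hence the primes containing
  the kernel of \<open>\<phi>\<close> are the primes of \<open>P\<^sub>V\<close>, and chains of primes in a polynomial ring in \<open>k\<close>
  variables have length at most \<open>k\<close>.  For the last fact (\<open>prime_chain_length\<close>) the following
  suffices: elements chosen in the successive differences of a chain are algebraically independent
  (\<open>eval_at_notin_prime\<close>), and \<open>k + 1\<close> polynomials in \<open>k\<close> variables over a finite field are
  algebraically dependent by counting (\<open>algebraic_dependence\<close>).

  \<^bold>\<open>Depth.\<close>  The regular sequence on \<open>F\<^sub>s\<close> consists of the images in \<open>R\<close> of the first \<open>s\<close> Dickson
  invariants of \<open>W\<close>: the coefficients of \<open>\<Phi>\<^sub>W(X) = \<Prod> (X - f)\<close>, where \<open>f\<close> runs through \<open>W\<^sup>*\<close>, at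
  \<open>X\<close> to the powers \<open>p\<close> to the \<open>n - 1\<close>, \<open>\<dots>\<close>, \<open>p\<close> to the \<open>n - s\<close>.  Restriction to \<open>V\<close> turns
  \<open>\<Phi>\<^sub>W\<close> into the \<open>q\<close>-th power of \<open>\<Phi>\<^sub>V\<close>, with \<open>q\<close> the index of \<open>V\<close>, so the invariants restrict to
  the \<open>q\<close>-th powers \<open>g\<^sub>k\<^sub>-\<^sub>1\<close>, \<open>\<dots>\<close>, \<open>g\<^sub>k\<^sub>-\<^sub>s\<close> of Dickson invariants of \<open>V\<close>, as long as \<open>s \<le> k\<close>.

  The ring \<open>P\<^sub>V\<close> is free over the polynomial ring in \<open>g\<^sub>0\<close>, \<open>\<dots>\<close>, \<open>g\<^sub>k\<^sub>-\<^sub>1\<close>, on the monomials whose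
  exponents are bounded by the degrees of the \<open>g\<^sub>l\<close>.  Equivalently, replacing the powers of the
  variables by the \<open>g\<^sub>l\<close> as far as possible is a linear bijection \<open>\<Theta>\<close> of the polynomial ring
  (\<open>dickson_twist_bij\<close>): it is surjective, because every variable is integral over \<open>g\<^sub>0\<close>, \<open>\<dots>\<close>,
  \<open>g\<^sub>k\<^sub>-\<^sub>1\<close> and the preceding variables, and it preserves the finite sets of polynomials of bounded
  degree.  In the coordinates given by \<open>\<Theta>\<close>, multiplication by \<open>g\<^sub>l\<close> shifts exponents, so the \<open>g\<^sub>l\<close> form
  a regular sequence (\<open>weakly_regular_shifts\<close>).

  On \<open>P\<^sub>V \<otimes> N\<close> the elements of \<open>R\<close> act through \<open>P\<^sub>V\<close> only up to terms of higher degree in \<open>N\<close>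
  (\<open>slice_mult_level\<close>), so the argument is applied to the layers of the filtration by degree in \<open>N\<close>.
  Regularity is then lifted from quotients by \<open>weakly_regular_extension\<close>: from the layers to
  \<open>P\<^sub>V \<otimes> N\<close>, from the summands to \<open>F\<^sub>k / F\<^sub>k\<^sub>+\<^sub>1\<close> for all \<open>k \<ge> s\<close>, and from these quotients to \<open>F\<^sub>s\<close>.
  Finally the invariants do not generate \<open>F\<^sub>s\<close>, because modulo \<open>F\<^sub>s\<^sub>+\<^sub>1\<close> there is a summand \<open>P\<^sub>V \<otimes> N\<close>,
  and its unit is not reached.
\<close>

hide_const (open) Multiset.mult Polynomial.smult Wellorder_Constructions.zero Ring_Hom.ring_hom LinearCombinations.submodule

section \<open>Polynomials over the prime field\<close>

type_synonym ('x, 'p) mpoly = "'x multiset \<Rightarrow>\<^sub>0 'p mod_ring"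

definition scalar_poly :: "'p::prime_card mod_ring \<Rightarrow> ('x, 'p) mpoly" where
  "scalar_poly c = Poly_Mapping.single {#} c"

definition var :: "'x \<Rightarrow> ('x, 'p::prime_card) mpoly" where
  "var x = Poly_Mapping.single {#x#} 1"

lemma scalar_poly_add: "scalar_poly (a + b) = scalar_poly a + scalar_poly b"
  by (simp add: scalar_poly_def single_add)

lemma scalar_poly_mult: "scalar_poly (a * b) = scalar_poly a * scalar_poly b"
  by (simp add: scalar_poly_def mult_single)

lemma scalar_poly_0 [simp]: "scalar_poly 0 = 0"
  by (simp add: scalar_poly_def)

lemma scalar_poly_1 [simp]: "scalar_poly 1 = 1"
  unfolding scalar_poly_def zero_multiset_def[symmetric] by simp

lemma scalar_poly_uminus: "scalar_poly (- a) = - scalar_poly a"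
  by (simp add: scalar_poly_def single_uminus)

lemma scalar_poly_power: "scalar_poly (a ^ n) = scalar_poly a ^ n"
  by (induction n) (simp_all add: scalar_poly_mult)

lemma CHAR_mpoly [simp]: "CHAR(('x, 'p::prime_card) mpoly) = CARD('p)"
proof (rule CHAR_eqI)
  have eq: "(of_nat n :: ('x, 'p) mpoly) = scalar_poly (of_nat n :: 'p mod_ring)" for n
    by (induction n) (simp_all add: scalar_poly_add)
  have zero: "of_nat CARD('p) = (0 :: 'p mod_ring)"
    using of_nat_CHAR[where ?'a = "'p mod_ring"] unfolding semiring_char_mod_ring .
  show "of_nat CARD('p) = (0 :: ('x, 'p) mpoly)"
    using eq[of "CARD('p)"] unfolding zero scalar_poly_0 .
  fix n assume "of_nat n = (0 :: ('x, 'p) mpoly)"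
  hence "Poly_Mapping.lookup (scalar_poly (of_nat n :: 'p mod_ring) :: ('x, 'p) mpoly) {#} = 0"
    unfolding eq by (metis lookup_zero)
  hence "of_nat n = (0 :: 'p mod_ring)"
    unfolding scalar_poly_def lookup_single_eq .
  thus "CARD('p) dvd n"
    by (rule of_nat_0_mod_ring_dvd)
qed

lemma prime_card_nat: "Factorial_Ring.prime CARD('p::prime_card)"
  by (rule prime_card)

lemma mpoly_induct [consumes 1, case_names single add zero]:
  fixes u :: "'x \<Rightarrow>\<^sub>0 'c::ab_group_add"
  assumes "Poly_Mapping.keys u \<subseteq> K"
    and single: "\<And>x c. x \<in> K \<Longrightarrow> P (Poly_Mapping.single x c)"
    and add: "\<And>u v. \<lbrakk>Poly_Mapping.keys u \<subseteq> K; Poly_Mapping.keys v \<subseteq> K; P u; P v\<rbrakk> \<Longrightarrow> P (u + v)"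
    and zero: "P 0"
  shows "P u"
  using assms(1)
proof (induction "card (Poly_Mapping.keys u)" arbitrary: u)
  case 0
  hence "u = 0" by simp
  thus ?case using zero by simp
next
  case (Suc n)
  then obtain x where x: "x \<in> Poly_Mapping.keys u"
    by (metis card.empty ex_in_conv nat.distinct(1))
  define v where "v = u - Poly_Mapping.single x (Poly_Mapping.lookup u x)"
  have keys: "Poly_Mapping.keys v = Poly_Mapping.keys u - {x}"
    by (auto simp: v_def in_keys_iff lookup_minus lookup_single when_def split: if_splits)
  have "P v"
    using Suc x keys by (intro Suc.hyps) auto
  moreover have "P (Poly_Mapping.single x (Poly_Mapping.lookup u x))"
    using Suc.prems x by (intro single) auto
  moreover have "u = v + Poly_Mapping.single x (Poly_Mapping.lookup u x)"
    by (simp add: v_def)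
  moreover have "Poly_Mapping.keys (Poly_Mapping.single x (Poly_Mapping.lookup u x)) \<subseteq> K"
    using Suc.prems x by (auto split: if_splits)
  moreover have "Poly_Mapping.keys v \<subseteq> K"
    using Suc.prems keys by auto
  ultimately show ?case
    using add by metis
qed

lemma linear_extension_add:
  fixes e :: "'x \<Rightarrow> ('y, 'p::prime_card) mpoly"
  defines "E \<equiv> \<lambda>u. \<Sum>x\<in>Poly_Mapping.keys u. scalar_poly (Poly_Mapping.lookup u x) * e x"
  shows "E (u + v) = E u + E v"
    and "E (Poly_Mapping.single x c) = scalar_poly c * e x"
    and "E 0 = 0"
proof -
  show "E (u + v) = E u + E v"
    unfolding E_def
    by (rule setsum_keys_plus_distrib) (simp_all add: scalar_poly_add algebra_simps)
  show "E (Poly_Mapping.single x c) = scalar_poly c * e x" "E 0 = 0"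
    by (simp_all add: E_def)
qed

definition polys_in :: "nat \<Rightarrow> (nat, 'p::prime_card) mpoly set" where
  "polys_in j = {u. \<forall>m\<in>Poly_Mapping.keys u. set_mset m \<subseteq> {..<j}}"

definition polys_upto :: "nat \<Rightarrow> nat \<Rightarrow> (nat, 'p::prime_card) mpoly set" where
  "polys_upto j d = {u. \<forall>m\<in>Poly_Mapping.keys u. set_mset m \<subseteq> {..<j} \<and> size m \<le> d}"

lemma polys_in_iff: "u \<in> polys_in j \<longleftrightarrow> Poly_Mapping.keys u \<subseteq> {m. set_mset m \<subseteq> {..<j}}"
  by (auto simp: polys_in_def)

lemma polys_upto_iff: "u \<in> polys_upto j d \<longleftrightarrow> Poly_Mapping.keys u \<subseteq> {m. set_mset m \<subseteq> {..<j} \<and> size m \<le> d}"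
  by (auto simp: polys_upto_def)

lemma polys_in_scalar: "scalar_poly c \<in> polys_in j"
  by (simp add: polys_in_def scalar_poly_def)

lemma polys_in_0: "0 \<in> polys_in j" and polys_in_1: "1 \<in> polys_in j"
  using polys_in_scalar[of 0] polys_in_scalar[of 1] by simp_all

lemma polys_in_var: "i < j \<Longrightarrow> var i \<in> polys_in j"
  by (simp add: polys_in_def var_def)

lemma polys_in_add: "\<lbrakk>u \<in> polys_in j; v \<in> polys_in j\<rbrakk> \<Longrightarrow> u + v \<in> polys_in j"
  using keys_add[of u v] unfolding polys_in_iff by blast

lemma polys_in_mult: "\<lbrakk>u \<in> polys_in j; v \<in> polys_in j\<rbrakk> \<Longrightarrow> u * v \<in> polys_in j"
  using keys_mult[of u v] by (fastforce simp: polys_in_def)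

lemmas polys_in_closed = polys_in_scalar polys_in_0 polys_in_1 polys_in_var polys_in_add polys_in_mult

lemma finite_bounded_multisets: "finite A \<Longrightarrow> finite {m. set_mset m \<subseteq> A \<and> size m \<le> d}"
proof -
  assume "finite A"
  hence "finite (mset ` {xs. set xs \<subseteq> A \<and> length xs \<le> d})"
    by (intro finite_imageI finite_lists_length_le)
  moreover have "{m. set_mset m \<subseteq> A \<and> size m \<le> d} \<subseteq> mset ` {xs. set xs \<subseteq> A \<and> length xs \<le> d}"
  proof
    fix m assume "m \<in> {m. set_mset m \<subseteq> A \<and> size m \<le> d}"
    moreover obtain xs where "mset xs = m"
      using ex_mset by blast
    ultimately show "m \<in> mset ` {xs. set xs \<subseteq> A \<and> length xs \<le> d}"
      by (intro image_eqI[of _ _ xs]) (auto simp flip: size_mset)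
  qed
  ultimately show ?thesis
    by (rule finite_subset[rotated])
qed

lemma finite_mpolys_with_keys:
  assumes "finite M"
  shows "finite {u :: ('x, 'p::prime_card) mpoly. Poly_Mapping.keys u \<subseteq> M}"
proof -
  have "finite {f :: 'x multiset \<Rightarrow> 'p mod_ring. \<forall>x. (x \<in> M \<longrightarrow> f x \<in> UNIV) \<and> (x \<notin> M \<longrightarrow> f x = 0)}"
    using assms by (rule finite_set_of_finite_funs) simp
  hence "finite (Poly_Mapping.lookup ` {u :: ('x, 'p) mpoly. Poly_Mapping.keys u \<subseteq> M})"
    by (rule finite_subset[rotated]) (auto simp: in_keys_iff)
  thus ?thesis
    by (rule finite_imageD) (auto intro!: inj_onI poly_mapping_eqI)
qed

lemma finite_polys_upto: "finite (polys_upto j d :: (nat, 'p::prime_card) mpoly set)"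
proof -
  have "polys_upto j d = {u :: (nat, 'p) mpoly. Poly_Mapping.keys u \<subseteq> {m. set_mset m \<subseteq> {..<j} \<and> size m \<le> d}}"
    by (auto simp: polys_upto_def)
  thus ?thesis
    using finite_mpolys_with_keys[OF finite_bounded_multisets[of "{..<j}" d]] by simp
qed

lemma polys_in_upto: "(u :: (nat, 'p::prime_card) mpoly) \<in> polys_in j \<Longrightarrow> \<exists>d0. \<forall>d\<ge>d0. u \<in> polys_upto j d"
proof -
  assume u: "u \<in> polys_in j"
  define d where "d = Max (insert 0 (size ` Poly_Mapping.keys u))"
  have "size m \<le> d" if "m \<in> Poly_Mapping.keys u" for m
    unfolding d_def using that by (intro Max_ge) auto
  thus ?thesis
    using u by (intro exI[of _ d]) (force simp: polys_in_def polys_upto_def)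
qed

lemma lookup_single_mult:
  fixes u :: "('x, 'p::prime_card) mpoly"
  shows "Poly_Mapping.lookup (Poly_Mapping.single \<mu> 1 * u) (\<beta> + \<mu>) = Poly_Mapping.lookup u \<beta>"
    and "(\<And>\<gamma>. \<beta> \<noteq> \<gamma> + \<mu>) \<Longrightarrow> Poly_Mapping.lookup (Poly_Mapping.single \<mu> 1 * u) \<beta> = 0"
proof -
  have "Poly_Mapping.keys u \<subseteq> UNIV" by simp
  thus "Poly_Mapping.lookup (Poly_Mapping.single \<mu> 1 * u) (\<beta> + \<mu>) = Poly_Mapping.lookup u \<beta>"
    by (induction rule: mpoly_induct)
      (simp_all add: mult_single lookup_single distrib_left lookup_add when_def add.commute)
  assume "\<And>\<gamma>. \<beta> \<noteq> \<gamma> + \<mu>"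
  hence "\<beta> \<notin> Poly_Mapping.keys (Poly_Mapping.single \<mu> 1 * u)"
    using keys_mult[of "Poly_Mapping.single \<mu> 1" u] by (auto simp: add.commute split: if_splits)
  thus "Poly_Mapping.lookup (Poly_Mapping.single \<mu> 1 * u) \<beta> = 0"
    by (simp add: in_keys_iff)
qed

section \<open>The Dickson polynomial of a vector space\<close>

text \<open>
  The vectors with \<open>r\<close> coordinates, padded by zeros.  In this way the vectors with \<open>r\<close> coordinates
  are also vectors with \<open>r + 1\<close> coordinates.
\<close>

definition coord_vectors :: "nat \<Rightarrow> (nat \<Rightarrow> 'p::prime_card mod_ring) set" where
  "coord_vectors r = {a. \<forall>i\<ge>r. a i = 0}"

definition linear_form :: "nat \<Rightarrow> (nat \<Rightarrow> 'p::prime_card mod_ring) \<Rightarrow> (nat, 'p) mpoly" where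
  "linear_form r a = (\<Sum>i<r. scalar_poly (a i) * var i)"

text \<open>
  The polynomial whose roots are all linear forms in \<open>r\<close> variables; its coefficients are, up to sign,
  the Dickson invariants.
\<close>

definition dickson_poly :: "nat \<Rightarrow> (nat, 'p::prime_card) mpoly poly" where
  "dickson_poly r = (\<Prod>a\<in>coord_vectors r. [:- linear_form r a, 1:])"

lemma coord_vectors_0: "coord_vectors 0 = {\<lambda>_. 0}"
  by (auto simp: coord_vectors_def)

lemma bij_betw_coord_vectors_Suc:
  "bij_betw (\<lambda>(a, c). a(r := c)) (coord_vectors r \<times> UNIV) (coord_vectors (Suc r))"
proof (rule bij_betw_byWitness[where f' = "\<lambda>a. (a(r := 0), a r)"])
  show "\<forall>x\<in>coord_vectors r \<times> UNIV. (\<lambda>a. (a(r := 0), a r)) (case x of (a, c) \<Rightarrow> a(r := c)) = x"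
    by (auto simp: coord_vectors_def fun_eq_iff)
  show "\<forall>a\<in>coord_vectors (Suc r). (case (a(r := 0), a r) of (a, c) \<Rightarrow> a(r := c)) = a"
    by auto
  show "(\<lambda>(a, c). a(r := c)) ` (coord_vectors r \<times> UNIV) \<subseteq> coord_vectors (Suc r)"
    by (auto simp: coord_vectors_def)
  show "(\<lambda>a. (a(r := 0), a r)) ` coord_vectors (Suc r) \<subseteq> coord_vectors r \<times> UNIV"
    by (auto simp: coord_vectors_def le_Suc_eq)
qed

lemma finite_coord_vectors [simp]: "finite (coord_vectors r :: (nat \<Rightarrow> 'p::prime_card mod_ring) set)"
proof (induction r)
  case (Suc r)
  have "finite ((coord_vectors r :: (nat \<Rightarrow> 'p mod_ring) set) \<times> (UNIV :: 'p mod_ring set))"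
    using Suc by (rule finite_cartesian_product) simp
  thus ?case
    unfolding bij_betw_finite[OF bij_betw_coord_vectors_Suc] .
qed (simp add: coord_vectors_0)

lemma card_coord_vectors: "card (coord_vectors r :: (nat \<Rightarrow> 'p::prime_card mod_ring) set) = CARD('p) ^ r"
proof (induction r)
  case (Suc r)
  thus ?case
    using bij_betw_same_card[OF bij_betw_coord_vectors_Suc[where ?'a = 'p and r = r]]
    by (simp add: card_cartesian_product mult.commute)
qed (simp add: coord_vectors_0)

lemma prod_coord_vectors_Suc:
  "(\<Prod>a\<in>coord_vectors (Suc r). f a) = (\<Prod>c\<in>UNIV. \<Prod>a\<in>coord_vectors r. f (a(r := c)))"
proof -
  have "(\<Prod>a\<in>coord_vectors (Suc r). f a) = (\<Prod>(a, c)\<in>coord_vectors r \<times> UNIV. f (a(r := c)))"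
    using prod.reindex_bij_betw[OF bij_betw_coord_vectors_Suc, of f r, symmetric]
    by (simp add: case_prod_unfold)
  also have "\<dots> = (\<Prod>a\<in>coord_vectors r. \<Prod>c\<in>UNIV. f (a(r := c)))"
    by (simp add: prod.cartesian_product)
  also have "\<dots> = (\<Prod>c\<in>UNIV. \<Prod>a\<in>coord_vectors r. f (a(r := c)))"
    by (rule prod.swap)
  finally show ?thesis .
qed

lemma linear_form_extend:
  assumes "r \<le> N" "a \<in> coord_vectors r"
  shows "linear_form N a = linear_form r a"
  unfolding linear_form_def
  by (rule sum.mono_neutral_right) (use assms in \<open>auto simp: coord_vectors_def\<close>)

lemma linear_form_upd_ge: "r \<ge> N \<Longrightarrow> linear_form N (a(r := c)) = linear_form N a"
  unfolding linear_form_def by (rule sum.cong) auto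

text \<open>
  This is \<open>\<Prod>\<^sub>c (T - c) = T\<^sup>p - T\<close> after homogenisation.  The map \<open>\<kappa>\<close> is the structure map of an algebra
  over the prime field; below it embeds the scalars into polynomials over a polynomial ring.
\<close>

lemma prod_scalar_multiples:
  fixes \<kappa> :: "'p::prime_card mod_ring \<Rightarrow> 'c::comm_ring_1"
  assumes add: "\<And>a b. \<kappa> (a + b) = \<kappa> a + \<kappa> b" and mult: "\<And>a b. \<kappa> (a * b) = \<kappa> a * \<kappa> b"
    and one: "\<kappa> 1 = 1"
  shows "(\<Prod>c\<in>UNIV. Y - \<kappa> c * Z) = Y ^ CARD('p) - Z ^ (CARD('p) - 1) * Y"
proof -
  have zero: "\<kappa> 0 = 0"
    using add[of 0 0] by simp
  have neg: "\<kappa> (- a) = - \<kappa> a" for a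
    using add[of a "- a"] zero by (simp add: eq_neg_iff_add_eq_0 add.commute)
  have diff: "\<kappa> (a - b) = \<kappa> a - \<kappa> b" for a b
    using add[of a "- b"] neg by simp
  \<comment> \<open>For every set \<open>S\<close> of scalars, the homogenisation of \<open>\<Prod>\<^sub>c (T - c)\<close> is the product of the
    homogenised factors; \<open>S = UNIV\<close> then gives the claim.\<close>
  have expand: "(\<Prod>c\<in>S. Y - \<kappa> c * Z) =
      (\<Sum>i\<le>card S. \<kappa> (Polynomial.coeff (\<Prod>c\<in>S. [:- c, 1:]) i) * Y ^ i * Z ^ (card S - i))"
    if "finite S" for S
    using that
  proof (induction S rule: finite_induct)
    case empty
    thus ?case by (simp add: one)
  next
    case (insert x S)
    define P where "P = (\<Prod>c\<in>S. [:- c, 1:])"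
    define n where "n = card S"
    define A where "A = (\<lambda>i. \<kappa> (Polynomial.coeff P i) * Y ^ i * Z ^ (n - i))"
    have degP: "Polynomial.degree P \<le> n"
      unfolding P_def n_def by (rule order.trans[OF degree_prod_sum_le]) (use insert in auto)
    have "(\<Prod>c\<in>insert x S. Y - \<kappa> c * Z) = (Y - \<kappa> x * Z) * (\<Sum>i\<le>n. A i)"
      using insert unfolding A_def P_def n_def by simp
    also have "\<dots> = (\<Sum>i\<le>n. Y * A i) + (\<Sum>i\<le>n. - \<kappa> x * Z * A i)"
      by (simp add: sum_distrib_left algebra_simps sum_negf)
    also have "(\<Sum>i\<le>n. Y * A i) = (\<Sum>i\<le>Suc n. if i = 0 then 0
        else \<kappa> (Polynomial.coeff P (i - 1)) * Y ^ i * Z ^ (Suc n - i))"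
      by (subst sum.atMost_Suc_shift) (simp add: A_def mult_ac)
    also have "(\<Sum>i\<le>n. - \<kappa> x * Z * A i) = (\<Sum>i\<le>Suc n. - \<kappa> x * \<kappa> (Polynomial.coeff P i) * Y ^ i * Z ^ (Suc n - i))"
    proof -
      have "Polynomial.coeff P (Suc n) = 0"
        using degP by (intro coeff_eq_0) auto
      thus ?thesis
        by (simp add: A_def zero Suc_diff_le mult_ac)
    qed
    also have "(\<Sum>i\<le>Suc n. if i = 0 then 0 else \<kappa> (Polynomial.coeff P (i - 1)) * Y ^ i * Z ^ (Suc n - i)) +
        (\<Sum>i\<le>Suc n. - \<kappa> x * \<kappa> (Polynomial.coeff P i) * Y ^ i * Z ^ (Suc n - i)) =
        (\<Sum>i\<le>Suc n. \<kappa> (Polynomial.coeff ([:- x, 1:] * P) i) * Y ^ i * Z ^ (Suc n - i))"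
      unfolding sum.distrib[symmetric]
    proof (rule sum.cong[OF refl])
      fix i
      show "(if i = 0 then 0 else \<kappa> (Polynomial.coeff P (i - 1)) * Y ^ i * Z ^ (Suc n - i)) +
          - \<kappa> x * \<kappa> (Polynomial.coeff P i) * Y ^ i * Z ^ (Suc n - i) =
          \<kappa> (Polynomial.coeff ([:- x, 1:] * P) i) * Y ^ i * Z ^ (Suc n - i)"
        by (cases i) (simp_all add: add mult neg diff algebra_simps)
    qed
    finally show ?case
      using insert unfolding P_def n_def by simp
  qed
  have p: "CARD('p) > 1"
    using prime_card_nat[where ?'p = 'p] prime_gt_1_nat by blast
  have "(\<Prod>c\<in>(UNIV :: 'p mod_ring set). [:- c, 1:]) = [:0, 1:] ^ CARD('p) - [:0, 1:]"
    using poly_identity_mod_p[of "[:0, 1:] :: 'p mod_ring poly"] by simp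
  also have "\<dots> = Polynomial.monom 1 CARD('p) - Polynomial.monom 1 1"
    by (simp add: monom_altdef)
  finally have coeff: "Polynomial.coeff (\<Prod>c\<in>(UNIV :: 'p mod_ring set). [:- c, 1:]) i =
      (if i = CARD('p) then 1 else if i = 1 then - 1 else 0)" for i
    using p by auto
  have "(\<Prod>c\<in>UNIV. Y - \<kappa> c * Z) = (\<Sum>i\<le>CARD('p). (if i = CARD('p) then Y ^ CARD('p) else 0) +
      (if i = 1 then - (Z ^ (CARD('p) - 1) * Y) else 0))"
    unfolding expand[OF finite] coeff CARD_mod_ring using p
    by (intro sum.cong) (auto simp: zero one neg)
  also have "\<dots> = Y ^ CARD('p) - Z ^ (CARD('p) - 1) * Y"
    using p by (simp add: sum.distrib)
  finally show ?thesis .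
qed

lemma pcompose_linear:
  "pcompose [:- s, 1:] [:- t, 1:] = [:- (s + t), 1 :: 'a::comm_ring_1:]"
  by (simp add: pcompose_pCons algebra_simps)

text \<open>
  In characteristic \<open>p\<close> the polynomial \<open>P\<close> is additive, so \<open>P(T - t) = P(T) - P(t)\<close>.
\<close>

lemma pcompose_sum_monom_char_power:
  fixes t :: "'c::comm_ring_1" and g :: "nat \<Rightarrow> 'c" and r :: nat
  assumes "Factorial_Ring.prime CHAR('c)"
  defines "P \<equiv> \<Sum>l\<le>r. Polynomial.monom (g l) (CHAR('c) ^ l)"
  shows "pcompose P [:- t, 1:] = P - [:poly P t:]"
proof -
  have pow: "[:- t, 1:] ^ (CHAR('c) ^ l) = Polynomial.monom 1 (CHAR('c) ^ l) - [:t ^ (CHAR('c) ^ l):]" for l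
  proof -
    have eq: "[:- t, 1:] + [:t:] = [:0, 1:]"
      by simp
    have "([:- t, 1:] + [:t:]) ^ (CHAR('c) ^ l) = [:- t, 1:] ^ (CHAR('c) ^ l) + [:t:] ^ (CHAR('c) ^ l)"
      by (rule freshmans_dream') (use assms(1) in auto)
    thus ?thesis
      unfolding eq by (simp add: monom_altdef poly_const_pow algebra_simps)
  qed
  have comp: "pcompose (Polynomial.monom a m) Q = Polynomial.smult a (Q ^ m)" for a :: 'c and m Q
    by (simp add: monom_altdef pcompose_smult pcompose_hom.hom_power pcompose_pCons)
  have "pcompose P [:- t, 1:] = (\<Sum>l\<le>r. Polynomial.smult (g l) ([:- t, 1:] ^ (CHAR('c) ^ l)))"
    unfolding P_def by (simp add: pcompose_sum comp)
  also have "\<dots> = (\<Sum>l\<le>r. Polynomial.monom (g l) (CHAR('c) ^ l) - [:g l * t ^ (CHAR('c) ^ l):])"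
    unfolding pow by (intro sum.cong) (simp_all add: smult_diff_right smult_monom)
  also have "\<dots> = P - [:poly P t:]"
    unfolding P_def by (simp add: sum_subtractf poly_sum poly_monom flip: sum_to_poly)
  finally show ?thesis .
qed

lemma dickson_poly_Suc:
  "(dickson_poly (Suc r) :: (nat, 'p::prime_card) mpoly poly) = (\<Prod>c\<in>UNIV. pcompose (dickson_poly r) [:- (scalar_poly c * var r), 1:])"
proof -
  have "linear_form (Suc r) (a(r := c)) = linear_form r a + scalar_poly c * var r"
    for a :: "nat \<Rightarrow> 'p mod_ring" and c
    unfolding linear_form_def by (simp add: fun_upd_def)
  thus ?thesis
    unfolding dickson_poly_def prod_coord_vectors_Suc pcompose_prod pcompose_linear by simp
qed

text \<open>
  By induction on \<open>r\<close>: since \<open>\<Phi>\<^sub>r\<close> is additive, \<open>\<Phi>\<^sub>r\<^sub>+\<^sub>1(T) = \<Prod>\<^sub>c \<Phi>\<^sub>r(T - c x\<^sub>r) = \<Prod>\<^sub>c (\<Phi>\<^sub>r(T) - c s)\<close> with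
  \<open>s = \<Phi>\<^sub>r(x\<^sub>r)\<close>, and this is \<open>\<Phi>\<^sub>r\<^sup>p\<close> minus a multiple of \<open>\<Phi>\<^sub>r\<close>.  Both are additive again.
\<close>

lemma dickson_poly_additive:
  "\<exists>g. g r = 1 \<and> (dickson_poly r :: (nat, 'p::prime_card) mpoly poly) =
     (\<Sum>l\<le>r. Polynomial.monom (g l) (CARD('p) ^ l))"
proof (induction r)
  case 0
  show ?case
    by (intro exI[of _ "\<lambda>_. 1"]) (simp add: dickson_poly_def coord_vectors_0 linear_form_def monom_altdef)
next
  case (Suc r)
  then obtain g where g: "g r = 1" and
    D: "(dickson_poly r :: (nat, 'p) mpoly poly) = (\<Sum>l\<le>r. Polynomial.monom (g l) (CARD('p) ^ l))"
    by blast
  define P where "P = (dickson_poly r :: (nat, 'p) mpoly poly)"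
  define s where "s = poly P (var r)"
  define \<kappa> :: "'p mod_ring \<Rightarrow> (nat, 'p) mpoly poly" where "\<kappa> = (\<lambda>c. [:scalar_poly c:])"
  have char: "Factorial_Ring.prime CHAR((nat, 'p) mpoly)"
    using prime_card_nat by simp
  have comp: "pcompose P [:- t, 1:] = P - [:poly P t:]" for t
    unfolding P_def D using pcompose_sum_monom_char_power[OF char, where t = t and g = g and r = r] by simp
  have fermat: "(c :: 'p mod_ring) ^ (CARD('p) ^ l) = c" for c l
    by (induction l) (simp_all add: power_mult)
  have val: "poly P (scalar_poly c * var r) = scalar_poly c * s" for c
  proof -
    have "poly P (scalar_poly c * var r) = (\<Sum>l\<le>r. g l * (scalar_poly (c ^ (CARD('p) ^ l)) * var r ^ (CARD('p) ^ l)))"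
      unfolding P_def D by (simp add: poly_sum poly_monom power_mult_distrib scalar_poly_power)
    thus ?thesis
      unfolding fermat s_def P_def D by (simp add: poly_sum poly_monom sum_distrib_left mult_ac)
  qed
  have "dickson_poly (Suc r) = (\<Prod>c\<in>UNIV. P - \<kappa> c * [:s:])"
    unfolding dickson_poly_Suc P_def[symmetric] comp val \<kappa>_def by (simp add: mult.commute)
  also have "\<dots> = P ^ CARD('p) - [:s:] ^ (CARD('p) - 1) * P"
    by (rule prod_scalar_multiples) (simp_all add: \<kappa>_def scalar_poly_add scalar_poly_mult)
  also have "P ^ CARD('p) = (\<Sum>l\<le>r. Polynomial.monom (g l ^ CARD('p)) (CARD('p) ^ Suc l))"
    unfolding P_def D
    by (subst freshmans_dream_sum) (simp_all add: prime_card_nat monom_power mult.commute)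
  also have "\<dots> = (\<Sum>l\<le>Suc r. Polynomial.monom (if l = 0 then 0 else g (l - 1) ^ CARD('p)) (CARD('p) ^ l))"
    by (subst sum.atMost_Suc_shift) simp
  also have "[:s:] ^ (CARD('p) - 1) * P = (\<Sum>l\<le>Suc r. Polynomial.monom (if l = Suc r then 0 else s ^ (CARD('p) - 1) * g l) (CARD('p) ^ l))"
    unfolding P_def D
    by (simp add: sum_distrib_left poly_const_pow smult_monom)
  finally show ?case
    by (intro exI[of _ "\<lambda>l. (if l = 0 then 0 else g (l - 1) ^ CARD('p)) -
          (if l = Suc r then 0 else s ^ (CARD('p) - 1) * g l)"])
      (simp add: sum_subtractf[symmetric] g diff_monom)
qed

text \<open>
  The linear form \<open>linear_form j\<close> forgets the coordinates from \<open>j\<close> on, so every root of \<open>\<Phi>\<^sub>j\<close> occurs once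
  for each choice of the \<open>n - j\<close> forgotten coordinates.
\<close>

lemma dickson_poly_restrict:
  assumes "j \<le> n"
  shows "(\<Prod>a\<in>coord_vectors n. [:- linear_form j a, 1:]) = (dickson_poly j :: (nat, 'p::prime_card) mpoly poly) ^ (CARD('p) ^ (n - j))"
  using assms
proof (induction n rule: dec_induct)
  case base
  show ?case by (simp add: dickson_poly_def)
next
  case (step n)
  thus ?case
    by (simp add: prod_coord_vectors_Suc linear_form_upd_ge Suc_diff_le mult.commute flip: power_mult)
qed

lemma dickson_power_coeffs:
  assumes "j \<le> n"
  defines "q \<equiv> CARD('p) ^ (n - j)"
  shows "\<exists>g. g j = 1 \<and> (dickson_poly j :: (nat, 'p::prime_card) mpoly poly) ^ q =
     (\<Sum>l\<le>j. Polynomial.monom (g l) (q * CARD('p) ^ l))"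
proof -
  obtain g where g: "g j = 1" and
    D: "(dickson_poly j :: (nat, 'p) mpoly poly) = (\<Sum>l\<le>j. Polynomial.monom (g l) (CARD('p) ^ l))"
    using dickson_poly_additive by blast
  have "(dickson_poly j :: (nat, 'p) mpoly poly) ^ q = (\<Sum>l\<le>j. Polynomial.monom (g l ^ q) (q * CARD('p) ^ l))"
    unfolding D q_def
    by (subst freshmans_dream_sum') (simp_all add: prime_card_nat monom_power mult.commute)
  thus ?thesis
    by (intro exI[of _ "\<lambda>l. g l ^ q"]) (simp add: g)
qed

section \<open>Freeness of the polynomial ring over the Dickson invariants\<close>

text \<open>
  A filtration \<open>A\<close> of a ring by degrees.  It is not required to be increasing: the members may
  also be the homogeneous parts of a grading.
\<close>

locale filtered_family =
  fixes A :: "int \<Rightarrow> 'a::comm_ring_1 set"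
  assumes zero: "0 \<in> A d"
    and one: "1 \<in> A 0"
    and add: "\<lbrakk>u \<in> A d; v \<in> A d\<rbrakk> \<Longrightarrow> u + v \<in> A d"
    and uminus: "u \<in> A d \<Longrightarrow> - u \<in> A d"
    and mult: "\<lbrakk>u \<in> A d; v \<in> A e\<rbrakk> \<Longrightarrow> u * v \<in> A (d + e)"
begin

text \<open>
  With the polynomial variable in degree 1, such a polynomial is homogeneous of degree \<open>M\<close>, or of degree
  at most \<open>M\<close> in the case of an increasing filtration.
\<close>

definition homogeneous_coeffs :: "int \<Rightarrow> 'a poly \<Rightarrow> bool" where
  "homogeneous_coeffs M P \<longleftrightarrow> (\<forall>m. Polynomial.coeff P m \<in> A (M - int m))"

lemma sum_mem: "(\<And>x. x \<in> I \<Longrightarrow> f x \<in> A d) \<Longrightarrow> sum f I \<in> A d"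
  by (induction I rule: infinite_finite_induct) (auto intro: zero add)

lemma homogeneous_coeffs_1: "homogeneous_coeffs 0 1"
  by (auto simp: homogeneous_coeffs_def coeff_1 one intro: zero)

lemma homogeneous_coeffs_mult:
  assumes "homogeneous_coeffs M P" "homogeneous_coeffs N Q"
  shows "homogeneous_coeffs (M + N) (P * Q)"
  unfolding homogeneous_coeffs_def coeff_mult
proof (intro allI sum_mem)
  fix m i :: nat assume "i \<in> {..m}"
  hence "(M + N) - int m = (M - int i) + (N - int (m - i))"
    by (simp add: of_nat_diff)
  thus "Polynomial.coeff P i * Polynomial.coeff Q (m - i) \<in> A ((M + N) - int m)"
    using assms mult unfolding homogeneous_coeffs_def by metis
qed

lemma homogeneous_coeffs_power:
  "homogeneous_coeffs M P \<Longrightarrow> homogeneous_coeffs (int n * M) (P ^ n)"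
  by (induction n) (auto simp: homogeneous_coeffs_1 algebra_simps dest: homogeneous_coeffs_mult)

lemma homogeneous_coeffs_prod:
  assumes "finite I" "\<And>i. i \<in> I \<Longrightarrow> homogeneous_coeffs 1 (f i)"
  shows "homogeneous_coeffs (int (card I)) (prod f I)"
  using assms
proof (induction I rule: finite_induct)
  case (insert x I)
  have "homogeneous_coeffs (1 + int (card I)) (f x * prod f I)"
    using insert by (intro homogeneous_coeffs_mult) auto
  thus ?case using insert by simp
qed (simp add: homogeneous_coeffs_1)

lemma homogeneous_coeffs_linear: "u \<in> A 1 \<Longrightarrow> homogeneous_coeffs 1 [:- u, 1:]"
  unfolding homogeneous_coeffs_def
  by (auto simp: coeff_pCons coeff_1 uminus one zero split: nat.splits)

text \<open>
  Division by a monic polynomial determines the coefficients of the quotient from the top downwards,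
  by the formula for the coefficients of the product.
\<close>

lemma homogeneous_coeffs_quotient:
  assumes G: "homogeneous_coeffs (int e) G" "Polynomial.coeff G e = 1" "Polynomial.degree G \<le> e"
    and GH: "homogeneous_coeffs (int e + M) (G * H)"
  shows "homogeneous_coeffs M H"
proof -
  have "Polynomial.coeff H m \<in> A (M - int m)" if "Polynomial.degree H < m + k" for m k
    using that
  proof (induction k arbitrary: m rule: less_induct)
    case (less k)
    show ?case
    proof (cases "k = 0")
      case True
      thus ?thesis using less.prems by (simp add: coeff_eq_0 zero)
    next
      case False
      have "Polynomial.coeff (G * H) (m + e) = (\<Sum>i\<le>m + e. Polynomial.coeff G i * Polynomial.coeff H (m + e - i))"
        by (rule coeff_mult)
      also have "\<dots> = (\<Sum>i\<le>e. Polynomial.coeff G i * Polynomial.coeff H (m + e - i))"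
      proof (rule sum.mono_neutral_right, goal_cases)
        case 3
        have "Polynomial.coeff G i = 0" if "i > e" for i
          using that G(3) by (intro coeff_eq_0) linarith
        thus ?case by auto
      qed auto
      also have "\<dots> = Polynomial.coeff H m + (\<Sum>i<e. Polynomial.coeff G i * Polynomial.coeff H (m + e - i))"
        by (simp add: lessThan_Suc_atMost[symmetric] G(2) add.commute)
      finally have eq: "Polynomial.coeff H m = Polynomial.coeff (G * H) (m + e) +
          - (\<Sum>i<e. Polynomial.coeff G i * Polynomial.coeff H (m + e - i))"
        by simp
      have "Polynomial.coeff (G * H) (m + e) \<in> A (M - int m)"
        using GH[unfolded homogeneous_coeffs_def, rule_format, of "m + e"] by simp
      moreover have "Polynomial.coeff G i * Polynomial.coeff H (m + e - i) \<in> A (M - int m)" if "i < e" for i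
      proof -
        have "Polynomial.coeff H (m + e - i) \<in> A (M - int (m + e - i))"
          using that False less.prems by (intro less.IH[of "k - 1"]) auto
        hence "Polynomial.coeff G i * Polynomial.coeff H (m + e - i) \<in> A ((int e - int i) + (M - int (m + e - i)))"
          using G(1) mult unfolding homogeneous_coeffs_def by blast
        thus ?thesis using that by (simp add: of_nat_diff)
      qed
      ultimately show ?thesis
        unfolding eq by (intro add uminus sum_mem) auto
    qed
  qed
  from this[of _ "Suc (Polynomial.degree H)"] show ?thesis
    unfolding homogeneous_coeffs_def by simp
qed

end

lemma monic_mult:
  fixes P Q :: "'a::comm_ring_1 poly"
  assumes "Polynomial.degree P \<le> m" "Polynomial.coeff P m = 1"
    and "Polynomial.degree Q \<le> n" "Polynomial.coeff Q n = 1"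
  shows "Polynomial.degree (P * Q) \<le> m + n \<and> Polynomial.coeff (P * Q) (m + n) = 1"
proof
  show "Polynomial.degree (P * Q) \<le> m + n"
    using degree_mult_le[of P Q] assms by linarith
  have "Polynomial.coeff (P * Q) (m + n) = (\<Sum>i\<le>m + n. Polynomial.coeff P i * Polynomial.coeff Q (m + n - i))"
    by (rule coeff_mult)
  also have "\<dots> = (\<Sum>i\<in>{m}. Polynomial.coeff P i * Polynomial.coeff Q (m + n - i))"
  proof (rule sum.mono_neutral_right, goal_cases)
    case 3
    have "Polynomial.coeff P i * Polynomial.coeff Q (m + n - i) = 0" if "i \<le> m + n" "i \<noteq> m" for i
    proof (cases "i < m")
      case True
      hence "Polynomial.coeff Q (m + n - i) = 0"
        using assms by (intro coeff_eq_0) linarith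
      thus ?thesis by simp
    next
      case False
      hence "Polynomial.coeff P i = 0"
        using that assms by (intro coeff_eq_0) linarith
      thus ?thesis by simp
    qed
    thus ?case by auto
  qed auto
  finally show "Polynomial.coeff (P * Q) (m + n) = 1"
    using assms by simp
qed

lemma monic_prod_linear:
  fixes f :: "'b \<Rightarrow> 'a::comm_ring_1"
  assumes "finite I"
  shows "Polynomial.degree (\<Prod>i\<in>I. [:f i, 1:]) \<le> card I \<and> Polynomial.coeff (\<Prod>i\<in>I. [:f i, 1:]) (card I) = 1"
  using assms
proof (induction I rule: finite_induct)
  case (insert x I)
  thus ?case
    using monic_mult[of "[:f x, 1:]" 1 "\<Prod>i\<in>I. [:f i, 1:]" "card I"] by simp
qed simp

lemma monic_power:
  fixes P :: "'a::comm_ring_1 poly"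
  assumes "Polynomial.degree P \<le> m" "Polynomial.coeff P m = 1"
  shows "Polynomial.degree (P ^ n) \<le> n * m \<and> Polynomial.coeff (P ^ n) (n * m) = 1"
proof (induction n)
  case (Suc n)
  thus ?case using monic_mult[of P m "P ^ n" "n * m"] assms by simp
qed simp

text \<open>
  In the application \<open>q\<close> is the index of a subspace, a power of \<open>p\<close>, and the \<open>g l\<close> are the \<open>q\<close>-th powers of the
  coefficients of \<open>\<Phi>\<^sub>j = dickson_poly j\<close>.  These are the restrictions of Dickson invariants of the larger space.
\<close>

locale dickson_system =
  fixes j q :: nat and g :: "nat \<Rightarrow> (nat, 'p::prime_card) mpoly"
  assumes q_pos: "q > 0"
    and g_top: "g j = 1"
    and expansion: "dickson_poly j ^ q = (\<Sum>l\<le>j. Polynomial.monom (g l) (q * CARD('p) ^ l))"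
begin

text \<open>The degree of \<open>g l\<close>.\<close>

definition D :: "nat \<Rightarrow> nat" where
  "D l = q * (CARD('p) ^ j - CARD('p) ^ l)"

lemma card_gt_1: "CARD('p) > 1"
  using prime_card_nat[where ?'p = 'p] prime_gt_1_nat by blast

lemma D_pos: "l < j \<Longrightarrow> D l > 0"
  unfolding D_def using q_pos card_gt_1 by (simp add: power_strict_increasing)

lemma int_D: "l \<le> j \<Longrightarrow> int (D l) = int (q * CARD('p) ^ j) - int (q * CARD('p) ^ l)"
  unfolding D_def using card_gt_1 by (simp add: of_nat_diff power_increasing right_diff_distrib)

text \<open>
  The degree filtration on the subalgebra generated by the \<open>g l\<close> and the first \<open>r\<close> variables.  The degree
  bound is an integer, so that it can be lowered freely; below degree 0 there is only 0.
\<close>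

inductive in_subalg :: "nat \<Rightarrow> int \<Rightarrow> (nat, 'p) mpoly \<Rightarrow> bool" for r where
  "in_subalg r d 0"
| "d \<ge> 0 \<Longrightarrow> in_subalg r d (scalar_poly c)"
| "in_subalg r d u \<Longrightarrow> in_subalg r d v \<Longrightarrow> in_subalg r d (u + v)"
| "l < j \<Longrightarrow> in_subalg r d u \<Longrightarrow> in_subalg r (d + int (D l)) (g l * u)"
| "l < r \<Longrightarrow> in_subalg r d u \<Longrightarrow> in_subalg r (d + 1) (var l * u)"

definition subalg :: "nat \<Rightarrow> int \<Rightarrow> (nat, 'p) mpoly set" where
  "subalg r d = {u. in_subalg r d u}"

lemma in_subalg_iff: "in_subalg r d u \<longleftrightarrow> u \<in> subalg r d"
  by (simp add: subalg_def)

lemmas subalg_intros = in_subalg.intros[unfolded in_subalg_iff]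
lemmas subalg_zero = subalg_intros(1)
  and subalg_scalar = subalg_intros(2)
  and subalg_add = subalg_intros(3)
  and subalg_dickson = subalg_intros(4)
  and subalg_var = subalg_intros(5)
lemmas subalg_induct [consumes 1, case_names zero scalar add dickson var] =
  in_subalg.induct[unfolded in_subalg_iff]

lemma subalg_scalar_mult: "u \<in> subalg r d \<Longrightarrow> e \<ge> 0 \<Longrightarrow> scalar_poly c * u \<in> subalg r (d + e)"
proof (induction rule: subalg_induct)
  case (scalar d c')
  thus ?case by (auto simp flip: scalar_poly_mult intro: subalg_scalar)
next
  case (dickson l d u)
  thus ?case
    using subalg_dickson[of l "scalar_poly c * u" r "d + e"] by (simp add: algebra_simps)
next
  case (var l d u)
  thus ?case
    using subalg_var[of l r "scalar_poly c * u" "d + e"] by (simp add: algebra_simps)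
qed (auto simp: distrib_left intro: subalg_zero subalg_add)

lemma subalg_mult: "u \<in> subalg r d \<Longrightarrow> v \<in> subalg r e \<Longrightarrow> u * v \<in> subalg r (d + e)"
proof (induction rule: subalg_induct)
  case (scalar d c)
  thus ?case using subalg_scalar_mult[of v r e d c] by (simp add: add.commute)
next
  case (dickson l d u)
  thus ?case
    using subalg_dickson[of l "u * v" r "d + e"] by (simp add: algebra_simps)
next
  case (var l d u)
  thus ?case
    using subalg_var[of l r "u * v" "d + e"] by (simp add: algebra_simps)
qed (auto simp: distrib_right intro: subalg_zero subalg_add)

sublocale subalg: filtered_family "subalg r" for r
proof
  fix u d assume "u \<in> subalg r d"
  hence "scalar_poly (- 1) * u \<in> subalg r (d + 0)"
    by (rule subalg_scalar_mult) simp
  thus "- u \<in> subalg r d"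
    by (simp add: scalar_poly_uminus)
qed (use subalg_scalar[of 0 1 r] in \<open>auto intro: subalg_intros subalg_mult\<close>)

lemma subalg_g: "l \<le> j \<Longrightarrow> g l \<in> subalg r (int (q * CARD('p) ^ j) - int (q * CARD('p) ^ l))"
proof (cases "l = j")
  case True
  thus ?thesis using subalg.one by (simp add: g_top)
next
  case False
  moreover assume "l \<le> j"
  ultimately have "g l * 1 \<in> subalg r (0 + int (D l))"
    by (intro subalg_dickson subalg.one) auto
  thus ?thesis using \<open>l \<le> j\<close> by (simp add: int_D)
qed

lemma subalg_linear_form: "linear_form r a \<in> subalg r 1"
  unfolding linear_form_def
proof (rule subalg.sum_mem)
  fix l assume "l \<in> {..<r}"
  hence "var l * scalar_poly (a l) \<in> subalg r (0 + 1)"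
    by (intro subalg_var subalg_scalar) auto
  thus "scalar_poly (a l) * var l \<in> subalg r 1"
    by (simp add: mult.commute)
qed

text \<open>
  The roots of \<open>\<Phi>\<^sub>r\<close> are linear in the first \<open>r\<close> variables.  On the other hand \<open>\<Phi>\<^sub>j\<^sup>q\<close> is homogeneous over the
  same subalgebra because its coefficients are the \<open>g l\<close>.
\<close>

lemma homogeneous_dickson_power:
  "subalg.homogeneous_coeffs r (int (q * CARD('p) ^ r)) (dickson_poly r ^ q)"
proof -
  have "subalg.homogeneous_coeffs r (int (card (coord_vectors r :: (nat \<Rightarrow> 'p mod_ring) set))) (dickson_poly r)"
    unfolding dickson_poly_def
    by (intro subalg.homogeneous_coeffs_prod subalg.homogeneous_coeffs_linear subalg_linear_form) simp
  from subalg.homogeneous_coeffs_power[OF this, of q] show ?thesis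
    by (simp add: card_coord_vectors)
qed

lemma homogeneous_expansion:
  "subalg.homogeneous_coeffs r (int (q * CARD('p) ^ j)) (dickson_poly j ^ q)"
  unfolding expansion subalg.homogeneous_coeffs_def Polynomial.coeff_sum
  by (intro allI subalg.sum_mem) (auto simp: subalg_g[simplified] subalg_zero)

text \<open>
  The variable \<open>x\<^sub>r\<close> is integral over the subalgebra generated by the \<open>g l\<close> and the preceding variables:
  \<open>\<Phi>\<^sub>r\<^sup>q\<close> divides \<open>\<Phi>\<^sub>j\<^sup>q\<close>, both have coefficients in this subalgebra, hence so has the quotient \<open>H\<close>, which is
  monic of degree \<open>D r\<close> and vanishes at \<open>x\<^sub>r\<close>.
\<close>

lemma var_power_reduction:
  assumes "r < j"
  shows "\<exists>h. (\<forall>m. h m \<in> subalg r (int (D r) - int m)) \<and> var r ^ D r = (\<Sum>m<D r. h m * var r ^ m)"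
proof -
  let ?C = "coord_vectors :: nat \<Rightarrow> (nat \<Rightarrow> 'p mod_ring) set"
  define H0 where "H0 = (\<Prod>a\<in>?C j - ?C r. [:- linear_form j a, 1:])"
  define H where "H = H0 ^ q"
  have sub: "?C r \<subseteq> ?C j"
    using assms by (auto simp: coord_vectors_def)
  have "(\<Prod>a\<in>?C r. [:- linear_form j a, 1:]) = dickson_poly r"
    unfolding dickson_poly_def using assms by (intro prod.cong) (simp_all add: linear_form_extend)
  hence "dickson_poly j = dickson_poly r * H0"
    unfolding dickson_poly_def[of j] H0_def prod.subset_diff[OF sub finite_coord_vectors]
    by (simp add: mult.commute)
  hence fac: "dickson_poly j ^ q = dickson_poly r ^ q * H"
    by (simp add: H_def power_mult_distrib)
  have deg: "Polynomial.degree (dickson_poly r ^ q :: (nat, 'p) mpoly poly) \<le> q * CARD('p) ^ r"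
    and lead: "Polynomial.coeff (dickson_poly r ^ q :: (nat, 'p) mpoly poly) (q * CARD('p) ^ r) = 1"
    using monic_power[of "dickson_poly r :: (nat, 'p) mpoly poly" "CARD('p) ^ r" q]
      monic_prod_linear[of "?C r" "\<lambda>a. - linear_form r a"]
    by (simp_all add: dickson_poly_def card_coord_vectors)
  have "card (?C j - ?C r) = CARD('p) ^ j - CARD('p) ^ r"
    using sub by (simp add: card_Diff_subset card_coord_vectors)
  hence degH: "Polynomial.degree H \<le> D r" and leadH: "Polynomial.coeff H (D r) = 1"
    using monic_power[of H0 "CARD('p) ^ j - CARD('p) ^ r" q]
      monic_prod_linear[of "?C j - ?C r" "\<lambda>a. - linear_form j a"]
    by (simp_all add: H_def H0_def D_def)
  have hom: "subalg.homogeneous_coeffs r (int (D r)) H"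
    by (rule subalg.homogeneous_coeffs_quotient[OF homogeneous_dickson_power lead deg])
      (use homogeneous_expansion[of r] assms in \<open>simp add: fac[symmetric] int_D\<close>)
  \<comment> \<open>The linear form \<open>x\<^sub>r\<close> is a root of \<open>\<Phi>\<^sub>j\<close> but not of \<open>\<Phi>\<^sub>r\<close>, so it is a root of the quotient.\<close>
  define a0 :: "nat \<Rightarrow> 'p mod_ring" where "a0 = (\<lambda>i. if i = r then 1 else 0)"
  have "a0 \<in> ?C j - ?C r"
    using assms by (auto simp: a0_def coord_vectors_def)
  moreover have "linear_form j a0 = var r"
    unfolding linear_form_def a0_def using assms
    by (subst sum.mono_neutral_right[of _ "{r}"]) auto
  ultimately have "poly H0 (var r) = 0"
    unfolding H0_def poly_prod by (intro prod_zero bexI[of _ a0]) auto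
  hence "0 = poly H (var r)"
    using q_pos by (simp add: H_def zero_power)
  also have "\<dots> = (\<Sum>m\<le>D r. Polynomial.coeff H m * var r ^ m)"
    unfolding poly_altdef
    by (rule sum.mono_neutral_left) (use degH in \<open>auto simp: coeff_eq_0\<close>)
  also have "\<dots> = (\<Sum>m<D r. Polynomial.coeff H m * var r ^ m) + var r ^ D r"
    by (simp add: lessThan_Suc_atMost[symmetric] leadH)
  finally have "var r ^ D r = (\<Sum>m<D r. - Polynomial.coeff H m * var r ^ m)"
    by (simp add: sum_negf eq_neg_iff_add_eq_0 add.commute)
  thus ?thesis
    using hom unfolding subalg.homogeneous_coeffs_def
    by (intro exI[of _ "\<lambda>m. - Polynomial.coeff H m"]) (auto intro: subalg.uminus)
qed

text \<open>
  By the integral equation for \<open>x\<^sub>r\<close>, only powers of \<open>x\<^sub>r\<close> below \<open>D r\<close> are needed, and this without raising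
  the degree.
\<close>

lemma subalg_Suc_reduce:
  assumes "r < j" "u \<in> subalg (Suc r) d"
  shows "\<exists>v. (\<forall>m. v m \<in> subalg r (d - int m)) \<and> u = (\<Sum>m<D r. v m * var r ^ m)"
  using assms(2)
proof (induction rule: subalg_induct)
  case (zero d)
  show ?case by (intro exI[of _ "\<lambda>_. 0"]) (simp add: subalg_zero)
next
  case (scalar d c)
  have "(\<Sum>m<D r. (if m = 0 then scalar_poly c else 0) * var r ^ m) = scalar_poly c"
    by (subst sum.mono_neutral_right[of _ "{0}"]) (use D_pos[OF assms(1)] in auto)
  thus ?case using scalar
    by (intro exI[of _ "\<lambda>m. if m = 0 then scalar_poly c else 0"]) (auto simp: subalg_zero subalg_scalar)
next
  case (add d u v)
  then obtain a b where "\<forall>m. a m \<in> subalg r (d - int m)" "u = (\<Sum>m<D r. a m * var r ^ m)"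
    "\<forall>m. b m \<in> subalg r (d - int m)" "v = (\<Sum>m<D r. b m * var r ^ m)"
    by blast
  thus ?case
    by (intro exI[of _ "\<lambda>m. a m + b m"]) (auto simp: subalg_add distrib_right sum.distrib)
next
  case (dickson l d u)
  then obtain a where a: "\<forall>m. a m \<in> subalg r (d - int m)" "u = (\<Sum>m<D r. a m * var r ^ m)"
    by blast
  have "g l * a m \<in> subalg r (d - int m + int (D l))" for m
    using a dickson by (intro subalg_dickson) auto
  thus ?case
    using a(2) by (intro exI[of _ "\<lambda>m. g l * a m"]) (simp add: sum_distrib_left algebra_simps)
next
  case (var l d u)
  then obtain a where a: "\<forall>m. a m \<in> subalg r (d - int m)" "u = (\<Sum>m<D r. a m * var r ^ m)"
    by blast
  show ?case
  proof (cases "l = r")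
    case False
    hence "l < r" using var by simp
    hence "var l * a m \<in> subalg r (d - int m + 1)" for m
      using a by (intro subalg_var) auto
    thus ?thesis
      using a(2) by (intro exI[of _ "\<lambda>m. var l * a m"]) (simp add: sum_distrib_left algebra_simps)
  next
    case True
    obtain h where h: "\<forall>m. h m \<in> subalg r (int (D r) - int m)" "var r ^ D r = (\<Sum>m<D r. h m * var r ^ m)"
      using var_power_reduction[OF assms(1)] by blast
    obtain k where k: "D r = Suc k"
      using D_pos[OF assms(1)] gr0_implies_Suc by blast
    define b where "b m = (if m = 0 then 0 else a (m - 1)) + a k * h m" for m
    have "a (m - 1) \<in> subalg r (d + 1 - int m)" if "m \<noteq> 0" for m
    proof -
      have "d - int (m - 1) = d + 1 - int m" using that by (simp add: of_nat_diff)
      thus ?thesis using a(1) by metis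
    qed
    moreover have "a k * h m \<in> subalg r (d + 1 - int m)" for m
    proof -
      have "d + 1 - int m = (d - int k) + (int (D r) - int m)" by (simp add: k)
      thus ?thesis using a(1) h(1) subalg_mult by metis
    qed
    ultimately have b: "b m \<in> subalg r (d + 1 - int m)" for m
      unfolding b_def by (cases "m = 0") (simp_all only: if_True if_False refl add_0, blast intro: subalg_add)
    have "var l * u = (\<Sum>m<Suc k. a m * var r ^ Suc m)"
      unfolding a(2) True k by (simp add: sum_distrib_left distrib_left mult_ac)
    also have "\<dots> = (\<Sum>m<k. a m * var r ^ Suc m) + a k * (\<Sum>m<D r. h m * var r ^ m)"
      unfolding h(2)[symmetric] by (simp add: k)
    also have "(\<Sum>m<k. a m * var r ^ Suc m) = (\<Sum>m<D r. (if m = 0 then 0 else a (m - 1)) * var r ^ m)"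
      unfolding k by (subst sum.lessThan_Suc_shift) simp
    finally have "var l * u = (\<Sum>m<D r. b m * var r ^ m)"
      by (simp add: b_def distrib_right sum.distrib sum_distrib_left mult.assoc)
    thus ?thesis using b by blast
  qed
qed

text \<open>
  The monomial with exponents \<open>\<beta>\<close>, where \<open>x\<^sub>l\<close> to the power \<open>D l\<close>, an element of the same degree as \<open>g l\<close>,
  is replaced by \<open>g l\<close> as often as possible.
\<close>

definition mixed_monomial :: "nat multiset \<Rightarrow> (nat, 'p) mpoly" where
  "mixed_monomial \<beta> = (\<Prod>l<j. g l ^ (count \<beta> l div D l) * var l ^ (count \<beta> l mod D l))"

definition dickson_twist :: "(nat, 'p) mpoly \<Rightarrow> (nat, 'p) mpoly" where
  "dickson_twist u = (\<Sum>\<beta>\<in>Poly_Mapping.keys u. scalar_poly (Poly_Mapping.lookup u \<beta>) * mixed_monomial \<beta>)"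

lemma dickson_twist_add: "dickson_twist (u + v) = dickson_twist u + dickson_twist v"
  and dickson_twist_single: "dickson_twist (Poly_Mapping.single \<beta> c) = scalar_poly c * mixed_monomial \<beta>"
  and dickson_twist_0 [simp]: "dickson_twist 0 = 0"
  unfolding dickson_twist_def by (rule linear_extension_add)+

lemma mixed_monomial_shift:
  assumes "l < j" "count \<beta>' l div D l = count \<beta> l div D l + a" "count \<beta>' l mod D l = count \<beta> l mod D l + b"
    "\<And>i. i \<noteq> l \<Longrightarrow> count \<beta>' i = count \<beta> i"
  shows "mixed_monomial \<beta>' = g l ^ a * var l ^ b * mixed_monomial \<beta>"
proof -
  have split: "mixed_monomial \<gamma> = (g l ^ (count \<gamma> l div D l) * var l ^ (count \<gamma> l mod D l)) *
    (\<Prod>i\<in>{..<j} - {l}. g i ^ (count \<gamma> i div D i) * var i ^ (count \<gamma> i mod D i))" for \<gamma>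
    unfolding mixed_monomial_def using assms(1) by (subst prod.remove[of _ l]) auto
  have "(\<Prod>i\<in>{..<j} - {l}. g i ^ (count \<beta>' i div D i) * var i ^ (count \<beta>' i mod D i)) =
      (\<Prod>i\<in>{..<j} - {l}. g i ^ (count \<beta> i div D i) * var i ^ (count \<beta> i mod D i))"
    using assms(4) by (intro prod.cong) auto
  thus ?thesis
    unfolding split[of \<beta>'] split[of \<beta>] assms(2,3) by (simp add: power_add mult_ac)
qed

lemma dickson_twist_mult_single:
  assumes "Poly_Mapping.keys u \<subseteq> B"
    and "\<And>\<beta>. \<beta> \<in> B \<Longrightarrow> mixed_monomial (\<beta> + \<mu>) = w * mixed_monomial \<beta>"
  shows "dickson_twist (u * Poly_Mapping.single \<mu> 1) = w * dickson_twist u"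
  using assms(1)
  by (induction rule: mpoly_induct)
     (simp_all add: mult_single dickson_twist_single dickson_twist_add assms(2) algebra_simps)

text \<open>
  Through the twist, multiplication by \<open>g l\<close> becomes multiplication by a monomial.  This is why the
  coordinates given by the twist make the \<open>g l\<close> a regular sequence.
\<close>

lemma dickson_twist_g:
  assumes "l < j"
  shows "dickson_twist (Poly_Mapping.single (replicate_mset (D l) l) 1 * u) = g l * dickson_twist u"
proof -
  have "mixed_monomial (\<beta> + replicate_mset (D l) l) = g l ^ 1 * var l ^ 0 * mixed_monomial \<beta>" for \<beta>
    using assms D_pos[OF assms] by (intro mixed_monomial_shift) auto
  thus ?thesis
    using dickson_twist_mult_single[of u UNIV "replicate_mset (D l) l" "g l"] by (simp add: mult.commute)
qed

lemma dickson_twist_scalar: "dickson_twist (scalar_poly c * u) = scalar_poly c * dickson_twist u"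
proof -
  have "Poly_Mapping.keys u \<subseteq> UNIV" by simp
  thus ?thesis
    by (induction rule: mpoly_induct)
      (simp_all add: scalar_poly_def[of c] mult_single dickson_twist_single dickson_twist_add algebra_simps,
       simp add: scalar_poly_def[symmetric] scalar_poly_mult mult.assoc)
qed

lemma dickson_twist_1 [simp]: "dickson_twist 1 = 1"
proof -
  have "dickson_twist (Poly_Mapping.single {#} 1) = 1"
    unfolding dickson_twist_single by (simp add: mixed_monomial_def)
  thus ?thesis
    by (simp flip: zero_multiset_def)
qed

text \<open>
  The exponents whose mixed monomials are products of the \<open>g l\<close> and of the variables before \<open>r\<close>.
\<close>

definition span_exponents :: "nat \<Rightarrow> int \<Rightarrow> nat multiset set" where
  "span_exponents r d =
     {\<beta>. set_mset \<beta> \<subseteq> {..<j} \<and> int (size \<beta>) \<le> d \<and> (\<forall>l<j. r \<le> l \<longrightarrow> count \<beta> l mod D l = 0)}"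

definition twist_span :: "nat \<Rightarrow> int \<Rightarrow> (nat, 'p) mpoly set" where
  "twist_span r d = dickson_twist ` {u. Poly_Mapping.keys u \<subseteq> span_exponents r d}"

lemma twist_span_0: "0 \<in> twist_span r d"
  unfolding twist_span_def by (intro image_eqI[of _ _ 0]) simp_all

lemma twist_span_add:
  assumes "u \<in> twist_span r d" "v \<in> twist_span r d"
  shows "u + v \<in> twist_span r d"
proof -
  obtain a b where "u = dickson_twist a" "Poly_Mapping.keys a \<subseteq> span_exponents r d"
    "v = dickson_twist b" "Poly_Mapping.keys b \<subseteq> span_exponents r d"
    using assms unfolding twist_span_def by blast
  moreover have "Poly_Mapping.keys (a + b) \<subseteq> Poly_Mapping.keys a \<union> Poly_Mapping.keys b"
    by (rule keys_add)
  ultimately show ?thesis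
    unfolding twist_span_def by (intro image_eqI[of _ _ "a + b"]) (auto simp: dickson_twist_add)
qed

lemma twist_span_sum: "(\<And>x. x \<in> I \<Longrightarrow> f x \<in> twist_span r d) \<Longrightarrow> sum f I \<in> twist_span r d"
  by (induction I rule: infinite_finite_induct) (auto intro: twist_span_0 twist_span_add)

lemma subalg_0_subset: "u \<in> subalg 0 d \<Longrightarrow> u \<in> twist_span 0 d"
proof (induction rule: subalg_induct)
  case (scalar d c)
  have "scalar_poly c = dickson_twist (scalar_poly c)"
    using dickson_twist_scalar[of c 1] by simp
  thus ?case
    using scalar unfolding twist_span_def
    by (intro image_eqI) (auto simp: scalar_poly_def span_exponents_def split: if_splits)
next
  case (dickson l d u)
  then obtain c where c: "u = dickson_twist c" "Poly_Mapping.keys c \<subseteq> span_exponents 0 d"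
    unfolding twist_span_def by blast
  let ?\<mu> = "replicate_mset (D l) l"
  have "g l * u = dickson_twist (Poly_Mapping.single ?\<mu> 1 * c)"
    using dickson c by (simp add: dickson_twist_g)
  moreover have "?\<mu> + \<beta> \<in> span_exponents 0 (d + int (D l))" if "\<beta> \<in> span_exponents 0 d" for \<beta>
    using that dickson by (auto simp: span_exponents_def)
  hence "Poly_Mapping.keys (Poly_Mapping.single ?\<mu> 1 * c) \<subseteq> span_exponents 0 (d + int (D l))"
    using c(2) keys_mult[of "Poly_Mapping.single ?\<mu> 1" c] by simp blast
  ultimately show ?case
    unfolding twist_span_def by blast
qed (auto intro: twist_span_0 twist_span_add)

text \<open>
  The elements of the subalgebra are combinations of mixed monomials: the variables are added one by
  one, and the remainder exponent of \<open>x\<^sub>r\<close> comes from the reduction of its powers.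
\<close>

lemma subalg_subset_twist_span:
  assumes "r \<le> j" "u \<in> subalg r d"
  shows "u \<in> twist_span r d"
  using assms
proof (induction r arbitrary: u d)
  case 0
  thus ?case by (simp add: subalg_0_subset)
next
  case (Suc r)
  then obtain v where v: "\<forall>m. v m \<in> subalg r (d - int m)" "u = (\<Sum>m<D r. v m * var r ^ m)"
    using subalg_Suc_reduce[of r u d] by auto
  have "v m * var r ^ m \<in> twist_span (Suc r) d" if m: "m < D r" for m
  proof -
    have "v m \<in> twist_span r (d - int m)"
      using Suc v by auto
    then obtain c where c: "v m = dickson_twist c" "Poly_Mapping.keys c \<subseteq> span_exponents r (d - int m)"
      unfolding twist_span_def by blast
    let ?\<mu> = "replicate_mset m r"
    have "v m * var r ^ m = var r ^ m * dickson_twist c"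
      by (simp add: c mult.commute)
    also have "\<dots> = dickson_twist (c * Poly_Mapping.single ?\<mu> 1)"
    proof (rule dickson_twist_mult_single[OF order.refl, symmetric])
      fix \<beta> assume "\<beta> \<in> Poly_Mapping.keys c"
      hence "count \<beta> r mod D r = 0"
        using c(2) Suc.prems(1) by (auto simp: span_exponents_def)
      moreover from this obtain k where "count \<beta> r = D r * k"
        by blast
      ultimately have "mixed_monomial (\<beta> + ?\<mu>) = g r ^ 0 * var r ^ m * mixed_monomial \<beta>"
        using Suc.prems(1) m by (intro mixed_monomial_shift) auto
      thus "mixed_monomial (\<beta> + ?\<mu>) = var r ^ m * mixed_monomial \<beta>"
        by simp
    qed
    finally have "v m * var r ^ m = dickson_twist (c * Poly_Mapping.single ?\<mu> 1)" .
    moreover have "\<beta> + ?\<mu> \<in> span_exponents (Suc r) d" if "\<beta> \<in> span_exponents r (d - int m)" for \<beta>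
      using that Suc.prems(1) by (auto simp: span_exponents_def)
    hence "Poly_Mapping.keys (c * Poly_Mapping.single ?\<mu> 1) \<subseteq> span_exponents (Suc r) d"
      using c(2) keys_mult[of c "Poly_Mapping.single ?\<mu> 1"] by simp blast
    ultimately show ?thesis
      unfolding twist_span_def by blast
  qed
  thus ?case
    unfolding v(2) by (intro twist_span_sum) auto
qed

lemma monomial_in_subalg: "set_mset \<alpha> \<subseteq> {..<j} \<Longrightarrow> Poly_Mapping.single \<alpha> 1 \<in> subalg j (int (size \<alpha>))"
proof (induction \<alpha>)
  case empty
  show ?case using subalg.one by (simp flip: zero_multiset_def)
next
  case (add l \<alpha>)
  have "var l * Poly_Mapping.single \<alpha> 1 \<in> subalg j (int (size \<alpha>) + 1)"
    using add by (intro subalg_var) auto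
  moreover have "var l * Poly_Mapping.single \<alpha> 1 = Poly_Mapping.single (add_mset l \<alpha>) (1 :: 'p mod_ring)"
    by (simp add: var_def mult_single)
  ultimately show ?case by (simp add: add.commute)
qed

lemma polys_upto_subset: "polys_upto j d \<subseteq> dickson_twist ` polys_upto j d"
proof
  fix u :: "(nat, 'p) mpoly" assume "u \<in> polys_upto j d"
  hence "Poly_Mapping.keys u \<subseteq> {m. set_mset m \<subseteq> {..<j} \<and> size m \<le> d}"
    by (auto simp: polys_upto_def)
  hence "u \<in> subalg j (int d)"
  proof (induction rule: mpoly_induct)
    case (single \<alpha> c)
    have "scalar_poly c * Poly_Mapping.single \<alpha> 1 \<in> subalg j (int (size \<alpha>) + (int d - int (size \<alpha>)))"
      using single by (intro subalg_scalar_mult monomial_in_subalg) auto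
    thus ?case by (simp add: scalar_poly_def mult_single)
  qed (auto intro: subalg_add subalg_zero)
  hence "u \<in> twist_span j (int d)"
    by (intro subalg_subset_twist_span) simp_all
  thus "u \<in> dickson_twist ` polys_upto j d"
    by (force simp: twist_span_def span_exponents_def polys_upto_def)
qed

text \<open>
  The polynomials of degree at most \<open>d\<close> form a finite set, which is contained in its own image; so the map
  permutes it.  Finiteness replaces a comparison of Hilbert series here.
\<close>

theorem dickson_twist_bij: "bij_betw dickson_twist (polys_in j) (polys_in j)"
proof -
  have inj: "inj_on dickson_twist (polys_upto j d)" for d
    by (rule finite_surj_inj[OF finite_polys_upto polys_upto_subset])
  have onto: "dickson_twist ` polys_upto j d = polys_upto j d" for d
    using polys_upto_subset card_image[OF inj] finite_polys_upto
    by (metis card_subset_eq finite_imageI)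
  have upto: "polys_upto j d \<subseteq> polys_in j" for d
    by (auto simp: polys_in_def polys_upto_def)
  have "inj_on dickson_twist (polys_in j)"
  proof (rule inj_onI)
    fix u v assume uv: "u \<in> polys_in j" "v \<in> polys_in j" "dickson_twist u = dickson_twist v"
    obtain d d' where "\<forall>x\<ge>d. u \<in> polys_upto j x" "\<forall>x\<ge>d'. v \<in> polys_upto j x"
      using uv polys_in_upto by meson
    hence "u \<in> polys_upto j (max d d')" "v \<in> polys_upto j (max d d')"
      by auto
    thus "u = v" using uv(3) inj by (meson inj_onD)
  qed
  moreover have "dickson_twist ` polys_in j = polys_in j"
  proof (intro equalityI subsetI)
    fix u :: "(nat, 'p) mpoly" assume "u \<in> polys_in j"
    then obtain d where "u \<in> polys_upto j d"
      using polys_in_upto by blast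
    thus "u \<in> dickson_twist ` polys_in j"
      using onto upto by blast
  next
    fix w assume "w \<in> dickson_twist ` polys_in j"
    then obtain u d where "w = dickson_twist u" "u \<in> polys_upto j d"
      using polys_in_upto by blast
    thus "w \<in> polys_in j"
      using onto upto by blast
  qed
  ultimately show ?thesis
    by (simp add: bij_betw_def)
qed

end

section \<open>Weakly regular sequences of operators\<close>

text \<open>
  In the main application \<open>f i\<close> is multiplication by the \<open>i\<close>-th element of a sequence, \<open>K \<subseteq> H\<close> are modules, and
  \<open>op_multiples G f H K i\<close> is \<open>K + f\<^sub>0 H + \<dots> + f\<^sub>i\<^sub>-\<^sub>1 H\<close>.
\<close>

primrec op_multiples ::
    "('a, 'z) ring_scheme \<Rightarrow> (nat \<Rightarrow> 'a \<Rightarrow> 'a) \<Rightarrow> 'a set \<Rightarrow> 'a set \<Rightarrow> nat \<Rightarrow> 'a set" where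
  "op_multiples G f H K 0 = K"
| "op_multiples G f H K (Suc i) = {u \<oplus>\<^bsub>G\<^esub> f i h | u h. u \<in> op_multiples G f H K i \<and> h \<in> H}"

text \<open>The sequence is regular on \<open>H / K\<close>, except that the final quotient may vanish.\<close>

definition weakly_regular ::
    "('a, 'z) ring_scheme \<Rightarrow> nat \<Rightarrow> (nat \<Rightarrow> 'a \<Rightarrow> 'a) \<Rightarrow> 'a set \<Rightarrow> 'a set \<Rightarrow> bool" where
  "weakly_regular G s f H K \<longleftrightarrow>
     (\<forall>i<s. \<forall>m\<in>H. f i m \<in> op_multiples G f H K i \<longrightarrow> m \<in> op_multiples G f H K i)"

lemma op_multiples_SucI:
  "\<lbrakk>u \<in> op_multiples G f H K i; h \<in> H\<rbrakk> \<Longrightarrow> u \<oplus>\<^bsub>G\<^esub> f i h \<in> op_multiples G f H K (Suc i)"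
  by auto

locale commuting_operators = abelian_group G for G :: "('a, 'z) ring_scheme" (structure) +
  fixes s :: nat and f :: "nat \<Rightarrow> 'a \<Rightarrow> 'a"
  assumes op_closed: "\<lbrakk>i < s; x \<in> carrier G\<rbrakk> \<Longrightarrow> f i x \<in> carrier G"
    and op_add: "\<lbrakk>i < s; x \<in> carrier G; y \<in> carrier G\<rbrakk> \<Longrightarrow> f i (x \<oplus> y) = f i x \<oplus> f i y"
    and op_commute: "\<lbrakk>i < s; l < s; x \<in> carrier G\<rbrakk> \<Longrightarrow> f i (f l x) = f l (f i x)"
begin

definition stable_subgroup :: "'a set \<Rightarrow> bool" where
  "stable_subgroup H \<longleftrightarrow> additive_subgroup H G \<and> (\<forall>i<s. \<forall>h\<in>H. f i h \<in> H)"

lemma stable_subgroupI: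
  assumes "H \<subseteq> carrier G" "\<zero> \<in> H" "\<And>x y. \<lbrakk>x \<in> H; y \<in> H\<rbrakk> \<Longrightarrow> x \<oplus> y \<in> H"
    "\<And>x. x \<in> H \<Longrightarrow> \<ominus> x \<in> H" "\<And>i h. \<lbrakk>i < s; h \<in> H\<rbrakk> \<Longrightarrow> f i h \<in> H"
  shows "stable_subgroup H"
  unfolding stable_subgroup_def additive_subgroup_def
  using assms by (auto intro!: add.subgroupI simp: a_inv_def)

lemma stable_subgroupD:
  assumes "stable_subgroup H"
  shows "H \<subseteq> carrier G" "\<zero> \<in> H" "\<And>x y. \<lbrakk>x \<in> H; y \<in> H\<rbrakk> \<Longrightarrow> x \<oplus> y \<in> H"
    "\<And>x. x \<in> H \<Longrightarrow> \<ominus> x \<in> H" "\<And>x y. \<lbrakk>x \<in> H; y \<in> H\<rbrakk> \<Longrightarrow> x \<ominus> y \<in> H"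
    "\<And>i h. \<lbrakk>i < s; h \<in> H\<rbrakk> \<Longrightarrow> f i h \<in> H"
  using assms unfolding stable_subgroup_def
  by (auto dest: additive_subgroup.a_subset additive_subgroup.zero_closed
      intro: additive_subgroup.a_closed additive_subgroup.a_inv_closed
      simp: a_minus_def)

lemma op_zero: "i < s \<Longrightarrow> f i \<zero> = \<zero>"
  using op_add[of i \<zero> \<zero>] op_closed[of i \<zero>] by (simp add: add.l_cancel_one')

lemma op_uminus: "\<lbrakk>i < s; x \<in> carrier G\<rbrakk> \<Longrightarrow> f i (\<ominus> x) = \<ominus> f i x"
  using op_add[of i "\<ominus> x" x] op_closed op_zero
  by (metis a_inv_closed l_neg minus_equality)

lemma diff_add_cancel: "\<lbrakk>x \<in> carrier G; y \<in> carrier G\<rbrakk> \<Longrightarrow> x \<ominus> y \<oplus> y = x"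
  by (simp add: a_minus_def a_assoc l_neg)

lemma add_eq_imp_diff: "\<lbrakk>x \<in> carrier G; y \<in> carrier G; z = x \<oplus> y\<rbrakk> \<Longrightarrow> z \<ominus> y = x"
  by (simp add: a_minus_def a_assoc r_neg)

lemma add_eq_imp_diff': "\<lbrakk>x \<in> carrier G; y \<in> carrier G; z = x \<oplus> y\<rbrakk> \<Longrightarrow> z \<ominus> x = y"
  by (metis a_comm add_eq_imp_diff)

lemma stable_op_multiples:
  assumes H: "stable_subgroup H" and K: "stable_subgroup K" and KH: "K \<subseteq> H"
  shows "i \<le> s \<Longrightarrow> stable_subgroup (op_multiples G f H K i) \<and>
    K \<subseteq> op_multiples G f H K i \<and> op_multiples G f H K i \<subseteq> H"
proof (induction i)
  case 0
  thus ?case using K KH by simp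
next
  case (Suc i)
  let ?E = "op_multiples G f H K i"
  have i: "i < s" using Suc by simp
  have E: "stable_subgroup ?E" "K \<subseteq> ?E" "?E \<subseteq> H"
    using Suc by auto
  note H' = stable_subgroupD[OF H] and E' = stable_subgroupD[OF E(1)]
  have Hc: "h \<in> carrier G" if "h \<in> H" for h using that H' by auto
  have fH: "f i h \<in> carrier G" if "h \<in> H" for h using that H'(6)[OF i] Hc by auto
  have "stable_subgroup (op_multiples G f H K (Suc i))"
  proof (rule stable_subgroupI)
    show "op_multiples G f H K (Suc i) \<subseteq> carrier G"
      using E' H' i by (auto intro!: a_closed op_closed)
    have "\<zero> = \<zero> \<oplus> f i \<zero>"
      using i by (simp add: op_zero)
    thus "\<zero> \<in> op_multiples G f H K (Suc i)"
      using E' H' by auto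
  next
    fix x y assume "x \<in> op_multiples G f H K (Suc i)" "y \<in> op_multiples G f H K (Suc i)"
    then obtain u h u' h' where *: "u \<in> ?E" "h \<in> H" "x = u \<oplus> f i h" "u' \<in> ?E" "h' \<in> H" "y = u' \<oplus> f i h'"
      by auto
    have "x \<oplus> y = (u \<oplus> u') \<oplus> f i (h \<oplus> h')"
      using * E(3) i by (simp add: op_add Hc fH subsetD[OF E(3)] a_ac)
    moreover have "(u \<oplus> u') \<oplus> f i (h \<oplus> h') \<in> op_multiples G f H K (Suc i)"
      by (rule op_multiples_SucI) (use * E'(3) H'(3) in auto)
    ultimately show "x \<oplus> y \<in> op_multiples G f H K (Suc i)"
      by (simp only:)
  next
    fix x assume "x \<in> op_multiples G f H K (Suc i)"
    then obtain u h where *: "u \<in> ?E" "h \<in> H" "x = u \<oplus> f i h"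
      by auto
    have "\<ominus> x = (\<ominus> u) \<oplus> f i (\<ominus> h)"
      using * E(3) i by (simp add: op_uminus Hc fH subsetD[OF E(3)] minus_add)
    thus "\<ominus> x \<in> op_multiples G f H K (Suc i)"
      using * E'(4) H'(4) by auto
  next
    fix l x assume l: "l < s" and "x \<in> op_multiples G f H K (Suc i)"
    then obtain u h where *: "u \<in> ?E" "h \<in> H" "x = u \<oplus> f i h"
      by auto
    have "f l x = f l u \<oplus> f i (f l h)"
      using * E(3) i l by (simp add: op_add op_commute Hc fH subsetD[OF E(3)])
    moreover have "f l u \<oplus> f i (f l h) \<in> op_multiples G f H K (Suc i)"
      by (rule op_multiples_SucI) (use * E'(6) H'(6) l in auto)
    ultimately show "f l x \<in> op_multiples G f H K (Suc i)"
      by (simp only:)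
  qed
  moreover have "K \<subseteq> op_multiples G f H K (Suc i)"
  proof
    fix k assume "k \<in> K"
    moreover from this have "k = k \<oplus> f i \<zero>"
      using stable_subgroupD(1)[OF K] i by (auto simp: op_zero)
    ultimately show "k \<in> op_multiples G f H K (Suc i)"
      using E(2) H'(2) by auto
  qed
  moreover have "op_multiples G f H K (Suc i) \<subseteq> H"
    using E(3) H'(3,6) i by auto
  ultimately show ?case by blast
qed

lemma op_multiples_mono:
  "H \<subseteq> H' \<Longrightarrow> K \<subseteq> K' \<Longrightarrow> op_multiples G f H K i \<subseteq> op_multiples G f H' K' i"
  by (induction i) (simp, fastforce)

lemma op_multiples_sum:
  assumes H: "stable_subgroup H" and K: "stable_subgroup K" and J: "stable_subgroup J"
    and KJ: "K \<subseteq> J" and JH: "J \<subseteq> H"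
  shows "i \<le> s \<Longrightarrow> op_multiples G f H J i = {a \<oplus> b | a b. a \<in> J \<and> b \<in> op_multiples G f H K i}"
proof (induction i)
  case 0
  have "a = a \<oplus> \<zero>" if "a \<in> J" for a
    using that stable_subgroupD(1)[OF J] by auto
  thus ?case
    using stable_subgroupD(2)[OF K] stable_subgroupD(3)[OF J] KJ by auto
next
  case (Suc i)
  hence i: "i < s" by simp
  have c: "a \<in> carrier G" "f i h \<in> carrier G" "b \<in> carrier G"
    if "a \<in> J" "h \<in> H" "b \<in> op_multiples G f H K i" for a b h
    using that stable_subgroupD(1)[OF H] stable_subgroupD(1)[OF J] op_closed[OF i]
      stable_op_multiples[OF H K order.trans[OF KJ JH], of i] i by auto
  show ?case
  proof (intro equalityI subsetI)
    fix x assume "x \<in> op_multiples G f H J (Suc i)"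
    then obtain a b h where "a \<in> J" "b \<in> op_multiples G f H K i" "h \<in> H" "x = (a \<oplus> b) \<oplus> f i h"
      using Suc by auto
    moreover from this have "x = a \<oplus> (b \<oplus> f i h)"
      using c by (simp add: a_assoc)
    ultimately show "x \<in> {a \<oplus> b | a b. a \<in> J \<and> b \<in> op_multiples G f H K (Suc i)}"
      using op_multiples_SucI[of b G f H K i h] by blast
  next
    fix x assume "x \<in> {a \<oplus> b | a b. a \<in> J \<and> b \<in> op_multiples G f H K (Suc i)}"
    then obtain a b h where *: "a \<in> J" "b \<in> op_multiples G f H K i" "h \<in> H" "x = a \<oplus> (b \<oplus> f i h)"
      by auto
    hence "x = (a \<oplus> b) \<oplus> f i h"
      using c by (simp add: a_assoc)
    thus "x \<in> op_multiples G f H J (Suc i)"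
      using * Suc by auto
  qed
qed

text \<open>
  The map from \<open>J / K\<close> to \<open>H / K\<close> stays injective modulo multiples, because the sequence is regular on \<open>H / J\<close>:
  if \<open>u + f\<^sub>i h\<close> lies in \<open>J\<close>, then \<open>h\<close> is a multiple modulo \<open>J\<close>, so it may be changed to an element of \<open>J\<close>.
\<close>

lemma op_multiples_inter:
  assumes H: "stable_subgroup H" and K: "stable_subgroup K" and J: "stable_subgroup J"
    and KJ: "K \<subseteq> J" and JH: "J \<subseteq> H" and reg: "weakly_regular G s f H J"
  shows "i \<le> s \<Longrightarrow> J \<inter> op_multiples G f H K i \<subseteq> op_multiples G f J K i"
proof (induction i)
  case (Suc i)
  hence i: "i < s" by simp
  let ?E = "op_multiples G f H K i"
  have E: "stable_subgroup ?E" "K \<subseteq> ?E" "?E \<subseteq> H"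
    using stable_op_multiples[OF H K] KJ JH i by auto
  note H' = stable_subgroupD[OF H] and J' = stable_subgroupD[OF J] and E' = stable_subgroupD[OF E(1)]
  show ?case
  proof
    fix w assume "w \<in> J \<inter> op_multiples G f H K (Suc i)"
    then obtain u h where w: "w \<in> J" "u \<in> ?E" "h \<in> H" "w = u \<oplus> f i h"
      by auto
    have car: "w \<in> carrier G" "u \<in> carrier G" "h \<in> carrier G" "f i h \<in> carrier G"
      using w H' J' E' i op_closed by auto
    have "f i h = w \<oplus> (\<ominus> u)"
      using w(4) car by (simp add: a_comm[of u] a_assoc r_neg)
    hence "f i h \<in> op_multiples G f H J i"
      using w E'(4) op_multiples_sum[OF H K J KJ JH, of i] i by auto
    hence "h \<in> op_multiples G f H J i"
      using reg i w unfolding weakly_regular_def by blast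
    then obtain h' u' where h: "h' \<in> J" "u' \<in> ?E" "h = h' \<oplus> u'"
      using op_multiples_sum[OF H K J KJ JH, of i] i by auto
    have car': "h' \<in> carrier G" "u' \<in> carrier G" "f i h' \<in> carrier G" "f i u' \<in> carrier G"
      using h J' E' i op_closed by auto
    have eq: "w = (u \<oplus> f i u') \<oplus> f i h'"
      unfolding w(4) h(3) using i car car' by (simp add: op_add a_ac)
    have "w \<ominus> f i h' = u \<oplus> f i u'"
      using eq car car' by (intro add_eq_imp_diff) auto
    moreover have "w \<ominus> f i h' \<in> J"
      using w h J' i by auto
    moreover have "u \<oplus> f i u' \<in> ?E"
      using w h E' i by auto
    ultimately have "u \<oplus> f i u' \<in> op_multiples G f J K i"
      using Suc by auto
    thus "w \<in> op_multiples G f J K (Suc i)"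
      using eq h by auto
  qed
qed simp

text \<open>
  An extension of weakly regular quotients is weakly regular.  If \<open>f\<^sub>i m\<close> is a multiple, then \<open>m\<close> is one
  modulo \<open>J\<close>; subtracting it leaves an element of \<open>J\<close>, to which regularity on \<open>J / K\<close> applies.
\<close>

lemma weakly_regular_extension:
  assumes H: "stable_subgroup H" and K: "stable_subgroup K" and J: "stable_subgroup J"
    and KJ: "K \<subseteq> J" and JH: "J \<subseteq> H"
    and reg: "weakly_regular G s f H J" "weakly_regular G s f J K"
  shows "weakly_regular G s f H K"
  unfolding weakly_regular_def
proof (intro allI impI ballI)
  fix i m assume i: "i < s" and m: "m \<in> H" "f i m \<in> op_multiples G f H K i"
  let ?E = "op_multiples G f H K i"
  have E: "stable_subgroup ?E" "K \<subseteq> ?E" "?E \<subseteq> H"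
    using stable_op_multiples[OF H K] KJ JH i by auto
  note H' = stable_subgroupD[OF H] and J' = stable_subgroupD[OF J] and E' = stable_subgroupD[OF E(1)]
  have "f i m \<in> op_multiples G f H J i"
    using m op_multiples_mono[OF order.refl KJ] by blast
  hence "m \<in> op_multiples G f H J i"
    using reg(1) i m unfolding weakly_regular_def by blast
  then obtain m' u where mu: "m' \<in> J" "u \<in> ?E" "m = m' \<oplus> u"
    using op_multiples_sum[OF H K J KJ JH, of i] i by auto
  have car: "m \<in> carrier G" "m' \<in> carrier G" "u \<in> carrier G"
    using m mu H' J' E' by auto
  have "f i m \<ominus> f i u = f i m'"
    using car i mu by (intro add_eq_imp_diff) (auto simp: op_add op_closed)
  moreover have "f i m \<ominus> f i u \<in> ?E"
    using m mu E' i by auto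
  ultimately have "f i m' \<in> op_multiples G f J K i"
    using op_multiples_inter[OF H K J KJ JH reg(1), of i] i J'(6)[OF i mu(1)] by auto
  hence "m' \<in> op_multiples G f J K i"
    using reg(2) i mu unfolding weakly_regular_def by blast
  hence "m' \<in> ?E"
    using op_multiples_mono[OF JH order.refl] by blast
  thus "m \<in> ?E"
    using mu E' by auto
qed

definition set_sum :: "'a set \<Rightarrow> 'a set \<Rightarrow> 'a set" where
  "set_sum A B = {a \<oplus> b | a b. a \<in> A \<and> b \<in> B}"

lemma stable_subgroup_sum:
  assumes A: "stable_subgroup A" and B: "stable_subgroup B"
  shows "stable_subgroup (set_sum A B)" "A \<subseteq> set_sum A B" "B \<subseteq> set_sum A B"
proof -
  note A' = stable_subgroupD[OF A] and B' = stable_subgroupD[OF B]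
  have c: "a \<in> carrier G" "b \<in> carrier G" if "a \<in> A" "b \<in> B" for a b
    using that A' B' by auto
  show "stable_subgroup (set_sum A B)"
  proof (rule stable_subgroupI)
    show "set_sum A B \<subseteq> carrier G"
      using c by (auto simp: set_sum_def)
    show "\<zero> \<in> set_sum A B"
      unfolding set_sum_def using A'(2) B'(2) by (intro CollectI exI[of _ \<zero>]) auto
  next
    fix x y assume "x \<in> set_sum A B" "y \<in> set_sum A B"
    then obtain a b a' b' where *: "a \<in> A" "b \<in> B" "x = a \<oplus> b" "a' \<in> A" "b' \<in> B" "y = a' \<oplus> b'"
      unfolding set_sum_def by blast
    have "x \<oplus> y = (a \<oplus> a') \<oplus> (b \<oplus> b')"
      using * c by (simp add: a_ac)
    thus "x \<oplus> y \<in> set_sum A B"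
      unfolding set_sum_def using * A'(3) B'(3) by blast
  next
    fix x assume "x \<in> set_sum A B"
    then obtain a b where *: "a \<in> A" "b \<in> B" "x = a \<oplus> b"
      unfolding set_sum_def by blast
    have "\<ominus> x = (\<ominus> a) \<oplus> (\<ominus> b)"
      using * c by (simp add: minus_add)
    thus "\<ominus> x \<in> set_sum A B"
      unfolding set_sum_def using * A'(4) B'(4) by blast
  next
    fix i x assume i: "i < s" "x \<in> set_sum A B"
    then obtain a b where *: "a \<in> A" "b \<in> B" "x = a \<oplus> b"
      unfolding set_sum_def by blast
    have "f i x = f i a \<oplus> f i b"
      using * c i by (simp add: op_add)
    thus "f i x \<in> set_sum A B"
      unfolding set_sum_def using * A'(6) B'(6) i by blast
  qed
  show "A \<subseteq> set_sum A B"
    unfolding set_sum_def using c B'(2) by (force intro: r_zero[symmetric])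
  show "B \<subseteq> set_sum A B"
    unfolding set_sum_def using c A'(2) by (force intro: l_zero[symmetric])
qed

lemma op_multiples_set_sum:
  assumes A: "stable_subgroup A" and B: "stable_subgroup B"
  shows "i \<le> s \<Longrightarrow> op_multiples G f (set_sum A B) B i = set_sum (op_multiples G f A (A \<inter> B) i) B"
proof (induction i)
  case 0
  note A' = stable_subgroupD[OF A] and B' = stable_subgroupD[OF B]
  have "b = \<zero> \<oplus> b" if "b \<in> B" for b
    using that B' by auto
  hence "B \<subseteq> set_sum (A \<inter> B) B"
    unfolding set_sum_def using A'(2) B'(2) by blast
  moreover have "set_sum (A \<inter> B) B \<subseteq> B"
    using B'(3) by (auto simp: set_sum_def)
  ultimately show ?case by simp
next
  case (Suc i)
  hence i: "i < s" by simp
  have AB: "stable_subgroup (A \<inter> B)"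
    by (rule stable_subgroupI) (use stable_subgroupD[OF A] stable_subgroupD[OF B] in auto)
  let ?E = "op_multiples G f A (A \<inter> B) i"
  have E: "stable_subgroup ?E" "?E \<subseteq> A"
    using stable_op_multiples[OF A AB] i by auto
  note A' = stable_subgroupD[OF A] and B' = stable_subgroupD[OF B] and E' = stable_subgroupD[OF E(1)]
  have c: "a \<in> carrier G" "f i a \<in> carrier G" "b \<in> carrier G" "f i b \<in> carrier G" "e \<in> carrier G"
    if "a \<in> A" "b \<in> B" "e \<in> ?E" for a b e
    using that A' B' E' i op_closed by auto
  show ?case
  proof (intro equalityI subsetI)
    fix x assume "x \<in> op_multiples G f (set_sum A B) B (Suc i)"
    then obtain e b a b' where *: "e \<in> ?E" "b \<in> B" "a \<in> A" "b' \<in> B" "x = (e \<oplus> b) \<oplus> f i (a \<oplus> b')"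
      using Suc by (auto simp: set_sum_def)
    have "x = (e \<oplus> f i a) \<oplus> (b \<oplus> f i b')"
      unfolding *(5) using c[OF *(3,2,1)] c[OF *(3,4,1)] i by (simp add: op_add a_ac)
    moreover have "b \<oplus> f i b' \<in> B"
      using * B' i by auto
    ultimately show "x \<in> set_sum (op_multiples G f A (A \<inter> B) (Suc i)) B"
      unfolding set_sum_def using * by auto
  next
    fix x assume "x \<in> set_sum (op_multiples G f A (A \<inter> B) (Suc i)) B"
    then obtain e a b where *: "e \<in> ?E" "a \<in> A" "b \<in> B" "x = (e \<oplus> f i a) \<oplus> b"
      by (auto simp: set_sum_def)
    have "x = (e \<oplus> b) \<oplus> f i a"
      unfolding *(4) using c[OF *(2,3,1)] by (simp add: a_ac)
    moreover have "e \<oplus> b \<in> op_multiples G f (set_sum A B) B i"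
      using Suc * by (auto simp: set_sum_def)
    ultimately show "x \<in> op_multiples G f (set_sum A B) B (Suc i)"
      using * stable_subgroup_sum(2)[OF A B] by auto
  qed
qed

text \<open>The isomorphism \<open>(A + B) / B = A / (A \<inter> B)\<close> is compatible with the operators.\<close>

lemma weakly_regular_sum:
  assumes A: "stable_subgroup A" and B: "stable_subgroup B"
    and reg: "weakly_regular G s f A (A \<inter> B)"
  shows "weakly_regular G s f (set_sum A B) B"
  unfolding weakly_regular_def
proof (intro allI impI ballI)
  fix i m assume i: "i < s" and m: "m \<in> set_sum A B" "f i m \<in> op_multiples G f (set_sum A B) B i"
  have AB: "stable_subgroup (A \<inter> B)"
    by (rule stable_subgroupI) (use stable_subgroupD[OF A] stable_subgroupD[OF B] in auto)
  let ?E = "op_multiples G f A (A \<inter> B) i"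
  have E: "stable_subgroup ?E" "A \<inter> B \<subseteq> ?E" "?E \<subseteq> A"
    using stable_op_multiples[OF A AB] i by auto
  note A' = stable_subgroupD[OF A] and B' = stable_subgroupD[OF B] and E' = stable_subgroupD[OF E(1)]
  obtain a b where ab: "a \<in> A" "b \<in> B" "m = a \<oplus> b"
    using m by (auto simp: set_sum_def)
  obtain e b' where e: "e \<in> ?E" "b' \<in> B" "f i m = e \<oplus> b'"
    using m op_multiples_set_sum[OF A B, of i] i by (auto simp: set_sum_def)
  have car: "a \<in> carrier G" "b \<in> carrier G" "e \<in> carrier G" "b' \<in> carrier G"
    "f i a \<in> carrier G" "f i b \<in> carrier G"
    using ab e A' B' E' i op_closed by auto
  have eq: "f i a \<oplus> f i b = e \<oplus> b'"
    using e ab i car by (simp add: op_add)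
  have "f i a = f i a \<oplus> f i b \<ominus> f i b"
    using car by (intro add_eq_imp_diff[symmetric]) auto
  also have "\<dots> = e \<oplus> (b' \<ominus> f i b)"
    unfolding eq using car by (simp add: a_minus_def a_assoc)
  finally have eq2: "f i a = e \<oplus> (b' \<ominus> f i b)" .
  hence "f i a \<ominus> e = b' \<ominus> f i b"
    using car by (intro add_eq_imp_diff') auto
  moreover have "f i a \<ominus> e \<in> A" "b' \<ominus> f i b \<in> B"
    using ab e A' B' E i by auto
  ultimately have "b' \<ominus> f i b \<in> ?E"
    using E by auto
  hence "f i a \<in> ?E"
    using eq2 e E' by auto
  hence "a \<in> ?E"
    using reg i ab unfolding weakly_regular_def by blast
  thus "m \<in> op_multiples G f (set_sum A B) B i"
    using op_multiples_set_sum[OF A B, of i] i ab by (auto simp: set_sum_def)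
qed

end

text \<open>
  The isomorphism \<open>H / K = H' / K'\<close> induced by \<open>\<gamma>\<close> is compatible with the operators.
\<close>

lemma op_multiples_preimage:
  assumes G: "commuting_operators G s f" and G': "commuting_operators G' s f'"
    and H: "commuting_operators.stable_subgroup G s f H"
    and H': "commuting_operators.stable_subgroup G' s f' H'"
    and onto: "\<gamma> ` H = H'"
    and add: "\<And>x y. \<lbrakk>x \<in> H; y \<in> H\<rbrakk> \<Longrightarrow> \<gamma> (x \<oplus>\<^bsub>G\<^esub> y) = \<gamma> x \<oplus>\<^bsub>G'\<^esub> \<gamma> y"
    and op: "\<And>i x. \<lbrakk>i < s; x \<in> H\<rbrakk> \<Longrightarrow> \<gamma> (f i x) = f' i (\<gamma> x)"
    and K: "K = {h \<in> H. \<gamma> h \<in> K'}" and K': "K' \<subseteq> H'" "commuting_operators.stable_subgroup G' s f' K'"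
  shows "i \<le> s \<Longrightarrow> op_multiples G f H K i = {h \<in> H. \<gamma> h \<in> op_multiples G' f' H' K' i}"
proof (induction i)
  case 0
  thus ?case by (simp add: K)
next
  case (Suc i)
  interpret G: commuting_operators G s f by (rule G)
  interpret G': commuting_operators G' s f' by (rule G')
  note HD = G.stable_subgroupD[OF H] and HD' = G'.stable_subgroupD[OF H']
  have i: "i < s" using Suc by simp
  show ?case
  proof (intro equalityI subsetI)
    fix x assume "x \<in> op_multiples G f H K (Suc i)"
    then obtain u h where *: "u \<in> H" "\<gamma> u \<in> op_multiples G' f' H' K' i" "h \<in> H" "x = u \<oplus>\<^bsub>G\<^esub> f i h"
      using Suc by auto
    have "f i h \<in> H" using HD i * by auto
    hence "\<gamma> x = \<gamma> u \<oplus>\<^bsub>G'\<^esub> f' i (\<gamma> h)" "x \<in> H"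
      using * add op i HD by auto
    thus "x \<in> {h \<in> H. \<gamma> h \<in> op_multiples G' f' H' K' (Suc i)}"
      using * onto by auto
  next
    fix x assume "x \<in> {h \<in> H. \<gamma> h \<in> op_multiples G' f' H' K' (Suc i)}"
    then obtain u' h where *: "x \<in> H" "u' \<in> op_multiples G' f' H' K' i" "h \<in> H" "\<gamma> x = u' \<oplus>\<^bsub>G'\<^esub> f' i (\<gamma> h)"
      using onto by auto
    define u where "u = x \<ominus>\<^bsub>G\<^esub> f i h"
    have fh: "f i h \<in> H" and u: "u \<in> H"
      using * HD i by (auto simp: u_def)
    have x: "x = u \<oplus>\<^bsub>G\<^esub> f i h"
      unfolding u_def using * fh HD(1) by (simp add: G.diff_add_cancel subset_iff)
    have "\<gamma> x = \<gamma> u \<oplus>\<^bsub>G'\<^esub> f' i (\<gamma> h)"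
      using add[OF u fh] op[OF i *(3)] x by simp
    moreover have "u' \<in> carrier G'"
      using * G'.stable_op_multiples[OF H' K'(2,1), of i] i HD'(1) by auto
    moreover have "\<gamma> u \<in> carrier G'" "f' i (\<gamma> h) \<in> carrier G'"
      using u * onto HD'(1) i by (auto intro!: G'.op_closed)
    ultimately have "\<gamma> u = u'"
      using *(4) by simp
    hence "u \<in> op_multiples G f H K i"
      using Suc u * by auto
    thus "x \<in> op_multiples G f H K (Suc i)"
      using x * by auto
  qed
qed

lemma weakly_regular_preimage:
  assumes G: "commuting_operators G s f" and G': "commuting_operators G' s f'"
    and H: "commuting_operators.stable_subgroup G s f H"
    and H': "commuting_operators.stable_subgroup G' s f' H'"
    and onto: "\<gamma> ` H = H'"
    and add: "\<And>x y. \<lbrakk>x \<in> H; y \<in> H\<rbrakk> \<Longrightarrow> \<gamma> (x \<oplus>\<^bsub>G\<^esub> y) = \<gamma> x \<oplus>\<^bsub>G'\<^esub> \<gamma> y"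
    and op: "\<And>i x. \<lbrakk>i < s; x \<in> H\<rbrakk> \<Longrightarrow> \<gamma> (f i x) = f' i (\<gamma> x)"
    and K: "K = {h \<in> H. \<gamma> h \<in> K'}" and K': "K' \<subseteq> H'" "commuting_operators.stable_subgroup G' s f' K'"
    and reg: "weakly_regular G' s f' H' K'"
  shows "weakly_regular G s f H K"
proof -
  note eq = op_multiples_preimage[OF G G' H H' onto add op K K']
  show ?thesis
    unfolding weakly_regular_def
  proof (intro allI impI ballI)
    fix i m assume i: "i < s" and m: "m \<in> H" "f i m \<in> op_multiples G f H K i"
    hence "f' i (\<gamma> m) \<in> op_multiples G' f' H' K' i"
      using eq[of i] op by auto
    hence "\<gamma> m \<in> op_multiples G' f' H' K' i"
      using reg i m onto unfolding weakly_regular_def by auto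
    thus "m \<in> op_multiples G f H K i"
      using eq[of i] i m by auto
  qed
qed

text \<open>
  The elements of \<open>H / K\<close> have coordinates \<open>\<kappa> \<beta>\<close>, indexed by \<open>B\<close>, on which the operators act by independent
  shifts, as multiplication by the variables acts on the coefficients of polynomials.
  Dividing by a variable is possible in the form of \<open>coord_unshift\<close>: the coordinates of any element can be
  shifted back, on any prescribed set of indices.
\<close>

locale shifting_operators = commuting_operators G s f + U: abelian_group U
  for G :: "('a, 'z) ring_scheme" (structure) and s f and U :: "('u, 'y) ring_scheme" +
  fixes H K :: "'a set" and B :: "'b set" and sh :: "nat \<Rightarrow> 'b \<Rightarrow> 'b" and \<kappa> :: "'b \<Rightarrow> 'a \<Rightarrow> 'u"
  assumes H: "stable_subgroup H"
    and coord_closed: "\<lbrakk>\<beta> \<in> B; x \<in> H\<rbrakk> \<Longrightarrow> \<kappa> \<beta> x \<in> carrier U"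
    and coord_add: "\<lbrakk>\<beta> \<in> B; x \<in> H; y \<in> H\<rbrakk> \<Longrightarrow> \<kappa> \<beta> (x \<oplus> y) = \<kappa> \<beta> x \<oplus>\<^bsub>U\<^esub> \<kappa> \<beta> y"
    and coord_zero: "K = {x \<in> H. \<forall>\<beta>\<in>B. \<kappa> \<beta> x = \<zero>\<^bsub>U\<^esub>}"
    and shift_closed: "\<lbrakk>i < s; \<beta> \<in> B\<rbrakk> \<Longrightarrow> sh i \<beta> \<in> B"
    and shift_commute: "\<lbrakk>i < s; l < s; \<beta> \<in> B\<rbrakk> \<Longrightarrow> sh i (sh l \<beta>) = sh l (sh i \<beta>)"
    and shift_independent: "\<lbrakk>i < s; l < s; i \<noteq> l; \<beta> \<in> B; sh i \<beta> \<in> sh l ` B\<rbrakk> \<Longrightarrow> \<beta> \<in> sh l ` B"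
    and coord_shift: "\<lbrakk>i < s; \<beta> \<in> B; x \<in> H\<rbrakk> \<Longrightarrow> \<kappa> (sh i \<beta>) (f i x) = \<kappa> \<beta> x"
    and coord_no_shift: "\<lbrakk>i < s; \<beta> \<in> B; \<beta> \<notin> sh i ` B; x \<in> H\<rbrakk> \<Longrightarrow> \<kappa> \<beta> (f i x) = \<zero>\<^bsub>U\<^esub>"
    and coord_unshift: "\<lbrakk>i < s; x \<in> H; S \<subseteq> B\<rbrakk> \<Longrightarrow>
      \<exists>y\<in>H. \<forall>\<beta>\<in>B. \<kappa> \<beta> y = (if \<beta> \<in> S then \<kappa> (sh i \<beta>) x else \<zero>\<^bsub>U\<^esub>)"
begin

text \<open>The analogue of the monomials not divisible by any of the first \<open>i\<close> variables.\<close>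

definition unshifted :: "nat \<Rightarrow> 'b set" where
  "unshifted i = {\<beta> \<in> B. \<forall>l<i. \<beta> \<notin> sh l ` B}"

text \<open>
  An element without coordinates at unshifted indices is a sum of shifted elements: subtract the part
  whose coordinates are shifted by the last operator.
\<close>

lemma op_multiples_coords:
  "i \<le> s \<Longrightarrow> op_multiples G f H K i = {x \<in> H. \<forall>\<beta>\<in>unshifted i. \<kappa> \<beta> x = \<zero>\<^bsub>U\<^esub>}"
proof (induction i)
  case 0
  thus ?case by (simp add: coord_zero unshifted_def)
next
  case (Suc i)
  hence i: "i < s" by simp
  note H' = stable_subgroupD[OF H]
  have sub: "unshifted (Suc i) \<subseteq> unshifted i" "unshifted i \<subseteq> B"
    unfolding unshifted_def using less_SucI by blast+
  show ?case
  proof (intro equalityI subsetI)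
    fix x assume "x \<in> op_multiples G f H K (Suc i)"
    then obtain u h where *: "u \<in> H" "\<forall>\<beta>\<in>unshifted i. \<kappa> \<beta> u = \<zero>\<^bsub>U\<^esub>" "h \<in> H" "x = u \<oplus> f i h"
      using Suc by auto
    have "\<kappa> \<beta> x = \<zero>\<^bsub>U\<^esub>" if "\<beta> \<in> unshifted (Suc i)" for \<beta>
    proof -
      have "\<beta> \<in> B" "\<beta> \<notin> sh i ` B" "\<beta> \<in> unshifted i"
        using that sub by (auto simp: unshifted_def)
      thus ?thesis
        using * i H'(6) by (simp add: coord_add coord_no_shift)
    qed
    thus "x \<in> {x \<in> H. \<forall>\<beta>\<in>unshifted (Suc i). \<kappa> \<beta> x = \<zero>\<^bsub>U\<^esub>}"
      using * H' i by auto
  next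
    fix x assume x: "x \<in> {x \<in> H. \<forall>\<beta>\<in>unshifted (Suc i). \<kappa> \<beta> x = \<zero>\<^bsub>U\<^esub>}"
    obtain h where h: "h \<in> H"
      "\<And>\<beta>. \<beta> \<in> B \<Longrightarrow> \<kappa> \<beta> h = (if \<beta> \<in> unshifted i then \<kappa> (sh i \<beta>) x else \<zero>\<^bsub>U\<^esub>)"
      using coord_unshift[OF i _ sub(2), of x] x by auto
    define u where "u = x \<ominus> f i h"
    have fh: "f i h \<in> H" and u: "u \<in> H"
      using h x H' i by (auto simp: u_def)
    have xu: "x = u \<oplus> f i h"
      unfolding u_def using x fh H'(1) by (simp add: diff_add_cancel subset_iff)
    have "\<kappa> \<beta> u = \<zero>\<^bsub>U\<^esub>" if \<beta>: "\<beta> \<in> unshifted i" for \<beta>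
    proof -
      have B: "\<beta> \<in> B" using \<beta> sub by auto
      have eq: "\<kappa> \<beta> x = \<kappa> \<beta> u \<oplus>\<^bsub>U\<^esub> \<kappa> \<beta> (f i h)"
        using B u fh by (simp add: xu coord_add)
      have "\<kappa> \<beta> x = \<kappa> \<beta> (f i h)"
      proof (cases "\<beta> \<in> sh i ` B")
        case False
        hence "\<beta> \<in> unshifted (Suc i)"
          using \<beta> by (auto simp: unshifted_def less_Suc_eq)
        thus ?thesis
          using x coord_no_shift[OF i B False h(1)] by simp
      next
        case True
        then obtain \<gamma> where \<gamma>: "\<gamma> \<in> B" "\<beta> = sh i \<gamma>" by auto
        have "\<gamma> \<in> unshifted i"
        proof (rule ccontr)
          \<comment> \<open>A shift of \<open>\<gamma>\<close> by an earlier operator would also be one of \<open>\<beta>\<close>, since the shifts commute.\<close>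
          assume "\<gamma> \<notin> unshifted i"
          then obtain l \<delta> where "l < i" "\<delta> \<in> B" "\<gamma> = sh l \<delta>"
            using \<gamma> by (auto simp: unshifted_def)
          hence "\<beta> = sh l (sh i \<delta>)" "sh i \<delta> \<in> B" "l < i"
            using \<gamma> i shift_commute[of i l \<delta>] shift_closed by auto
          thus False using \<beta> by (auto simp: unshifted_def)
        qed
        thus ?thesis
          using \<gamma> h i coord_shift by simp
      qed
      moreover have "\<kappa> \<beta> u \<in> carrier U" "\<kappa> \<beta> (f i h) \<in> carrier U"
        using B u fh coord_closed by auto
      ultimately show ?thesis
        using eq by (metis U.add.r_cancel_one)
    qed
    hence "u \<in> op_multiples G f H K i"
      using Suc u by auto
    thus "x \<in> op_multiples G f H K (Suc i)"
      using xu h by auto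
  qed
qed

text \<open>
  Shifting by the \<open>i\<close>-th operator preserves unshifted indices, by independence of the shifts, and \<open>f\<^sub>i m\<close> has at
  the shifted index the coordinate of \<open>m\<close>.
\<close>

theorem weakly_regular_shifts: "weakly_regular G s f H K"
  unfolding weakly_regular_def
proof (intro allI impI ballI)
  fix i m assume i: "i < s" and m: "m \<in> H" "f i m \<in> op_multiples G f H K i"
  have "\<kappa> \<beta> m = \<zero>\<^bsub>U\<^esub>" if "\<beta> \<in> unshifted i" for \<beta>
  proof -
    have "sh i \<beta> \<in> unshifted i"
      using that i shift_closed shift_independent[of i _ \<beta>] by (force simp: unshifted_def)
    hence "\<kappa> (sh i \<beta>) (f i m) = \<zero>\<^bsub>U\<^esub>"
      using m op_multiples_coords[of i] i by auto
    thus ?thesis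
      using that i m coord_shift by (auto simp: unshifted_def)
  qed
  thus "m \<in> op_multiples G f H K i"
    using m op_multiples_coords[of i] i by auto
qed

end

section \<open>Quotients by subgroups and ideals\<close>

locale quotient_group = abelian_group M for M :: "('r, 'm) graded" (structure) +
  fixes H :: "'m set"
  assumes subgroup_H: "additive_subgroup H M"
begin

abbreviation Q where "Q \<equiv> graded_quotient M H"
abbreviation cls where "cls x \<equiv> H +> x"

lemma abelian_subgroup_H: "abelian_subgroup H M"
  by (rule abelian_subgroupI3[OF subgroup_H abelian_group_axioms])

lemma Q_simps: "carrier Q = a_rcosets H" "\<zero>\<^bsub>Q\<^esub> = H" "x \<oplus>\<^bsub>Q\<^esub> y = x <+> y"
  "\<one>\<^bsub>Q\<^esub> = H +> \<one>" "x \<otimes>\<^bsub>Q\<^esub> y = rcoset_mult M H x y"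
  by (simp_all add: graded_quotient_def)

lemma subset_H: "H \<subseteq> carrier M"
  by (rule additive_subgroup.a_subset[OF subgroup_H])

lemma carrier_Q: "carrier Q = cls ` carrier M"
  unfolding Q_simps by (auto simp: A_RCOSETS_def')

lemma cls_closed: "x \<in> carrier M \<Longrightarrow> cls x \<in> carrier Q"
  by (simp add: carrier_Q)

lemma cls_add: "\<lbrakk>x \<in> carrier M; y \<in> carrier M\<rbrakk> \<Longrightarrow> cls x \<oplus>\<^bsub>Q\<^esub> cls y = cls (x \<oplus> y)"
  by (simp add: Q_simps abelian_subgroup.a_rcos_sum[OF abelian_subgroup_H])

lemma cls_zero: "cls \<zero> = \<zero>\<^bsub>Q\<^esub>"
  by (simp add: Q_simps subset_H)

lemma cls_eq_iff: "\<lbrakk>x \<in> carrier M; y \<in> carrier M\<rbrakk> \<Longrightarrow> cls x = cls y \<longleftrightarrow> x \<ominus> y \<in> H"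
  unfolding a_minus_def
  using abelian_subgroup.a_rcos_module[OF abelian_subgroup_H, of y x]
    abelian_subgroup.a_repr_independence'[OF abelian_subgroup_H, of x y]
    abelian_subgroup.a_repr_independenceD[OF abelian_subgroup_H, of x y] by metis

lemma cls_eq_zero_iff: "x \<in> carrier M \<Longrightarrow> cls x = \<zero>\<^bsub>Q\<^esub> \<longleftrightarrow> x \<in> H"
proof -
  assume x: "x \<in> carrier M"
  have "\<ominus> \<zero> = \<zero>"
    by (rule minus_equality) simp_all
  hence "x \<ominus> \<zero> = x"
    unfolding a_minus_def using x by (metis r_zero)
  thus ?thesis
    unfolding cls_zero[symmetric] using x by (simp only: cls_eq_iff zero_closed)
qed

lemma abelian_group_Q: "abelian_group Q"
proof (rule abelian_groupI)
  fix x assume "x \<in> carrier Q"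
  then obtain a where "a \<in> carrier M" "x = cls a"
    by (auto simp: carrier_Q)
  thus "\<exists>y\<in>carrier Q. y \<oplus>\<^bsub>Q\<^esub> x = \<zero>\<^bsub>Q\<^esub>"
    by (intro bexI[of _ "cls (\<ominus> a)"]) (simp_all add: cls_closed cls_add l_neg cls_zero)
qed (auto simp: carrier_Q cls_add a_ac simp flip: cls_zero)

lemma cls_smult:
  assumes x: "x \<in> carrier M"
    and closed: "\<And>x. x \<in> carrier M \<Longrightarrow> a \<odot> x \<in> carrier M"
    and add: "\<And>x y. \<lbrakk>x \<in> carrier M; y \<in> carrier M\<rbrakk> \<Longrightarrow> a \<odot> (x \<oplus> y) = a \<odot> x \<oplus> a \<odot> y"
    and stable: "\<And>h. h \<in> H \<Longrightarrow> a \<odot> h \<in> H"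
  shows "a \<odot>\<^bsub>Q\<^esub> cls x = cls (a \<odot> x)"
proof -
  have H: "h \<in> carrier M" if "h \<in> H" for h
    using that subset_H by auto
  have "a \<odot>\<^bsub>Q\<^esub> cls x = H <+>\<^bsub>M\<^esub> ((\<lambda>x. a \<odot> x) ` cls x)"
    by (simp add: graded_quotient_def)
  also have "\<dots> = cls (a \<odot> x)"
  proof (intro equalityI subsetI)
    fix y assume "y \<in> H <+>\<^bsub>M\<^esub> ((\<lambda>x. a \<odot> x) ` cls x)"
    then obtain h h' where h: "h \<in> H" "h' \<in> H" "y = h \<oplus> (a \<odot> (h' \<oplus> x))"
      by (auto simp: set_add_def' a_r_coset_def')
    hence "y = (h \<oplus> a \<odot> h') \<oplus> a \<odot> x"
      using x H by (simp add: add closed a_assoc)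
    moreover have "h \<oplus> a \<odot> h' \<in> H"
      using h stable additive_subgroup.a_closed[OF subgroup_H] by auto
    ultimately show "y \<in> cls (a \<odot> x)"
      by (auto simp: a_r_coset_def')
  next
    fix y assume "y \<in> cls (a \<odot> x)"
    then obtain h where "h \<in> H" "y = h \<oplus> a \<odot> x"
      by (auto simp: a_r_coset_def')
    moreover have "x \<in> cls x"
      using x by (rule abelian_subgroup.a_rcos_self[OF abelian_subgroup_H])
    ultimately show "y \<in> H <+>\<^bsub>M\<^esub> ((\<lambda>x. a \<odot> x) ` cls x)"
      by (auto simp: set_add_def')
  qed
  finally show ?thesis .
qed

end

locale quotient_ring = ring A for A :: "('k, 'a) graded" (structure) +
  fixes I :: "'a set"
  assumes ideal_I: "ideal I A"
begin

sublocale quotient_group A I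
  by (intro quotient_group.intro quotient_group_axioms.intro abelian_group_axioms ideal.axioms(1)[OF ideal_I])

lemma cls_mult: "\<lbrakk>x \<in> carrier A; y \<in> carrier A\<rbrakk> \<Longrightarrow> cls x \<otimes>\<^bsub>Q\<^esub> cls y = cls (x \<otimes> y)"
  by (simp add: Q_simps ideal.rcoset_mult_add[OF ideal_I])

lemma ring_Q: "ring Q"
proof (rule ringI[OF abelian_group_Q])
  show "monoid Q"
    by (rule monoidI) (auto simp: carrier_Q cls_mult m_assoc Q_simps(4))
qed (auto simp: carrier_Q cls_mult cls_add l_distr r_distr)

end

section \<open>Monoid algebras\<close>

text \<open>
  Elements are finitely supported functions, but only those with support in the carrier of \<open>M\<close>.
  Hence addition is that of the type of all such functions, while multiplication is not.
\<close>

locale monoid_alg = monoid M for M :: "('m, 'z) monoid_scheme" (structure) +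
  fixes wt :: "'m \<Rightarrow> int \<Rightarrow> bool"
    and A :: "('k::field, 'm \<Rightarrow>\<^sub>0 'k) graded"
  assumes A_def: "A = monoid_algebra M wt"
begin

lemma A_simps:
  "carrier A = {u. Poly_Mapping.keys u \<subseteq> carrier M}" "\<zero>\<^bsub>A\<^esub> = 0" "u \<oplus>\<^bsub>A\<^esub> v = u + v"
  "\<one>\<^bsub>A\<^esub> = Poly_Mapping.single \<one> 1"
  by (simp_all add: A_def monoid_algebra_def)

lemma mult_A: "u \<otimes>\<^bsub>A\<^esub> v = (\<Sum>x\<in>Poly_Mapping.keys u. \<Sum>y\<in>Poly_Mapping.keys v.
    Poly_Mapping.single (x \<otimes> y) (Poly_Mapping.lookup u x * Poly_Mapping.lookup v y))"
  by (simp add: A_def monoid_algebra_def)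

lemma mult_add_left: "(u + u') \<otimes>\<^bsub>A\<^esub> v = u \<otimes>\<^bsub>A\<^esub> v + u' \<otimes>\<^bsub>A\<^esub> v"
  unfolding mult_A
  by (rule setsum_keys_plus_distrib) (simp_all add: single_add distrib_right sum.distrib)

lemma mult_add_right: "v \<otimes>\<^bsub>A\<^esub> (u + u') = v \<otimes>\<^bsub>A\<^esub> u + v \<otimes>\<^bsub>A\<^esub> u'"
  unfolding mult_A sum.swap[of _ _ "Poly_Mapping.keys v"]
  by (rule setsum_keys_plus_distrib) (simp_all add: single_add distrib_left sum.distrib)

lemma mult_zero: "0 \<otimes>\<^bsub>A\<^esub> v = 0" "v \<otimes>\<^bsub>A\<^esub> 0 = 0"
  by (simp_all add: mult_A)

lemma mult_single_single:
  "Poly_Mapping.single x a \<otimes>\<^bsub>A\<^esub> Poly_Mapping.single y b = Poly_Mapping.single (x \<otimes> y) (a * b)"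
  by (simp add: mult_A)

lemma mult_closed_A: "\<lbrakk>u \<in> carrier A; v \<in> carrier A\<rbrakk> \<Longrightarrow> u \<otimes>\<^bsub>A\<^esub> v \<in> carrier A"
  unfolding A_simps mult_A
  by (auto dest!: subsetD[OF keys_sum] split: if_splits, blast)

lemma assoc_A:
  assumes "u \<in> carrier A" "v \<in> carrier A" "w \<in> carrier A"
  shows "(u \<otimes>\<^bsub>A\<^esub> v) \<otimes>\<^bsub>A\<^esub> w = u \<otimes>\<^bsub>A\<^esub> (v \<otimes>\<^bsub>A\<^esub> w)"
proof -
  have "Poly_Mapping.keys u \<subseteq> carrier M" "Poly_Mapping.keys v \<subseteq> carrier M" "Poly_Mapping.keys w \<subseteq> carrier M"
    using assms by (simp_all add: A_simps)
  thus ?thesis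
  proof (induction rule: mpoly_induct)
    case u: (single x a)
    from u(2) show ?case
    proof (induction rule: mpoly_induct)
      case v: (single y b)
      from u(3) show ?case
        by (induction rule: mpoly_induct)
          (use u v in \<open>simp_all add: mult_single_single mult_add_right mult_zero m_assoc mult.assoc\<close>)
    qed (simp_all add: mult_add_left mult_add_right mult_zero u.prems)
  qed (simp_all add: mult_add_left mult_zero)
qed

lemma ring_A: "ring A"
proof (rule ringI)
  show "abelian_group A"
  proof (rule abelian_groupI)
    fix u assume "u \<in> carrier A"
    hence "Poly_Mapping.keys (- u) \<subseteq> carrier M"
      by (simp add: A_simps in_keys_iff subset_iff)
    thus "\<exists>v\<in>carrier A. v \<oplus>\<^bsub>A\<^esub> u = \<zero>\<^bsub>A\<^esub>"
      by (intro bexI[of _ "- u"]) (simp_all add: A_simps)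
  qed (auto simp: A_simps add_ac dest!: subsetD[OF keys_add])
  show "monoid A"
  proof (rule monoidI)
    fix u assume "u \<in> carrier A"
    hence u: "Poly_Mapping.keys u \<subseteq> carrier M"
      by (simp add: A_simps)
    show "\<one>\<^bsub>A\<^esub> \<otimes>\<^bsub>A\<^esub> u = u"
      using u by (induction rule: mpoly_induct)
        (simp_all add: A_simps mult_single_single mult_add_right mult_zero)
    show "u \<otimes>\<^bsub>A\<^esub> \<one>\<^bsub>A\<^esub> = u"
      using u by (induction rule: mpoly_induct)
        (simp_all add: A_simps mult_single_single mult_add_left mult_zero)
  qed (simp_all add: mult_closed_A assoc_A A_simps(4), simp add: A_simps)
qed (simp_all add: A_simps(3) mult_add_left mult_add_right)

lemma uminus_A: "u \<in> carrier A \<Longrightarrow> \<ominus>\<^bsub>A\<^esub> u = - u"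
proof -
  assume u: "u \<in> carrier A"
  interpret ring A by (rule ring_A)
  show ?thesis
    by (rule minus_equality) (use u in \<open>simp_all add: A_simps in_keys_iff subset_iff\<close>)
qed

lemma minus_A: "\<lbrakk>u \<in> carrier A; v \<in> carrier A\<rbrakk> \<Longrightarrow> u \<ominus>\<^bsub>A\<^esub> v = u - v"
  by (simp add: a_minus_def uminus_A A_simps(3))

lemma smult_A: "c \<odot>\<^bsub>A\<^esub> u = Poly_Mapping.map ((*) c) u"
  by (simp add: A_def monoid_algebra_def)

lemma smult_single: "c \<odot>\<^bsub>A\<^esub> Poly_Mapping.single x d = Poly_Mapping.single x (c * d)"
  by (simp add: smult_A)

lemma lookup_smult: "Poly_Mapping.lookup (c \<odot>\<^bsub>A\<^esub> u) x = c * Poly_Mapping.lookup u x"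
  by (simp add: smult_A Poly_Mapping.map.rep_eq when_def)

lemma smult_add: "c \<odot>\<^bsub>A\<^esub> (u + v) = c \<odot>\<^bsub>A\<^esub> u + c \<odot>\<^bsub>A\<^esub> v"
  by (rule poly_mapping_eqI) (simp add: lookup_add lookup_smult distrib_left)

lemma smult_closed_A: "u \<in> carrier A \<Longrightarrow> c \<odot>\<^bsub>A\<^esub> u \<in> carrier A"
  by (auto simp: A_simps in_keys_iff lookup_smult)

text \<open>Consequently ideals are stable under scalars.\<close>

lemma smult_eq_mult: "u \<in> carrier A \<Longrightarrow> c \<odot>\<^bsub>A\<^esub> u = Poly_Mapping.single \<one> c \<otimes>\<^bsub>A\<^esub> u"
proof -
  assume "u \<in> carrier A"
  hence "Poly_Mapping.keys u \<subseteq> carrier M"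
    by (simp add: A_simps)
  thus ?thesis
  proof (induction rule: mpoly_induct)
    case (add u v)
    thus ?case by (simp add: smult_add mult_add_right)
  next
    case zero
    thus ?case using smult_add[of c 0 0] by (simp add: mult_zero)
  qed (simp add: smult_single mult_single_single)
qed

end

section \<open>Substitution homomorphisms\<close>

definition substitute :: "('x \<Rightarrow> ('y, 'p::prime_card) mpoly) \<Rightarrow> ('x, 'p) mpoly \<Rightarrow> ('y, 'p) mpoly" where
  "substitute \<rho> u = (\<Sum>m\<in>Poly_Mapping.keys u. scalar_poly (Poly_Mapping.lookup u m) * prod_mset (image_mset \<rho> m))"

lemma substitute_add: "substitute \<rho> (u + v) = substitute \<rho> u + substitute \<rho> v"
  and substitute_single: "substitute \<rho> (Poly_Mapping.single m c) = scalar_poly c * prod_mset (image_mset \<rho> m)"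
  and substitute_0 [simp]: "substitute \<rho> 0 = 0"
  unfolding substitute_def by (rule linear_extension_add)+

lemma substitute_var [simp]: "substitute \<rho> (var x) = \<rho> x"
  by (simp add: var_def substitute_single)

lemma substitute_scalar [simp]: "substitute \<rho> (scalar_poly c) = scalar_poly c"
  by (simp add: scalar_poly_def substitute_single)

lemma substitute_1 [simp]: "substitute \<rho> 1 = 1"
  using substitute_scalar[of \<rho> 1] by simp

lemma substitute_uminus: "substitute \<rho> (- u) = - substitute \<rho> u"
  using substitute_add[of \<rho> u "- u"] by (simp add: eq_neg_iff_add_eq_0 add.commute)

lemma substitute_diff: "substitute \<rho> (u - v) = substitute \<rho> u - substitute \<rho> v"
  using substitute_add[of \<rho> u "- v"] by (simp add: substitute_uminus)

lemma substitute_sum: "substitute \<rho> (sum f A) = (\<Sum>x\<in>A. substitute \<rho> (f x))"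
  by (induction A rule: infinite_finite_induct) (simp_all add: substitute_add)

lemma substitute_mult: "substitute \<rho> (u * v) = substitute \<rho> u * substitute \<rho> v"
proof -
  have "Poly_Mapping.keys u \<subseteq> UNIV" "Poly_Mapping.keys v \<subseteq> UNIV" by simp_all
  thus ?thesis
  proof (induction rule: mpoly_induct)
    case (single m c)
    from single(2) show ?case
      by (induction rule: mpoly_induct)
        (simp_all add: mult_single substitute_single substitute_add scalar_poly_mult algebra_simps)
  qed (simp_all add: substitute_add distrib_right)
qed

text \<open>This and the following rule reduce statements about ring maps on polynomials to variables.\<close>

lemma monomial_induct [case_names one var]:
  fixes u :: "('x, 'p::prime_card) mpoly"
  assumes "set_mset m \<subseteq> K"
    and "P 1" "\<And>x u. \<lbrakk>x \<in> K; Poly_Mapping.keys u \<subseteq> {m. set_mset m \<subseteq> K}; P u\<rbrakk> \<Longrightarrow> P (var x * u :: ('x, 'p) mpoly)"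
  shows "P (Poly_Mapping.single m 1)"
  using assms(1)
proof (induction m)
  case empty
  thus ?case using assms(2) by (simp flip: zero_multiset_def)
next
  case (add x m)
  have "P (var x * Poly_Mapping.single m 1)"
    using add by (intro assms(3)) auto
  thus ?case by (simp add: var_def mult_single)
qed

lemma mpoly_ring_induct [consumes 1, case_names one var scalar add zero]:
  fixes u :: "('x, 'p::prime_card) mpoly"
  assumes "Poly_Mapping.keys u \<subseteq> {m. set_mset m \<subseteq> K}"
    and "P 1"
    and "\<And>x u. \<lbrakk>x \<in> K; Poly_Mapping.keys u \<subseteq> {m. set_mset m \<subseteq> K}; P u\<rbrakk> \<Longrightarrow> P (var x * u)"
    and "\<And>c u. \<lbrakk>Poly_Mapping.keys u \<subseteq> {m. set_mset m \<subseteq> K}; P u\<rbrakk> \<Longrightarrow> P (scalar_poly c * u)"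
    and "\<And>u v. \<lbrakk>Poly_Mapping.keys u \<subseteq> {m. set_mset m \<subseteq> K}; Poly_Mapping.keys v \<subseteq> {m. set_mset m \<subseteq> K}; P u; P v\<rbrakk> \<Longrightarrow> P (u + v)"
    and "P 0"
  shows "P u"
  using assms(1)
proof (induction rule: mpoly_induct)
  case (single m c)
  have "P (scalar_poly c * Poly_Mapping.single m 1)"
  proof (rule assms(4))
    show "Poly_Mapping.keys (Poly_Mapping.single m (1 :: 'p mod_ring)) \<subseteq> {m. set_mset m \<subseteq> K}"
      using single by auto
    show "P (Poly_Mapping.single m 1)"
    proof (rule monomial_induct[where K = K])
      show "set_mset m \<subseteq> K" using single by simp
    qed (fact assms(2), rule assms(3))
  qed
  thus ?case by (simp add: scalar_poly_def mult_single)
next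
  case (add u v)
  show ?case by (rule assms(5)[OF add])
next
  case zero
  show ?case by (rule assms(6))
qed

section \<open>The symmetric algebra of a dual space is a polynomial ring\<close>

lemma dual_space_closed:
  assumes "f \<in> dual_space scale V" "g \<in> dual_space scale V"
  shows "(\<lambda>x. f x + g x) \<in> dual_space scale V" "(\<lambda>x. c * f x) \<in> dual_space scale V"
    "(\<lambda>x. 0) \<in> dual_space scale V"
  using assms by (simp_all add: dual_space_def algebra_simps)

lemma dual_space_sum: "(\<And>i. i \<in> I \<Longrightarrow> f i \<in> dual_space scale V) \<Longrightarrow> (\<lambda>x. \<Sum>i\<in>I. a i * f i x) \<in> dual_space scale V"
  by (simp add: dual_space_def sum.distrib distrib_left sum_distrib_left mult.left_commute)

text \<open>
  The polynomial ring with a variable for every functional, of which the symmetric algebra is the quotient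
  by the ideal \<open>SI\<close> of linear relations.
\<close>

locale free_polys =
  fixes scale :: "'p::prime_card mod_ring \<Rightarrow> 'w::ab_group_add \<Rightarrow> 'w" and V :: "'w set"
begin

abbreviation FP where "FP \<equiv> free_polynomials scale V"
abbreviation SI where "SI \<equiv> symmetric_ideal scale V"

sublocale FP: monoid_alg "\<lparr>carrier = {m. set_mset m \<subseteq> dual_space scale V}, mult = (+), one = {#}\<rparr>"
    "\<lambda>m n. n = (if CARD('p) = 2 then 1 else 2) * int (size m)" FP
  by (intro monoid_alg.intro monoid_alg_axioms.intro monoidI) (auto simp: free_polynomials_def)

lemma carrier_FP: "carrier FP = {u. Poly_Mapping.keys u \<subseteq> {m. set_mset m \<subseteq> dual_space scale V}}"
  by (simp add: FP.A_simps)

lemma mult_FP: "u \<otimes>\<^bsub>FP\<^esub> v = u * v"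
proof -
  have "Poly_Mapping.keys u \<subseteq> UNIV" "Poly_Mapping.keys v \<subseteq> UNIV" by simp_all
  thus ?thesis
  proof (induction rule: mpoly_induct)
    case (single m c)
    from single(2) show ?case
      by (induction rule: mpoly_induct)
        (simp_all add: mult_single FP.mult_single_single FP.mult_add_right FP.mult_zero distrib_left)
  qed (simp_all add: FP.mult_add_left FP.mult_zero distrib_right)
qed

lemma one_FP: "\<one>\<^bsub>FP\<^esub> = 1"
  by (simp add: FP.A_simps flip: zero_multiset_def)

lemma var_closed: "f \<in> dual_space scale V \<Longrightarrow> var f \<in> carrier FP"
  by (simp add: carrier_FP var_def)

lemma scalar_closed: "scalar_poly c \<in> carrier FP"
  by (simp add: carrier_FP scalar_poly_def)

lemma mult_closed: "u \<in> carrier FP \<Longrightarrow> v \<in> carrier FP \<Longrightarrow> u * v \<in> carrier FP"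
  using FP.mult_closed_A by (simp add: mult_FP)

lemma add_closed: "u \<in> carrier FP \<Longrightarrow> v \<in> carrier FP \<Longrightarrow> u + v \<in> carrier FP"
  using ring.ring_simprules(1)[OF FP.ring_A, of u v] by (simp add: FP.A_simps(3))

lemma diff_closed: "u \<in> carrier FP \<Longrightarrow> v \<in> carrier FP \<Longrightarrow> u - v \<in> carrier FP"
  using ring.ring_simprules(4)[OF FP.ring_A, of u v] by (simp add: FP.minus_A)

lemma relations_subset: "linear_relations scale V \<subseteq> carrier FP"
  unfolding linear_relations_def var_def[symmetric]
proof (intro Un_least subsetI, goal_cases)
  case (1 x)
  thus ?case by (auto intro!: diff_closed var_closed dual_space_closed)
next
  case (2 x)
  then obtain c f where "f \<in> dual_space scale V" "x = var (\<lambda>x. c * f x) - scalar_poly c * var f"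
    by (auto simp: var_def scalar_poly_def mult_single)
  thus ?case by (auto intro!: diff_closed var_closed mult_closed scalar_closed dual_space_closed)
qed

lemma one_closed: "1 \<in> carrier FP"
  using scalar_closed[of 1] by simp

lemma smult_FP: "u \<in> carrier FP \<Longrightarrow> c \<odot>\<^bsub>FP\<^esub> u = scalar_poly c * u"
  by (simp add: FP.smult_eq_mult mult_FP scalar_poly_def)

lemma ideal_SI: "ideal SI FP"
  unfolding symmetric_ideal_def by (rule ring.genideal_ideal[OF FP.ring_A relations_subset])

sublocale SA: quotient_ring FP SI
  by (intro quotient_ring.intro quotient_ring_axioms.intro FP.ring_A ideal_SI)

lemma symmetric_algebra_eq: "symmetric_algebra scale V = graded_quotient FP SI"
  by (simp add: symmetric_algebra_def)

lemma SI_relations: 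
  assumes "f \<in> dual_space scale V" "g \<in> dual_space scale V"
  shows "var (\<lambda>x. f x + g x) - var f - var g \<in> SI" "var (\<lambda>x. c * f x) - scalar_poly c * var f \<in> SI"
proof -
  have sub: "linear_relations scale V \<subseteq> SI"
    unfolding symmetric_ideal_def by (rule ring.genideal_self[OF FP.ring_A relations_subset])
  show "var (\<lambda>x. f x + g x) - var f - var g \<in> SI" "var (\<lambda>x. c * f x) - scalar_poly c * var f \<in> SI"
    by (rule subsetD[OF sub], unfold linear_relations_def var_def scalar_poly_def mult_single, use assms in auto)+
qed

lemma SI_closed:
  "0 \<in> SI" "\<lbrakk>u \<in> SI; v \<in> SI\<rbrakk> \<Longrightarrow> u + v \<in> SI" "\<lbrakk>u \<in> SI; v \<in> carrier FP\<rbrakk> \<Longrightarrow> v * u \<in> SI"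
  "SI \<subseteq> carrier FP" "u \<in> SI \<Longrightarrow> - u \<in> SI"
proof -
  interpret ideal SI FP by (rule ideal_SI)
  show "SI \<subseteq> carrier FP" by (rule a_subset)
  show "0 \<in> SI" using zero_closed by (simp add: FP.A_simps(2))
  show "u + v \<in> SI" if "u \<in> SI" "v \<in> SI"
    using a_closed[OF that] by (simp add: FP.A_simps(3))
  show "v * u \<in> SI" if "u \<in> SI" "v \<in> carrier FP"
    using I_l_closed[OF that] by (simp add: mult_FP)
  show "- u \<in> SI" if "u \<in> SI"
    using a_inv_closed[OF that] that a_subset by (auto simp: FP.uminus_A)
qed

end

locale subspace_coords = free_polys scale V
  for scale :: "'p::prime_card mod_ring \<Rightarrow> 'w::ab_group_add \<Rightarrow> 'w" and V :: "'w set" +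
  fixes j :: nat and e :: "nat \<Rightarrow> 'w" and b :: "nat \<Rightarrow> 'w \<Rightarrow> 'p mod_ring"
  assumes vector_space: "vector_space scale"
    and subspace: "module.subspace scale V"
    and e_in: "i < j \<Longrightarrow> e i \<in> V"
    and b_dual: "i < j \<Longrightarrow> b i \<in> dual_space scale V"
    and b_e: "\<lbrakk>i < j; l < j\<rbrakk> \<Longrightarrow> b i (e l) = (if i = l then 1 else 0)"
    and span: "x \<in> V \<Longrightarrow> x = (\<Sum>i<j. scale (b i x) (e i))"
begin

text \<open>
  Expressing every functional through the dual basis maps the symmetric algebra to the polynomial ring in
  \<open>j\<close> variables.
\<close>

definition coord_map :: "('w \<Rightarrow> 'p mod_ring, 'p) mpoly \<Rightarrow> (nat, 'p) mpoly" where
  "coord_map = substitute (\<lambda>f. linear_form j (\<lambda>i. f (e i)))"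

definition coord_section :: "(nat, 'p) mpoly \<Rightarrow> ('w \<Rightarrow> 'p mod_ring, 'p) mpoly" where
  "coord_section = substitute (\<lambda>i. var (b i))"

lemma functional_expansion:
  assumes "f \<in> dual_space scale V"
  shows "f = (\<lambda>x. \<Sum>i<j. f (e i) * b i x)"
proof
  fix x
  interpret vector_space scale by (rule vector_space)
  have zero: "f 0 = 0"
  proof -
    have "f (0 + 0) = f 0 + f 0"
      using assms subspace_0[OF subspace] unfolding dual_space_def by blast
    hence "f 0 + f 0 = f 0 + 0"
      by (simp only: add_0_right)
    thus ?thesis by (rule add_left_imp_eq)
  qed
  have lin: "f (\<Sum>i<r. scale (a i) (e i)) = (\<Sum>i<r. a i * f (e i)) \<and> (\<Sum>i<r. scale (a i) (e i)) \<in> V" if "r \<le> j" for r a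
    using that
  proof (induction r)
    case 0
    show ?case by (simp add: zero subspace_0[OF subspace])
  next
    case (Suc r)
    have "scale (a r) (e r) \<in> V"
      using Suc e_in by (intro subspace_scale[OF subspace]) auto
    thus ?case
      using Suc assms e_in[of r] by (auto simp: dual_space_def intro: subspace_add[OF subspace])
  qed
  show "f x = (\<Sum>i<j. f (e i) * b i x)"
  proof (cases "x \<in> V")
    case True
    hence "f x = f (\<Sum>i<j. scale (b i x) (e i))"
      using span by simp
    thus ?thesis
      using lin[OF order.refl, of "\<lambda>i. b i x"] by (simp add: mult.commute)
  next
    case False
    hence "b i x = 0" if "i < j" for i
      using b_dual[OF that] by (auto simp: dual_space_def)
    thus ?thesis
      using assms False by (auto simp: dual_space_def)
  qed
qed

lemma coord_section_closed: "y \<in> polys_in j \<Longrightarrow> coord_section y \<in> carrier FP"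
proof -
  assume "y \<in> polys_in j"
  hence "Poly_Mapping.keys y \<subseteq> {m. set_mset m \<subseteq> {..<j}}"
    by (auto simp: polys_in_def)
  thus ?thesis
    by (induction rule: mpoly_ring_induct)
      (auto simp: coord_section_def substitute_mult substitute_add one_FP[symmetric] FP.A_simps(2)[symmetric]
        intro!: mult_closed add_closed var_closed scalar_closed b_dual
          ring.ring_simprules(2,6)[OF FP.ring_A] simp del: FP.A_simps)
qed

lemma linear_form_in: "linear_form j a \<in> polys_in j"
proof -
  have "r \<le> j \<Longrightarrow> linear_form r a \<in> polys_in j" for r
    by (induction r) (auto simp: linear_form_def intro!: polys_in_closed)
  thus ?thesis by simp
qed

lemma coord_map_in: "coord_map u \<in> polys_in j"
proof -
  have "Poly_Mapping.keys u \<subseteq> {m. set_mset m \<subseteq> UNIV}" by simp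
  thus ?thesis
    by (induction rule: mpoly_ring_induct)
      (auto simp: coord_map_def substitute_mult substitute_add intro!: polys_in_closed linear_form_in)
qed

lemma coord_map_section: "y \<in> polys_in j \<Longrightarrow> coord_map (coord_section y) = y"
proof -
  have b: "linear_form j (\<lambda>l. b i (e l)) = var i" if "i < j" for i
    unfolding linear_form_def using that by (subst sum.mono_neutral_right[of _ "{i}"]) (auto simp: b_e)
  assume "y \<in> polys_in j"
  hence "Poly_Mapping.keys y \<subseteq> {m. set_mset m \<subseteq> {..<j}}"
    by (auto simp: polys_in_def)
  thus ?thesis
    by (induction rule: mpoly_ring_induct)
      (simp_all add: coord_section_def coord_map_def substitute_mult substitute_add b)
qed

text \<open>
  Modulo the linear relations every functional is the combination of the dual basis given by its
  values on the basis.  As \<open>coord_section\<close> and \<open>coord_map\<close> are ring maps, this suffices.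
\<close>

lemma coord_section_map:
  assumes "u \<in> carrier FP"
  shows "u - coord_section (coord_map u) \<in> SI"
proof -
  have var_case: "var f - coord_section (coord_map (var f)) \<in> SI" if f: "f \<in> dual_space scale V" for f
  proof -
    have "var (\<lambda>x. \<Sum>i<r. a i * b i x) - (\<Sum>i<r. scalar_poly (a i) * var (b i)) \<in> SI" if "r \<le> j" for r a
      using that
    proof (induction r)
      case 0
      show ?case
        using SI_relations(2)[OF f f, of 0] by simp
    next
      case (Suc r)
      let ?S = "\<lambda>x. \<Sum>i<r. a i * b i x"
      have S: "?S \<in> dual_space scale V" "(\<lambda>x. a r * b r x) \<in> dual_space scale V" "b r \<in> dual_space scale V"
        using Suc by (auto intro!: dual_space_sum b_dual dual_space_closed)
      have "(var (\<lambda>x. ?S x + a r * b r x) - var ?S - var (\<lambda>x. a r * b r x)) +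
          (var (\<lambda>x. a r * b r x) - scalar_poly (a r) * var (b r)) +
          (var ?S - (\<Sum>i<r. scalar_poly (a i) * var (b i))) \<in> SI"
        using Suc S by (intro SI_closed SI_relations) auto
      thus ?case by (simp add: algebra_simps)
    qed
    from this[OF order.refl, of "\<lambda>i. f (e i)"]
    show ?thesis
      using functional_expansion[OF f]
      by (simp add: coord_map_def coord_section_def linear_form_def substitute_sum substitute_mult)
  qed
  have closed: "coord_section (coord_map v) \<in> carrier FP" for v
    by (rule coord_section_closed[OF coord_map_in])
  have "Poly_Mapping.keys u \<subseteq> {m. set_mset m \<subseteq> dual_space scale V}"
    using assms by (simp add: carrier_FP)
  thus ?thesis
  proof (induction rule: mpoly_ring_induct)
    case one
    show ?case by (simp add: coord_map_def coord_section_def SI_closed)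
  next
    case (var f v)
    define \<tau> where "\<tau> = (\<lambda>v. coord_section (coord_map v))"
    have "v * (var f - \<tau> (var f)) + \<tau> (var f) * (v - \<tau> v) \<in> SI"
      using var var_case closed unfolding \<tau>_def
      by (intro SI_closed) (auto simp: carrier_FP)
    moreover have "\<tau> (var f * v) = \<tau> (var f) * \<tau> v"
      by (simp add: \<tau>_def coord_map_def coord_section_def substitute_mult)
    ultimately show ?case
      by (simp add: \<tau>_def algebra_simps)
  next
    case (scalar c v)
    have "scalar_poly c * (v - coord_section (coord_map v)) \<in> SI"
      using scalar scalar_closed by (intro SI_closed)
    thus ?case
      by (simp add: coord_map_def coord_section_def substitute_mult algebra_simps)
  next
    case (add u v)
    have "(u - coord_section (coord_map u)) + (v - coord_section (coord_map v)) \<in> SI"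
      using add by (intro SI_closed)
    thus ?case
      by (simp add: coord_map_def coord_section_def substitute_add algebra_simps)
  next
    case zero
    show ?case by (simp add: coord_map_def coord_section_def SI_closed)
  qed
qed

lemma SI_subset_kernel: "u \<in> SI \<Longrightarrow> coord_map u = 0"
proof -
  have "ideal {u \<in> carrier FP. coord_map u = 0} FP"
  proof (rule idealI[OF FP.ring_A])
    show "subgroup {u \<in> carrier FP. coord_map u = 0} (add_monoid FP)"
    proof (rule group.subgroupI)
      show "Group.group (add_monoid FP)"
        using ring.is_abelian_group[OF FP.ring_A] abelian_group.a_group by blast
      have "0 \<in> {u \<in> carrier FP. coord_map u = 0}"
        using ring.ring_simprules(2)[OF FP.ring_A] by (simp add: FP.A_simps(2) coord_map_def)
      thus "{u \<in> carrier FP. coord_map u = 0} \<noteq> {}" by blast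
      show "inv\<^bsub>add_monoid FP\<^esub> u \<in> {u \<in> carrier FP. coord_map u = 0}" if "u \<in> {u \<in> carrier FP. coord_map u = 0}" for u
        using that ring.ring_simprules(3)[OF FP.ring_A, of u] FP.uminus_A[of u]
        by (simp add: a_inv_def[symmetric] coord_map_def substitute_uminus)
    qed (auto simp: FP.A_simps(3) coord_map_def substitute_add intro: add_closed)
  qed (auto simp: mult_FP coord_map_def substitute_mult intro: mult_closed)
  moreover have "linear_relations scale V \<subseteq> {u \<in> carrier FP. coord_map u = 0}"
  proof -
    have "linear_form j (\<lambda>i. f (e i) + g (e i)) = linear_form j (\<lambda>i. f (e i)) + linear_form j (\<lambda>i. g (e i))"
      for f g :: "'w \<Rightarrow> 'p mod_ring"
      by (simp add: linear_form_def scalar_poly_add distrib_right sum.distrib)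
    moreover have "linear_form j (\<lambda>i. c * f (e i)) = scalar_poly c * linear_form j (\<lambda>i. f (e i))"
      for c and f :: "'w \<Rightarrow> 'p mod_ring"
      by (simp add: linear_form_def scalar_poly_mult sum_distrib_left mult.assoc)
    ultimately have "coord_map u = 0" if "u \<in> linear_relations scale V" for u
      using that by (auto simp: linear_relations_def coord_map_def substitute_diff substitute_single)
    thus ?thesis
      using relations_subset by auto
  qed
  ultimately have "SI \<subseteq> {u \<in> carrier FP. coord_map u = 0}"
    unfolding symmetric_ideal_def by (rule ring.genideal_minimal[OF FP.ring_A])
  thus "u \<in> SI \<Longrightarrow> coord_map u = 0" by auto
qed

lemma coord_map_eq_iff:
  assumes "u \<in> carrier FP" "v \<in> carrier FP"
  shows "SA.cls u = SA.cls v \<longleftrightarrow> coord_map u = coord_map v"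
proof -
  have "u - v \<in> SI \<longleftrightarrow> coord_map (u - v) = 0"
  proof
    assume "coord_map (u - v) = 0"
    thus "u - v \<in> SI"
      using coord_section_map[OF diff_closed[OF assms]] by (simp add: coord_section_def)
  qed (rule SI_subset_kernel)
  thus ?thesis
    using assms by (simp add: SA.cls_eq_iff FP.minus_A coord_map_def substitute_diff)
qed

text \<open>
  The value does not depend on the chosen representative, because \<open>coord_map\<close> kills exactly the linear
  relations.
\<close>

definition coord_iso :: "(('w \<Rightarrow> 'p mod_ring, 'p) mpoly) set \<Rightarrow> (nat, 'p) mpoly" where
  "coord_iso C = coord_map (SOME u. u \<in> carrier FP \<and> C = SA.cls u)"

lemma coord_iso_cls: "u \<in> carrier FP \<Longrightarrow> coord_iso (SA.cls u) = coord_map u"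
proof -
  assume u: "u \<in> carrier FP"
  define v where "v = (SOME v. v \<in> carrier FP \<and> SA.cls u = SA.cls v)"
  have "v \<in> carrier FP \<and> SA.cls u = SA.cls v"
    unfolding v_def by (rule someI[of _ u]) (simp add: u)
  thus ?thesis
    using coord_map_eq_iff[OF u, of v] by (simp add: coord_iso_def v_def)
qed

end

locale polynomial_algebra = ring A for A :: "('p::prime_card mod_ring, 'a) graded" (structure) +
  fixes j :: nat and \<alpha> :: "'a \<Rightarrow> (nat, 'p) mpoly"
  assumes bij: "bij_betw \<alpha> (carrier A) (polys_in j)"
    and iso_add: "\<lbrakk>x \<in> carrier A; y \<in> carrier A\<rbrakk> \<Longrightarrow> \<alpha> (x \<oplus> y) = \<alpha> x + \<alpha> y"
    and iso_mult: "\<lbrakk>x \<in> carrier A; y \<in> carrier A\<rbrakk> \<Longrightarrow> \<alpha> (x \<otimes> y) = \<alpha> x * \<alpha> y"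
    and iso_one: "\<alpha> \<one> = 1"
    and smult_closed: "x \<in> carrier A \<Longrightarrow> c \<odot> x \<in> carrier A"
    and iso_smult: "x \<in> carrier A \<Longrightarrow> \<alpha> (c \<odot> x) = scalar_poly c * \<alpha> x"

context subspace_coords
begin

lemma smult_SI: "u \<in> SI \<Longrightarrow> c \<odot>\<^bsub>FP\<^esub> u \<in> SI"
  using smult_FP[of u c] SI_closed(3)[of u "scalar_poly c"] SI_closed(4) scalar_closed[of c] by auto

lemma smult_cls: "u \<in> carrier FP \<Longrightarrow> c \<odot>\<^bsub>symmetric_algebra scale V\<^esub> SA.cls u = SA.cls (c \<odot>\<^bsub>FP\<^esub> u)"
  unfolding symmetric_algebra_eq
  by (rule SA.cls_smult) (auto simp: FP.smult_closed_A FP.smult_add FP.A_simps(3) smult_SI)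

lemma polynomial_algebra: "polynomial_algebra (symmetric_algebra scale V) j coord_iso"
proof (intro polynomial_algebra.intro polynomial_algebra_axioms.intro)
  show "ring (symmetric_algebra scale V)"
    unfolding symmetric_algebra_eq by (rule SA.ring_Q)
  have "inj_on coord_iso (SA.cls ` carrier FP)"
    using coord_map_eq_iff by (intro inj_onI) (force simp: coord_iso_cls)
  moreover have "coord_iso ` SA.cls ` carrier FP = polys_in j"
  proof (intro equalityI subsetI)
    fix y :: "(nat, 'p) mpoly" assume "y \<in> polys_in j"
    thus "y \<in> coord_iso ` SA.cls ` carrier FP"
      by (intro image_eqI[of _ _ "SA.cls (coord_section y)"] imageI)
        (simp_all add: coord_iso_cls coord_section_closed coord_map_section)
  qed (auto simp: coord_iso_cls coord_map_in)
  ultimately show "bij_betw coord_iso (carrier (symmetric_algebra scale V)) (polys_in j)"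
    unfolding symmetric_algebra_eq SA.carrier_Q bij_betw_def by simp
qed (auto simp: symmetric_algebra_eq SA.carrier_Q SA.cls_add SA.cls_mult coord_iso_cls mult_FP
    mult_closed add_closed FP.A_simps(3) coord_map_def substitute_add substitute_mult SA.Q_simps(4)
    one_FP smult_cls[unfolded symmetric_algebra_eq] FP.smult_closed_A one_closed smult_FP mult_closed scalar_closed)

end

section \<open>Homogeneous components\<close>

locale graded_group = abelian_group M for M :: "('b, 'z) ring_scheme" (structure) +
  fixes gp :: "int \<Rightarrow> 'b set"
  assumes direct_sum: "internal_direct_sum M gp UNIV"
begin

definition component :: "'b \<Rightarrow> int \<Rightarrow> 'b" where
  "component x = (THE f. (\<forall>i. f i \<in> gp i) \<and> finite {i. f i \<noteq> \<zero>} \<and> x = (\<Oplus>i\<in>{i. f i \<noteq> \<zero>}. f i))"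

lemma gp_subgroup: "additive_subgroup (gp i) M"
  using direct_sum by (simp add: internal_direct_sum_def)

lemma gp_closed:
  "gp i \<subseteq> carrier M" "\<zero> \<in> gp i" "\<lbrakk>x \<in> gp i; y \<in> gp i\<rbrakk> \<Longrightarrow> x \<oplus> y \<in> gp i"
  using gp_subgroup additive_subgroup.a_subset additive_subgroup.zero_closed additive_subgroup.a_closed
  by metis+

lemma ex1_component:
  "x \<in> carrier M \<Longrightarrow> \<exists>!f. (\<forall>i. f i \<in> gp i) \<and> finite {i. f i \<noteq> \<zero>} \<and> x = (\<Oplus>i\<in>{i. f i \<noteq> \<zero>}. f i)"
  using direct_sum unfolding internal_direct_sum_def by simp

lemma component_props:
  assumes "x \<in> carrier M"
  shows "component x i \<in> gp i" "finite {i. component x i \<noteq> \<zero>}"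
    "x = (\<Oplus>i\<in>{i. component x i \<noteq> \<zero>}. component x i)"
  using theI'[OF ex1_component[OF assms]] unfolding component_def by blast+

lemma component_closed: "x \<in> carrier M \<Longrightarrow> component x i \<in> carrier M"
  using component_props(1) gp_closed(1) by blast

lemma sum_extend:
  assumes "finite S" "{i. f i \<noteq> \<zero>} \<subseteq> S" "\<And>i. f i \<in> carrier M"
  shows "(\<Oplus>i\<in>S. f i) = (\<Oplus>i\<in>{i. f i \<noteq> \<zero>}. f i)"
  by (rule add.finprod_mono_neutral_cong_right) (use assms in auto)

lemma component_eqI:
  assumes "\<And>i. f i \<in> gp i" "finite S" "{i. f i \<noteq> \<zero>} \<subseteq> S" "x = (\<Oplus>i\<in>S. f i)"
  shows "component x i = f i"
proof -
  have f: "f i \<in> carrier M" for i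
    using assms(1) gp_closed(1) by blast
  have x: "x \<in> carrier M"
    unfolding assms(4) using f by (intro finsum_closed) auto
  have "(\<forall>i. f i \<in> gp i) \<and> finite {i. f i \<noteq> \<zero>} \<and> x = (\<Oplus>i\<in>{i. f i \<noteq> \<zero>}. f i)"
    using assms sum_extend[OF assms(2,3) f] finite_subset by metis
  moreover have "(\<forall>i. component x i \<in> gp i) \<and> finite {i. component x i \<noteq> \<zero>} \<and>
      x = (\<Oplus>i\<in>{i. component x i \<noteq> \<zero>}. component x i)"
    using component_props[OF x] by blast
  ultimately have "component x = f"
    using ex1_component[OF x] by blast
  thus ?thesis by simp
qed

lemma component_homogeneous: "x \<in> gp d \<Longrightarrow> component x i = (if i = d then x else \<zero>)"
proof (rule component_eqI[where S = "{d}"])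
  assume "x \<in> gp d"
  hence "x \<in> carrier M"
    using gp_closed(1) by blast
  thus "x = (\<Oplus>i\<in>{d}. if i = d then x else \<zero>)"
    by (simp add: finsum_insert)
qed (auto simp: gp_closed(2))

lemma component_zero: "component \<zero> i = \<zero>"
  using component_homogeneous[OF gp_closed(2)[of 0], of i] by (simp split: if_splits)

lemma component_add:
  assumes "x \<in> carrier M" "y \<in> carrier M"
  shows "component (x \<oplus> y) i = component x i \<oplus> component y i"
proof -
  define S where "S = {i. component x i \<noteq> \<zero>} \<union> {i. component y i \<noteq> \<zero>}"
  have S: "finite S" "{i. component x i \<noteq> \<zero>} \<subseteq> S" "{i. component y i \<noteq> \<zero>} \<subseteq> S"
    using component_props(2) assms by (auto simp: S_def)
  have "x = (\<Oplus>i\<in>S. component x i)" "y = (\<Oplus>i\<in>S. component y i)"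
    using sum_extend[OF S(1,2)] sum_extend[OF S(1,3)] component_closed component_props(3) assms by auto
  hence "x \<oplus> y = (\<Oplus>i\<in>S. component x i) \<oplus> (\<Oplus>i\<in>S. component y i)"
    by simp
  also have "\<dots> = (\<Oplus>i\<in>S. component x i \<oplus> component y i)"
    using assms by (intro finsum_addf[symmetric]) (auto intro: component_closed)
  finally have eq: "x \<oplus> y = (\<Oplus>i\<in>S. component x i \<oplus> component y i)" .
  show ?thesis
    by (rule component_eqI[OF _ S(1) _ eq])
      (use assms component_props(1) in \<open>auto simp: S_def intro!: gp_closed\<close>)
qed

lemma homogeneous_induct [consumes 1, case_names homogeneous add]:
  assumes "x \<in> carrier M"
    and "\<And>d x. x \<in> gp d \<Longrightarrow> P x"
    and "\<And>x y. \<lbrakk>x \<in> carrier M; y \<in> carrier M; P x; P y\<rbrakk> \<Longrightarrow> P (x \<oplus> y)"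
  shows "P x"
proof -
  have "P (\<Oplus>i\<in>S. component x i)" if "finite S" for S
    using that
  proof (induction S rule: finite_induct)
    case empty
    show ?case using assms(2)[OF gp_closed(2)] by simp
  next
    case (insert i S)
    have "P (component x i \<oplus> (\<Oplus>i\<in>S. component x i))"
      using insert assms(1) component_props(1) assms(2)
      by (intro assms(3) finsum_closed) (auto intro: component_closed)
    thus ?case
      using insert assms(1) by (simp add: component_closed finsum_insert Pi_def)
  qed
  thus ?thesis
    using component_props(2,3)[OF assms(1)] by metis
qed

lemma components_zero: "x \<in> carrier M \<Longrightarrow> (\<And>i. component x i = \<zero>) \<Longrightarrow> x = \<zero>"
  using component_props(3)[of x] by simp

end

context graded_commutative_algebra
begin

sublocale graded_group A "gpart A"
  by unfold_locales (rule grading)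

lemma scalar_simps [simp]:
  "x \<in> carrier A \<Longrightarrow> c \<odot> x \<in> carrier A"
  "\<lbrakk>x \<in> carrier A; y \<in> carrier A\<rbrakk> \<Longrightarrow> c \<odot> (x \<oplus> y) = c \<odot> x \<oplus> c \<odot> y"
  "x \<in> carrier A \<Longrightarrow> c \<odot> (d \<odot> x) = (c * d) \<odot> x"
  "x \<in> carrier A \<Longrightarrow> 1 \<odot> x = x"
  "x \<in> carrier A \<Longrightarrow> 0 \<odot> x = \<zero>"
  "c \<odot> \<zero> = \<zero>"
  using scalars.smult_closed[of c x] scalars.smult_r_distr[of c x y] scalars.smult_assoc1[of c d x]
    scalars.smult_one[of x] scalars.smult_l_null[of x] scalars.smult_r_null[of c]
  by (simp_all add: base_field_def)

lemma scalar_distrib: "x \<in> carrier A \<Longrightarrow> (c + d) \<odot> x = c \<odot> x \<oplus> d \<odot> x"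
  using scalars.smult_l_distr[of c d x] by (simp add: base_field_def)

lemma component_smult:
  assumes "x \<in> carrier A"
  shows "component (c \<odot> x) i = c \<odot> component x i"
  using assms
proof (induction rule: homogeneous_induct)
  case (homogeneous d x)
  thus ?case
    using component_homogeneous[OF gpart_smult[OF homogeneous, of c], of i]
      component_homogeneous[OF homogeneous, of i] by simp
qed (simp add: component_add component_closed)

lemma component_mult_homogeneous:
  assumes y: "y \<in> gpart A k" and "x \<in> carrier A"
  shows "component (y \<otimes> x) i = y \<otimes> component x (i - k)"
  using assms(2)
proof (induction rule: homogeneous_induct)
  case (homogeneous d x)
  have "y \<in> carrier A" using y gp_closed by auto
  thus ?case
    using component_homogeneous[OF gpart_mult[OF y homogeneous], of i]
      component_homogeneous[OF homogeneous, of "i - k"] by (auto simp: algebra_simps)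
next
  case (add u v)
  have "y \<in> carrier A" using y gp_closed by auto
  thus ?case using add by (simp add: r_distr component_add component_closed)
qed

definition degree_ge :: "nat \<Rightarrow> 'a set" where
  "degree_ge m = {x \<in> carrier A. \<forall>i<int m. component x i = \<zero>}"

lemma degree_ge_closed:
  "degree_ge m \<subseteq> carrier A" "\<zero> \<in> degree_ge m"
  "\<lbrakk>x \<in> degree_ge m; y \<in> degree_ge m\<rbrakk> \<Longrightarrow> x \<oplus> y \<in> degree_ge m"
  "x \<in> degree_ge m \<Longrightarrow> c \<odot> x \<in> degree_ge m"
  "x \<in> carrier A \<Longrightarrow> component x (int m) \<in> degree_ge m"
  by (auto simp: degree_ge_def component_add component_smult component_zero component_closed
      component_homogeneous[OF component_props(1)])

lemma degree_ge_uminus: "x \<in> degree_ge m \<Longrightarrow> \<ominus> x \<in> degree_ge m"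
proof -
  assume x: "x \<in> degree_ge m"
  hence xc: "x \<in> carrier A" by (simp add: degree_ge_def)
  have "(- 1) \<odot> x \<oplus> x = ((- 1) + 1) \<odot> x"
    using xc scalar_distrib[of x "- 1" 1] by simp
  hence "\<ominus> x = (- 1) \<odot> x"
    using xc by (intro minus_equality) auto
  thus ?thesis using x degree_ge_closed(4) by simp
qed

lemma degree_ge_Suc: "degree_ge (Suc m) = {x \<in> degree_ge m. component x (int m) = \<zero>}"
proof -
  have "(\<forall>i<int (Suc m). P i) \<longleftrightarrow> (\<forall>i<int m. P i) \<and> P (int m)" for P
  proof -
    have "i < int (Suc m) \<longleftrightarrow> i < int m \<or> i = int m" for i by auto
    thus ?thesis by blast
  qed
  thus ?thesis by (auto simp: degree_ge_def)
qed

lemma connected_degree_ge_0: "connected_algebra A \<Longrightarrow> degree_ge 0 = carrier A"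
  using component_props(1) by (fastforce simp: degree_ge_def connected_algebra_def)

lemma bounded_degree_ge: "bounded_algebra A \<Longrightarrow> connected_algebra A \<Longrightarrow> \<exists>d. degree_ge d = {\<zero>}"
proof -
  assume "bounded_algebra A" "connected_algebra A"
  hence fin: "finite {n. gpart A n \<noteq> {\<zero>}}"
    by (simp add: bounded_algebra_def)
  define d where "d = nat (Max (insert 0 {n. gpart A n \<noteq> {\<zero>}}) + 1)"
  have "n < int d" if "gpart A n \<noteq> {\<zero>}" for n
  proof -
    have "n \<le> Max (insert 0 {n. gpart A n \<noteq> {\<zero>}})"
      using that fin by (intro Max_ge) auto
    thus ?thesis by (simp add: d_def)
  qed
  hence "component x i = \<zero>" if "x \<in> carrier A" "\<not> i < int d" for x i
    using that component_props(1)[of x i] by fastforce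
  hence "degree_ge d \<subseteq> {\<zero>}"
    by (auto simp: degree_ge_def) (metis components_zero)
  thus ?thesis
    using degree_ge_closed(2) by blast
qed

text \<open>
  Modulo higher degrees, an element of a connected algebra acts through its augmentation: its components
  of positive degree raise the degree, and its component of degree 0 is a scalar.
\<close>

lemma mult_degree_ge:
  assumes "connected_algebra A" and \<epsilon>: "\<epsilon> \<in> graded_algebra_hom A base_field"
    and y: "y \<in> carrier A" and x: "x \<in> degree_ge m"
  shows "(\<forall>i<int m. component (y \<otimes> x) i = \<zero>) \<and> component (y \<otimes> x) (int m) = \<epsilon> y \<odot> component x (int m)"
  using y
proof (induction rule: homogeneous_induct)
  case (homogeneous k y)
  have c: "x \<in> carrier A" "y \<in> carrier A"
    using x homogeneous gp_closed by (auto simp: degree_ge_def)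
  have gp: "gpart A n = {\<zero>}" if "n < 0" for n
    using assms(1) that by (simp add: connected_algebra_def)
  consider "k < 0" | "k = 0" | "k > 0" by linarith
  thus ?case
  proof cases
    case 1
    hence "y = \<zero>" using homogeneous gp by auto
    moreover from this have "\<epsilon> y = 0"
      using ring_hom_zero[of \<epsilon> A base_field] \<epsilon> ring_axioms scalars.R.ring_axioms
      by (simp add: graded_algebra_hom_def base_field_def)
    ultimately show ?thesis using c by (simp add: component_zero component_closed)
  next
    case 2
    then obtain a where a: "y = a \<odot> \<one>"
      using homogeneous assms(1) by (auto simp: connected_algebra_def)
    have "\<epsilon> y = a * \<epsilon> \<one>"
      using \<epsilon> by (simp add: a graded_algebra_hom_def base_field_def)
    moreover have "\<epsilon> \<one> = 1"
      using \<epsilon> ring_hom_one[of \<epsilon> A base_field] by (simp add: graded_algebra_hom_def base_field_def)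
    ultimately show ?thesis
      using c x by (simp add: a smult_mult_left component_smult degree_ge_def)
  next
    case 3
    hence "\<epsilon> y = 0"
      using \<epsilon> homogeneous by (fastforce simp: graded_algebra_hom_def base_field_def)
    moreover have "component (y \<otimes> x) i = \<zero>" if "i \<le> int m" for i
    proof -
      have "component x (i - k) = \<zero>"
        using x that 3 by (simp add: degree_ge_def)
      thus ?thesis
        using component_mult_homogeneous[OF homogeneous c(1), of i] c by simp
    qed
    ultimately show ?thesis
      using c by (simp add: component_closed)
  qed
next
  case (add y z)
  have c: "x \<in> carrier A"
    using x by (auto simp: degree_ge_def)
  have "\<epsilon> (y \<oplus> z) = \<epsilon> y + \<epsilon> z"
    using \<epsilon> add ring_hom_add[of \<epsilon> A base_field y z] by (simp add: graded_algebra_hom_def base_field_def)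
  thus ?case
    using add c by (simp add: l_distr component_add scalar_distrib component_closed)
qed

end

section \<open>Tensor products with a polynomial ring\<close>

text \<open>
  The images under \<open>\<Theta>\<close> of the monomials are a basis of the polynomial ring \<open>A\<close>, so an element of \<open>A \<otimes> N\<close> has
  coordinates in \<open>N\<close> with respect to this basis.  In the application to depth, \<open>\<Theta>\<close> is the twist by
  the Dickson invariants.
\<close>

locale poly_tensor = A: polynomial_algebra A j \<alpha> + N: graded_commutative_algebra N
  for A :: "('p::prime_card mod_ring, 'a) graded" and j \<alpha> and N :: "('p mod_ring, 'b) graded" +
  fixes \<Theta> :: "(nat, 'p) mpoly \<Rightarrow> (nat, 'p) mpoly"
  assumes basis_bij: "bij_betw \<Theta> (polys_in j) (polys_in j)"
    and basis_add: "\<Theta> (u + v) = \<Theta> u + \<Theta> v"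
    and basis_scalar: "\<Theta> (scalar_poly c * u) = scalar_poly c * \<Theta> u"
begin

abbreviation TF where "TF \<equiv> tensor_free A N"
abbreviation TI where "TI \<equiv> tensor_ideal A N"
abbreviation T where "T \<equiv> tensor_algebra A N"

sublocale TF: monoid_alg "A \<times>\<times> N" "\<lambda>(a, b) n. \<exists>i j. a \<in> gpart A i \<and> b \<in> gpart N j \<and> n = i + j" TF
proof (intro monoid_alg.intro monoid_alg_axioms.intro)
  show "monoid (A \<times>\<times> N)"
    by (rule DirProd_monoid) unfold_locales
qed (simp add: tensor_free_def)

lemma carrier_TF: "carrier TF = {u. Poly_Mapping.keys u \<subseteq> carrier A \<times> carrier N}"
  by (simp add: TF.A_simps)

lemma single_in: "\<lbrakk>a \<in> carrier A; n \<in> carrier N\<rbrakk> \<Longrightarrow> Poly_Mapping.single (a, n) c \<in> carrier TF"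
  by (simp add: carrier_TF)

lemma TF_add: "u \<oplus>\<^bsub>TF\<^esub> v = u + v"
  by (rule TF.A_simps(3))

lemma add_closed: "\<lbrakk>u \<in> carrier TF; v \<in> carrier TF\<rbrakk> \<Longrightarrow> u + v \<in> carrier TF"
  using ring.ring_simprules(1)[OF TF.ring_A, of u v] by (simp add: TF_add)

lemma diff_closed: "\<lbrakk>u \<in> carrier TF; v \<in> carrier TF\<rbrakk> \<Longrightarrow> u - v \<in> carrier TF"
  using ring.ring_simprules(4)[OF TF.ring_A, of u v] by (simp add: TF.minus_A)

lemma relations_subset: "bilinear_relations A N \<subseteq> carrier TF"
  unfolding bilinear_relations_def
  by (auto intro!: diff_closed single_in A.smult_closed)

lemma ideal_TI: "ideal TI TF"
  unfolding tensor_ideal_def by (rule ring.genideal_ideal[OF TF.ring_A relations_subset])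

sublocale TQ: quotient_ring TF TI
  by (intro quotient_ring.intro quotient_ring_axioms.intro TF.ring_A ideal_TI)

lemma T_eq: "T = graded_quotient TF TI"
  by (simp add: tensor_algebra_def)

lemma ring_T: "ring T"
  unfolding T_eq by (rule TQ.ring_Q)

lemma cls_mult: "\<lbrakk>u \<in> carrier TF; v \<in> carrier TF\<rbrakk> \<Longrightarrow> TQ.cls u \<otimes>\<^bsub>T\<^esub> TQ.cls v = TQ.cls (u \<otimes>\<^bsub>TF\<^esub> v)"
  unfolding T_eq by (rule TQ.cls_mult)

lemma cls_add: "\<lbrakk>u \<in> carrier TF; v \<in> carrier TF\<rbrakk> \<Longrightarrow> TQ.cls u \<oplus>\<^bsub>T\<^esub> TQ.cls v = TQ.cls (u + v)"
  unfolding T_eq using TQ.cls_add by (simp add: TF_add)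

lemma carrier_T: "carrier T = TQ.cls ` carrier TF"
  unfolding T_eq by (rule TQ.carrier_Q)

lemma cls_eqI: "\<lbrakk>u \<in> carrier TF; v \<in> carrier TF; u - v \<in> TI\<rbrakk> \<Longrightarrow> TQ.cls u = TQ.cls v"
  by (simp add: TQ.cls_eq_iff TF.minus_A)

lemma TI_relations: "u \<in> bilinear_relations A N \<Longrightarrow> u \<in> TI"
  unfolding tensor_ideal_def using ring.genideal_self[OF TF.ring_A relations_subset] by blast

lemma pure_tensor_eq: "pure_tensor A N a n = TQ.cls (Poly_Mapping.single (a, n) 1)"
  by (simp add: pure_tensor_def)

lemma pure_closed: "\<lbrakk>a \<in> carrier A; n \<in> carrier N\<rbrakk> \<Longrightarrow> pure_tensor A N a n \<in> carrier T"
  by (simp add: pure_tensor_eq carrier_T single_in)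

lemma pure_add_left:
  assumes "a \<in> carrier A" "a' \<in> carrier A" "n \<in> carrier N"
  shows "pure_tensor A N (a \<oplus>\<^bsub>A\<^esub> a') n = pure_tensor A N a n \<oplus>\<^bsub>T\<^esub> pure_tensor A N a' n"
proof -
  have "Poly_Mapping.single (a \<oplus>\<^bsub>A\<^esub> a', n) 1 - Poly_Mapping.single (a, n) 1 - Poly_Mapping.single (a', n) 1
      \<in> TI"
    by (rule TI_relations) (use assms in \<open>auto simp: bilinear_relations_def\<close>)
  hence "TQ.cls (Poly_Mapping.single (a \<oplus>\<^bsub>A\<^esub> a', n) 1) =
      TQ.cls (Poly_Mapping.single (a, n) 1 + Poly_Mapping.single (a', n) 1)"
    using assms by (intro cls_eqI single_in add_closed) (auto simp: algebra_simps)
  thus ?thesis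
    using assms by (simp add: pure_tensor_eq cls_add single_in)
qed

lemma cls_single_left:
  assumes "a \<in> carrier A" "n \<in> carrier N"
  shows "TQ.cls (Poly_Mapping.single (a, n) c) = pure_tensor A N (c \<odot>\<^bsub>A\<^esub> a) n"
proof -
  have "Poly_Mapping.single (c \<odot>\<^bsub>A\<^esub> a, n) 1 - Poly_Mapping.single (a, n) c \<in> TI"
    by (rule TI_relations) (use assms in \<open>auto simp: bilinear_relations_def\<close>)
  thus ?thesis
    unfolding pure_tensor_eq using assms
    by (intro cls_eqI[symmetric]) (simp_all add: single_in A.smult_closed)
qed

lemma cls_single_right:
  assumes "a \<in> carrier A" "n \<in> carrier N"
  shows "TQ.cls (Poly_Mapping.single (a, n) c) = pure_tensor A N a (c \<odot>\<^bsub>N\<^esub> n)"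
proof -
  have "Poly_Mapping.single (a, c \<odot>\<^bsub>N\<^esub> n) 1 - Poly_Mapping.single (a, n) c \<in> TI"
    by (rule TI_relations) (use assms in \<open>auto simp: bilinear_relations_def\<close>)
  thus ?thesis
    unfolding pure_tensor_eq using assms
    by (intro cls_eqI[symmetric]) (simp_all add: single_in)
qed

definition functional :: "((nat, 'p) mpoly \<Rightarrow> 'p mod_ring) \<Rightarrow> bool" where
  "functional \<psi> \<longleftrightarrow> (\<forall>u\<in>polys_in j. \<forall>v\<in>polys_in j. \<psi> (u + v) = \<psi> u + \<psi> v) \<and>
     (\<forall>c. \<forall>u\<in>polys_in j. \<psi> (scalar_poly c * u) = c * \<psi> u)"

text \<open>
  A linear functional \<open>\<psi>\<close> on the polynomial ring contracts the first factor: \<open>a \<otimes> n\<close> is sent to \<open>\<psi>(a) n\<close>.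
  Contractions are used to detect that an element of the tensor product does not vanish.
\<close>

definition contract :: "((nat, 'p) mpoly \<Rightarrow> 'p mod_ring) \<Rightarrow> (('a \<times> 'b) \<Rightarrow>\<^sub>0 'p mod_ring) \<Rightarrow> 'b" where
  "contract \<psi> u = (\<Oplus>\<^bsub>N\<^esub>x\<in>Poly_Mapping.keys u. (Poly_Mapping.lookup u x * \<psi> (\<alpha> (fst x))) \<odot>\<^bsub>N\<^esub> snd x)"

lemma contract_superset:
  assumes "finite S" "Poly_Mapping.keys u \<subseteq> S" "S \<subseteq> carrier A \<times> carrier N"
  shows "contract \<psi> u = (\<Oplus>\<^bsub>N\<^esub>x\<in>S. (Poly_Mapping.lookup u x * \<psi> (\<alpha> (fst x))) \<odot>\<^bsub>N\<^esub> snd x)"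
  unfolding contract_def
  by (rule N.add.finprod_mono_neutral_cong_left) (use assms in \<open>auto simp: in_keys_iff\<close>)

lemma contract_closed: "u \<in> carrier TF \<Longrightarrow> contract \<psi> u \<in> carrier N"
  unfolding contract_def by (rule N.finsum_closed) (auto simp: carrier_TF)

lemma contract_add:
  assumes "u \<in> carrier TF" "v \<in> carrier TF"
  shows "contract \<psi> (u + v) = contract \<psi> u \<oplus>\<^bsub>N\<^esub> contract \<psi> v"
proof -
  define S where "S = Poly_Mapping.keys u \<union> Poly_Mapping.keys v"
  have S: "finite S" "S \<subseteq> carrier A \<times> carrier N" "Poly_Mapping.keys (u + v) \<subseteq> S"
    using assms keys_add[of u v] by (auto simp: S_def carrier_TF)
  have car: "snd x \<in> carrier N" if "x \<in> S" for x
    using S that by auto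
  have "contract \<psi> (u + v) = (\<Oplus>\<^bsub>N\<^esub>x\<in>S. (Poly_Mapping.lookup u x * \<psi> (\<alpha> (fst x))) \<odot>\<^bsub>N\<^esub> snd x \<oplus>\<^bsub>N\<^esub>
      (Poly_Mapping.lookup v x * \<psi> (\<alpha> (fst x))) \<odot>\<^bsub>N\<^esub> snd x)"
    unfolding contract_superset[OF S(1,3,2)]
    by (rule N.finsum_cong') (auto simp: car lookup_add distrib_right N.scalar_distrib)
  also have "\<dots> = contract \<psi> u \<oplus>\<^bsub>N\<^esub> contract \<psi> v"
    using contract_superset[OF S(1) _ S(2), of u \<psi>] contract_superset[OF S(1) _ S(2), of v \<psi>] car
    by (subst N.finsum_addf) (auto simp: S_def)
  finally show ?thesis .
qed

lemma contract_single: "n \<in> carrier N \<Longrightarrow> contract \<psi> (Poly_Mapping.single (a, n) c) = (c * \<psi> (\<alpha> a)) \<odot>\<^bsub>N\<^esub> n"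
  by (cases "c = 0") (simp_all add: contract_def N.finsum_insert)

lemma contract_zero: "contract \<psi> 0 = \<zero>\<^bsub>N\<^esub>"
  by (simp add: contract_def)

lemma TF_induct [consumes 1, case_names single add]:
  assumes "u \<in> carrier TF"
    and "\<And>a n c. \<lbrakk>a \<in> carrier A; n \<in> carrier N\<rbrakk> \<Longrightarrow> P (Poly_Mapping.single (a, n) c)"
    and "\<And>u v. \<lbrakk>u \<in> carrier TF; v \<in> carrier TF; P u; P v\<rbrakk> \<Longrightarrow> P (u + v)"
  shows "P u"
proof -
  have "Poly_Mapping.keys u \<subseteq> carrier A \<times> carrier N"
    using assms(1) by (simp add: carrier_TF)
  thus ?thesis
  proof (induction rule: mpoly_induct)
    case (single x c)
    thus ?case using assms(2) by (cases x) auto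
  next
    case (add u v)
    thus ?case using assms(3) by (simp add: carrier_TF)
  next
    case zero
    show ?case using assms(2)[of "\<zero>\<^bsub>A\<^esub>" "\<zero>\<^bsub>N\<^esub>" 0] by simp
  qed
qed

lemma TF_mult_add: "(u + v) \<otimes>\<^bsub>TF\<^esub> w = u \<otimes>\<^bsub>TF\<^esub> w + v \<otimes>\<^bsub>TF\<^esub> w" "w \<otimes>\<^bsub>TF\<^esub> (u + v) = w \<otimes>\<^bsub>TF\<^esub> u + w \<otimes>\<^bsub>TF\<^esub> v"
  by (rule TF.mult_add_left TF.mult_add_right)+

lemma TF_mult_closed: "\<lbrakk>u \<in> carrier TF; v \<in> carrier TF\<rbrakk> \<Longrightarrow> u \<otimes>\<^bsub>TF\<^esub> v \<in> carrier TF"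
  by (rule TF.mult_closed_A)

lemma TF_mult_single: "Poly_Mapping.single (a, n) c \<otimes>\<^bsub>TF\<^esub> Poly_Mapping.single (a', n') c' =
    Poly_Mapping.single (a \<otimes>\<^bsub>A\<^esub> a', n \<otimes>\<^bsub>N\<^esub> n') (c * c')"
  by (simp add: TF.mult_single_single mult_DirProd)

lemma contract_mult_single_left:
  assumes "a \<in> carrier A" "n \<in> carrier N" "u \<in> carrier TF"
  shows "contract \<psi> (Poly_Mapping.single (a, n) c \<otimes>\<^bsub>TF\<^esub> u) = c \<odot>\<^bsub>N\<^esub> (n \<otimes>\<^bsub>N\<^esub> contract (\<lambda>y. \<psi> (\<alpha> a * y)) u)"
  using assms(3)
proof (induction rule: TF_induct)
  case (single a' n' c')
  thus ?case using assms
    by (simp add: TF_mult_single contract_single A.iso_mult N.smult_mult_right mult.assoc)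
next
  case (add u v)
  thus ?case using assms
    by (simp add: TF_mult_add contract_add TF_mult_closed single_in contract_closed N.r_distr)
qed

lemma contract_mult_single_right:
  assumes "a \<in> carrier A" "n \<in> carrier N" "u \<in> carrier TF"
  shows "contract \<psi> (u \<otimes>\<^bsub>TF\<^esub> Poly_Mapping.single (a, n) c) = c \<odot>\<^bsub>N\<^esub> (contract (\<lambda>y. \<psi> (y * \<alpha> a)) u \<otimes>\<^bsub>N\<^esub> n)"
  using assms(3)
proof (induction rule: TF_induct)
  case (single a' n' c')
  thus ?case using assms
    by (simp add: TF_mult_single contract_single A.iso_mult N.smult_mult_left mult_ac)
next
  case (add u v)
  thus ?case using assms
    by (simp add: TF_mult_add contract_add TF_mult_closed single_in contract_closed N.l_distr)
qed

lemma iso_in: "a \<in> carrier A \<Longrightarrow> \<alpha> a \<in> polys_in j"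
  using A.bij by (auto simp: bij_betw_def)

lemma functional_mult:
  assumes "functional \<psi>" "w \<in> polys_in j"
  shows "functional (\<lambda>y. \<psi> (w * y))" "functional (\<lambda>y. \<psi> (y * w))"
proof -
  have "w * (scalar_poly c * u) = scalar_poly c * (w * u)" for c u
    by (simp add: mult_ac)
  moreover have "\<psi> (scalar_poly c * (w * u)) = c * \<psi> (w * u)" if "u \<in> polys_in j" for c u
    using that assms polys_in_mult unfolding functional_def by blast
  ultimately show left: "functional (\<lambda>y. \<psi> (w * y))"
    using assms unfolding functional_def by (auto simp only: distrib_left polys_in_closed)
  show "functional (\<lambda>y. \<psi> (y * w))"
    using left by (simp add: mult.commute)
qed

lemma functional_zero: "functional \<psi> \<Longrightarrow> \<psi> 0 = 0"
  unfolding functional_def using polys_in_scalar[of 0] by (metis mult_zero_left scalar_poly_0)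

text \<open>
  Multiplication by \<open>a \<otimes> n\<close> changes the functional to \<open>\<lambda>y. \<psi> (a y)\<close>.  Hence the elements killed by one
  functional are not an ideal, but those killed by all functionals are.
\<close>

definition contract_kernel :: "(('a \<times> 'b) \<Rightarrow>\<^sub>0 'p mod_ring) set" where
  "contract_kernel = {u \<in> carrier TF. \<forall>\<psi>. functional \<psi> \<longrightarrow> contract \<psi> u = \<zero>\<^bsub>N\<^esub>}"

lemma contract_kernel_mult:
  assumes u: "u \<in> contract_kernel" and w: "w \<in> carrier TF"
  shows "w \<otimes>\<^bsub>TF\<^esub> u \<in> contract_kernel \<and> u \<otimes>\<^bsub>TF\<^esub> w \<in> contract_kernel"
  using w
proof (induction rule: TF_induct)
  case (single a n c)
  have uc: "u \<in> carrier TF" using u by (simp add: contract_kernel_def)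
  have "contract (\<lambda>y. \<psi> (\<alpha> a * y)) u = \<zero>\<^bsub>N\<^esub>" "contract (\<lambda>y. \<psi> (y * \<alpha> a)) u = \<zero>\<^bsub>N\<^esub>" if "functional \<psi>" for \<psi>
    using u functional_mult[OF that iso_in[OF single(1)]] by (simp_all add: contract_kernel_def)
  thus ?case
    using single uc
    by (auto simp: contract_kernel_def TF_mult_closed single_in contract_mult_single_left contract_mult_single_right)
next
  case (add v w)
  have uc: "u \<in> carrier TF" using u by (simp add: contract_kernel_def)
  show ?case
    using add uc by (auto simp: contract_kernel_def TF_mult_add contract_add TF_mult_closed add_closed)
qed

lemma contract_uminus:
  assumes u: "u \<in> carrier TF"
  shows "contract \<psi> (- u) = \<ominus>\<^bsub>N\<^esub> contract \<psi> u"
proof -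
  have m: "- u \<in> carrier TF"
    using u by (simp add: carrier_TF in_keys_iff subset_iff)
  show ?thesis
    by (rule N.minus_equality[symmetric])
      (use contract_add[OF m u, of \<psi>] contract_closed m u in \<open>simp_all add: contract_zero\<close>)
qed

text \<open>
  The common kernel of the contractions is an ideal containing the bilinear relations, so the contractions
  are defined on the tensor product.
\<close>

lemma TI_subset_kernel: "TI \<subseteq> contract_kernel"
proof -
  have "ideal contract_kernel TF"
  proof (rule idealI[OF TF.ring_A])
    show "subgroup contract_kernel (add_monoid TF)"
    proof (rule group.subgroupI)
      show "Group.group (add_monoid TF)"
        using ring.is_abelian_group[OF TF.ring_A] abelian_group.a_group by blast
      have "0 \<in> contract_kernel"
        by (simp add: contract_kernel_def contract_zero carrier_TF)
      thus "contract_kernel \<noteq> {}" by blast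
      show "inv\<^bsub>add_monoid TF\<^esub> u \<in> contract_kernel" if u: "u \<in> contract_kernel" for u
      proof -
        have uc: "u \<in> carrier TF" using u by (simp add: contract_kernel_def)
        hence "- u \<in> carrier TF"
          by (simp add: carrier_TF in_keys_iff subset_iff)
        thus ?thesis
          using u uc TF.uminus_A[OF uc]
          by (simp add: a_inv_def[symmetric] contract_kernel_def contract_uminus)
      qed
    qed (auto simp: contract_kernel_def TF_add contract_add add_closed)
  qed (use contract_kernel_mult in auto)
  moreover have "bilinear_relations A N \<subseteq> contract_kernel"
  proof
    fix u assume u: "u \<in> bilinear_relations A N"
    have sub: "contract \<psi> (u - v) = contract \<psi> u \<oplus>\<^bsub>N\<^esub> (\<ominus>\<^bsub>N\<^esub> contract \<psi> v)"
      if "u \<in> carrier TF" "v \<in> carrier TF" for u v \<psi>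
    proof -
      have "- v \<in> carrier TF"
        using that by (simp add: carrier_TF in_keys_iff subset_iff)
      thus ?thesis
        using contract_add[OF that(1), of "- v" \<psi>] that by (simp add: contract_uminus)
    qed
    have cancel: "x \<oplus>\<^bsub>N\<^esub> y \<oplus>\<^bsub>N\<^esub> (\<ominus>\<^bsub>N\<^esub> x) \<oplus>\<^bsub>N\<^esub> (\<ominus>\<^bsub>N\<^esub> y) = \<zero>\<^bsub>N\<^esub>"
      if "x \<in> carrier N" "y \<in> carrier N" for x y
      using that by algebra
    have "contract \<psi> u = \<zero>\<^bsub>N\<^esub>" if \<psi>: "functional \<psi>" for \<psi>
      using u unfolding bilinear_relations_def
    proof (elim UnE CollectE exE conjE, goal_cases)
      case (1 a a' n)
      have "\<psi> (\<alpha> a + \<alpha> a') = \<psi> (\<alpha> a) + \<psi> (\<alpha> a')"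
        using \<psi> 1 iso_in by (auto simp: functional_def)
      thus ?case
        using 1 by (simp add: sub diff_closed single_in contract_single A.iso_add N.scalar_distrib cancel)
    next
      case (2 a n n')
      thus ?case
        by (simp add: sub diff_closed single_in contract_single cancel)
    next
      case (3 a n c)
      have "\<psi> (scalar_poly c * \<alpha> a) = c * \<psi> (\<alpha> a)"
        using \<psi> 3 iso_in by (auto simp: functional_def)
      thus ?case
        using 3 by (simp add: sub single_in contract_single A.smult_closed A.iso_smult N.r_neg)
    next
      case (4 a n c)
      thus ?case
        by (simp add: sub single_in contract_single N.r_neg mult.commute)
    qed
    thus "u \<in> contract_kernel"
      using u relations_subset by (auto simp: contract_kernel_def)
  qed
  ultimately show ?thesis
    unfolding tensor_ideal_def by (rule ring.genideal_minimal[OF TF.ring_A])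
qed

lemma contract_eq_iff:
  assumes "u \<in> carrier TF" "v \<in> carrier TF" "TQ.cls u = TQ.cls v" "functional \<psi>"
  shows "contract \<psi> u = contract \<psi> v"
proof -
  have "- v \<in> carrier TF"
    using assms by (simp add: carrier_TF in_keys_iff subset_iff)
  moreover have "u - v \<in> contract_kernel"
    using assms TI_subset_kernel by (auto simp: TQ.cls_eq_iff TF.minus_A)
  ultimately have "contract \<psi> u \<oplus>\<^bsub>N\<^esub> (\<ominus>\<^bsub>N\<^esub> contract \<psi> v) = \<zero>\<^bsub>N\<^esub>"
    using assms contract_add[of u "- v" \<psi>] by (simp add: contract_kernel_def contract_uminus)
  thus ?thesis
    using assms contract_closed
    by (metis N.add.inv_closed N.add.inv_equality N.minus_minus a_inv_def)
qed

definition slice :: "((nat, 'p) mpoly \<Rightarrow> 'p mod_ring) \<Rightarrow> (('a \<times> 'b) \<Rightarrow>\<^sub>0 'p mod_ring) set \<Rightarrow> 'b" where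
  "slice \<psi> C = contract \<psi> (SOME u. u \<in> carrier TF \<and> C = TQ.cls u)"

lemma slice_cls:
  assumes "u \<in> carrier TF" "functional \<psi>"
  shows "slice \<psi> (TQ.cls u) = contract \<psi> u"
proof -
  define v where "v = (SOME v. v \<in> carrier TF \<and> TQ.cls u = TQ.cls v)"
  have "v \<in> carrier TF \<and> TQ.cls u = TQ.cls v"
    unfolding v_def by (rule someI[of _ u]) (simp add: assms)
  thus ?thesis
    using contract_eq_iff[of v u \<psi>] assms by (simp add: slice_def v_def)
qed

lemma slice_closed: "\<lbrakk>C \<in> carrier T; functional \<psi>\<rbrakk> \<Longrightarrow> slice \<psi> C \<in> carrier N"
  by (auto simp: carrier_T slice_cls contract_closed)

lemma slice_add: "\<lbrakk>C \<in> carrier T; C' \<in> carrier T; functional \<psi>\<rbrakk> \<Longrightarrow>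
    slice \<psi> (C \<oplus>\<^bsub>T\<^esub> C') = slice \<psi> C \<oplus>\<^bsub>N\<^esub> slice \<psi> C'"
  by (auto simp: carrier_T slice_cls cls_add add_closed contract_add)

lemma slice_pure: "\<lbrakk>a \<in> carrier A; n \<in> carrier N; functional \<psi>\<rbrakk> \<Longrightarrow>
    slice \<psi> (pure_tensor A N a n) = \<psi> (\<alpha> a) \<odot>\<^bsub>N\<^esub> n"
  by (simp add: pure_tensor_eq slice_cls single_in contract_single)

lemma zero_T: "\<zero>\<^bsub>T\<^esub> = TQ.cls 0"
  unfolding T_eq using TQ.cls_zero by (simp add: TF.A_simps(2))

lemma slice_zero: "functional \<psi> \<Longrightarrow> slice \<psi> \<zero>\<^bsub>T\<^esub> = \<zero>\<^bsub>N\<^esub>"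
  using slice_cls[of 0 \<psi>] by (simp add: zero_T carrier_TF contract_zero)

lemma T_induct [consumes 1, case_names pure add]:
  assumes "C \<in> carrier T"
    and "\<And>a n. \<lbrakk>a \<in> carrier A; n \<in> carrier N\<rbrakk> \<Longrightarrow> P (pure_tensor A N a n)"
    and "\<And>C C'. \<lbrakk>C \<in> carrier T; C' \<in> carrier T; P C; P C'\<rbrakk> \<Longrightarrow> P (C \<oplus>\<^bsub>T\<^esub> C')"
  shows "P C"
proof -
  obtain u where u: "u \<in> carrier TF" "C = TQ.cls u"
    using assms(1) by (auto simp: carrier_T)
  from u(1) have "P (TQ.cls u)"
  proof (induction rule: TF_induct)
    case (single a n c)
    thus ?case using assms(2) by (simp add: cls_single_left A.smult_closed)
  next
    case (add u v)
    have "P (TQ.cls u \<oplus>\<^bsub>T\<^esub> TQ.cls v)"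
      using add by (intro assms(3)) (auto simp: carrier_T)
    thus ?case using add by (simp add: cls_add)
  qed
  thus ?thesis using u by simp
qed

lemma slice_pure_mult:
  assumes "a \<in> carrier A" "n \<in> carrier N" "C \<in> carrier T" "functional \<psi>"
  shows "slice \<psi> (pure_tensor A N a n \<otimes>\<^bsub>T\<^esub> C) = n \<otimes>\<^bsub>N\<^esub> slice (\<lambda>y. \<psi> (\<alpha> a * y)) C"
proof -
  obtain u where u: "u \<in> carrier TF" "C = TQ.cls u"
    using assms(3) by (auto simp: carrier_T)
  show ?thesis
    using assms u functional_mult(1)[OF assms(4) iso_in[OF assms(1)]]
    by (simp add: pure_tensor_eq cls_mult single_in slice_cls TF_mult_closed contract_mult_single_left contract_closed)
qed

lemma slice_functional_add:
  assumes "C \<in> carrier T" "functional \<psi>" "functional \<psi>'"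
  shows "slice (\<lambda>y. \<psi> y + \<psi>' y) C = slice \<psi> C \<oplus>\<^bsub>N\<^esub> slice \<psi>' C"
proof -
  have f: "functional (\<lambda>y. \<psi> y + \<psi>' y)"
    using assms(2,3) by (simp add: functional_def algebra_simps)
  show ?thesis
    using assms(1)
  proof (induction rule: T_induct)
    case (pure a n)
    thus ?case using f assms by (simp add: slice_pure N.scalar_distrib)
  next
    case (add C C')
    thus ?case
      using f assms by (simp add: slice_add slice_closed N.a_ac)
  qed
qed

lemma slice_functional_smult:
  assumes "C \<in> carrier T" "functional \<psi>"
  shows "slice (\<lambda>y. c * \<psi> y) C = c \<odot>\<^bsub>N\<^esub> slice \<psi> C"
proof -
  have f: "functional (\<lambda>y. c * \<psi> y)"
    using assms(2) by (simp add: functional_def algebra_simps)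
  show ?thesis
    using assms(1)
  proof (induction rule: T_induct)
    case (pure a n)
    thus ?case using f assms by (simp add: slice_pure)
  next
    case (add C C')
    thus ?case
      using f assms by (simp add: slice_add slice_closed)
  qed
qed

lemma slice_cong:
  assumes "C \<in> carrier T" "functional \<psi>" "functional \<psi>'" "\<And>y. y \<in> polys_in j \<Longrightarrow> \<psi> y = \<psi>' y"
  shows "slice \<psi> C = slice \<psi>' C"
  using assms(1)
  by (induction rule: T_induct) (simp_all add: assms slice_pure slice_add iso_in)

definition exponents :: "nat multiset set" where
  "exponents = {\<beta>. set_mset \<beta> \<subseteq> {..<j}}"

text \<open>The coefficient at the basis element with index \<open>\<beta>\<close>.\<close>

definition coord :: "nat multiset \<Rightarrow> (nat, 'p) mpoly \<Rightarrow> 'p mod_ring" where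
  "coord \<beta> y = Poly_Mapping.lookup (inv_into (polys_in j) \<Theta> y) \<beta>"

definition basis :: "nat multiset \<Rightarrow> (nat, 'p) mpoly" where
  "basis \<beta> = \<Theta> (Poly_Mapping.single \<beta> 1)"

definition basis_elem :: "nat multiset \<Rightarrow> 'a" where
  "basis_elem \<beta> = inv_into (carrier A) \<alpha> (basis \<beta>)"

lemma inv_basis: "u \<in> polys_in j \<Longrightarrow> inv_into (polys_in j) \<Theta> (\<Theta> u) = u"
  using basis_bij by (simp add: bij_betw_def)

lemma coord_basis_image: "u \<in> polys_in j \<Longrightarrow> coord \<beta> (\<Theta> u) = Poly_Mapping.lookup u \<beta>"
  by (simp add: coord_def inv_basis)

lemma basis_surj: "y \<in> polys_in j \<Longrightarrow> \<exists>u\<in>polys_in j. y = \<Theta> u"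
  using basis_bij by (auto simp: bij_betw_def)

lemma single_in_polys: "\<beta> \<in> exponents \<Longrightarrow> Poly_Mapping.single \<beta> c \<in> (polys_in j :: (nat, 'p) mpoly set)"
  by (simp add: exponents_def polys_in_def)

lemma basis_in: "\<beta> \<in> exponents \<Longrightarrow> basis \<beta> \<in> polys_in j"
  using basis_bij single_in_polys[of \<beta> 1] by (auto simp: basis_def bij_betw_def)

lemma basis_elem: "\<beta> \<in> exponents \<Longrightarrow> basis_elem \<beta> \<in> carrier A" "\<beta> \<in> exponents \<Longrightarrow> \<alpha> (basis_elem \<beta>) = basis \<beta>"
proof -
  assume "\<beta> \<in> exponents"
  hence "basis \<beta> \<in> \<alpha> ` carrier A"
    using A.bij basis_in by (simp add: bij_betw_def)
  thus "basis_elem \<beta> \<in> carrier A" "\<alpha> (basis_elem \<beta>) = basis \<beta>"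
    unfolding basis_elem_def by (rule inv_into_into, rule f_inv_into_f)
qed

lemma functional_coord: "functional (coord \<beta>)"
  unfolding functional_def
proof (intro conjI ballI allI)
  fix y y' :: "(nat, 'p) mpoly" and c
  assume y: "y \<in> polys_in j"
  then obtain u where u: "u \<in> polys_in j" "y = \<Theta> u" using basis_surj by blast
  have "coord \<beta> (\<Theta> (scalar_poly c * u)) = c * coord \<beta> y"
  proof -
    have "scalar_poly c * u = Poly_Mapping.map ((*) c) u"
      by (simp add: scalar_poly_def mult_map_scale_conv_mult zero_multiset_def)
    thus ?thesis
      using u polys_in_mult[OF polys_in_scalar u(1), of c]
      by (simp add: coord_basis_image Poly_Mapping.map.rep_eq when_def)
  qed
  thus "coord \<beta> (scalar_poly c * y) = c * coord \<beta> y"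
    by (simp add: u basis_scalar)
  assume y': "y' \<in> polys_in j"
  then obtain u' where u': "u' \<in> polys_in j" "y' = \<Theta> u'" using basis_surj by blast
  have "coord \<beta> (\<Theta> (u + u')) = coord \<beta> y + coord \<beta> y'"
    using u u' by (simp add: coord_basis_image polys_in_closed lookup_add)
  thus "coord \<beta> (y + y') = coord \<beta> y + coord \<beta> y'"
    by (simp add: u u' basis_add)
qed

lemma coord_basis: "\<beta> \<in> exponents \<Longrightarrow> coord \<gamma> (basis \<beta>) = (if \<beta> = \<gamma> then 1 else 0)"
  by (simp add: basis_def coord_basis_image single_in_polys lookup_single when_def)

lemma finite_coords_poly: "y \<in> polys_in j \<Longrightarrow> finite {\<beta>. coord \<beta> y \<noteq> 0}"
proof -
  assume "y \<in> polys_in j"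
  then obtain u where u: "u \<in> polys_in j" "y = \<Theta> u" using basis_surj by blast
  have "{\<beta>. coord \<beta> y \<noteq> 0} = Poly_Mapping.keys u"
    using u by (auto simp: coord_basis_image in_keys_iff)
  thus ?thesis by simp
qed

lemma finite_coords:
  assumes "C \<in> carrier T"
  shows "finite {\<beta>. slice (coord \<beta>) C \<noteq> \<zero>\<^bsub>N\<^esub>}"
  using assms
proof (induction rule: T_induct)
  case (pure a n)
  have "{\<beta>. slice (coord \<beta>) (pure_tensor A N a n) \<noteq> \<zero>\<^bsub>N\<^esub>} \<subseteq> {\<beta>. coord \<beta> (\<alpha> a) \<noteq> 0}"
    using pure by (auto simp: slice_pure functional_coord)
  thus ?case
    using finite_coords_poly[OF iso_in[OF pure(1)]] finite_subset by blast
next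
  case (add C C')
  have "{\<beta>. slice (coord \<beta>) (C \<oplus>\<^bsub>T\<^esub> C') \<noteq> \<zero>\<^bsub>N\<^esub>} \<subseteq>
      {\<beta>. slice (coord \<beta>) C \<noteq> \<zero>\<^bsub>N\<^esub>} \<union> {\<beta>. slice (coord \<beta>) C' \<noteq> \<zero>\<^bsub>N\<^esub>}"
    using add by (auto simp: slice_add functional_coord)
  thus ?case
    using add finite_subset by blast
qed

lemma abelian_group_T: "abelian_group T"
  using ring_T by (rule ring.is_abelian_group)

lemma pure_add_right:
  assumes "a \<in> carrier A" "n \<in> carrier N" "n' \<in> carrier N"
  shows "pure_tensor A N a (n \<oplus>\<^bsub>N\<^esub> n') = pure_tensor A N a n \<oplus>\<^bsub>T\<^esub> pure_tensor A N a n'"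
proof -
  have "Poly_Mapping.single (a, n \<oplus>\<^bsub>N\<^esub> n') 1 - Poly_Mapping.single (a, n) 1 - Poly_Mapping.single (a, n') 1
      \<in> TI"
    by (rule TI_relations) (use assms in \<open>auto simp: bilinear_relations_def\<close>)
  hence "TQ.cls (Poly_Mapping.single (a, n \<oplus>\<^bsub>N\<^esub> n') 1) =
      TQ.cls (Poly_Mapping.single (a, n) 1 + Poly_Mapping.single (a, n') 1)"
    using assms by (intro cls_eqI single_in add_closed) (auto simp: algebra_simps)
  thus ?thesis
    using assms by (simp add: pure_tensor_eq cls_add single_in)
qed

lemma pure_smult:
  "\<lbrakk>a \<in> carrier A; n \<in> carrier N\<rbrakk> \<Longrightarrow> pure_tensor A N (c \<odot>\<^bsub>A\<^esub> a) n = pure_tensor A N a (c \<odot>\<^bsub>N\<^esub> n)"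
  using cls_single_left[of a n c] cls_single_right[of a n c] by simp

lemma pure_zero: "n \<in> carrier N \<Longrightarrow> pure_tensor A N \<zero>\<^bsub>A\<^esub> n = \<zero>\<^bsub>T\<^esub>"
proof -
  assume n: "n \<in> carrier N"
  interpret T: abelian_group T by (rule abelian_group_T)
  have "pure_tensor A N \<zero>\<^bsub>A\<^esub> n \<oplus>\<^bsub>T\<^esub> pure_tensor A N \<zero>\<^bsub>A\<^esub> n = pure_tensor A N \<zero>\<^bsub>A\<^esub> n"
    using pure_add_left[of "\<zero>\<^bsub>A\<^esub>" "\<zero>\<^bsub>A\<^esub>" n] n by simp
  thus ?thesis
    using pure_closed[of "\<zero>\<^bsub>A\<^esub>" n] n by (metis A.zero_closed T.add.l_cancel_one')
qed

text \<open>
  The tensor product is spanned by the basis elements times elements of \<open>N\<close>.  The set \<open>S\<close> is allowed to grow,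
  so that the expansions of two elements can be added.
\<close>

lemma tensor_expansion:
  assumes "C \<in> carrier T"
  shows "\<exists>S0. finite S0 \<and> S0 \<subseteq> exponents \<and> (\<forall>S. finite S \<longrightarrow> S0 \<subseteq> S \<longrightarrow> S \<subseteq> exponents \<longrightarrow>
    C = (\<Oplus>\<^bsub>T\<^esub>\<beta>\<in>S. pure_tensor A N (basis_elem \<beta>) (slice (coord \<beta>) C)))"
  using assms
proof (induction rule: T_induct)
  case (pure a n)
  interpret T: abelian_group T by (rule abelian_group_T)
  obtain u where u: "u \<in> polys_in j" "\<alpha> a = \<Theta> u"
    using basis_surj iso_in pure by blast
  have c: "Poly_Mapping.lookup u \<beta> \<odot>\<^bsub>A\<^esub> basis_elem \<beta> \<in> carrier A" if "\<beta> \<in> exponents" for \<beta>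
    using that by (simp add: basis_elem A.smult_closed)
  have "pure_tensor A N a n = (\<Oplus>\<^bsub>T\<^esub>\<beta>\<in>S. pure_tensor A N (basis_elem \<beta>) (slice (coord \<beta>) (pure_tensor A N a n)))"
    if S: "finite S" "Poly_Mapping.keys u \<subseteq> S" "S \<subseteq> exponents" for S
  proof -
    have fin: "(\<Oplus>\<^bsub>A\<^esub>\<beta>\<in>S'. Poly_Mapping.lookup u \<beta> \<odot>\<^bsub>A\<^esub> basis_elem \<beta>) \<in> carrier A \<and>
      \<alpha> (\<Oplus>\<^bsub>A\<^esub>\<beta>\<in>S'. Poly_Mapping.lookup u \<beta> \<odot>\<^bsub>A\<^esub> basis_elem \<beta>) =
        \<Theta> (\<Sum>\<beta>\<in>S'. Poly_Mapping.single \<beta> (Poly_Mapping.lookup u \<beta>)) \<and>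
      pure_tensor A N (\<Oplus>\<^bsub>A\<^esub>\<beta>\<in>S'. Poly_Mapping.lookup u \<beta> \<odot>\<^bsub>A\<^esub> basis_elem \<beta>) n =
        (\<Oplus>\<^bsub>T\<^esub>\<beta>\<in>S'. pure_tensor A N (basis_elem \<beta>) (slice (coord \<beta>) (pure_tensor A N a n)))"
      if "finite S'" "S' \<subseteq> S" for S'
      using that
    proof (induction S' rule: finite_induct)
      case empty
      have "\<Theta> 0 = 0" using basis_scalar[of 0 0] by simp
      moreover have "\<alpha> \<zero>\<^bsub>A\<^esub> = 0"
        using A.iso_add[of "\<zero>\<^bsub>A\<^esub>" "\<zero>\<^bsub>A\<^esub>"] by simp
      ultimately show ?case using pure by (simp add: pure_zero)
    next
      case (insert \<beta> S')
      have \<beta>: "\<beta> \<in> exponents" using insert S by auto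
      have "slice (coord \<beta>) (pure_tensor A N a n) = Poly_Mapping.lookup u \<beta> \<odot>\<^bsub>N\<^esub> n"
        using pure u by (simp add: slice_pure functional_coord coord_basis_image)
      hence "pure_tensor A N (basis_elem \<beta>) (slice (coord \<beta>) (pure_tensor A N a n)) =
          pure_tensor A N (Poly_Mapping.lookup u \<beta> \<odot>\<^bsub>A\<^esub> basis_elem \<beta>) n"
        using pure \<beta> by (simp add: pure_smult basis_elem)
      moreover have "\<Theta> (Poly_Mapping.single \<beta> (Poly_Mapping.lookup u \<beta>)) =
          scalar_poly (Poly_Mapping.lookup u \<beta>) * basis \<beta>"
        unfolding basis_def basis_scalar[symmetric] by (simp add: scalar_poly_def mult_single)
      moreover have "slice (coord \<gamma>) (pure_tensor A N a n) \<in> carrier N" for \<gamma>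
        using pure by (simp add: slice_closed pure_closed functional_coord)
      hence "(\<lambda>\<gamma>. pure_tensor A N (basis_elem \<gamma>) (slice (coord \<gamma>) (pure_tensor A N a n))) \<in> S' \<rightarrow> carrier T"
        using insert S by (auto intro!: pure_closed basis_elem)
      moreover have "(\<lambda>\<gamma>. Poly_Mapping.lookup u \<gamma> \<odot>\<^bsub>A\<^esub> basis_elem \<gamma>) \<in> S' \<rightarrow> carrier A"
        using insert S by (auto intro!: c)
      ultimately show ?case
        using insert pure c[OF \<beta>] \<beta>
        by (simp add: A.finsum_insert T.finsum_insert A.iso_add A.iso_smult basis_elem basis_add pure_add_left pure_closed)
    qed
    have "(\<Sum>\<beta>\<in>S. Poly_Mapping.single \<beta> (Poly_Mapping.lookup u \<beta>)) = u"
      using S by (intro poly_mapping_eqI) (auto simp: lookup_sum lookup_single when_def in_keys_iff)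
    hence "\<alpha> (\<Oplus>\<^bsub>A\<^esub>\<beta>\<in>S. Poly_Mapping.lookup u \<beta> \<odot>\<^bsub>A\<^esub> basis_elem \<beta>) = \<alpha> a"
      using fin[OF S(1)] u by simp
    hence "(\<Oplus>\<^bsub>A\<^esub>\<beta>\<in>S. Poly_Mapping.lookup u \<beta> \<odot>\<^bsub>A\<^esub> basis_elem \<beta>) = a"
      using fin[OF S(1)] pure A.bij by (auto simp: bij_betw_def inj_on_def)
    thus ?thesis
      using fin[OF S(1)] by simp
  qed
  moreover have "Poly_Mapping.keys u \<subseteq> exponents"
    using u by (auto simp: polys_in_def exponents_def)
  ultimately show ?case
    by (intro exI[of _ "Poly_Mapping.keys u"]) simp
next
  case (add C C')
  interpret T: abelian_group T by (rule abelian_group_T)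
  let ?E = "\<lambda>C S. (\<Oplus>\<^bsub>T\<^esub>\<beta>\<in>S. pure_tensor A N (basis_elem \<beta>) (slice (coord \<beta>) C))"
  from add(3) obtain S0 where S0: "finite S0" "S0 \<subseteq> exponents"
    "\<forall>S. finite S \<longrightarrow> S0 \<subseteq> S \<longrightarrow> S \<subseteq> exponents \<longrightarrow> C = ?E C S"
    by (elim exE conjE)
  from add(4) obtain S1 where S1: "finite S1" "S1 \<subseteq> exponents"
    "\<forall>S. finite S \<longrightarrow> S1 \<subseteq> S \<longrightarrow> S \<subseteq> exponents \<longrightarrow> C' = ?E C' S"
    by (elim exE conjE)
  have "C \<oplus>\<^bsub>T\<^esub> C' = ?E (C \<oplus>\<^bsub>T\<^esub> C') S" if S: "finite S" "S0 \<union> S1 \<subseteq> S" "S \<subseteq> exponents" for S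
  proof -
    have p: "pure_tensor A N (basis_elem \<beta>) (slice (coord \<beta>) B) \<in> carrier T"
      if "\<beta> \<in> S" "B \<in> carrier T" for \<beta> B
      using that S by (intro pure_closed basis_elem slice_closed functional_coord) auto
    have eq: "pure_tensor A N (basis_elem \<beta>) (slice (coord \<beta>) (C \<oplus>\<^bsub>T\<^esub> C')) =
        pure_tensor A N (basis_elem \<beta>) (slice (coord \<beta>) C) \<oplus>\<^bsub>T\<^esub> pure_tensor A N (basis_elem \<beta>) (slice (coord \<beta>) C')"
      if "\<beta> \<in> S" for \<beta>
      using that S add basis_elem(1)[of \<beta>]
      by (simp add: slice_add functional_coord slice_closed pure_add_right subset_iff)
    have "?E (C \<oplus>\<^bsub>T\<^esub> C') S = (\<Oplus>\<^bsub>T\<^esub>\<beta>\<in>S. pure_tensor A N (basis_elem \<beta>) (slice (coord \<beta>) C) \<oplus>\<^bsub>T\<^esub>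
        pure_tensor A N (basis_elem \<beta>) (slice (coord \<beta>) C'))"
      using add(1,2) p by (intro T.finsum_cong') (simp_all add: eq)
    also have "\<dots> = ?E C S \<oplus>\<^bsub>T\<^esub> ?E C' S"
      using add(1,2) p by (intro T.finsum_addf) auto
    also have "\<dots> = C \<oplus>\<^bsub>T\<^esub> C'"
      using S0(3)[rule_format, of S] S1(3)[rule_format, of S] S by simp
    finally show ?thesis by simp
  qed
  thus ?case
    using S0 S1 by (intro exI[of _ "S0 \<union> S1"]) simp
qed

end

locale augmented_tensor = poly_tensor A j \<alpha> N \<Theta>
  for A :: "('p::prime_card mod_ring, 'a) graded" and j \<alpha> and N :: "('p mod_ring, 'b) graded" and \<Theta> +
  fixes \<epsilon> :: "'b \<Rightarrow> 'p mod_ring" and \<pi> :: "(('a \<times> 'b) \<Rightarrow>\<^sub>0 'p mod_ring) set \<Rightarrow> 'a"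
  assumes connected: "connected_algebra N" and bounded: "bounded_algebra N"
    and augmentation: "\<epsilon> \<in> graded_algebra_hom N base_field"
    and proj_hom: "\<pi> \<in> graded_algebra_hom T A"
    and proj_pure: "\<lbrakk>a \<in> carrier A; n \<in> carrier N\<rbrakk> \<Longrightarrow> \<pi> (pure_tensor A N a n) = \<epsilon> n \<odot>\<^bsub>A\<^esub> a"
begin

sublocale T: ring T by (rule ring_T)

lemma proj_closed: "v \<in> carrier T \<Longrightarrow> \<pi> v \<in> carrier A"
  using proj_hom ring_hom_closed[of \<pi> T A v] by (simp add: graded_algebra_hom_def)

lemma proj_in: "v \<in> carrier T \<Longrightarrow> \<alpha> (\<pi> v) \<in> polys_in j"
  by (simp add: iso_in proj_closed)

lemma proj_add: "\<lbrakk>v \<in> carrier T; w \<in> carrier T\<rbrakk> \<Longrightarrow> \<pi> (v \<oplus>\<^bsub>T\<^esub> w) = \<pi> v \<oplus>\<^bsub>A\<^esub> \<pi> w"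
  using proj_hom ring_hom_add[of \<pi> T A v w] by (simp add: graded_algebra_hom_def)

text \<open>
  The filtration of \<open>A \<otimes> N\<close> by degree in \<open>N\<close>, that is \<open>A \<otimes> N\<^sub>\<ge>\<^sub>m\<close>.
\<close>

definition level :: "nat \<Rightarrow> (('a \<times> 'b) \<Rightarrow>\<^sub>0 'p mod_ring) set set" where
  "level m = {C \<in> carrier T. \<forall>\<psi>. functional \<psi> \<longrightarrow> slice \<psi> C \<in> N.degree_ge m}"

lemma levelD: "C \<in> level m \<Longrightarrow> C \<in> carrier T" "\<lbrakk>C \<in> level m; functional \<psi>\<rbrakk> \<Longrightarrow> slice \<psi> C \<in> N.degree_ge m"
  by (auto simp: level_def)

lemma slice_uminus: "\<lbrakk>C \<in> carrier T; functional \<psi>\<rbrakk> \<Longrightarrow> slice \<psi> (\<ominus>\<^bsub>T\<^esub> C) = \<ominus>\<^bsub>N\<^esub> slice \<psi> C"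
proof -
  assume C: "C \<in> carrier T" "functional \<psi>"
  have "slice \<psi> (\<ominus>\<^bsub>T\<^esub> C) \<oplus>\<^bsub>N\<^esub> slice \<psi> C = \<zero>\<^bsub>N\<^esub>"
    using slice_add[of "\<ominus>\<^bsub>T\<^esub> C" C \<psi>] C by (simp add: T.l_neg slice_zero)
  thus ?thesis
    using C by (intro N.minus_equality[symmetric]) (auto simp: slice_closed)
qed

lemma level_subgroup:
  "level m \<subseteq> carrier T" "\<zero>\<^bsub>T\<^esub> \<in> level m"
  "\<lbrakk>C \<in> level m; C' \<in> level m\<rbrakk> \<Longrightarrow> C \<oplus>\<^bsub>T\<^esub> C' \<in> level m"
  "C \<in> level m \<Longrightarrow> \<ominus>\<^bsub>T\<^esub> C \<in> level m"
  by (auto simp: level_def slice_zero slice_add slice_uminus N.degree_ge_closed N.degree_ge_uminus)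

lemma level_Suc_subset: "level (Suc m) \<subseteq> level m"
  by (auto simp: level_def N.degree_ge_Suc)

lemma level_0: "level 0 = carrier T"
  by (auto simp: level_def N.connected_degree_ge_0[OF connected] slice_closed)

lemma pure_in_level: "\<lbrakk>a \<in> carrier A; n \<in> N.degree_ge m\<rbrakk> \<Longrightarrow> pure_tensor A N a n \<in> level m"
  using subsetD[OF N.degree_ge_closed(1)] by (simp add: level_def pure_closed slice_pure N.degree_ge_closed)

lemma finsum_in_level:
  assumes "finite S" "\<And>\<beta>. \<beta> \<in> S \<Longrightarrow> f \<beta> \<in> level m"
  shows "(\<Oplus>\<^bsub>T\<^esub>\<beta>\<in>S. f \<beta>) \<in> level m"
  using assms
proof (induction S rule: finite_induct)
  case (insert x S)
  hence "f \<in> S \<rightarrow> carrier T" "f x \<in> carrier T"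
    using level_subgroup(1) by auto
  thus ?case
    using insert by (simp add: T.finsum_insert level_subgroup(3))
qed (simp add: level_subgroup(2))

text \<open>
  An element can be recovered from its coordinates, so among all slices these suffice to detect the next level.
\<close>

lemma level_Suc_iff:
  "level (Suc m) = {C \<in> level m. \<forall>\<beta>\<in>exponents. N.component (slice (coord \<beta>) C) (int m) = \<zero>\<^bsub>N\<^esub>}"
proof (intro equalityI subsetI)
  fix C assume "C \<in> level (Suc m)"
  thus "C \<in> {C \<in> level m. \<forall>\<beta>\<in>exponents. N.component (slice (coord \<beta>) C) (int m) = \<zero>\<^bsub>N\<^esub>}"
    using level_Suc_subset levelD(2)[of C "Suc m"] functional_coord by (auto simp: N.degree_ge_Suc)
next
  fix C assume C: "C \<in> {C \<in> level m. \<forall>\<beta>\<in>exponents. N.component (slice (coord \<beta>) C) (int m) = \<zero>\<^bsub>N\<^esub>}"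
  hence "C \<in> carrier T" by (auto simp: level_def)
  from tensor_expansion[OF this] obtain S where S: "finite S" "S \<subseteq> exponents"
    "\<forall>S'. finite S' \<longrightarrow> S \<subseteq> S' \<longrightarrow> S' \<subseteq> exponents \<longrightarrow>
      C = (\<Oplus>\<^bsub>T\<^esub>\<beta>\<in>S'. pure_tensor A N (basis_elem \<beta>) (slice (coord \<beta>) C))"
    by (elim exE conjE)
  have "(\<Oplus>\<^bsub>T\<^esub>\<beta>\<in>S. pure_tensor A N (basis_elem \<beta>) (slice (coord \<beta>) C)) \<in> level (Suc m)"
  proof (rule finsum_in_level[OF S(1)])
    fix \<beta> assume "\<beta> \<in> S"
    hence "\<beta> \<in> exponents" using S by auto
    thus "pure_tensor A N (basis_elem \<beta>) (slice (coord \<beta>) C) \<in> level (Suc m)"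
      using C levelD(2)[of C m] functional_coord
      by (intro pure_in_level) (auto simp: basis_elem N.degree_ge_Suc)
  qed
  moreover have "C = (\<Oplus>\<^bsub>T\<^esub>\<beta>\<in>S. pure_tensor A N (basis_elem \<beta>) (slice (coord \<beta>) C))"
    using S(3)[rule_format, of S] S(1,2) by blast
  ultimately show "C \<in> level (Suc m)" by metis
qed

lemma level_eventually_zero: "\<exists>d. level d = {\<zero>\<^bsub>T\<^esub>}"
proof -
  obtain d where d: "N.degree_ge d = {\<zero>\<^bsub>N\<^esub>}"
    using N.bounded_degree_ge[OF bounded connected] by blast
  have "C = \<zero>\<^bsub>T\<^esub>" if C: "C \<in> level d" for C
  proof -
    have "C \<in> carrier T" using C by (rule levelD)
    from tensor_expansion[OF this] obtain S where S: "finite S" "S \<subseteq> exponents"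
      "\<forall>S'. finite S' \<longrightarrow> S \<subseteq> S' \<longrightarrow> S' \<subseteq> exponents \<longrightarrow>
        C = (\<Oplus>\<^bsub>T\<^esub>\<beta>\<in>S'. pure_tensor A N (basis_elem \<beta>) (slice (coord \<beta>) C))"
      by (elim exE conjE)
    have z: "slice (coord \<beta>) C = \<zero>\<^bsub>N\<^esub>" for \<beta>
      using levelD(2)[OF C functional_coord] d by auto
    have pz: "pure_tensor A N (basis_elem \<beta>) \<zero>\<^bsub>N\<^esub> = \<zero>\<^bsub>T\<^esub>" if "\<beta> \<in> exponents" for \<beta>
      using pure_smult[of "basis_elem \<beta>" "\<zero>\<^bsub>N\<^esub>" 0] pure_add_right[of "basis_elem \<beta>" "\<zero>\<^bsub>N\<^esub>" "\<zero>\<^bsub>N\<^esub>"]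
        pure_closed[of "basis_elem \<beta>" "\<zero>\<^bsub>N\<^esub>"] basis_elem(1)[OF that]
      by (simp add: T.add.l_cancel_one')
    have "C = (\<Oplus>\<^bsub>T\<^esub>\<beta>\<in>S. pure_tensor A N (basis_elem \<beta>) (slice (coord \<beta>) C))"
      using S(3)[rule_format, of S] S(1,2) by blast
    also have "\<dots> = (\<Oplus>\<^bsub>T\<^esub>\<beta>\<in>S. \<zero>\<^bsub>T\<^esub>)"
      using S(2) pz by (intro T.finsum_cong') (auto simp: z)
    finally show ?thesis by simp
  qed
  thus ?thesis using level_subgroup(2) by blast
qed

text \<open>
  On the associated graded of the filtration by degree in \<open>N\<close>, an element \<open>v\<close> of the tensor product acts as
  its projection \<open>\<pi> v\<close> to the polynomial ring, because \<open>N\<close> acts on its associated graded through the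
  augmentation.
\<close>

lemma slice_mult_level:
  assumes v: "v \<in> carrier T" and w: "w \<in> level m" and \<psi>: "functional \<psi>"
  shows "slice \<psi> (v \<otimes>\<^bsub>T\<^esub> w) \<in> N.degree_ge m \<and>
    N.component (slice \<psi> (v \<otimes>\<^bsub>T\<^esub> w)) (int m) = N.component (slice (\<lambda>y. \<psi> (\<alpha> (\<pi> v) * y)) w) (int m)"
  using v
proof (induction rule: T_induct)
  case (pure a n)
  have wc: "w \<in> carrier T" using w by (rule levelD)
  have f: "functional (\<lambda>y. \<psi> (\<alpha> a * y))"
    by (rule functional_mult[OF \<psi> iso_in[OF pure(1)]])
  have "slice (\<lambda>y. \<psi> (\<alpha> (\<pi> (pure_tensor A N a n)) * y)) w = slice (\<lambda>y. \<epsilon> n * \<psi> (\<alpha> a * y)) w"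
  proof (rule slice_cong[OF wc])
    show "functional (\<lambda>y. \<psi> (\<alpha> (\<pi> (pure_tensor A N a n)) * y))"
      using pure by (intro functional_mult(1)[OF \<psi>] proj_in pure_closed)
    show "functional (\<lambda>y. \<epsilon> n * \<psi> (\<alpha> a * y))"
      using f by (simp add: functional_def distrib_left mult.left_commute)
    fix y :: "(nat, 'p) mpoly" assume "y \<in> polys_in j"
    hence "\<alpha> a * y \<in> polys_in j" using pure by (intro polys_in_closed iso_in)
    hence "\<psi> (scalar_poly (\<epsilon> n) * (\<alpha> a * y)) = \<epsilon> n * \<psi> (\<alpha> a * y)"
      using \<psi> unfolding functional_def by blast
    thus "\<psi> (\<alpha> (\<pi> (pure_tensor A N a n)) * y) = \<epsilon> n * \<psi> (\<alpha> a * y)"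
      using pure by (simp add: proj_pure A.iso_smult mult.assoc)
  qed
  also have "\<dots> = \<epsilon> n \<odot>\<^bsub>N\<^esub> slice (\<lambda>y. \<psi> (\<alpha> a * y)) w"
    by (rule slice_functional_smult[OF wc f])
  finally have eq: "slice (\<lambda>y. \<psi> (\<alpha> (\<pi> (pure_tensor A N a n)) * y)) w = \<epsilon> n \<odot>\<^bsub>N\<^esub> slice (\<lambda>y. \<psi> (\<alpha> a * y)) w" .
  have sw: "slice (\<lambda>y. \<psi> (\<alpha> a * y)) w \<in> N.degree_ge m" "slice (\<lambda>y. \<psi> (\<alpha> a * y)) w \<in> carrier N"
    using levelD(2)[OF w f] slice_closed[OF wc f] by auto
  show ?case
    unfolding slice_pure_mult[OF pure wc \<psi>] eq
    using N.mult_degree_ge[OF connected augmentation pure(2) sw(1)] pure sw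
    by (simp add: N.degree_ge_def N.component_smult)
next
  case (add v v')
  have wc: "w \<in> carrier T" using w by (rule levelD)
  have f: "functional (\<lambda>y. \<psi> (\<alpha> (\<pi> v) * y))" "functional (\<lambda>y. \<psi> (\<alpha> (\<pi> v') * y))"
    "functional (\<lambda>y. \<psi> (\<alpha> (\<pi> (v \<oplus>\<^bsub>T\<^esub> v')) * y))"
    using add by (auto intro!: functional_mult(1)[OF \<psi>] proj_in)
  have "slice (\<lambda>y. \<psi> (\<alpha> (\<pi> (v \<oplus>\<^bsub>T\<^esub> v')) * y)) w = slice (\<lambda>y. \<psi> (\<alpha> (\<pi> v) * y) + \<psi> (\<alpha> (\<pi> v') * y)) w"
  proof (rule slice_cong[OF wc f(3)])
    show "functional (\<lambda>y. \<psi> (\<alpha> (\<pi> v) * y) + \<psi> (\<alpha> (\<pi> v') * y))"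
      using f by (simp add: functional_def algebra_simps)
    fix y :: "(nat, 'p) mpoly" assume "y \<in> polys_in j"
    thus "\<psi> (\<alpha> (\<pi> (v \<oplus>\<^bsub>T\<^esub> v')) * y) = \<psi> (\<alpha> (\<pi> v) * y) + \<psi> (\<alpha> (\<pi> v') * y)"
      using \<psi> add by (simp add: functional_def proj_add A.iso_add proj_closed distrib_right polys_in_closed proj_in)
  qed
  also have "\<dots> = slice (\<lambda>y. \<psi> (\<alpha> (\<pi> v) * y)) w \<oplus>\<^bsub>N\<^esub> slice (\<lambda>y. \<psi> (\<alpha> (\<pi> v') * y)) w"
    by (rule slice_functional_add[OF wc f(1,2)])
  finally have eq: "slice (\<lambda>y. \<psi> (\<alpha> (\<pi> (v \<oplus>\<^bsub>T\<^esub> v')) * y)) w =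
      slice (\<lambda>y. \<psi> (\<alpha> (\<pi> v) * y)) w \<oplus>\<^bsub>N\<^esub> slice (\<lambda>y. \<psi> (\<alpha> (\<pi> v') * y)) w" .
  have "slice \<psi> ((v \<oplus>\<^bsub>T\<^esub> v') \<otimes>\<^bsub>T\<^esub> w) = slice \<psi> (v \<otimes>\<^bsub>T\<^esub> w) \<oplus>\<^bsub>N\<^esub> slice \<psi> (v' \<otimes>\<^bsub>T\<^esub> w)"
    using add wc \<psi> by (simp add: T.l_distr slice_add)
  moreover have "slice \<psi> (v \<otimes>\<^bsub>T\<^esub> w) \<in> carrier N" "slice \<psi> (v' \<otimes>\<^bsub>T\<^esub> w) \<in> carrier N"
    using add(1,2) wc by (auto intro!: slice_closed[OF _ \<psi>])
  moreover have "slice (\<lambda>y. \<psi> (\<alpha> (\<pi> v) * y)) w \<in> carrier N" "slice (\<lambda>y. \<psi> (\<alpha> (\<pi> v') * y)) w \<in> carrier N"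
    by (rule slice_closed[OF wc f(1)], rule slice_closed[OF wc f(2)])
  ultimately show ?case
    unfolding eq using add(3,4) by (simp only: N.component_add N.degree_ge_closed simp_thms)
qed

lemma mult_level: "\<lbrakk>v \<in> carrier T; w \<in> level m\<rbrakk> \<Longrightarrow> v \<otimes>\<^bsub>T\<^esub> w \<in> level m"
  using conjunct1[OF slice_mult_level] T.m_closed[OF _ levelD(1)] by (simp add: level_def)

text \<open>
  An element of the kernel of \<open>\<pi>\<close> raises the level, and there are finitely many levels because \<open>N\<close> is bounded.
\<close>

lemma kernel_nilpotent:
  "\<exists>d. \<forall>v\<in>carrier T. \<pi> v = \<zero>\<^bsub>A\<^esub> \<longrightarrow> v [^]\<^bsub>T\<^esub> (d::nat) = \<zero>\<^bsub>T\<^esub>"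
proof -
  obtain d where d: "level d = {\<zero>\<^bsub>T\<^esub>}"
    using level_eventually_zero by blast
  have "v [^]\<^bsub>T\<^esub> (n::nat) \<in> level n" if v: "v \<in> carrier T" "\<pi> v = \<zero>\<^bsub>A\<^esub>" for v n
  proof (induction n)
    case 0
    thus ?case by (simp add: level_0)
  next
    case (Suc n)
    have \<alpha>0: "\<alpha> \<zero>\<^bsub>A\<^esub> = 0"
      using A.iso_add[of "\<zero>\<^bsub>A\<^esub>" "\<zero>\<^bsub>A\<^esub>"] by simp
    have wc: "v [^]\<^bsub>T\<^esub> n \<in> carrier T" using Suc by (rule levelD)
    have "slice \<psi> (v \<otimes>\<^bsub>T\<^esub> v [^]\<^bsub>T\<^esub> n) \<in> N.degree_ge (Suc n)" if \<psi>: "functional \<psi>" for \<psi>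
    proof -
      have "functional (\<lambda>y. 0 * \<psi> y)"
        by (simp add: functional_def)
      hence "slice (\<lambda>y. \<psi> (\<alpha> (\<pi> v) * y)) (v [^]\<^bsub>T\<^esub> n) = slice (\<lambda>y. 0 * \<psi> y) (v [^]\<^bsub>T\<^esub> n)"
        by (intro slice_cong[OF wc]) (simp_all add: v \<alpha>0 functional_zero[OF \<psi>] functional_def)
      also have "\<dots> = \<zero>\<^bsub>N\<^esub>"
        unfolding slice_functional_smult[OF wc \<psi>] using slice_closed[OF wc \<psi>] by simp
      finally show ?thesis
        using slice_mult_level[OF v(1) Suc \<psi>] by (simp add: N.degree_ge_Suc N.component_zero)
    qed
    hence "v \<otimes>\<^bsub>T\<^esub> v [^]\<^bsub>T\<^esub> n \<in> level (Suc n)"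
      using v wc by (simp add: level_def)
    thus ?case
      using v by (simp only: T.nat_pow_Suc2)
  qed
  thus ?thesis
    using d by (intro exI[of _ d]) auto
qed

end

text \<open>
  The elements \<open>y i\<close> project to polynomials \<open>g i\<close> such that multiplication by \<open>g i\<close> corresponds under \<open>\<Theta>\<close> to
  multiplication by a power of the variable \<open>l i\<close>, the variables being distinct.
\<close>

locale regular_tensor = augmented_tensor A j \<alpha> N \<Theta> \<epsilon> \<pi>
  for A :: "('p::prime_card mod_ring, 'a) graded" and j \<alpha> and N :: "('p mod_ring, 'b) graded" and \<Theta> \<epsilon> \<pi> +
  fixes s :: nat and y :: "nat \<Rightarrow> (('a \<times> 'b) \<Rightarrow>\<^sub>0 'p mod_ring) set"
    and g :: "nat \<Rightarrow> (nat, 'p) mpoly" and D l :: "nat \<Rightarrow> nat"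
  assumes l_less: "i < s \<Longrightarrow> l i < j" and l_inj: "inj_on l {..<s}"
    and D_pos: "i < s \<Longrightarrow> D (l i) > 0"
    and basis_one: "\<Theta> 1 = 1"
    and basis_shift: "i < s \<Longrightarrow> \<Theta> (Poly_Mapping.single (replicate_mset (D (l i)) (l i)) 1 * u) = g i * \<Theta> u"
    and y_closed: "i < s \<Longrightarrow> y i \<in> carrier T"
    and y_commute: "\<lbrakk>i < s; i' < s\<rbrakk> \<Longrightarrow> y i \<otimes>\<^bsub>T\<^esub> y i' = y i' \<otimes>\<^bsub>T\<^esub> y i"
    and y_proj: "i < s \<Longrightarrow> \<alpha> (\<pi> (y i)) = g i"
begin

definition op :: "nat \<Rightarrow> (('a \<times> 'b) \<Rightarrow>\<^sub>0 'p mod_ring) set \<Rightarrow> (('a \<times> 'b) \<Rightarrow>\<^sub>0 'p mod_ring) set" where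
  "op i C = y i \<otimes>\<^bsub>T\<^esub> C"

definition shift :: "nat \<Rightarrow> nat multiset \<Rightarrow> nat multiset" where
  "shift i \<beta> = \<beta> + replicate_mset (D (l i)) (l i)"

sublocale ops: commuting_operators T s op
proof (intro commuting_operators.intro commuting_operators_axioms.intro abelian_group_T)
  fix i i' x assume "i < s" "i' < s" "x \<in> carrier T"
  thus "op i (op i' x) = op i' (op i x)"
    unfolding op_def using y_closed y_commute by (metis T.m_assoc)
qed (simp_all add: op_def y_closed T.r_distr)

lemma stable_level: "ops.stable_subgroup (level m)"
  by (rule ops.stable_subgroupI) (auto simp: op_def level_subgroup mult_level y_closed subsetD[OF level_subgroup(1)])

lemma coord_shift_poly:
  assumes "i < s" "x \<in> polys_in j"
  shows "coord (shift i \<beta>) (g i * x) = coord \<beta> x"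
    and "\<beta> \<in> exponents \<Longrightarrow> \<beta> \<notin> shift i ` exponents \<Longrightarrow> coord \<beta> (g i * x) = 0"
proof -
  let ?\<mu> = "replicate_mset (D (l i)) (l i)"
  obtain u where u: "u \<in> polys_in j" "x = \<Theta> u"
    using basis_surj assms by blast
  have "?\<mu> \<in> exponents"
    using l_less[OF assms(1)] by (auto simp: exponents_def)
  hence in': "Poly_Mapping.single ?\<mu> 1 * u \<in> polys_in j"
    by (intro polys_in_mult single_in_polys u)
  have eq: "coord \<gamma> (g i * x) = Poly_Mapping.lookup (Poly_Mapping.single ?\<mu> 1 * u) \<gamma>" for \<gamma>
    unfolding u(2) basis_shift[OF assms(1), symmetric] by (rule coord_basis_image[OF in'])
  show "coord (shift i \<beta>) (g i * x) = coord \<beta> x"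
    unfolding eq shift_def lookup_single_mult(1) using u coord_basis_image by simp
  assume \<beta>: "\<beta> \<in> exponents" "\<beta> \<notin> shift i ` exponents"
  have "\<beta> \<noteq> \<gamma> + ?\<mu>" for \<gamma>
    using \<beta> by (auto simp: shift_def exponents_def)
  thus "coord \<beta> (g i * x) = 0"
    unfolding eq by (rule lookup_single_mult(2))
qed

lemma slice_op:
  assumes "i < s" "C \<in> level m"
  shows "N.component (slice (coord (shift i \<beta>)) (op i C)) (int m) = N.component (slice (coord \<beta>) C) (int m)"
    and "\<beta> \<in> exponents \<Longrightarrow> \<beta> \<notin> shift i ` exponents \<Longrightarrow> N.component (slice (coord \<beta>) (op i C)) (int m) = \<zero>\<^bsub>N\<^esub>"
proof -
  have C: "C \<in> carrier T" using assms(2) by (rule levelD)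
  have g: "g i \<in> polys_in j"
    using proj_in[OF y_closed] y_proj assms by metis
  have f: "functional (\<lambda>x. coord \<gamma> (g i * x))" for \<gamma>
    by (rule functional_mult(1)[OF functional_coord g])
  have eq: "N.component (slice (coord \<gamma>) (op i C)) (int m) = N.component (slice (\<lambda>x. coord \<gamma> (g i * x)) C) (int m)" for \<gamma>
    using slice_mult_level[OF y_closed[OF assms(1)] assms(2) functional_coord] y_proj[OF assms(1)] by (simp add: op_def)
  have "slice (\<lambda>x. coord (shift i \<beta>) (g i * x)) C = slice (coord \<beta>) C"
    by (rule slice_cong[OF C f functional_coord]) (rule coord_shift_poly(1)[OF assms(1)])
  thus "N.component (slice (coord (shift i \<beta>)) (op i C)) (int m) = N.component (slice (coord \<beta>) C) (int m)"
    by (simp add: eq)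
  assume \<beta>: "\<beta> \<in> exponents" "\<beta> \<notin> shift i ` exponents"
  have "slice (\<lambda>x. coord \<beta> (g i * x)) C = slice (\<lambda>x. 0 * coord \<beta> x) C"
    by (rule slice_cong[OF C f]) (simp_all add: coord_shift_poly(2)[OF assms(1) _ \<beta>] functional_def)
  also have "\<dots> = \<zero>\<^bsub>N\<^esub>"
    unfolding slice_functional_smult[OF C functional_coord] using slice_closed[OF C functional_coord] by simp
  finally show "N.component (slice (coord \<beta>) (op i C)) (int m) = \<zero>\<^bsub>N\<^esub>"
    by (simp add: eq N.component_zero)
qed

lemma coord_finsum:
  assumes "finite S" "S \<subseteq> exponents" "\<And>\<beta>. \<beta> \<in> S \<Longrightarrow> n \<beta> \<in> carrier N"
  shows "slice (coord \<gamma>) (\<Oplus>\<^bsub>T\<^esub>\<beta>\<in>S. pure_tensor A N (basis_elem \<beta>) (n \<beta>)) = (if \<gamma> \<in> S then n \<gamma> else \<zero>\<^bsub>N\<^esub>)"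
  using assms
proof (induction S rule: finite_induct)
  case empty
  thus ?case by (simp add: slice_zero functional_coord)
next
  case (insert \<beta> S)
  let ?f = "\<lambda>\<beta>. pure_tensor A N (basis_elem \<beta>) (n \<beta>)"
  have c: "?f \<in> S \<rightarrow> carrier T" "?f \<beta> \<in> carrier T"
    using insert by (auto intro!: pure_closed basis_elem)
  have "slice (coord \<gamma>) (?f \<beta>) = (if \<beta> = \<gamma> then n \<beta> else \<zero>\<^bsub>N\<^esub>)"
    using insert by (simp add: slice_pure functional_coord basis_elem coord_basis)
  thus ?case
    using insert c by (auto simp: T.finsum_insert slice_add functional_coord T.finsum_closed)
qed

text \<open>
  In the layer \<open>level m / level (m + 1)\<close> an element has as coordinates the degree \<open>m\<close> components of its
  coordinates in \<open>N\<close>.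
\<close>

sublocale shifts: shifting_operators T s op N "level m" "level (Suc m)" exponents shift
    "\<lambda>\<beta> C. N.component (slice (coord \<beta>) C) (int m)" for m
proof (intro shifting_operators.intro shifting_operators_axioms.intro ops.commuting_operators_axioms
    N.abelian_group_axioms stable_level level_Suc_iff)
  fix i i' \<beta> assume i: "i < s" "\<beta> \<in> exponents"
  show "shift i \<beta> \<in> exponents"
    using i l_less[of i] by (auto simp: shift_def exponents_def)
  assume i': "i' < s"
  show "shift i (shift i' \<beta>) = shift i' (shift i \<beta>)"
    by (simp add: shift_def add_ac)
  assume ne: "i \<noteq> i'" and "shift i \<beta> \<in> shift i' ` exponents"
  then obtain \<gamma> where \<gamma>: "\<gamma> \<in> exponents" "\<beta> + replicate_mset (D (l i)) (l i) = \<gamma> + replicate_mset (D (l i')) (l i')"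
    by (auto simp: shift_def)
  have ll: "l i \<noteq> l i'"
    using l_inj i i' ne by (auto simp: inj_on_def)
  have "replicate_mset (D (l i')) (l i') \<subseteq># \<beta>"
  proof (rule mset_subset_eqI)
    fix a
    have "count (\<beta> + replicate_mset (D (l i)) (l i)) a = count (\<gamma> + replicate_mset (D (l i')) (l i')) a"
      by (simp only: \<gamma>(2))
    thus "count (replicate_mset (D (l i')) (l i')) a \<le> count \<beta> a"
      using ll by (auto split: if_splits)
  qed
  then obtain \<delta> where \<delta>: "\<beta> = replicate_mset (D (l i')) (l i') + \<delta>"
    by (metis mset_subset_eq_exists_conv)
  hence "\<beta> = shift i' \<delta>" "\<delta> \<in> exponents"
    using i by (auto simp: shift_def exponents_def)
  thus "\<beta> \<in> shift i' ` exponents" by blast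
next
  fix i C S assume i: "i < s" and C: "C \<in> level m" and S: "S \<subseteq> exponents"
  have Cc: "C \<in> carrier T" using C by (rule levelD)
  \<comment> \<open>Shifting coordinates back: put the coordinate of \<open>C\<close> at the shifted index.  Only the component of
    degree \<open>m\<close> counts in this layer, and only finitely many indices contribute.\<close>
  define n where "n = (\<lambda>\<beta>. N.component (slice (coord (shift i \<beta>)) C) (int m))"
  define S' where "S' = {\<beta> \<in> S. n \<beta> \<noteq> \<zero>\<^bsub>N\<^esub>}"
  have nc: "n \<beta> \<in> N.degree_ge m" "n \<beta> \<in> carrier N" for \<beta>
    unfolding n_def using slice_closed[OF Cc functional_coord] N.degree_ge_closed(5) N.component_closed by auto
  have "inj (shift i)"
    by (auto simp: shift_def inj_on_def)
  hence "finite (shift i -` {\<beta>. slice (coord \<beta>) C \<noteq> \<zero>\<^bsub>N\<^esub>})"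
    using finite_coords[OF Cc] finite_vimageI by blast
  moreover have "S' \<subseteq> shift i -` {\<beta>. slice (coord \<beta>) C \<noteq> \<zero>\<^bsub>N\<^esub>}"
    by (auto simp: S'_def n_def N.component_zero)
  ultimately have S': "finite S'" "S' \<subseteq> exponents"
    using S finite_subset by (auto simp: S'_def)
  define E where "E = (\<Oplus>\<^bsub>T\<^esub>\<beta>\<in>S'. pure_tensor A N (basis_elem \<beta>) (n \<beta>))"
  have "E \<in> level m"
    unfolding E_def using S' nc by (intro finsum_in_level pure_in_level basis_elem) auto
  moreover have "N.component (slice (coord \<beta>) E) (int m) =
      (if \<beta> \<in> S then N.component (slice (coord (shift i \<beta>)) C) (int m) else \<zero>\<^bsub>N\<^esub>)" for \<beta>
  proof -
    have "slice (coord \<beta>) E = (if \<beta> \<in> S' then n \<beta> else \<zero>\<^bsub>N\<^esub>)"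
      unfolding E_def using S' nc(2) by (intro coord_finsum) auto
    also have "\<dots> = (if \<beta> \<in> S then n \<beta> else \<zero>\<^bsub>N\<^esub>)"
      by (auto simp: S'_def)
    finally show ?thesis
      using N.component_homogeneous[OF N.component_props(1), of "slice (coord (shift i \<beta>)) C" "int m" "int m"]
        slice_closed[OF Cc functional_coord] by (simp add: n_def N.component_zero)
  qed
  ultimately show "\<exists>E\<in>level m. \<forall>\<beta>\<in>exponents. N.component (slice (coord \<beta>) E) (int m) =
      (if \<beta> \<in> S then N.component (slice (coord (shift i \<beta>)) C) (int m) else \<zero>\<^bsub>N\<^esub>)"
    by blast
next
  fix \<beta> C C' assume "\<beta> \<in> exponents" "C \<in> level m" "C' \<in> level m"
  hence "C \<in> carrier T" "C' \<in> carrier T"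
    by (auto dest: levelD)
  thus "N.component (slice (coord \<beta>) (C \<oplus>\<^bsub>T\<^esub> C')) (int m) =
      N.component (slice (coord \<beta>) C) (int m) \<oplus>\<^bsub>N\<^esub> N.component (slice (coord \<beta>) C') (int m)"
    by (simp only: slice_add[OF _ _ functional_coord] N.component_add slice_closed[OF _ functional_coord])
next
  fix \<beta> C assume "\<beta> \<in> exponents" "C \<in> level m"
  thus "N.component (slice (coord \<beta>) C) (int m) \<in> carrier N"
    by (intro N.component_closed slice_closed functional_coord levelD)
qed (auto simp: slice_op)

text \<open>
  By induction on the levels: on each layer the operators act by shifts, and there are finitely many layers.
\<close>

theorem weakly_regular_T: "weakly_regular T s op (carrier T) {\<zero>\<^bsub>T\<^esub>}"
proof -
  have "weakly_regular T s op (level 0) (level m)" for m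
  proof (induction m)
    case 0
    have "level 0 \<subseteq> op_multiples T op (level 0) (level 0) i" if "i < s" for i
      using ops.stable_op_multiples[OF stable_level stable_level order.refl, of i 0] that by simp
    thus ?case by (auto simp: weakly_regular_def)
  next
    case (Suc m)
    have "level m \<subseteq> level 0"
      unfolding level_0 by (rule level_subgroup)
    thus ?case
      by (rule ops.weakly_regular_extension[OF stable_level stable_level stable_level level_Suc_subset _ Suc
            shifts.weakly_regular_shifts])
  qed
  moreover obtain d where "level d = {\<zero>\<^bsub>T\<^esub>}"
    using level_eventually_zero by blast
  ultimately show ?thesis
    by (metis level_0)
qed

text \<open>In the layer of degree 0 the unit has a nonzero coordinate at the exponent 0, which no shift reaches.\<close>

theorem op_multiples_T: "op_multiples T op (carrier T) {\<zero>\<^bsub>T\<^esub>} s \<noteq> carrier T"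
proof
  assume eq: "op_multiples T op (carrier T) {\<zero>\<^bsub>T\<^esub>} s = carrier T"
  have one: "\<one>\<^bsub>T\<^esub> = pure_tensor A N \<one>\<^bsub>A\<^esub> \<one>\<^bsub>N\<^esub>"
    by (simp add: T_eq TQ.Q_simps(4) TF.A_simps(4) pure_tensor_eq)
  have "op_multiples T op (carrier T) {\<zero>\<^bsub>T\<^esub>} s \<subseteq> op_multiples T op (level 0) (level (Suc 0)) s"
    using level_subgroup(2) by (intro ops.op_multiples_mono) (auto simp: level_0)
  hence "\<one>\<^bsub>T\<^esub> \<in> op_multiples T op (level 0) (level (Suc 0)) s"
    using eq T.one_closed by blast
  moreover have "{#} \<in> shifts.unshifted s"
    unfolding shifts.unshifted_def using D_pos by (force simp: exponents_def shift_def)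
  ultimately have zero: "N.component (slice (coord {#}) \<one>\<^bsub>T\<^esub>) (int 0) = \<zero>\<^bsub>N\<^esub>"
    using shifts.op_multiples_coords[of s 0] by blast
  have "coord {#} (\<Theta> 1) = 1"
    using coord_basis_image[OF polys_in_scalar[of 1], of "{#}"] by (simp flip: zero_multiset_def)
  hence "slice (coord {#}) \<one>\<^bsub>T\<^esub> = \<one>\<^bsub>N\<^esub>"
    unfolding one by (simp add: slice_pure functional_coord A.iso_one basis_one)
  hence "\<one>\<^bsub>N\<^esub> = \<zero>\<^bsub>N\<^esub>"
    using zero N.component_homogeneous[OF N.gpart_one, of 0] by simp
  thus False
    using connected by (simp add: connected_algebra_def)
qed

end

section \<open>Chains of primes in a polynomial ring\<close>

text \<open>Prime ideals of a commutative ring that is given as a type.\<close>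

definition prime_subset :: "'a::comm_ring_1 set \<Rightarrow> bool" where
  "prime_subset P \<longleftrightarrow> 0 \<in> P \<and> (\<forall>u\<in>P. \<forall>v\<in>P. u + v \<in> P) \<and> (\<forall>u\<in>P. \<forall>v. v * u \<in> P) \<and> 1 \<notin> P \<and>
     (\<forall>u v. u * v \<in> P \<longrightarrow> u \<in> P \<or> v \<in> P)"

lemma prime_subsetD:
  assumes "prime_subset P"
  shows "0 \<in> P" "\<lbrakk>u \<in> P; v \<in> P\<rbrakk> \<Longrightarrow> u + v \<in> P" "u \<in> P \<Longrightarrow> v * u \<in> P" "u \<in> P \<Longrightarrow> u * v \<in> P" "1 \<notin> P"
    "u * v \<in> P \<Longrightarrow> u \<in> P \<or> v \<in> P" "u \<in> P \<Longrightarrow> - u \<in> P" "\<lbrakk>u \<in> P; v \<in> P\<rbrakk> \<Longrightarrow> u - v \<in> P"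
proof -
  show P: "0 \<in> P" "\<lbrakk>u \<in> P; v \<in> P\<rbrakk> \<Longrightarrow> u + v \<in> P" "u \<in> P \<Longrightarrow> v * u \<in> P" "1 \<notin> P"
    "u * v \<in> P \<Longrightarrow> u \<in> P \<or> v \<in> P" for u v
    using assms unfolding prime_subset_def by blast+
  show "u \<in> P \<Longrightarrow> u * v \<in> P" using P(3)[of u v] by (simp add: mult.commute)
  show m: "u \<in> P \<Longrightarrow> - u \<in> P" for u using P(3)[of u "- 1"] by simp
  show "\<lbrakk>u \<in> P; v \<in> P\<rbrakk> \<Longrightarrow> u - v \<in> P" using P(2)[of u "- v"] m by simp
qed

lemma prime_subset_power: "prime_subset P \<Longrightarrow> u ^ n * v \<in> P \<Longrightarrow> u \<notin> P \<Longrightarrow> v \<in> P"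
  by (induction n) (auto dest: prime_subsetD(6) simp: mult.assoc)

lemma prime_subset_sum: "prime_subset P \<Longrightarrow> (\<And>i. i \<in> I \<Longrightarrow> f i \<in> P) \<Longrightarrow> sum f I \<in> P"
  by (induction I rule: infinite_finite_induct) (auto simp: prime_subsetD)

definition exponent_lists :: "nat \<Rightarrow> nat \<Rightarrow> nat list set" where
  "exponent_lists r D = {es. set es \<subseteq> {..D} \<and> length es = r}"

lemma finite_exponent_lists: "finite (exponent_lists r D)"
  by (simp add: exponent_lists_def finite_lists_length_eq)

text \<open>
  The value at \<open>y\<close> of the polynomial in \<open>r\<close> variables with coefficients \<open>c\<close>.
\<close>

definition eval_at :: "nat \<Rightarrow> nat \<Rightarrow> (nat list \<Rightarrow> 'p::prime_card mod_ring) \<Rightarrow> (nat \<Rightarrow> ('x, 'p) mpoly) \<Rightarrow> ('x, 'p) mpoly" where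
  "eval_at r D c y = (\<Sum>es\<in>exponent_lists r D. scalar_poly (c es) * (\<Prod>k<r. y k ^ (es ! k)))"

lemma eval_at_Suc: "eval_at (Suc r) D c y = (\<Sum>m\<le>D. y 0 ^ m * eval_at r D (\<lambda>es. c (m # es)) (\<lambda>k. y (Suc k)))"
proof -
  have bij: "bij_betw (\<lambda>(m, es). m # es) ({..D} \<times> exponent_lists r D) (exponent_lists (Suc r) D)"
    by (rule bij_betw_byWitness[where f' = "\<lambda>es. (hd es, tl es)"])
      (auto simp: exponent_lists_def length_Suc_conv)
  have "eval_at (Suc r) D c y = (\<Sum>(m, es)\<in>{..D} \<times> exponent_lists r D.
      scalar_poly (c (m # es)) * (\<Prod>k<Suc r. y k ^ ((m # es) ! k)))"
    unfolding eval_at_def using sum.reindex_bij_betw[OF bij, symmetric, of "\<lambda>es. scalar_poly (c es) * (\<Prod>k<Suc r. y k ^ (es ! k))"]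
    by (simp add: case_prod_unfold)
  also have "\<dots> = (\<Sum>m\<le>D. \<Sum>es\<in>exponent_lists r D. y 0 ^ m * (scalar_poly (c (m # es)) * (\<Prod>k<r. y (Suc k) ^ (es ! k))))"
    unfolding sum.cartesian_product
    by (intro sum.cong) (auto simp: prod.lessThan_Suc_shift mult.left_commute simp del: prod.lessThan_Suc)
  finally show ?thesis
    by (simp add: eval_at_def sum_distrib_left)
qed

text \<open>
  Elements in the successive differences of a chain of primes are algebraically independent: divide a relation
  by the largest possible power of \<open>y 0\<close>, which is not in \<open>P 0\<close>, and reduce modulo \<open>y 0\<close>, which is in \<open>P 1\<close>.
\<close>

lemma eval_at_notin_prime:
  assumes "\<And>k. k \<le> r \<Longrightarrow> prime_subset (P k)" "\<And>k. k < r \<Longrightarrow> P k \<subseteq> P (Suc k)"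
    and "\<And>k. k < r \<Longrightarrow> y k \<in> P (Suc k) \<and> y k \<notin> P k"
    and "es0 \<in> exponent_lists r D" "c es0 \<noteq> 0"
  shows "eval_at r D c y \<notin> P 0"
  using assms
proof (induction r arbitrary: P y c es0)
  case 0
  have "exponent_lists 0 D = {[]}" "es0 = []"
    using 0 by (auto simp: exponent_lists_def)
  hence "eval_at 0 D c y = scalar_poly (c [])" "c [] \<noteq> 0"
    using 0 by (auto simp: eval_at_def)
  moreover have "scalar_poly (1 / c []) * scalar_poly (c []) = 1" if "c [] \<noteq> 0"
    using that by (simp flip: scalar_poly_mult)
  ultimately show ?case
    using prime_subsetD(3,5)[OF 0(1)[OF order.refl]] by metis
next
  case (Suc r)
  define Q where "Q = (\<lambda>m. eval_at r D (\<lambda>es. c (m # es)) (\<lambda>k. y (Suc k)))"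
  obtain m1 es1 where es1: "es0 = m1 # es1" "m1 \<le> D" "es1 \<in> exponent_lists r D"
    using Suc.prems(4) by (cases es0) (auto simp: exponent_lists_def)
  define m0 where "m0 = (LEAST m. m \<le> D \<and> (\<exists>es\<in>exponent_lists r D. c (m # es) \<noteq> 0))"
  have "m0 \<le> D \<and> (\<exists>es\<in>exponent_lists r D. c (m0 # es) \<noteq> 0)"
    unfolding m0_def by (rule LeastI[of _ m1]) (use es1 Suc.prems(5) in auto)
  then obtain es2 where m0: "m0 \<le> D" "es2 \<in> exponent_lists r D" "c (m0 # es2) \<noteq> 0"
    by blast
  have Q0: "Q m = 0" if "m < m0" for m
  proof -
    have "c (m # es) = 0" if "es \<in> exponent_lists r D" for es
      using not_less_Least[of m "\<lambda>m. m \<le> D \<and> (\<exists>es\<in>exponent_lists r D. c (m # es) \<noteq> 0)"]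
        \<open>m < m0\<close> m0(1) that by (auto simp: m0_def[symmetric])
    thus ?thesis by (simp add: Q_def eval_at_def)
  qed
  have eval_Q: "eval_at (Suc r) D c y = (\<Sum>m\<le>D. y 0 ^ m * Q m)"
    by (simp add: eval_at_Suc Q_def)
  show ?case
  proof
    assume "eval_at (Suc r) D c y \<in> P 0"
    moreover have "eval_at (Suc r) D c y = (\<Sum>m=m0..D. y 0 ^ m * Q m)"
      unfolding eval_Q by (rule sum.mono_neutral_right) (use Q0 in auto)
    moreover have "\<dots> = y 0 ^ m0 * (\<Sum>m=m0..D. y 0 ^ (m - m0) * Q m)"
      unfolding sum_distrib_left by (rule sum.cong) (simp_all add: mult.assoc[symmetric] power_add[symmetric])
    ultimately have "y 0 ^ m0 * (\<Sum>m=m0..D. y 0 ^ (m - m0) * Q m) \<in> P 0"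
      by simp
    hence "(\<Sum>m=m0..D. y 0 ^ (m - m0) * Q m) \<in> P 0"
      using Suc.prems(1)[of 0] Suc.prems(3)[of 0] prime_subset_power by blast
    hence S: "(\<Sum>m=m0..D. y 0 ^ (m - m0) * Q m) \<in> P 1"
      using Suc.prems(2)[of 0] by auto
    have P1: "prime_subset (P 1)" using Suc.prems(1)[of 1] by simp
    have "(\<Sum>m\<in>{m0<..D}. y 0 ^ (m - m0) * Q m) \<in> P 1"
    proof (rule prime_subset_sum[OF P1])
      fix m assume "m \<in> {m0<..D}"
      hence "y 0 ^ (m - m0) * Q m = y 0 * (y 0 ^ (m - m0 - 1) * Q m)"
        by (simp add: mult.assoc[symmetric] power_Suc[symmetric] Suc_diff_Suc del: power_Suc)
      thus "y 0 ^ (m - m0) * Q m \<in> P 1"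
        using prime_subsetD(4)[OF P1, of "y 0"] Suc.prems(3)[of 0] by simp
    qed
    moreover have "(\<Sum>m=m0..D. y 0 ^ (m - m0) * Q m) = Q m0 + (\<Sum>m\<in>{m0<..D}. y 0 ^ (m - m0) * Q m)"
      using m0(1) by (simp add: sum.head)
    ultimately have "Q m0 \<in> P 1"
      using S prime_subsetD(8)[OF P1 S, of "\<Sum>m\<in>{m0<..D}. y 0 ^ (m - m0) * Q m"] by simp
    moreover have "Q m0 \<notin> P (Suc 0)"
      unfolding Q_def using Suc.IH[of "\<lambda>k. P (Suc k)" "\<lambda>k. y (Suc k)" es2 "\<lambda>es. c (m0 # es)"] Suc.prems m0
      by auto
    ultimately show False by simp
  qed
qed

lemma card_bounded_multisets: "card {m. set_mset m \<subseteq> {..<j} \<and> size m \<le> d} \<le> Suc d ^ j"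
proof -
  let ?M = "{m :: nat multiset. set_mset m \<subseteq> {..<j} \<and> size m \<le> d}"
  have "inj_on (\<lambda>m. restrict (count m) {..<j}) ?M"
  proof (rule inj_onI, rule multiset_eqI)
    fix m m' i assume m: "m \<in> ?M" "m' \<in> ?M" "restrict (count m) {..<j} = restrict (count m') {..<j}"
    show "count m i = count m' i"
    proof (cases "i < j")
      case True
      thus ?thesis using fun_cong[OF m(3), of i] by simp
    next
      case False
      hence "i \<notin># m" "i \<notin># m'" using m by auto
      thus ?thesis by (simp add: not_in_iff)
    qed
  qed
  moreover have "(\<lambda>m. restrict (count m) {..<j}) ` ?M \<subseteq> (\<Pi>\<^sub>E i\<in>{..<j}. {..d})"
    unfolding image_subset_iff restrict_PiE_iff using order.trans[OF count_le_size] by auto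
  ultimately have "card ?M \<le> card (\<Pi>\<^sub>E i\<in>{..<j}. {..d})"
    by (intro card_inj_on_le) (auto intro: finite_PiE)
  thus ?thesis by (simp add: card_PiE)
qed

lemma card_polys_upto: "card (polys_upto j d :: (nat, 'p::prime_card) mpoly set) \<le> CARD('p) ^ (Suc d ^ j)"
proof -
  let ?M = "{m :: nat multiset. set_mset m \<subseteq> {..<j} \<and> size m \<le> d}"
  have fin: "finite ?M" by (rule finite_bounded_multisets) simp
  have "inj_on (\<lambda>u. restrict (Poly_Mapping.lookup u) ?M) (polys_upto j d :: (nat, 'p) mpoly set)"
  proof (rule inj_onI, rule poly_mapping_eqI)
    fix u v :: "(nat, 'p) mpoly" and m
    assume u: "u \<in> polys_upto j d" "v \<in> polys_upto j d"
      "restrict (Poly_Mapping.lookup u) ?M = restrict (Poly_Mapping.lookup v) ?M"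
    show "Poly_Mapping.lookup u m = Poly_Mapping.lookup v m"
    proof (cases "m \<in> ?M")
      case True
      thus ?thesis using fun_cong[OF u(3), of m] by simp
    next
      case False
      hence "m \<notin> Poly_Mapping.keys u" "m \<notin> Poly_Mapping.keys v"
        using u by (auto simp: polys_upto_def)
      thus ?thesis by (simp add: in_keys_iff)
    qed
  qed
  moreover have "(\<lambda>u. restrict (Poly_Mapping.lookup u) ?M) ` polys_upto j d \<subseteq> (\<Pi>\<^sub>E m\<in>?M. (UNIV :: 'p mod_ring set))"
    by (auto simp only: restrict_PiE_iff image_subset_iff)
  ultimately have "card (polys_upto j d :: (nat, 'p) mpoly set) \<le> card (\<Pi>\<^sub>E m\<in>?M. (UNIV :: 'p mod_ring set))"
    using fin by (intro card_inj_on_le) (auto intro: finite_PiE)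
  also have "\<dots> = CARD('p) ^ card ?M"
    using fin by (simp add: card_PiE)
  also have "\<dots> \<le> CARD('p) ^ (Suc d ^ j)"
    using card_bounded_multisets[of j d] prime_gt_0_nat[OF prime_card_nat[where ?'p = 'p]]
    by (intro power_increasing) auto
  finally show ?thesis .
qed

lemma polys_upto_mult: "\<lbrakk>u \<in> polys_upto j d; v \<in> polys_upto j d'\<rbrakk> \<Longrightarrow> u * v \<in> polys_upto j (d + d')"
  using keys_mult[of u v] unfolding polys_upto_def by fastforce

lemma polys_upto_mono: "d \<le> d' \<Longrightarrow> polys_upto j d \<subseteq> polys_upto j d'"
  by (auto simp: polys_upto_def)

lemma polys_upto_scalar: "scalar_poly c \<in> polys_upto j d"
  by (simp add: polys_upto_def scalar_poly_def)

lemma polys_upto_power: "u \<in> polys_upto j d \<Longrightarrow> u ^ n \<in> polys_upto j (n * d)"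
proof (induction n)
  case 0
  thus ?case using polys_upto_scalar[of 1] by simp
qed (simp add: polys_upto_mult)

lemma polys_upto_sum: "(\<And>i. i \<in> I \<Longrightarrow> f i \<in> polys_upto j d) \<Longrightarrow> sum f I \<in> polys_upto j d"
proof (induction I rule: infinite_finite_induct)
  case (insert x I)
  have "f x + sum f I \<in> polys_upto j d"
    using insert keys_add[of "f x" "sum f I"] unfolding polys_upto_iff by blast
  thus ?case using insert by simp
qed (simp_all add: polys_upto_def)

lemma polys_upto_prod: "(\<And>k. k < r \<Longrightarrow> f k \<in> polys_upto j d) \<Longrightarrow> (\<Prod>k<r. f k) \<in> polys_upto j (r * d)"
proof (induction r)
  case 0
  thus ?case using polys_upto_scalar[of 1] by simp
next
  case (Suc r)
  thus ?case using polys_upto_mult[of "\<Prod>k<r. f k" j "r * d" "f r" d] by (simp add: add.commute)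
qed

text \<open>
  There are at most \<open>p\<close> to the \<open>(d + 1)\<^sup>j\<close> polynomials of degree at most \<open>d\<close> in \<open>j\<close> variables, and \<open>p\<close> to the
  \<open>(D + 1)\<^sup>j\<^sup>+\<^sup>1\<close> polynomials of degree at most \<open>D\<close> in each of \<open>j + 1\<close> variables.  Substituting elements of
  bounded degree makes \<open>d\<close> linear in \<open>D\<close>, so for large \<open>D\<close> two of the latter have the same value.
\<close>

lemma algebraic_dependence:
  assumes "\<And>k. k \<le> j \<Longrightarrow> y k \<in> polys_upto j \<delta>"
  shows "\<exists>D c. (\<exists>es\<in>exponent_lists (Suc j) D. c es \<noteq> 0) \<and>
    eval_at (Suc j) D c (y :: nat \<Rightarrow> (nat, 'p::prime_card) mpoly) = 0"
proof -
  \<comment> \<open>The values have degree at most \<open>d\<close> with \<open>d + 1 \<le> K (D + 1)\<close>, so \<open>(d + 1)\<^sup>j < (D + 1)\<^sup>j\<^sup>+\<^sup>1\<close> as soon as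
    \<open>K\<^sup>j < D + 1\<close>.\<close>
  define K where "K = Suc (\<delta> * Suc j)"
  define D where "D = K ^ j"
  let ?E = "exponent_lists (Suc j) D"
  let ?F = "\<Pi>\<^sub>E es\<in>?E. (UNIV :: 'p mod_ring set)"
  have card_E: "card ?E = Suc D ^ Suc j"
    unfolding exponent_lists_def by (simp add: card_lists_length_eq)
  define d where "d = Suc j * (D * \<delta>)"
  have "eval_at (Suc j) D c y \<in> polys_upto j d" for c
    unfolding eval_at_def
  proof (rule polys_upto_sum)
    fix es assume es: "es \<in> ?E"
    have "(\<Prod>k<Suc j. y k ^ (es ! k)) \<in> polys_upto j (Suc j * (D * \<delta>))"
    proof (rule polys_upto_prod)
      fix k assume k: "k < Suc j"
      hence "es ! k \<in> set es"
        using es by (intro nth_mem) (auto simp: exponent_lists_def)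
      hence "es ! k \<in> {..D}"
        using es by (auto simp: exponent_lists_def)
      hence le: "es ! k * \<delta> \<le> D * \<delta>"
        by simp
      show "y k ^ (es ! k) \<in> polys_upto j (D * \<delta>)"
        by (rule subsetD[OF polys_upto_mono[OF le] polys_upto_power[OF assms]]) (use k in simp)
    qed
    thus "scalar_poly (c es) * (\<Prod>k<Suc j. y k ^ (es ! k)) \<in> polys_upto j d"
      using polys_upto_mult[OF polys_upto_scalar[of "c es" j 0]] by (simp add: d_def)
  qed
  hence "(\<lambda>c. eval_at (Suc j) D c y) ` ?F \<subseteq> polys_upto j d"
    by auto
  hence "card ((\<lambda>c. eval_at (Suc j) D c y) ` ?F) \<le> CARD('p) ^ (Suc d ^ j)"
    using card_mono[OF finite_polys_upto] card_polys_upto[of j d, where ?'p = 'p] order.trans by blast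
  also have "\<dots> < CARD('p) ^ (Suc D ^ Suc j)"
  proof -
    have "Suc d \<le> K * Suc D"
      by (simp add: d_def K_def algebra_simps)
    hence "Suc d ^ j \<le> (K * Suc D) ^ j"
      by (intro power_mono) simp_all
    also have "\<dots> = K ^ j * Suc D ^ j"
      by (rule power_mult_distrib)
    finally have "Suc d ^ j \<le> K ^ j * Suc D ^ j" .
    also have "\<dots> < Suc D * Suc D ^ j"
      by (intro mult_strict_right_mono) (simp_all add: D_def)
    finally show ?thesis
      using prime_gt_1_nat[OF prime_card_nat[where ?'p = 'p]] by (intro power_strict_increasing) simp_all
  qed
  also have "\<dots> = card ?F"
    using finite_exponent_lists[of "Suc j" D] by (simp add: card_PiE card_E)
  finally have "\<not> inj_on (\<lambda>c. eval_at (Suc j) D c y) ?F"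
    by (rule pigeonhole)
  then obtain c c' where c: "c \<in> ?F" "c' \<in> ?F" "c \<noteq> c'" "eval_at (Suc j) D c y = eval_at (Suc j) D c' y"
    by (auto simp: inj_on_def)
  have "eval_at (Suc j) D (\<lambda>es. c es - c' es) y = eval_at (Suc j) D c y - eval_at (Suc j) D c' y"
  proof -
    have "scalar_poly (a - b) = scalar_poly a - (scalar_poly b :: (nat, 'p) mpoly)" for a b
      using scalar_poly_add[of a "- b"] by (simp add: scalar_poly_uminus)
    thus ?thesis
      unfolding eval_at_def by (simp add: left_diff_distrib sum_subtractf)
  qed
  moreover obtain es where "es \<in> ?E" "c es \<noteq> c' es"
    using c PiE_ext[of c ?E "\<lambda>_. UNIV" c'] by blast
  ultimately show ?thesis
    using c(4) by (intro exI[of _ D] exI[of _ "\<lambda>es. c es - c' es"]) auto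
qed

text \<open>
  The polynomial ring here has infinitely many variables, of which those from \<open>j\<close> on lie in all primes of the chain.
  This encodes chains of primes in \<open>j\<close> variables, without changing the ring.
\<close>

theorem prime_chain_length:
  fixes P :: "nat \<Rightarrow> (nat, 'p::prime_card) mpoly set"
  assumes prime: "\<And>k. k \<le> n \<Longrightarrow> prime_subset (P k)"
    and chain: "\<And>k. k < n \<Longrightarrow> P k \<subset> P (Suc k)"
    and vars: "\<And>i. i \<ge> j \<Longrightarrow> var i \<in> P 0"
  shows "n \<le> j"
proof (rule ccontr)
  assume "\<not> n \<le> j"
  hence n: "Suc j \<le> n" by simp
  \<comment> \<open>Setting the variables from \<open>j\<close> on to zero does not change anything modulo \<open>P 0\<close>.\<close>
  define \<rho> where "\<rho> = substitute (\<lambda>i. if i < j then var i else 0 :: (nat, 'p) mpoly)"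
  note P0 = prime_subsetD[OF prime[OF le0]]
  have \<rho>: "u - \<rho> u \<in> P 0" for u
  proof -
    have "Poly_Mapping.keys u \<subseteq> {m. set_mset m \<subseteq> UNIV}" by simp
    thus ?thesis
    proof (induction rule: mpoly_ring_induct)
      case (var i u)
      have "var i - \<rho> (var i) \<in> P 0"
        using vars[of i] P0(1) by (simp add: \<rho>_def)
      hence "u * (var i - \<rho> (var i)) + \<rho> (var i) * (u - \<rho> u) \<in> P 0"
        using var by (intro P0(2,3))
      thus ?case by (simp add: \<rho>_def substitute_mult algebra_simps)
    next
      case (scalar c u)
      have "scalar_poly c * (u - \<rho> u) \<in> P 0"
        using scalar by (intro P0(3))
      thus ?case by (simp add: \<rho>_def substitute_mult algebra_simps)
    next
      case (add u v)
      have "(u - \<rho> u) + (v - \<rho> v) \<in> P 0"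
        using add by (intro P0(2))
      thus ?case by (simp add: \<rho>_def substitute_add algebra_simps)
    qed (simp_all add: \<rho>_def P0(1))
  qed
  have P0_sub: "P 0 \<subseteq> P k" if "k \<le> n" for k
    using that by (induction k) (use chain in \<open>auto dest: Suc_le_lessD\<close>)
  have "\<forall>k. \<exists>y. k < n \<longrightarrow> y \<in> P (Suc k) \<and> y \<notin> P k"
    using chain by blast
  then obtain y where y: "\<And>k. k < n \<Longrightarrow> y k \<in> P (Suc k) \<and> y k \<notin> P k"
    by metis
  have y': "\<rho> (y k) \<in> P (Suc k) \<and> \<rho> (y k) \<notin> P k" if "k < n" for k
  proof
    have "y k - (y k - \<rho> (y k)) \<in> P (Suc k)"
      using y[OF that] \<rho>[of "y k"] P0_sub[of "Suc k"] that
      by (auto intro: prime_subsetD(8)[OF prime[of "Suc k"], of "y k" "y k - \<rho> (y k)", simplified])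
    thus "\<rho> (y k) \<in> P (Suc k)" by simp
    show "\<rho> (y k) \<notin> P k"
    proof
      assume "\<rho> (y k) \<in> P k"
      hence "\<rho> (y k) + (y k - \<rho> (y k)) \<in> P k"
        using \<rho>[of "y k"] P0_sub[of k] that by (intro prime_subsetD(2)[OF prime[of k]]) auto
      thus False using y[OF that] by simp
    qed
  qed
  have in_polys: "\<rho> u \<in> polys_in j" for u
  proof -
    have "Poly_Mapping.keys u \<subseteq> {m. set_mset m \<subseteq> UNIV}" by simp
    thus ?thesis
      by (induction rule: mpoly_ring_induct)
        (auto simp: \<rho>_def substitute_mult substitute_add intro!: polys_in_mult polys_in_add
          simp: polys_in_closed)
  qed
  have "\<forall>k. \<exists>d. \<rho> (y k) \<in> polys_upto j d"
    using polys_in_upto in_polys by blast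
  then obtain d where d: "\<And>k. \<rho> (y k) \<in> polys_upto j (d k)"
    by metis
  define \<delta> where "\<delta> = Max (d ` {..j})"
  have "\<rho> (y k) \<in> polys_upto j \<delta>" if "k \<le> j" for k
    using d[of k] polys_upto_mono[of "d k" \<delta> j] that by (auto simp: \<delta>_def)
  then obtain D c es where "es \<in> exponent_lists (Suc j) D" "c es \<noteq> 0"
    "eval_at (Suc j) D c (\<lambda>k. \<rho> (y k)) = 0"
    using algebraic_dependence[of j "\<lambda>k. \<rho> (y k)" \<delta>] by blast
  moreover have "eval_at (Suc j) D c (\<lambda>k. \<rho> (y k)) \<notin> P 0"
    using calculation n prime chain y'
    by (intro eval_at_notin_prime[of "Suc j" P "\<lambda>k. \<rho> (y k)" es D c]) (auto simp: psubset_imp_subset)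
  ultimately show False
    using P0(1) by simp
qed

section \<open>Dickson invariants of the ambient space\<close>

text \<open>
  A basis \<open>e\<close> of the whole space that begins with a basis of \<open>V\<close>, with its dual basis \<open>b\<close>.
\<close>

definition adapted_basis ::
    "('p::prime_card mod_ring \<Rightarrow> 'w::ab_group_add \<Rightarrow> 'w) \<Rightarrow> 'w set \<Rightarrow> 'w set \<Rightarrow> (nat \<Rightarrow> 'w) \<Rightarrow>
      (nat \<Rightarrow> 'w \<Rightarrow> 'p mod_ring) \<Rightarrow> bool" where
  "adapted_basis scale Basis V e b \<longleftrightarrow> vector_space.dim scale V \<le> card Basis \<and>
    (\<forall>i<vector_space.dim scale V. e i \<in> V) \<and>
    (\<forall>i<card Basis. b i \<in> dual_space scale UNIV) \<and>
    (\<forall>i<card Basis. \<forall>l<card Basis. b i (e l) = (if i = l then 1 else 0)) \<and>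
    (\<forall>x. x = (\<Sum>i<card Basis. scale (b i x) (e i))) \<and>
    (\<forall>x\<in>V. x = (\<Sum>i<vector_space.dim scale V. scale (b i x) (e i)))"

lemma adapted_basis_exists:
  fixes scale :: "'p::prime_card mod_ring \<Rightarrow> 'w::ab_group_add \<Rightarrow> 'w"
  assumes fd: "finite_dimensional_vector_space scale Basis" and V: "module.subspace scale V"
  shows "\<exists>e b. adapted_basis scale Basis V e b"
proof -
  interpret finite_dimensional_vector_space scale Basis by (rule fd)
  obtain BV where BV: "BV \<subseteq> V" "independent BV" "V \<subseteq> span BV" "card BV = dim V"
    by (rule basis_exists)
  obtain B where B: "BV \<subseteq> B" "B \<subseteq> UNIV" "independent B" "UNIV \<subseteq> span B"
    by (rule maximal_independent_subset_extend[OF subset_UNIV BV(2)])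
  have fin: "finite B" "finite BV"
    using finiteI_independent B BV by auto
  have cardB: "card B = card Basis"
    using basis_card_eq_dim[of B UNIV] B dim_UNIV by auto
  obtain xs where xs: "set xs = BV" "distinct xs"
    using finite_distinct_list[OF fin(2)] by blast
  obtain ys where ys: "set ys = B - BV" "distinct ys"
    using finite_distinct_list[of "B - BV"] fin by blast
  define zs where "zs = xs @ ys"
  have zs: "set zs = B" "distinct zs"
    using xs ys B by (auto simp: zs_def)
  define n j where "n = card Basis" and "j = dim V"
  have len: "length zs = n" "length xs = j"
    using distinct_card[OF zs(2)] distinct_card[OF xs(2)] zs xs cardB BV by (simp_all add: n_def j_def)
  have jn: "j \<le> n"
    using len by (simp add: zs_def)
  define e where "e = (\<lambda>i. zs ! i)"
  define b where "b = (\<lambda>i x. representation B x (e i))"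
  have eB: "e i \<in> B" if "i < n" for i
    using that len zs nth_mem by (auto simp: e_def)
  have spanB: "x \<in> span B" for x
    using B(4) by auto
  have sum_B: "(\<Sum>i<n. f (e i)) = sum f B" for f :: "'w \<Rightarrow> 'w"
    using sum.distinct_set_conv_list[OF zs(2), of f] zs(1) len
    by (simp add: e_def sum_list_sum_nth atLeast0LessThan)
  have eV: "e i \<in> BV" if "i < j" for i
    using that len xs nth_mem[of i xs] by (auto simp: e_def zs_def nth_append)
  have sum_BV: "(\<Sum>i<j. f (e i)) = sum f BV" for f :: "'w \<Rightarrow> 'w"
    using sum.distinct_set_conv_list[OF xs(2), of f] xs(1) len
    by (simp add: e_def zs_def nth_append sum_list_sum_nth atLeast0LessThan)
  have "\<forall>i<j. e i \<in> V"
    using eV BV by auto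
  moreover have "\<forall>i<n. b i \<in> dual_space scale UNIV"
    using representation_add[OF B(3) spanB spanB] representation_scale[OF B(3) spanB]
    by (auto simp: dual_space_def b_def)
  moreover have "\<forall>i<n. \<forall>l<n. b i (e l) = (if i = l then 1 else 0)"
    using representation_basis[OF B(3) eB] zs(2) len by (auto simp: b_def e_def nth_eq_iff_index_eq)
  moreover have "x = (\<Sum>i<n. scale (b i x) (e i))" for x
    using sum_B[of "\<lambda>v. scale (representation B x v) v"] sum_representation_eq[OF B(3) spanB fin(1) order.refl]
    by (simp add: b_def)
  moreover have "x = (\<Sum>i<j. scale (b i x) (e i))" if "x \<in> V" for x
  proof -
    have x: "x \<in> span BV" using that BV by auto
    have "(\<Sum>i<j. scale (b i x) (e i)) = (\<Sum>v\<in>BV. scale (representation BV x v) v)"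
      using sum_BV[of "\<lambda>v. scale (representation B x v) v"] representation_extend[OF B(3) x B(1)]
      by (simp add: b_def)
    also have "\<dots> = x"
      by (rule sum_representation_eq[OF BV(2) x fin(2) order.refl])
    finally show ?thesis by simp
  qed
  ultimately have "adapted_basis scale Basis V e b"
    using jn unfolding adapted_basis_def n_def j_def by simp
  thus ?thesis by blast
qed

definition root_poly :: "('p::prime_card mod_ring \<Rightarrow> 'w::ab_group_add \<Rightarrow> 'w) \<Rightarrow> ('w \<Rightarrow> 'p mod_ring, 'p) mpoly poly" where
  "root_poly scale = (\<Prod>f\<in>dual_space scale UNIV. [:- var f, 1:])"

lemma coeff_prod_linear_hom:
  fixes h :: "'a::comm_ring_1 \<Rightarrow> 'b::comm_ring_1"
  assumes "h 1 = 1" "h 0 = 0" "\<And>u v. h (u + v) = h u + h v" "\<And>u v. h (u * v) = h u * h v"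
  shows "h (Polynomial.coeff (\<Prod>i\<in>I. [:- f i, 1:]) m) = Polynomial.coeff (\<Prod>i\<in>I. [:- h (f i), 1:]) m"
proof (induction I arbitrary: m rule: infinite_finite_induct)
  case (insert i I)
  have "h (- u) = - h u" for u
    using assms(2) assms(3)[of u "- u"] by (simp add: eq_neg_iff_add_eq_0 add.commute)
  moreover from this have "h (u - v) = h u - h v" for u v
    using assms(3)[of u "- v"] by simp
  ultimately show ?case
    using insert by (cases m) (simp_all add: assms)
qed (simp_all add: coeff_1 assms)

context free_polys
begin

text \<open>Here the functionals have degree 1 in all characteristics.\<close>

definition homogeneous_part :: "int \<Rightarrow> ('w \<Rightarrow> 'p mod_ring, 'p) mpoly set" where
  "homogeneous_part d = {u. \<forall>m\<in>Poly_Mapping.keys u. set_mset m \<subseteq> dual_space scale V \<and> int (size m) = d}"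

lemma homogeneous_part_iff:
  "u \<in> homogeneous_part d \<longleftrightarrow> Poly_Mapping.keys u \<subseteq> {m. set_mset m \<subseteq> dual_space scale V \<and> int (size m) = d}"
  by (auto simp: homogeneous_part_def)

sublocale hom: filtered_family homogeneous_part
proof
  show "1 \<in> homogeneous_part 0" "0 \<in> homogeneous_part d" for d
    by (simp_all add: homogeneous_part_iff)
  show "u + v \<in> homogeneous_part d" if "u \<in> homogeneous_part d" "v \<in> homogeneous_part d" for u v d
    using that keys_add[of u v] unfolding homogeneous_part_iff by blast
  show "- u \<in> homogeneous_part d" if "u \<in> homogeneous_part d" for u d
    using that by (simp add: homogeneous_part_iff in_keys_iff subset_iff)
  show "u * v \<in> homogeneous_part (d + e)" if "u \<in> homogeneous_part d" "v \<in> homogeneous_part e" for u v d e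
    using that keys_mult[of u v] by (fastforce simp: homogeneous_part_def)
qed

lemma var_homogeneous: "f \<in> dual_space scale V \<Longrightarrow> var f \<in> homogeneous_part 1"
  by (simp add: homogeneous_part_def var_def)

lemma homogeneous_closed: "u \<in> homogeneous_part d \<Longrightarrow> u \<in> carrier FP"
  by (auto simp: homogeneous_part_def carrier_FP)

lemma homogeneous_gpart:
  "u \<in> homogeneous_part d \<Longrightarrow> u \<in> gpart FP ((if CARD('p) = 2 then 1 else 2) * d)"
  by (auto simp: homogeneous_part_def free_polynomials_def monoid_algebra_def)

lemma cls_gpart: "u \<in> gpart FP d \<Longrightarrow> SA.cls u \<in> gpart (symmetric_algebra scale V) d"
  by (auto simp: symmetric_algebra_eq graded_quotient_def)

end

locale ambient =
  fixes scale :: "'p::prime_card mod_ring \<Rightarrow> 'w::ab_group_add \<Rightarrow> 'w" and Basis :: "'w set"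
  assumes fd: "finite_dimensional_vector_space scale Basis"
begin

sublocale vs: finite_dimensional_vector_space scale Basis
  by (rule fd)

sublocale W: free_polys scale UNIV .

abbreviation n where "n \<equiv> card Basis"

abbreviation PW where "PW \<equiv> symmetric_algebra scale UNIV"

text \<open>
  Representatives of the Dickson invariants of the ambient space \<open>W\<close>.  They are numbered from the top of the polynomial
  downwards, so that the \<open>i\<close>-th one restricts, for every subspace \<open>V\<close> of dimension greater than \<open>i\<close>, to a power
  of the \<open>i\<close>-th Dickson invariant of \<open>V\<close>.
\<close>

definition dickson_lift :: "nat \<Rightarrow> ('w \<Rightarrow> 'p mod_ring, 'p) mpoly" where
  "dickson_lift i = Polynomial.coeff (root_poly scale) (CARD('p) ^ (n - 1 - i))"

lemma dual_bij:
  assumes b: "\<forall>i<n. b i \<in> dual_space scale UNIV"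
    and be: "\<forall>i<n. \<forall>l<n. b i (e l) = (if i = l then 1 else 0)"
    and span: "\<forall>x. x = (\<Sum>i<n. scale (b i x) (e i))"
  shows "bij_betw (\<lambda>f i. if i < n then f (e i) else 0) (dual_space scale UNIV) (coord_vectors n)"
proof (rule bij_betw_byWitness[where f' = "\<lambda>a x. \<Sum>i<n. a i * b i x"])
  show "\<forall>f\<in>dual_space scale UNIV. (\<lambda>x. \<Sum>i<n. (if i < n then f (e i) else 0) * b i x) = f"
  proof (intro ballI ext)
    fix f x assume f: "f \<in> dual_space scale UNIV"
    have add: "f (x + y) = f x + f y" and sc: "f (scale c x) = c * f x" for x y c
      using f by (auto simp: dual_space_def)
    have zero: "f 0 = 0"
      using sc[of 0 0] by simp
    have "f (\<Sum>i\<in>I. scale (b i x) (e i)) = (\<Sum>i\<in>I. b i x * f (e i))" for I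
      by (induction I rule: infinite_finite_induct) (simp_all add: zero add sc)
    from this[of "{..<n}"] show "(\<Sum>i<n. (if i < n then f (e i) else 0) * b i x) = f x"
      using span[rule_format, of x] by (simp add: mult.commute)
  qed
  show "\<forall>a\<in>coord_vectors n. (\<lambda>i. if i < n then (\<Sum>l<n. a l * b l (e i)) else 0) = a"
  proof (intro ballI ext)
    fix a :: "nat \<Rightarrow> 'p mod_ring" and i
    assume a: "a \<in> coord_vectors n"
    have "(\<Sum>l<n. a l * b l (e i)) = a i" if "i < n"
      using that be by (subst sum.mono_neutral_right[of _ "{i}"]) auto
    thus "(if i < n then (\<Sum>l<n. a l * b l (e i)) else 0) = a i"
      using a by (auto simp: coord_vectors_def)
  qed
  show "(\<lambda>f i. if i < n then f (e i) else 0) ` dual_space scale UNIV \<subseteq> coord_vectors n"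
    by (auto simp: coord_vectors_def)
  show "(\<lambda>a x. \<Sum>i<n. a i * b i x) ` coord_vectors n \<subseteq> dual_space scale UNIV"
    using b by (auto intro!: dual_space_sum)
qed

lemma finite_dual: "finite (dual_space scale UNIV)" and card_dual: "card (dual_space scale UNIV) = CARD('p) ^ n"
proof -
  obtain e b where "adapted_basis scale Basis UNIV e b"
    using adapted_basis_exists[OF fd vs.subspace_UNIV] by blast
  hence bij: "bij_betw (\<lambda>f i. if i < n then f (e i) else 0) (dual_space scale UNIV) (coord_vectors n)"
    unfolding adapted_basis_def by (intro dual_bij[where b = b and e = e]) auto
  show "finite (dual_space scale UNIV)"
    using bij_betw_finite[OF bij] finite_coord_vectors by simp
  show "card (dual_space scale UNIV) = CARD('p) ^ n"
    using bij_betw_same_card[OF bij] by (simp add: card_coord_vectors)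
qed

lemma dickson_lift_homogeneous:
  "dickson_lift i \<in> W.homogeneous_part (int (CARD('p) ^ n) - int (CARD('p) ^ (n - 1 - i)))"
proof -
  have "W.hom.homogeneous_coeffs (int (card (dual_space scale UNIV))) (root_poly scale)"
    unfolding root_poly_def
    by (intro W.hom.homogeneous_coeffs_prod finite_dual W.hom.homogeneous_coeffs_linear W.var_homogeneous)
  from this[unfolded W.hom.homogeneous_coeffs_def, rule_format, of "CARD('p) ^ (n - 1 - i)"]
  show ?thesis
    by (simp add: dickson_lift_def card_dual)
qed

lemma dickson_lift_closed: "dickson_lift i \<in> carrier W.FP"
  by (rule W.homogeneous_closed[OF dickson_lift_homogeneous])

lemma dickson_lift_gpart:
  assumes "i < n"
  shows "\<exists>d>0. (CARD('p) = 2 \<or> even d) \<and> W.SA.cls (dickson_lift i) \<in> gpart PW d"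
proof -
  let ?D = "int (CARD('p) ^ n) - int (CARD('p) ^ (n - 1 - i))"
  have "CARD('p) > 1"
    using prime_gt_1_nat[OF prime_card_nat[where ?'p = 'p]] .
  hence "CARD('p) ^ (n - 1 - i) < CARD('p) ^ n"
    using assms by (intro power_strict_increasing) auto
  hence "?D > 0"
    by (metis diff_gt_0_iff_gt of_nat_less_iff)
  thus ?thesis
    using W.cls_gpart[OF W.homogeneous_gpart[OF dickson_lift_homogeneous], of i]
    by (intro exI[of _ "(if CARD('p) = 2 then 1 else 2) * ?D"]) auto
qed

end

locale subspace_in_ambient = ambient scale Basis
  for scale :: "'p::prime_card mod_ring \<Rightarrow> 'w::ab_group_add \<Rightarrow> 'w" and Basis +
  fixes V :: "'w set" and e :: "nat \<Rightarrow> 'w" and b :: "nat \<Rightarrow> 'w \<Rightarrow> 'p mod_ring"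
  assumes V: "vs.subspace V" and adapted: "adapted_basis scale Basis V e b"
begin

lemma le: "vs.dim V \<le> n"
  and eV: "i < vs.dim V \<Longrightarrow> e i \<in> V"
  and b_dual: "i < n \<Longrightarrow> b i \<in> dual_space scale UNIV"
  and be: "\<lbrakk>i < n; l < n\<rbrakk> \<Longrightarrow> b i (e l) = (if i = l then 1 else 0)"
  and span_UNIV: "x = (\<Sum>i<n. scale (b i x) (e i))"
  and span_V: "x \<in> V \<Longrightarrow> x = (\<Sum>i<vs.dim V. scale (b i x) (e i))"
  using adapted unfolding adapted_basis_def by auto

abbreviation j where "j \<equiv> vs.dim V"

lemma restrict_dual: "f \<in> dual_space scale UNIV \<Longrightarrow> restrict_functional V f \<in> dual_space scale V"
  using vs.subspace_add[OF V] vs.subspace_scale[OF V] by (auto simp: dual_space_def restrict_functional_def)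

sublocale V: subspace_coords scale V j e "\<lambda>i. restrict_functional V (b i)"
proof
  show "module.subspace scale V" by (rule V)
  show "restrict_functional V (b i) \<in> dual_space scale V" if "i < j" for i
    using that le by (intro restrict_dual b_dual) auto
  show "restrict_functional V (b i) (e l) = (if i = l then 1 else 0)" if "i < j" "l < j" for i l
    using that le be[of i l] eV by (simp add: restrict_functional_def)
  show "x = (\<Sum>i<j. scale (restrict_functional V (b i) x) (e i))" if "x \<in> V" for x
    using span_V[OF that] that by (simp add: restrict_functional_def)
qed (use eV in auto)

abbreviation PV where "PV \<equiv> symmetric_algebra scale V"

definition q :: nat where "q = CARD('p) ^ (n - j)"

text \<open>
  A functional on \<open>W\<close> restricts to the linear form on \<open>V\<close> given by its first \<open>j\<close> coordinates.
\<close>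

lemma root_poly_restrict: "V.coord_map (Polynomial.coeff (root_poly scale) m) = Polynomial.coeff (dickson_poly j ^ q) m"
proof -
  have bij: "bij_betw (\<lambda>f i. if i < n then f (e i) else 0) (dual_space scale UNIV) (coord_vectors n)"
    using b_dual be span_UNIV by (intro dual_bij) auto
  have "V.coord_map (Polynomial.coeff (root_poly scale) m) =
      Polynomial.coeff (\<Prod>f\<in>dual_space scale UNIV. [:- V.coord_map (var f), 1:]) m"
    unfolding root_poly_def V.coord_map_def
    by (rule coeff_prod_linear_hom) (simp_all add: substitute_add substitute_mult)
  also have "(\<Prod>f\<in>dual_space scale UNIV. [:- V.coord_map (var f), 1:]) = (\<Prod>a\<in>coord_vectors n. [:- linear_form j a, 1:])"
  proof -
    have "V.coord_map (var f) = linear_form j (\<lambda>i. if i < n then f (e i) else 0)" for f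
      using le by (simp add: V.coord_map_def linear_form_def)
    thus ?thesis
      unfolding prod.reindex_bij_betw[OF bij, of "\<lambda>a. [:- linear_form j a, 1:]", symmetric] by (simp only:)
  qed
  finally show ?thesis
    unfolding dickson_poly_restrict[OF le] q_def .
qed

lemma dickson_system_exists:
  "\<exists>G. dickson_system j q G \<and> (\<forall>i<j. V.coord_map (dickson_lift i) = G (j - 1 - i))"
proof -
  obtain G where G: "G j = 1"
    "(dickson_poly j :: (nat, 'p) mpoly poly) ^ q = (\<Sum>l\<le>j. Polynomial.monom (G l) (q * CARD('p) ^ l))"
    using dickson_power_coeffs[OF le] unfolding q_def by blast
  have p: "CARD('p) > 1"
    using prime_gt_1_nat[OF prime_card_nat[where ?'p = 'p]] .
  hence q: "q > 0" by (simp add: q_def)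
  have "V.coord_map (dickson_lift i) = G (j - 1 - i)" if "i < j" for i
  proof -
    have "n - 1 - i = (n - j) + (j - 1 - i)"
      using that le by simp
    hence pow: "CARD('p) ^ (n - 1 - i) = q * CARD('p) ^ (j - 1 - i)"
      by (simp add: q_def power_add)
    have "q * CARD('p) ^ l = q * CARD('p) ^ (j - 1 - i) \<longleftrightarrow> l = j - 1 - i" for l
      using q p by simp
    thus ?thesis
      unfolding dickson_lift_def root_poly_restrict G(2) pow Polynomial.coeff_sum
      by (subst sum.mono_neutral_right[of _ "{j - 1 - i}"]) auto
  qed
  thus ?thesis
    using G q by (intro exI[of _ G]) (simp add: dickson_system_def)
qed

text \<open>On functionals the induced map is restriction to \<open>V\<close>, and both sides are ring maps.\<close>

lemma induced_map_coords:
  assumes h: "is_induced_map scale V UNIV h" and u: "u \<in> carrier W.FP"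
  shows "h (W.SA.cls u) \<in> carrier PV \<and> V.coord_iso (h (W.SA.cls u)) = V.coord_map u"
proof -
  interpret PV: polynomial_algebra PV j V.coord_iso
    by (rule V.polynomial_algebra)
  have hom: "h \<in> ring_hom PW PV" and sm: "\<And>c C. C \<in> carrier PW \<Longrightarrow> h (c \<odot>\<^bsub>PW\<^esub> C) = c \<odot>\<^bsub>PV\<^esub> h C"
    and gen: "\<And>f. f \<in> dual_space scale UNIV \<Longrightarrow> h (W.SA.cls (var f)) = V.SA.cls (var (restrict_functional V f))"
    using h by (auto simp: is_induced_map_def graded_algebra_hom_def symmetric_generator_def var_def)
  have carrier_PW: "carrier PW = W.SA.cls ` carrier W.FP"
    unfolding W.symmetric_algebra_eq by (rule W.SA.carrier_Q)
  have add: "h (W.SA.cls (u + v)) = h (W.SA.cls u) \<oplus>\<^bsub>PV\<^esub> h (W.SA.cls v)"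
    if "u \<in> carrier W.FP" "v \<in> carrier W.FP" for u v
    using ring_hom_add[OF hom, of "W.SA.cls u" "W.SA.cls v"] that W.SA.cls_add[OF that]
    by (simp add: W.SA.cls_closed W.symmetric_algebra_eq W.FP.A_simps(3))
  have mult: "h (W.SA.cls (u * v)) = h (W.SA.cls u) \<otimes>\<^bsub>PV\<^esub> h (W.SA.cls v)"
    if "u \<in> carrier W.FP" "v \<in> carrier W.FP" for u v
    using ring_hom_mult[OF hom, of "W.SA.cls u" "W.SA.cls v"] that W.SA.cls_mult[OF that]
    by (simp add: W.SA.cls_closed W.symmetric_algebra_eq W.mult_FP)
  have one: "h (W.SA.cls 1) = \<one>\<^bsub>PV\<^esub>"
    using ring_hom_one[OF hom] by (simp add: W.symmetric_algebra_eq W.SA.Q_simps(4) W.one_FP)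
  have "Poly_Mapping.keys u \<subseteq> {m. set_mset m \<subseteq> dual_space scale UNIV}"
    using u by (simp add: W.carrier_FP)
  thus ?thesis
  proof (induction rule: mpoly_ring_induct)
    case one
    thus ?case by (simp add: \<open>h (W.SA.cls 1) = \<one>\<^bsub>PV\<^esub>\<close> PV.iso_one V.coord_map_def)
  next
    case (var f u)
    have uc: "u \<in> carrier W.FP" using var by (simp add: W.carrier_FP)
    have vf: "var (restrict_functional V f) \<in> carrier V.FP"
      by (intro V.var_closed restrict_dual var)
    have "(\<lambda>i. restrict_functional V f (e i)) l = f (e l)" if "l < j" for l
      using eV[OF that] by (simp add: restrict_functional_def)
    hence "V.coord_map (var (restrict_functional V f)) = V.coord_map (var f)"
      by (simp add: V.coord_map_def linear_form_def)
    hence "h (W.SA.cls (var f)) \<in> carrier PV \<and> V.coord_iso (h (W.SA.cls (var f))) = V.coord_map (var f)"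
      using gen[OF var(1)] vf V.SA.carrier_Q by (simp add: V.coord_iso_cls V.symmetric_algebra_eq)
    thus ?case
      using var uc mult[OF W.var_closed[OF var(1)] uc]
      by (simp add: PV.iso_mult V.coord_map_def substitute_mult)
  next
    case (scalar c u)
    have uc: "u \<in> carrier W.FP" using scalar by (simp add: W.carrier_FP)
    have "c \<odot>\<^bsub>PW\<^esub> W.SA.cls u = W.SA.cls (scalar_poly c * u)"
      unfolding W.smult_FP[OF uc, symmetric] W.symmetric_algebra_eq
    proof (rule W.SA.cls_smult[OF uc])
      fix v assume "v \<in> W.SI"
      thus "c \<odot>\<^bsub>W.FP\<^esub> v \<in> W.SI"
        using W.SI_closed(3)[of v "scalar_poly c"] W.SI_closed(4) W.scalar_closed[of c] W.smult_FP[of v c] by auto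
    qed (auto simp: W.FP.smult_closed_A W.FP.smult_add W.FP.A_simps(3))
    hence "h (W.SA.cls (scalar_poly c * u)) = c \<odot>\<^bsub>PV\<^esub> h (W.SA.cls u)"
      using sm[of "W.SA.cls u" c] uc by (simp add: carrier_PW)
    thus ?case
      using scalar by (simp add: PV.smult_closed PV.iso_smult V.coord_map_def substitute_mult)
  next
    case (add u v)
    thus ?case
      using \<open>\<And>v u. \<lbrakk>u \<in> carrier W.FP; v \<in> carrier W.FP\<rbrakk> \<Longrightarrow> h (W.SA.cls (u + v)) = h (W.SA.cls u) \<oplus>\<^bsub>PV\<^esub> h (W.SA.cls v)\<close>[of u v]
      by (simp add: W.carrier_FP PV.iso_add V.coord_map_def substitute_add)
  next
    case zero
    have "h (W.SA.cls 0) \<oplus>\<^bsub>PV\<^esub> h (W.SA.cls 0) = h (W.SA.cls 0)"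
      using \<open>\<And>v u. \<lbrakk>u \<in> carrier W.FP; v \<in> carrier W.FP\<rbrakk> \<Longrightarrow> h (W.SA.cls (u + v)) = h (W.SA.cls u) \<oplus>\<^bsub>PV\<^esub> h (W.SA.cls v)\<close>[of 0 0]
      by (simp add: W.carrier_FP)
    moreover have "h (W.SA.cls 0) \<in> carrier PV"
      using ring_hom_closed[OF hom, of "W.SA.cls 0"] by (simp add: carrier_PW W.carrier_FP)
    ultimately have "h (W.SA.cls 0) = \<zero>\<^bsub>PV\<^esub>"
      by (simp add: PV.add.l_cancel_one')
    moreover have "V.coord_iso \<zero>\<^bsub>PV\<^esub> = 0"
      using PV.iso_add[of "\<zero>\<^bsub>PV\<^esub>" "\<zero>\<^bsub>PV\<^esub>"] by simp
    ultimately show ?case by (simp add: V.coord_map_def)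
  qed
qed

end

section \<open>The action of an algebra on \<open>P\<^sub>V \<otimes> N\<close>\<close>

text \<open>
  The maps of a free module over \<open>R\<close>, up to suspension, together with a choice of an adapted basis.
\<close>

locale free_module_data = subspace_in_ambient scale Basis V e b + R: graded_commutative_algebra R +
    N: graded_commutative_algebra N
  for scale :: "'p::prime_card mod_ring \<Rightarrow> 'w::ab_group_add \<Rightarrow> 'w" and Basis V e b
    and R :: "('p mod_ring, 'r) graded" and N :: "('p mod_ring, 'm) graded" +
  fixes \<eta> :: "(('w \<Rightarrow> 'p mod_ring) multiset \<Rightarrow>\<^sub>0 'p mod_ring) set \<Rightarrow> 'r" and \<phi> \<pi>
  assumes eta: "\<eta> \<in> graded_algebra_hom PW R"
    and connected: "connected_algebra N" and bounded: "bounded_algebra N"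
    and phi: "\<phi> \<in> graded_algebra_hom R (tensor_algebra PV N)"
    and proj: "is_tensor_augmentation PV N \<pi>"
    and induced: "is_induced_map scale V UNIV (\<pi> \<circ> \<phi> \<circ> \<eta>)"
begin

abbreviation T where "T \<equiv> tensor_algebra PV N"

definition \<epsilon> :: "'m \<Rightarrow> 'p mod_ring" where
  "\<epsilon> = (SOME \<epsilon>. \<epsilon> \<in> graded_algebra_hom N base_field \<and>
     (\<forall>a\<in>carrier PV. \<forall>x\<in>carrier N. \<pi> (pure_tensor PV N a x) = \<epsilon> x \<odot>\<^bsub>PV\<^esub> a))"

lemma epsilon: "\<epsilon> \<in> graded_algebra_hom N base_field"
  "\<lbrakk>a \<in> carrier PV; x \<in> carrier N\<rbrakk> \<Longrightarrow> \<pi> (pure_tensor PV N a x) = \<epsilon> x \<odot>\<^bsub>PV\<^esub> a"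
proof -
  have "\<exists>\<epsilon>. \<epsilon> \<in> graded_algebra_hom N base_field \<and>
     (\<forall>a\<in>carrier PV. \<forall>x\<in>carrier N. \<pi> (pure_tensor PV N a x) = \<epsilon> x \<odot>\<^bsub>PV\<^esub> a)"
    using proj unfolding is_tensor_augmentation_def by blast
  from someI_ex[OF this] show "\<epsilon> \<in> graded_algebra_hom N base_field"
    "\<lbrakk>a \<in> carrier PV; x \<in> carrier N\<rbrakk> \<Longrightarrow> \<pi> (pure_tensor PV N a x) = \<epsilon> x \<odot>\<^bsub>PV\<^esub> a"
    unfolding \<epsilon>_def by blast+
qed

lemma PV_polynomial: "polynomial_algebra PV j V.coord_iso"
  by (rule V.polynomial_algebra)

lemma augmented_tensor:
  assumes "bij_betw \<Theta> (polys_in j) (polys_in j)" "\<And>u v. \<Theta> (u + v) = \<Theta> u + \<Theta> v"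
    "\<And>c u. \<Theta> (scalar_poly c * u) = scalar_poly c * \<Theta> u"
  shows "augmented_tensor PV j V.coord_iso N \<Theta> \<epsilon> \<pi>"
proof -
  interpret pt: poly_tensor PV j V.coord_iso N \<Theta>
    by (intro poly_tensor.intro poly_tensor_axioms.intro PV_polynomial N.graded_commutative_algebra_axioms)
      (use assms in auto)
  show ?thesis
    by (intro augmented_tensor.intro augmented_tensor_axioms.intro pt.poly_tensor_axioms connected bounded epsilon)
      (use proj in \<open>auto simp: is_tensor_augmentation_def\<close>)
qed

sublocale at: augmented_tensor PV j V.coord_iso N id \<epsilon> \<pi>
  by (rule augmented_tensor) (auto simp: bij_betw_def)

lemma eta_ring_hom: "\<eta> \<in> ring_hom PW R"
  using eta by (simp add: graded_algebra_hom_def)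

lemma phi_ring_hom: "\<phi> \<in> ring_hom R T"
  using phi by (simp add: graded_algebra_hom_def)

lemma phi_closed: "r \<in> carrier R \<Longrightarrow> \<phi> r \<in> carrier T"
  by (rule ring_hom_closed[OF phi_ring_hom])

lemma pi_ring_hom: "\<pi> \<in> ring_hom T PV"
  using proj by (simp add: is_tensor_augmentation_def graded_algebra_hom_def)

definition lift :: "('w \<Rightarrow> 'p mod_ring, 'p) mpoly \<Rightarrow> 'r" where
  "lift u = \<eta> (W.SA.cls u)"

lemma cls_W_closed: "u \<in> carrier W.FP \<Longrightarrow> W.SA.cls u \<in> carrier PW"
  unfolding W.symmetric_algebra_eq by (rule W.SA.cls_closed)

lemma lift_closed: "u \<in> carrier W.FP \<Longrightarrow> lift u \<in> carrier R"
  unfolding lift_def by (intro ring_hom_closed[OF eta_ring_hom] cls_W_closed)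

lemma lift_add: "\<lbrakk>u \<in> carrier W.FP; v \<in> carrier W.FP\<rbrakk> \<Longrightarrow> lift (u + v) = lift u \<oplus>\<^bsub>R\<^esub> lift v"
  using ring_hom_add[OF eta_ring_hom, of "W.SA.cls u" "W.SA.cls v"] W.SA.cls_add[of u v]
  by (simp add: lift_def W.SA.cls_closed W.symmetric_algebra_eq W.FP.A_simps(3))

lemma lift_mult: "\<lbrakk>u \<in> carrier W.FP; v \<in> carrier W.FP\<rbrakk> \<Longrightarrow> lift (u * v) = lift u \<otimes>\<^bsub>R\<^esub> lift v"
  using ring_hom_mult[OF eta_ring_hom, of "W.SA.cls u" "W.SA.cls v"] W.SA.cls_mult[of u v]
  by (simp add: lift_def W.SA.cls_closed W.symmetric_algebra_eq W.mult_FP)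

lemma lift_one: "lift 1 = \<one>\<^bsub>R\<^esub>"
  using ring_hom_one[OF eta_ring_hom] by (simp add: lift_def W.symmetric_algebra_eq W.SA.Q_simps(4) W.one_FP)

lemma lift_zero: "lift 0 = \<zero>\<^bsub>R\<^esub>"
proof -
  have "0 \<in> carrier W.FP" by (simp add: W.carrier_FP)
  hence "lift 0 \<oplus>\<^bsub>R\<^esub> lift 0 = lift 0" "lift 0 \<in> carrier R"
    using lift_add[of 0 0] lift_closed by simp_all
  thus ?thesis by (simp add: R.add.l_cancel_one')
qed

definition coords :: "'r \<Rightarrow> (nat, 'p) mpoly" where
  "coords r = V.coord_iso (\<pi> (\<phi> r))"

lemma coords_lift: "u \<in> carrier W.FP \<Longrightarrow> coords (lift u) = V.coord_map u"
  using induced_map_coords[OF induced] by (simp add: coords_def lift_def)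

lemma coords_add: "\<lbrakk>r \<in> carrier R; r' \<in> carrier R\<rbrakk> \<Longrightarrow> coords (r \<oplus>\<^bsub>R\<^esub> r') = coords r + coords r'"
  using ring_hom_add[OF phi_ring_hom, of r r'] ring_hom_add[OF pi_ring_hom, of "\<phi> r" "\<phi> r'"]
  by (simp add: coords_def phi_closed at.A.iso_add at.proj_closed)

lemma coords_in: "r \<in> carrier R \<Longrightarrow> coords r \<in> polys_in j"
  by (simp add: coords_def at.proj_in phi_closed)

lemma coords_uminus: "r \<in> carrier R \<Longrightarrow> coords (\<ominus>\<^bsub>R\<^esub> r) = - coords r"
proof -
  assume r: "r \<in> carrier R"
  have "\<zero>\<^bsub>R\<^esub> = \<zero>\<^bsub>R\<^esub> \<oplus>\<^bsub>R\<^esub> \<zero>\<^bsub>R\<^esub>" by simp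
  hence "coords \<zero>\<^bsub>R\<^esub> = coords \<zero>\<^bsub>R\<^esub> + coords \<zero>\<^bsub>R\<^esub>"
    by (metis coords_add R.zero_closed)
  hence "coords (\<ominus>\<^bsub>R\<^esub> r) + coords r = 0"
    using r coords_add[of "\<ominus>\<^bsub>R\<^esub> r" r] by (simp add: R.l_neg)
  thus ?thesis by (simp add: eq_neg_iff_add_eq_0)
qed

lemma coords_zero_nilpotent:
  "\<exists>d. \<forall>r\<in>carrier R. coords r = 0 \<longrightarrow> \<phi> (r [^]\<^bsub>R\<^esub> (d::nat)) = \<zero>\<^bsub>T\<^esub>"
proof -
  obtain d where d: "\<And>v. \<lbrakk>v \<in> carrier T; \<pi> v = \<zero>\<^bsub>PV\<^esub>\<rbrakk> \<Longrightarrow> v [^]\<^bsub>T\<^esub> (d::nat) = \<zero>\<^bsub>T\<^esub>"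
    using at.kernel_nilpotent by blast
  have pow: "\<phi> (r [^]\<^bsub>R\<^esub> (n::nat)) = \<phi> r [^]\<^bsub>T\<^esub> n" if "r \<in> carrier R" for r n
    using that by (induction n) (simp_all add: ring_hom_one[OF phi_ring_hom] ring_hom_mult[OF phi_ring_hom])
  have "\<phi> (r [^]\<^bsub>R\<^esub> d) = \<zero>\<^bsub>T\<^esub>" if r: "r \<in> carrier R" "coords r = 0" for r
  proof -
    have "V.coord_iso \<zero>\<^bsub>PV\<^esub> = 0"
      using at.A.iso_add[of "\<zero>\<^bsub>PV\<^esub>" "\<zero>\<^bsub>PV\<^esub>"] by simp
    hence "V.coord_iso (\<pi> (\<phi> r)) = V.coord_iso \<zero>\<^bsub>PV\<^esub>"
      using r by (simp add: coords_def)
    hence "\<pi> (\<phi> r) = \<zero>\<^bsub>PV\<^esub>"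
      using at.A.bij at.proj_closed[OF phi_closed[OF r(1)]] by (auto simp: bij_betw_def dest: inj_onD)
    thus ?thesis
      using d[OF phi_closed[OF r(1)]] pow r by simp
  qed
  thus ?thesis by blast
qed

text \<open>
  A section, up to linear relations, of the surjection \<open>P\<^sub>W \<rightarrow> P\<^sub>V\<close>.  It is extended to all variables, so that
  preimages of primes of \<open>R\<close> are primes of the polynomial ring in all variables.
\<close>

definition ambient_section :: "(nat, 'p) mpoly \<Rightarrow> ('w \<Rightarrow> 'p mod_ring, 'p) mpoly" where
  "ambient_section = substitute (\<lambda>i. var (if i < n then b i else (\<lambda>_. 0)))"

lemma ambient_section_closed: "ambient_section u \<in> carrier W.FP"
proof -
  have zero: "(\<lambda>_. 0) \<in> dual_space scale UNIV"
    by (simp add: dual_space_def)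
  have "Poly_Mapping.keys u \<subseteq> {m. set_mset m \<subseteq> UNIV}" by simp
  thus ?thesis
  proof (induction rule: mpoly_ring_induct)
    case zero
    show ?case by (simp add: ambient_section_def W.carrier_FP)
  qed (use b_dual zero in \<open>auto simp: ambient_section_def substitute_mult substitute_add
      intro!: W.mult_closed W.add_closed W.var_closed W.scalar_closed W.one_closed\<close>)
qed

lemma coords_section_var: "V.coord_map (ambient_section (var i)) = (if i < j then var i else 0)"
proof (cases "i < n")
  case True
  have "linear_form j (\<lambda>l. b i (e l)) = (\<Sum>l<j. if l = i then var i else 0)"
    unfolding linear_form_def using be[OF True] le by (intro sum.cong) auto
  thus ?thesis
    using True by (simp add: ambient_section_def V.coord_map_def)
next
  case False
  thus ?thesis
    using le by (simp add: ambient_section_def V.coord_map_def linear_form_def)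
qed

lemma coords_section: "u \<in> polys_in j \<Longrightarrow> V.coord_map (ambient_section u) = u"
proof -
  assume "u \<in> polys_in j"
  hence "Poly_Mapping.keys u \<subseteq> {m. set_mset m \<subseteq> {..<j}}"
    by (simp add: polys_in_iff)
  thus ?thesis
  proof (induction rule: mpoly_ring_induct)
    case (var i u)
    thus ?case
      using coords_section_var[of i]
      by (simp add: ambient_section_def V.coord_map_def substitute_mult)
  qed (simp_all add: ambient_section_def V.coord_map_def substitute_mult substitute_add)
qed

text \<open>
  The map \<open>R \<rightarrow> P\<^sub>V\<close> is onto, and every element of its kernel has a power in the kernel of \<open>\<phi>\<close>, which lies in all
  primes of the chain.  So the chain pulls back, along a section, to a chain of primes of the polynomial ring.
\<close>

lemma prime_chain_bound:
  assumes prime: "\<And>k. k \<le> m \<Longrightarrow> is_prime_ideal R (P k)"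
    and chain: "\<And>k. k < m \<Longrightarrow> P k \<subset> P (Suc k)"
    and ker: "\<And>r. \<lbrakk>r \<in> carrier R; \<phi> r = \<zero>\<^bsub>T\<^esub>\<rbrakk> \<Longrightarrow> r \<in> P 0"
  shows "m \<le> j"
proof -
  have P_ideal: "ideal (P k) R" and P_proper: "\<one>\<^bsub>R\<^esub> \<notin> P k"
    and P_prime: "\<And>x y. \<lbrakk>x \<in> carrier R; y \<in> carrier R; x \<otimes>\<^bsub>R\<^esub> y \<in> P k\<rbrakk> \<Longrightarrow> x \<in> P k \<or> y \<in> P k" if "k \<le> m" for k
    using prime[OF that] ideal.one_imp_carrier[of "P k" R] unfolding is_prime_ideal_def by blast+
  have P_sub: "P k \<subseteq> carrier R" if "k \<le> m" for k
    using ideal.Icarr[OF P_ideal[OF that]] by blast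
  have P_add: "x \<oplus>\<^bsub>R\<^esub> y \<in> P k" if "k \<le> m" "x \<in> P k" "y \<in> P k" for k x y
    using that additive_subgroup.a_closed[OF ideal.axioms(1)[OF P_ideal]] by blast
  have P_uminus: "\<ominus>\<^bsub>R\<^esub> x \<in> P k" if "k \<le> m" "x \<in> P k" for k x
    using that additive_subgroup.a_inv_closed[OF ideal.axioms(1)[OF P_ideal]] by blast
  have P0_sub: "P 0 \<subseteq> P k" if "k \<le> m" for k
    using that by (induction k) (use chain in \<open>auto dest: Suc_le_lessD\<close>)
  obtain d where d: "\<And>r. \<lbrakk>r \<in> carrier R; coords r = 0\<rbrakk> \<Longrightarrow> \<phi> (r [^]\<^bsub>R\<^esub> (d::nat)) = \<zero>\<^bsub>T\<^esub>"
    using coords_zero_nilpotent by blast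
  have coords_P0: "r \<in> P 0" if r: "r \<in> carrier R" "coords r = 0" for r
  proof -
    have "r [^]\<^bsub>R\<^esub> d \<in> P 0"
      using d[OF r] r by (intro ker) auto
    moreover have "r [^]\<^bsub>R\<^esub> k \<in> P 0 \<Longrightarrow> r \<in> P 0" for k :: nat
    proof (induction k)
      case 0
      thus ?case using P_proper[of 0] by simp
    next
      case (Suc k)
      thus ?case using P_prime[OF le0 R.nat_pow_closed[OF r(1)] r(1), of k] by auto
    qed
    ultimately show ?thesis by blast
  qed
  define \<theta> where "\<theta> = (\<lambda>u. lift (ambient_section u))"
  have \<theta>_closed: "\<theta> u \<in> carrier R" for u
    by (simp add: \<theta>_def lift_closed ambient_section_closed)
  have \<theta>_add: "\<theta> (u + v) = \<theta> u \<oplus>\<^bsub>R\<^esub> \<theta> v" for u v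
    using lift_add[OF ambient_section_closed ambient_section_closed, of u v]
    by (simp add: \<theta>_def ambient_section_def substitute_add)
  have \<theta>_mult: "\<theta> (u * v) = \<theta> u \<otimes>\<^bsub>R\<^esub> \<theta> v" for u v
    using lift_mult[OF ambient_section_closed ambient_section_closed, of u v]
    by (simp add: \<theta>_def ambient_section_def substitute_mult)
  have \<theta>_one: "\<theta> 1 = \<one>\<^bsub>R\<^esub>" and \<theta>_zero: "\<theta> 0 = \<zero>\<^bsub>R\<^esub>"
    by (simp_all add: \<theta>_def ambient_section_def lift_one lift_zero)
  have \<theta>_coords: "coords (\<theta> u) = V.coord_map (ambient_section u)" for u
    by (simp add: \<theta>_def coords_lift ambient_section_closed)
  show ?thesis
  proof (rule prime_chain_length[where P = "\<lambda>k. {u. \<theta> u \<in> P k}"])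
    fix k assume k: "k \<le> m"
    show "prime_subset {u. \<theta> u \<in> P k}"
      unfolding prime_subset_def
    proof (intro conjI)
      show "0 \<in> {u. \<theta> u \<in> P k}"
        using additive_subgroup.zero_closed[OF ideal.axioms(1)[OF P_ideal[OF k]]] by (simp add: \<theta>_zero)
      show "\<forall>u\<in>{u. \<theta> u \<in> P k}. \<forall>v\<in>{u. \<theta> u \<in> P k}. u + v \<in> {u. \<theta> u \<in> P k}"
        using P_add[OF k] by (simp add: \<theta>_add)
      show "\<forall>u\<in>{u. \<theta> u \<in> P k}. \<forall>v. v * u \<in> {u. \<theta> u \<in> P k}"
        using ideal.I_l_closed[OF P_ideal[OF k]] \<theta>_closed by (simp add: \<theta>_mult)
      show "1 \<notin> {u. \<theta> u \<in> P k}"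
        using P_proper[OF k] by (simp add: \<theta>_one)
      show "\<forall>u v. u * v \<in> {u. \<theta> u \<in> P k} \<longrightarrow> u \<in> {u. \<theta> u \<in> P k} \<or> v \<in> {u. \<theta> u \<in> P k}"
        using P_prime[OF k] \<theta>_closed by (simp add: \<theta>_mult)
    qed
  next
    fix k assume k: "k < m"
    then obtain r where r: "r \<in> P (Suc k)" "r \<notin> P k"
      using chain by blast
    have rc: "r \<in> carrier R" using r P_sub[of "Suc k"] k by auto
    define u where "u = coords r"
    have "coords (\<theta> u) = coords r"
      unfolding \<theta>_coords u_def by (rule coords_section[OF coords_in[OF rc]])
    hence "coords (\<theta> u \<oplus>\<^bsub>R\<^esub> (\<ominus>\<^bsub>R\<^esub> r)) = 0"
      using rc \<theta>_closed by (simp add: coords_add coords_uminus)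
    hence diff: "\<theta> u \<oplus>\<^bsub>R\<^esub> (\<ominus>\<^bsub>R\<^esub> r) \<in> P 0"
      using rc \<theta>_closed by (intro coords_P0) auto
    have "(\<theta> u \<oplus>\<^bsub>R\<^esub> (\<ominus>\<^bsub>R\<^esub> r)) \<oplus>\<^bsub>R\<^esub> r \<in> P (Suc k)"
      by (rule P_add) (use diff r k P0_sub[of "Suc k"] in auto)
    moreover have "(\<theta> u \<oplus>\<^bsub>R\<^esub> (\<ominus>\<^bsub>R\<^esub> r)) \<oplus>\<^bsub>R\<^esub> r = \<theta> u"
      using rc \<theta>_closed by (simp add: R.a_assoc R.l_neg)
    ultimately have "\<theta> u \<in> P (Suc k)" by simp
    moreover have "\<theta> u \<notin> P k"
    proof
      assume u: "\<theta> u \<in> P k"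
      have "\<ominus>\<^bsub>R\<^esub> (\<theta> u \<oplus>\<^bsub>R\<^esub> (\<ominus>\<^bsub>R\<^esub> r)) \<oplus>\<^bsub>R\<^esub> \<theta> u \<in> P k"
        by (rule P_add[OF _ P_uminus]) (use u diff k P0_sub[of k] in auto)
      moreover have "\<ominus>\<^bsub>R\<^esub> (\<theta> u \<oplus>\<^bsub>R\<^esub> (\<ominus>\<^bsub>R\<^esub> r)) \<oplus>\<^bsub>R\<^esub> \<theta> u = r"
        using rc \<theta>_closed[of u] by (simp add: R.minus_add R.a_comm[of "\<ominus>\<^bsub>R\<^esub> \<theta> u" r] R.a_assoc R.l_neg)
      ultimately show False using r by simp
    qed
    ultimately show "{u. \<theta> u \<in> P k} \<subset> {u. \<theta> u \<in> P (Suc k)}"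
      using chain[OF k] by blast
  next
    fix i assume "j \<le> i"
    hence "coords (\<theta> (var i)) = 0"
      unfolding \<theta>_coords coords_section_var by simp
    thus "var i \<in> {u. \<theta> u \<in> P 0}"
      using coords_P0[OF \<theta>_closed] by simp
  qed
qed

definition dickson :: "nat \<Rightarrow> 'r" where
  "dickson i = lift (dickson_lift i)"

lemma dickson_closed: "dickson i \<in> carrier R"
  by (simp add: dickson_def lift_closed dickson_lift_closed)

lemma dickson_commute: "dickson i \<otimes>\<^bsub>R\<^esub> dickson k = dickson k \<otimes>\<^bsub>R\<^esub> dickson i"
  using lift_mult[OF dickson_lift_closed dickson_lift_closed, of i k]
    lift_mult[OF dickson_lift_closed dickson_lift_closed, of k i]
  by (simp add: dickson_def mult.commute)

text \<open>
  The Dickson invariants of \<open>W\<close> restrict to \<open>q\<close>-th powers of those of \<open>V\<close>, whose twist provides the basis of \<open>P\<^sub>V\<close>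
  on which they act by shifts.
\<close>

lemma regular_T:
  assumes "s \<le> j"
  shows "commuting_operators T s (\<lambda>i v. \<phi> (dickson i) \<otimes>\<^bsub>T\<^esub> v)"
    and "weakly_regular T s (\<lambda>i v. \<phi> (dickson i) \<otimes>\<^bsub>T\<^esub> v) (carrier T) {\<zero>\<^bsub>T\<^esub>}"
    and "op_multiples T (\<lambda>i v. \<phi> (dickson i) \<otimes>\<^bsub>T\<^esub> v) (carrier T) {\<zero>\<^bsub>T\<^esub>} s \<noteq> carrier T"
proof -
  obtain G where G: "dickson_system j q G" "\<And>i. i < j \<Longrightarrow> V.coord_map (dickson_lift i) = G (j - 1 - i)"
    using dickson_system_exists by blast
  interpret D: dickson_system j q G by (rule G(1))
  interpret A: augmented_tensor PV j V.coord_iso N D.dickson_twist \<epsilon> \<pi>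
    by (rule augmented_tensor[OF D.dickson_twist_bij D.dickson_twist_add D.dickson_twist_scalar])
  interpret reg: regular_tensor PV j V.coord_iso N D.dickson_twist \<epsilon> \<pi> s "\<lambda>i. \<phi> (dickson i)"
    "\<lambda>i. V.coord_map (dickson_lift i)" D.D "\<lambda>i. j - 1 - i"
  proof (intro regular_tensor.intro regular_tensor_axioms.intro A.augmented_tensor_axioms)
    show "inj_on (\<lambda>i. j - 1 - i) {..<s}"
      using assms by (auto simp: inj_on_def)
    fix i assume i: "i < s"
    thus less: "j - 1 - i < j" using assms by simp
    show "D.D (j - 1 - i) > 0"
      by (rule D.D_pos[OF less])
    show "D.dickson_twist (Poly_Mapping.single (replicate_mset (D.D (j - 1 - i)) (j - 1 - i)) 1 * u) =
        V.coord_map (dickson_lift i) * D.dickson_twist u" for u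
      using D.dickson_twist_g[OF less] G(2)[of i] i assms by simp
    show "\<phi> (dickson i) \<in> carrier T"
      by (rule phi_closed[OF dickson_closed])
    show "\<phi> (dickson i) \<otimes>\<^bsub>T\<^esub> \<phi> (dickson i') = \<phi> (dickson i') \<otimes>\<^bsub>T\<^esub> \<phi> (dickson i)" for i'
      using ring_hom_mult[OF phi_ring_hom dickson_closed dickson_closed, of i i']
        ring_hom_mult[OF phi_ring_hom dickson_closed dickson_closed, of i' i] dickson_commute[of i i'] by simp
    show "V.coord_iso (\<pi> (\<phi> (dickson i))) = V.coord_map (dickson_lift i)"
      using coords_lift[OF dickson_lift_closed, of i] by (simp add: coords_def dickson_def)
  qed simp
  have op: "reg.op = (\<lambda>i v. \<phi> (dickson i) \<otimes>\<^bsub>T\<^esub> v)"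
    by (simp add: reg.op_def fun_eq_iff)
  show "commuting_operators T s (\<lambda>i v. \<phi> (dickson i) \<otimes>\<^bsub>T\<^esub> v)"
    using reg.ops.commuting_operators_axioms by (simp add: op)
  show "weakly_regular T s (\<lambda>i v. \<phi> (dickson i) \<otimes>\<^bsub>T\<^esub> v) (carrier T) {\<zero>\<^bsub>T\<^esub>}"
    using reg.weakly_regular_T by (simp add: op)
  show "op_multiples T (\<lambda>i v. \<phi> (dickson i) \<otimes>\<^bsub>T\<^esub> v) (carrier T) {\<zero>\<^bsub>T\<^esub>} s \<noteq> carrier T"
    using reg.op_multiples_T by (simp add: op)
qed

end

section \<open>Submodules and direct sums\<close>

lemma restrict_to_simps [simp]:
  "carrier (restrict_to M H) = H" "x \<oplus>\<^bsub>restrict_to M H\<^esub> y = x \<oplus>\<^bsub>M\<^esub> y" "\<zero>\<^bsub>restrict_to M H\<^esub> = \<zero>\<^bsub>M\<^esub>"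
  "a \<odot>\<^bsub>restrict_to M H\<^esub> x = a \<odot>\<^bsub>M\<^esub> x"
  by (simp_all add: restrict_to_def)

lemma abelian_group_restrict_to:
  assumes "abelian_group M" "additive_subgroup H M"
  shows "abelian_group (restrict_to M H)"
proof -
  interpret abelian_group M by fact
  note H = additive_subgroup.a_subset[OF assms(2)] additive_subgroup.a_closed[OF assms(2)]
    additive_subgroup.zero_closed[OF assms(2)] additive_subgroup.a_inv_closed[OF assms(2)]
  show ?thesis
  proof (rule abelian_groupI)
    fix x assume "x \<in> carrier (restrict_to M H)"
    thus "\<exists>y\<in>carrier (restrict_to M H). y \<oplus>\<^bsub>restrict_to M H\<^esub> x = \<zero>\<^bsub>restrict_to M H\<^esub>"
      using H by (intro bexI[of _ "\<ominus>\<^bsub>M\<^esub> x"]) (auto simp: l_neg)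
  qed (use H in \<open>auto simp: a_ac subsetD[OF H(1)]\<close>)
qed

lemma additive_subgroup_restrict_to:
  assumes "abelian_group M" "additive_subgroup H M" "additive_subgroup K M" "K \<subseteq> H"
  shows "additive_subgroup K (restrict_to M H)"
proof -
  interpret abelian_group "restrict_to M H" by (rule abelian_group_restrict_to[OF assms(1,2)])
  interpret M: abelian_group M by fact
  note K = additive_subgroup.a_subset[OF assms(3)] additive_subgroup.a_closed[OF assms(3)]
    additive_subgroup.zero_closed[OF assms(3)] additive_subgroup.a_inv_closed[OF assms(3)]
  have "\<ominus>\<^bsub>restrict_to M H\<^esub> x \<in> K" if "x \<in> K" for x
  proof -
    have "\<ominus>\<^bsub>restrict_to M H\<^esub> x = \<ominus>\<^bsub>M\<^esub> x"
      using that K assms(4) by (intro minus_equality) (auto simp: M.l_neg)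
    thus ?thesis using K that by simp
  qed
  thus ?thesis
    using K assms(4) by (intro additive_subgroup.intro add.subgroupI) (auto simp: a_inv_def)
qed

locale finite_direct_sum = abelian_group Q for Q :: "('b, 'z) ring_scheme" (structure) +
  fixes D :: "nat \<Rightarrow> 'b set" and n :: nat
  assumes direct: "internal_direct_sum Q D {..<n}"
begin

lemma summand_subgroup: "i < n \<Longrightarrow> additive_subgroup (D i) Q"
  using direct by (simp add: internal_direct_sum_def)

lemma summand_closed:
  "i < n \<Longrightarrow> D i \<subseteq> carrier Q" "i < n \<Longrightarrow> \<zero> \<in> D i"
  using summand_subgroup additive_subgroup.a_subset additive_subgroup.zero_closed by blast+

lemma decomposition_unique:
  assumes "\<And>i. i < n \<Longrightarrow> f i \<in> D i" "\<And>i. i < n \<Longrightarrow> g i \<in> D i"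
    "(\<Oplus>i\<in>{..<n}. f i) = (\<Oplus>i\<in>{..<n}. g i)" "i < n"
  shows "f i = g i"
proof -
  define ext where "ext = (\<lambda>f i. if i < n then f i else \<zero>)"
  have ext: "(\<forall>i\<in>{..<n}. ext f i \<in> D i) \<and> (\<forall>i. i \<notin> {..<n} \<longrightarrow> ext f i = \<zero>) \<and> finite {i. ext f i \<noteq> \<zero>} \<and>
      (\<Oplus>i\<in>{..<n}. f i) = (\<Oplus>i\<in>{i. ext f i \<noteq> \<zero>}. ext f i)" if "\<And>i. i < n \<Longrightarrow> f i \<in> D i" for f
  proof -
    have c: "f i \<in> carrier Q" if "i < n" for i
      using that \<open>\<And>i. i < n \<Longrightarrow> f i \<in> D i\<close> summand_closed by blast
    have "{i. ext f i \<noteq> \<zero>} \<subseteq> {..<n}"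
      by (auto simp: ext_def)
    moreover have "(\<Oplus>i\<in>{..<n}. f i) = (\<Oplus>i\<in>{i. ext f i \<noteq> \<zero>}. ext f i)"
      by (rule add.finprod_mono_neutral_cong_right) (use c in \<open>auto simp: ext_def split: if_splits\<close>)
    ultimately show ?thesis
      using that finite_subset by (auto simp: ext_def)
  qed
  have "(\<Oplus>i\<in>{..<n}. f i) \<in> carrier Q"
    using assms(1) summand_closed(1) by (intro finsum_closed) blast
  hence ex1: "\<exists>!h. (\<forall>i\<in>{..<n}. h i \<in> D i) \<and> (\<forall>i. i \<notin> {..<n} \<longrightarrow> h i = \<zero>) \<and> finite {i. h i \<noteq> \<zero>} \<and>
      (\<Oplus>i\<in>{..<n}. f i) = (\<Oplus>i\<in>{i. h i \<noteq> \<zero>}. h i)"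
    using direct by (simp add: internal_direct_sum_def)
  have "ext f = ext g"
  proof -
    have "(\<forall>i\<in>{..<n}. ext f i \<in> D i) \<and> (\<forall>i. i \<notin> {..<n} \<longrightarrow> ext f i = \<zero>) \<and> finite {i. ext f i \<noteq> \<zero>} \<and>
        (\<Oplus>i\<in>{..<n}. f i) = (\<Oplus>i\<in>{i. ext f i \<noteq> \<zero>}. ext f i)"
      using assms(1) by (rule ext)
    moreover have "(\<forall>i\<in>{..<n}. ext g i \<in> D i) \<and> (\<forall>i. i \<notin> {..<n} \<longrightarrow> ext g i = \<zero>) \<and> finite {i. ext g i \<noteq> \<zero>} \<and>
        (\<Oplus>i\<in>{..<n}. f i) = (\<Oplus>i\<in>{i. ext g i \<noteq> \<zero>}. ext g i)"
      unfolding assms(3) using assms(2) by (rule ext)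
    ultimately show ?thesis
      using ex1 by blast
  qed
  thus ?thesis
    using assms(4) by (auto simp: ext_def dest: fun_cong[of _ _ i])
qed

lemma decomposition_exists:
  assumes "x \<in> carrier Q"
  shows "\<exists>f. (\<forall>i<n. f i \<in> D i) \<and> x = (\<Oplus>i\<in>{..<n}. f i)"
proof -
  have "\<exists>f. (\<forall>i\<in>{..<n}. f i \<in> D i) \<and> (\<forall>i. i \<notin> {..<n} \<longrightarrow> f i = \<zero>) \<and> finite {i. f i \<noteq> \<zero>} \<and>
      x = (\<Oplus>i\<in>{i. f i \<noteq> \<zero>}. f i)"
    using direct assms unfolding internal_direct_sum_def by blast
  then obtain f where f: "\<forall>i\<in>{..<n}. f i \<in> D i" "\<forall>i. i \<notin> {..<n} \<longrightarrow> f i = \<zero>"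
    "x = (\<Oplus>i\<in>{i. f i \<noteq> \<zero>}. f i)"
    by blast
  have "f i \<in> carrier Q" if "i < n" for i
    using f(1) that summand_closed(1)[of i] by auto
  hence "(\<Oplus>i\<in>{..<n}. f i) = (\<Oplus>i\<in>{i. f i \<noteq> \<zero>}. f i)"
    by (intro add.finprod_mono_neutral_cong_right) (use f(2) in auto)
  thus ?thesis using f by auto
qed

text \<open>The partial sums filter the direct sum, with the summands as quotients.\<close>

definition partial_sum :: "nat \<Rightarrow> 'b set" where
  "partial_sum a = {\<Oplus>i\<in>{..<a}. f i | f. \<forall>i<a. f i \<in> D i}"

lemma partial_sum_0: "partial_sum 0 = {\<zero>}"
  by (simp add: partial_sum_def)

lemma partial_sum_Suc:
  assumes "a < n"
  shows "partial_sum (Suc a) = {d \<oplus> p | d p. d \<in> D a \<and> p \<in> partial_sum a}"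
proof (intro equalityI subsetI)
  fix x assume "x \<in> partial_sum (Suc a)"
  then obtain f where f: "\<forall>i<Suc a. f i \<in> D i" "x = (\<Oplus>i\<in>{..<Suc a}. f i)"
    by (auto simp: partial_sum_def)
  have c: "f i \<in> carrier Q" if "i < Suc a" for i
    using f that assms summand_closed(1)[of i] by auto
  have "x = f a \<oplus> (\<Oplus>i\<in>{..<a}. f i)"
    unfolding f(2) lessThan_Suc using c by (subst finsum_insert) auto
  thus "x \<in> {d \<oplus> p | d p. d \<in> D a \<and> p \<in> partial_sum a}"
    unfolding partial_sum_def using f(1)
    by (intro CollectI exI[of _ "f a"] exI[of _ "\<Oplus>i\<in>{..<a}. f i"] conjI exI[of _ f]) auto
next
  fix x assume "x \<in> {d \<oplus> p | d p. d \<in> D a \<and> p \<in> partial_sum a}"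
  then obtain d f where f: "d \<in> D a" "\<forall>i<a. f i \<in> D i" "x = d \<oplus> (\<Oplus>i\<in>{..<a}. f i)"
    by (auto simp: partial_sum_def)
  have c: "f i \<in> carrier Q" if "i < a" for i
    using f that assms summand_closed(1)[of i] by auto
  have dc: "d \<in> carrier Q"
    using f assms summand_closed(1)[of a] by auto
  have "(\<Oplus>i\<in>{..<Suc a}. (f(a := d)) i) = d \<oplus> (\<Oplus>i\<in>{..<a}. (f(a := d)) i)"
    unfolding lessThan_Suc using c dc by (subst finsum_insert) auto
  also have "(\<Oplus>i\<in>{..<a}. (f(a := d)) i) = (\<Oplus>i\<in>{..<a}. f i)"
    using c by (intro finsum_cong') auto
  finally have "x = (\<Oplus>i\<in>{..<Suc a}. (f(a := d)) i)"
    using f(3) by (simp only:)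
  moreover have "\<forall>i<Suc a. (f(a := d)) i \<in> D i"
    using f by auto
  ultimately show "x \<in> partial_sum (Suc a)"
    unfolding partial_sum_def by blast
qed

lemma partial_sum_n: "partial_sum n = carrier Q"
proof (intro equalityI subsetI)
  fix x assume "x \<in> partial_sum n"
  thus "x \<in> carrier Q"
    unfolding partial_sum_def using summand_closed(1) by (auto intro!: finsum_closed)
qed (use decomposition_exists in \<open>auto simp: partial_sum_def\<close>)

lemma partial_sum_disjoint:
  assumes "a < n"
  shows "D a \<inter> partial_sum a = {\<zero>}"
proof (intro equalityI subsetI)
  fix x assume x: "x \<in> D a \<inter> partial_sum a"
  then obtain f where f: "\<forall>i<a. f i \<in> D i" "x = (\<Oplus>i\<in>{..<a}. f i)"
    by (auto simp: partial_sum_def)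
  have c: "f i \<in> carrier Q" if "i < a" for i
    using f that assms summand_closed(1)[of i] by auto
  have xc: "x \<in> carrier Q"
    using x assms summand_closed(1)[of a] by auto
  let ?f = "\<lambda>i. if i < a then f i else \<zero>" and ?g = "\<lambda>i. if i = a then x else \<zero>"
  have "(\<Oplus>i\<in>{..<n}. ?f i) = (\<Oplus>i\<in>{..<a}. f i)"
    by (rule add.finprod_mono_neutral_cong_right) (use c assms in auto)
  also have "\<dots> = (\<Oplus>i\<in>{a}. ?g i)"
    using xc f by (simp add: finsum_insert)
  also have "\<dots> = (\<Oplus>i\<in>{..<n}. ?g i)"
    by (rule add.finprod_mono_neutral_cong_left) (use xc assms in auto)
  finally have "?f a = ?g a"
    by (rule decomposition_unique[rotated 2]) (use f x assms summand_closed in auto)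
  thus "x \<in> {\<zero>}" by simp
next
  fix x assume "x \<in> {\<zero>}"
  moreover have "\<zero> = (\<Oplus>i\<in>{..<a}. \<zero>)" by simp
  hence "\<zero> \<in> partial_sum a"
    unfolding partial_sum_def using assms summand_closed(2) by (intro CollectI exI[of _ "\<lambda>_. \<zero>"]) auto
  ultimately show "x \<in> D a \<inter> partial_sum a"
    using assms summand_closed(2) by auto
qed

lemma direct_sum_induct [consumes 1, case_names zero summand add]:
  assumes "x \<in> carrier Q" "P \<zero>" "\<And>i x. \<lbrakk>i < n; x \<in> D i\<rbrakk> \<Longrightarrow> P x"
    "\<And>x y. \<lbrakk>x \<in> carrier Q; y \<in> carrier Q; P x; P y\<rbrakk> \<Longrightarrow> P (x \<oplus> y)"
  shows "P x"
proof -
  have "\<forall>x\<in>partial_sum a. x \<in> carrier Q \<and> P x" if "a \<le> n" for a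
    using that
  proof (induction a)
    case 0
    thus ?case using assms(2) by (simp add: partial_sum_0)
  next
    case (Suc a)
    hence "a < n" by simp
    show ?case
    proof
      fix x assume "x \<in> partial_sum (Suc a)"
      then obtain d p where x: "d \<in> D a" "p \<in> partial_sum a" "x = d \<oplus> p"
        using partial_sum_Suc[OF \<open>a < n\<close>] by auto
      have "d \<in> carrier Q" "P d" "p \<in> carrier Q" "P p"
        using x(1,2) Suc assms(3)[OF \<open>a < n\<close>] summand_closed(1)[of a] by auto
      thus "x \<in> carrier Q \<and> P x"
        using x assms(4) by auto
    qed
  qed
  thus ?thesis
    using assms(1) partial_sum_n by blast
qed

end

locale direct_sum_operators = finite_direct_sum Q D n + commuting_operators Q s f
  for Q :: "('b, 'z) ring_scheme" (structure) and D n s f +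
  assumes stable: "a < n \<Longrightarrow> stable_subgroup (D a)"
    and regular: "a < n \<Longrightarrow> weakly_regular Q s f (D a) {\<zero>}"
begin

lemma stable_zero: "stable_subgroup {\<zero>}"
  by (rule stable_subgroupI) (auto simp: op_zero minus_equality)

lemma partial_sum_Suc': "a < n \<Longrightarrow> partial_sum (Suc a) = set_sum (D a) (partial_sum a)"
  by (simp add: partial_sum_Suc set_sum_def)

lemma stable_partial_sum: "a \<le> n \<Longrightarrow> stable_subgroup (partial_sum a)"
proof (induction a)
  case 0
  thus ?case by (simp add: partial_sum_0 stable_zero)
next
  case (Suc a)
  thus ?case by (simp add: partial_sum_Suc' stable stable_subgroup_sum)
qed

lemma regular_partial_sum: "a \<le> n \<Longrightarrow> weakly_regular Q s f (partial_sum a) {\<zero>}"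
proof (induction a)
  case 0
  have "{\<zero>} \<subseteq> op_multiples Q f {\<zero>} {\<zero>} i" if "i < s" for i
    using stable_op_multiples[OF stable_zero stable_zero order.refl, of i] that by simp
  thus ?case by (auto simp: weakly_regular_def partial_sum_0)
next
  case (Suc a)
  hence a: "a < n" by simp
  have st: "stable_subgroup (partial_sum a)" "stable_subgroup (D a)"
    using a by (auto intro: stable_partial_sum stable)
  have reg: "weakly_regular Q s f (set_sum (D a) (partial_sum a)) (partial_sum a)"
    using regular[OF a] by (intro weakly_regular_sum st) (simp add: partial_sum_disjoint[OF a])
  show ?case
    unfolding partial_sum_Suc'[OF a]
    by (rule weakly_regular_extension[OF stable_subgroup_sum(1)[OF st(2,1)] stable_zero st(1) _
          stable_subgroup_sum(3)[OF st(2,1)] reg])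
      (use Suc stable_subgroupD(2)[OF st(1)] in auto)
qed

lemma regular_direct_sum: "weakly_regular Q s f (carrier Q) {\<zero>}"
  using regular_partial_sum[of n] by (simp add: partial_sum_n)

text \<open>The direct sum projects onto its last summand, compatibly with the operators.\<close>

lemma proper_direct_sum:
  assumes a: "n = Suc a" and proper: "op_multiples Q f (D a) {\<zero>} s \<noteq> D a"
  shows "op_multiples Q f (carrier Q) {\<zero>} s \<noteq> carrier Q"
proof
  assume eq: "op_multiples Q f (carrier Q) {\<zero>} s = carrier Q"
  have an: "a < n" using a by simp
  have st: "stable_subgroup (partial_sum a)" "stable_subgroup (D a)"
    using an by (auto intro: stable_partial_sum stable)
  have Q: "carrier Q = set_sum (D a) (partial_sum a)"
    using partial_sum_n partial_sum_Suc'[OF an] by (simp add: a)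
  let ?E = "op_multiples Q f (D a) {\<zero>} s"
  have E: "stable_subgroup ?E" "?E \<subseteq> D a"
    using stable_op_multiples[OF st(2) stable_zero _ order.refl] stable_subgroupD(2)[OF st(2)] by auto
  have "carrier Q \<subseteq> op_multiples Q f (carrier Q) (partial_sum a) s"
    using op_multiples_mono[of "carrier Q" "carrier Q" "{\<zero>}" "partial_sum a" s]
      stable_subgroupD(2)[OF st(1)] eq by auto
  hence sub: "carrier Q \<subseteq> set_sum ?E (partial_sum a)"
    using op_multiples_set_sum[OF st(2,1) order.refl] partial_sum_disjoint[OF an] by (simp flip: Q)
  have "D a \<subseteq> ?E"
  proof
    fix d assume d: "d \<in> D a"
    hence "d \<in> carrier Q" using stable_subgroupD(1)[OF st(2)] by auto
    then obtain x p where x: "x \<in> ?E" "p \<in> partial_sum a" "d = x \<oplus> p"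
      using sub by (auto simp: set_sum_def)
    have c: "x \<in> carrier Q" "p \<in> carrier Q"
      using x E stable_subgroupD(1)[OF st(1)] stable_subgroupD(1)[OF st(2)] by auto
    have "d \<ominus> x = p"
      using x(3) c by (rule_tac add_eq_imp_diff') auto
    moreover have "d \<ominus> x \<in> D a"
      using d x E stable_subgroupD(5)[OF st(2)] by auto
    ultimately have "p \<in> D a \<inter> partial_sum a"
      using x by auto
    hence "p = \<zero>"
      using partial_sum_disjoint[OF an] by auto
    thus "d \<in> ?E" using x c by simp
  qed
  thus False using proper E by auto
qed

end

section \<open>Free modules\<close>

context ambient
begin

definition dickson_elt :: "((('w \<Rightarrow> 'p mod_ring) multiset \<Rightarrow>\<^sub>0 'p mod_ring) set \<Rightarrow> 'r) \<Rightarrow> nat \<Rightarrow> 'r" where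
  "dickson_elt \<eta> i = \<eta> (W.SA.cls (dickson_lift i))"

lemma j_free_data:
  fixes R :: "('p mod_ring, 'r) graded" and M :: "('r, 'm) graded"
  assumes R: "graded_commutative_algebra R" and eta: "\<eta> \<in> graded_algebra_hom PW R"
    and free: "j_free scale R \<eta> j M"
  obtains V e b and N :: "('p mod_ring, 'm) graded" and \<phi> \<pi> h
  where "free_module_data scale Basis V e b R N \<eta> \<phi> \<pi>" "vs.dim V = j"
    "bij_betw h (carrier M) (carrier (tensor_algebra (symmetric_algebra scale V) N))"
    "\<And>x y. \<lbrakk>x \<in> carrier M; y \<in> carrier M\<rbrakk> \<Longrightarrow>
      h (x \<oplus>\<^bsub>M\<^esub> y) = h x \<oplus>\<^bsub>tensor_algebra (symmetric_algebra scale V) N\<^esub> h y"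
    "\<And>r x. \<lbrakk>r \<in> carrier R; x \<in> carrier M\<rbrakk> \<Longrightarrow>
      h (r \<odot>\<^bsub>M\<^esub> x) = \<phi> r \<otimes>\<^bsub>tensor_algebra (symmetric_algebra scale V) N\<^esub> h x"
proof -
  from free[unfolded j_free_def] obtain V and N :: "('p mod_ring, 'm) graded" and \<phi> \<pi> d h
    where V: "vs.subspace V" "vs.dim V = j"
      and N: "graded_commutative_algebra N" "connected_algebra N" "bounded_algebra N"
      and maps: "\<phi> \<in> graded_algebra_hom R (tensor_algebra (symmetric_algebra scale V) N)"
        "is_tensor_augmentation (symmetric_algebra scale V) N \<pi>"
        "is_induced_map scale V UNIV (\<pi> \<circ> \<phi> \<circ> \<eta>)"
      and h: "h \<in> graded_module_iso R M
          (suspension d (module_via \<phi> (tensor_algebra (symmetric_algebra scale V) N)))"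
    by (elim exE conjE)
  obtain e b where eb: "adapted_basis scale Basis V e b"
    using adapted_basis_exists[OF fd V(1)] by blast
  have "free_module_data scale Basis V e b R N \<eta> \<phi> \<pi>"
    by (intro free_module_data.intro free_module_data_axioms.intro subspace_in_ambient.intro
        subspace_in_ambient_axioms.intro ambient_axioms R N V eb eta maps)
  thus ?thesis
    by (rule that) (use V h in \<open>auto simp: graded_module_iso_def suspension_def module_via_def\<close>)
qed

text \<open>
  The kernel of \<open>\<phi>\<close> annihilates the module \<open>P\<^sub>V \<otimes> N\<close>, so it is contained in all primes of the chain.
\<close>

lemma j_free_prime_chain:
  assumes R: "graded_commutative_algebra R" and eta: "\<eta> \<in> graded_algebra_hom PW R"
    and free: "j_free scale R \<eta> j M"
    and M: "abelian_group M" "\<And>r x. \<lbrakk>r \<in> carrier R; x \<in> carrier M\<rbrakk> \<Longrightarrow> r \<odot>\<^bsub>M\<^esub> x \<in> carrier M"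
    and prime: "\<And>k. k \<le> m \<Longrightarrow> is_prime_ideal R (P k)"
    and chain: "\<And>k. k < m \<Longrightarrow> P k \<subset> P (Suc k)"
    and ann: "annihilator R M \<subseteq> P 0"
  shows "m \<le> j"
proof (rule j_free_data[OF R eta free])
  fix V e b N \<phi> \<pi> h
  assume data: "free_module_data scale Basis V e b R N \<eta> \<phi> \<pi>" "vs.dim V = j"
  let ?T = "tensor_algebra (symmetric_algebra scale V) N"
  assume h: "bij_betw h (carrier M) (carrier ?T)"
    "\<And>x y. \<lbrakk>x \<in> carrier M; y \<in> carrier M\<rbrakk> \<Longrightarrow> h (x \<oplus>\<^bsub>M\<^esub> y) = h x \<oplus>\<^bsub>?T\<^esub> h y"
    "\<And>r x. \<lbrakk>r \<in> carrier R; x \<in> carrier M\<rbrakk> \<Longrightarrow> h (r \<odot>\<^bsub>M\<^esub> x) = \<phi> r \<otimes>\<^bsub>?T\<^esub> h x"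
  interpret free_module_data scale Basis V e b R N \<eta> \<phi> \<pi> by (rule data)
  interpret M: abelian_group M by (rule M)
  have hc: "h x \<in> carrier ?T" if "x \<in> carrier M" for x
    using h(1) that by (auto simp: bij_betw_def)
  have "h \<zero>\<^bsub>M\<^esub> \<oplus>\<^bsub>?T\<^esub> h \<zero>\<^bsub>M\<^esub> = h \<zero>\<^bsub>M\<^esub>"
    using h(2)[of "\<zero>\<^bsub>M\<^esub>" "\<zero>\<^bsub>M\<^esub>"] by simp
  hence h0: "h \<zero>\<^bsub>M\<^esub> = \<zero>\<^bsub>?T\<^esub>"
    using hc[of "\<zero>\<^bsub>M\<^esub>"] by (simp add: at.T.add.l_cancel_one')
  have "vs.dim V \<ge> m"
  proof (rule prime_chain_bound[of m P])
    fix r assume r: "r \<in> carrier R" "\<phi> r = \<zero>\<^bsub>?T\<^esub>"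
    have "r \<odot>\<^bsub>M\<^esub> x = \<zero>\<^bsub>M\<^esub>" if x: "x \<in> carrier M" for x
    proof -
      have "h (r \<odot>\<^bsub>M\<^esub> x) = h \<zero>\<^bsub>M\<^esub>"
        using h(3)[OF r(1) x] hc[OF x] by (simp add: r h0)
      thus ?thesis
        using h(1) M(2)[OF r(1) x] M.zero_closed unfolding bij_betw_def by (meson inj_onD)
    qed
    hence "r \<in> annihilator R M"
      using r by (simp add: annihilator_def)
    thus "r \<in> P 0" using ann by blast
  qed (use prime chain in auto)
  thus ?thesis using data by simp
qed

text \<open>
  Regularity is transported along the isomorphism to \<open>P\<^sub>V \<otimes> N\<close>.  The group \<open>G\<close> is an ambient group with the
  same addition as the module on \<open>H\<close>, so that several summands of one module can be treated together.
\<close>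

lemma j_free_regular:
  fixes G :: "('m, 'z) ring_scheme"
  assumes R: "graded_commutative_algebra R" and eta: "\<eta> \<in> graded_algebra_hom PW R"
    and free: "j_free scale R \<eta> j M" and s: "s \<le> j"
    and G: "commuting_operators G s f" and H: "commuting_operators.stable_subgroup G s f H"
    and M: "carrier M = H" "\<And>x y. x \<oplus>\<^bsub>M\<^esub> y = x \<oplus>\<^bsub>G\<^esub> y"
      "\<And>i x. \<lbrakk>i < s; x \<in> H\<rbrakk> \<Longrightarrow> f i x = dickson_elt \<eta> i \<odot>\<^bsub>M\<^esub> x"
  shows "weakly_regular G s f H {\<zero>\<^bsub>G\<^esub>} \<and> op_multiples G f H {\<zero>\<^bsub>G\<^esub>} s \<noteq> H \<and> j \<le> n"
proof (rule j_free_data[OF R eta free])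
  fix V e b N \<phi> \<pi> h
  assume data: "free_module_data scale Basis V e b R N \<eta> \<phi> \<pi>" "vs.dim V = j"
  let ?T = "tensor_algebra (symmetric_algebra scale V) N"
  assume h: "bij_betw h (carrier M) (carrier ?T)"
    "\<And>x y. \<lbrakk>x \<in> carrier M; y \<in> carrier M\<rbrakk> \<Longrightarrow> h (x \<oplus>\<^bsub>M\<^esub> y) = h x \<oplus>\<^bsub>?T\<^esub> h y"
    "\<And>r x. \<lbrakk>r \<in> carrier R; x \<in> carrier M\<rbrakk> \<Longrightarrow> h (r \<odot>\<^bsub>M\<^esub> x) = \<phi> r \<otimes>\<^bsub>?T\<^esub> h x"
  interpret F: free_module_data scale Basis V e b R N \<eta> \<phi> \<pi> by (rule data)
  interpret G: commuting_operators G s f by (rule G)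
  define f' where "f' = (\<lambda>i v. \<phi> (F.dickson i) \<otimes>\<^bsub>?T\<^esub> v)"
  have s': "s \<le> F.j" using s data by simp
  note reg = F.regular_T[OF s', folded f'_def]
  interpret T: commuting_operators ?T s f' by (rule reg)
  have onto: "h ` H = carrier ?T"
    using h(1) M by (simp add: bij_betw_def)
  have hc: "h x \<in> carrier ?T" if "x \<in> H" for x
    using onto that by auto
  have stT: "T.stable_subgroup (carrier ?T)" "T.stable_subgroup {\<zero>\<^bsub>?T\<^esub>}"
    by (rule T.stable_subgroupI, auto simp: T.op_closed T.op_zero F.at.T.minus_equality)+
  have zH: "\<zero>\<^bsub>G\<^esub> \<in> H" by (rule G.stable_subgroupD(2)[OF H])
  have "h \<zero>\<^bsub>G\<^esub> \<oplus>\<^bsub>?T\<^esub> h \<zero>\<^bsub>G\<^esub> = h \<zero>\<^bsub>G\<^esub>"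
    using h(2)[of "\<zero>\<^bsub>G\<^esub>" "\<zero>\<^bsub>G\<^esub>"] zH M by simp
  hence h0: "h \<zero>\<^bsub>G\<^esub> = \<zero>\<^bsub>?T\<^esub>"
    using hc[OF zH] by (simp add: F.at.T.add.l_cancel_one')
  have K: "{\<zero>\<^bsub>G\<^esub>} = {x \<in> H. h x \<in> {\<zero>\<^bsub>?T\<^esub>}}"
  proof -
    have inj: "inj_on h H"
      using h(1) M(1) by (simp add: bij_betw_def)
    have "x = \<zero>\<^bsub>G\<^esub>" if "x \<in> H" "h x = \<zero>\<^bsub>?T\<^esub>" for x
      by (rule inj_onD[OF inj _ that(1) zH]) (simp only: that(2) h0)
    hence "{x \<in> H. h x \<in> {\<zero>\<^bsub>?T\<^esub>}} \<subseteq> {\<zero>\<^bsub>G\<^esub>}" by blast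
    moreover have "{\<zero>\<^bsub>G\<^esub>} \<subseteq> {x \<in> H. h x \<in> {\<zero>\<^bsub>?T\<^esub>}}" by (simp only: h0 zH mem_Collect_eq insert_subset empty_subsetI singleton_iff simp_thms)
    ultimately show ?thesis by (rule equalityI[rotated])
  qed
  have add: "h (x \<oplus>\<^bsub>G\<^esub> y) = h x \<oplus>\<^bsub>?T\<^esub> h y" if "x \<in> H" "y \<in> H" for x y
    using h(2)[of x y] that M by simp
  have op: "h (f i x) = f' i (h x)" if "i < s" "x \<in> H" for i x
    using h(3)[OF F.dickson_closed[of i], of x] that M
    by (simp add: f'_def F.dickson_def F.lift_def dickson_elt_def)
  have sub: "{\<zero>\<^bsub>?T\<^esub>} \<subseteq> carrier ?T" by simp
  have "weakly_regular G s f H {\<zero>\<^bsub>G\<^esub>}"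
    by (rule weakly_regular_preimage[OF G reg(1) H stT(1) onto add op K sub stT(2) reg(2)])
  moreover have eq: "op_multiples G f H {\<zero>\<^bsub>G\<^esub>} s = {x \<in> H. h x \<in> op_multiples ?T f' (carrier ?T) {\<zero>\<^bsub>?T\<^esub>} s}"
    by (rule op_multiples_preimage[OF G reg(1) H stT(1) onto add op K sub stT(2) order.refl])
  moreover have "op_multiples G f H {\<zero>\<^bsub>G\<^esub>} s \<noteq> H"
  proof
    assume "op_multiples G f H {\<zero>\<^bsub>G\<^esub>} s = H"
    hence "carrier ?T \<subseteq> op_multiples ?T f' (carrier ?T) {\<zero>\<^bsub>?T\<^esub>} s"
      unfolding eq onto[symmetric] by blast
    thus False
      using reg(3) T.stable_op_multiples[OF stT sub order.refl] by blast
  qed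
  ultimately show ?thesis
    using F.le data by simp
qed

end

section \<open>Filtered modules\<close>

context graded_module
begin

lemma submodule_props:
  assumes "submodule H R M"
  shows "additive_subgroup H M" "H \<subseteq> carrier M" "\<zero>\<^bsub>M\<^esub> \<in> H"
    "\<lbrakk>x \<in> H; y \<in> H\<rbrakk> \<Longrightarrow> x \<oplus>\<^bsub>M\<^esub> y \<in> H" "x \<in> H \<Longrightarrow> \<ominus>\<^bsub>M\<^esub> x \<in> H"
    "\<lbrakk>a \<in> carrier R; x \<in> H\<rbrakk> \<Longrightarrow> a \<odot>\<^bsub>M\<^esub> x \<in> H"
proof -
  show a: "additive_subgroup H M"
    using Module.submodule.axioms(1)[OF assms] by (rule additive_subgroup.intro)
  show "H \<subseteq> carrier M" "\<zero>\<^bsub>M\<^esub> \<in> H"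
    using additive_subgroup.a_subset[OF a] additive_subgroup.zero_closed[OF a] .
  show "x \<oplus>\<^bsub>M\<^esub> y \<in> H" if "x \<in> H" "y \<in> H"
    using additive_subgroup.a_closed[OF a that] .
  show "\<ominus>\<^bsub>M\<^esub> x \<in> H" if "x \<in> H"
    using additive_subgroup.a_inv_closed[OF a that] .
  show "a \<odot>\<^bsub>M\<^esub> x \<in> H" if "a \<in> carrier R" "x \<in> H"
    using Module.submodule.smult_closed[OF assms that] .
qed

end

text \<open>
  The sign in the commutation rule is trivial, either since one degree is even or since \<open>-1 = 1\<close>.
\<close>

lemma (in graded_commutative_algebra) homogeneous_central:
  fixes d :: int
  assumes x: "x \<in> gpart A d" and d: "even d \<or> (2 :: 'k) = 0" and r: "r \<in> carrier A"
  shows "x \<otimes> r = r \<otimes> x"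
  using r
proof (induction rule: homogeneous_induct)
  case (homogeneous k r)
  have c: "x \<in> carrier A" "r \<in> carrier A"
    using x homogeneous gp_closed(1) by blast+
  show ?case
  proof (cases "even d")
    case True
    thus ?thesis using graded_commute[OF x homogeneous] by simp
  next
    case False
    hence "(1 :: 'k) + 1 = 0" using d by simp
    hence "(r \<otimes> x) \<oplus> (r \<otimes> x) = \<zero>"
      using scalar_distrib[of "r \<otimes> x" 1 1] c by simp
    hence "\<ominus> (r \<otimes> x) = r \<otimes> x"
      using c by (intro minus_equality) auto
    thus ?thesis using graded_commute[OF x homogeneous] by simp
  qed
next
  case (add r r')
  have "x \<in> carrier A" using x gp_closed(1) by blast
  thus ?case using add by (simp add: l_distr r_distr)
qed

locale filtered_module = ambient scale Basis + graded_module R L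
  for scale :: "'p::prime_card mod_ring \<Rightarrow> 'w::ab_group_add \<Rightarrow> 'w" and Basis
    and R :: "('p mod_ring, 'r) graded" and L :: "('r, 'm) graded" +
  fixes \<eta> :: "(('w \<Rightarrow> 'p mod_ring) multiset \<Rightarrow>\<^sub>0 'p mod_ring) set \<Rightarrow> 'r" and F :: "nat \<Rightarrow> 'm set" and len :: nat
  assumes eta: "\<eta> \<in> graded_algebra_hom PW R"
    and filtration: "free_rank_filtration scale R \<eta> L len F"
begin

lemma F_0: "F 0 = carrier L" and F_top: "F (Suc len) = {\<zero>\<^bsub>L\<^esub>}"
  and F_submodule: "k \<le> Suc len \<Longrightarrow> submodule (F k) R L"
  and F_decreasing: "k \<le> len \<Longrightarrow> F (Suc k) \<subseteq> F k"
  using filtration by (auto simp: free_rank_filtration_def graded_submodule_def)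

abbreviation Q where "Q k \<equiv> graded_quotient (restrict_to L (F k)) (F (Suc k))"

lemma Q_decomposition:
  assumes "k \<le> len"
  obtains m :: nat and D :: "nat \<Rightarrow> 'm set set"
    where "internal_direct_sum (Q k) D {..<m}" "\<And>a. a < m \<Longrightarrow> submodule (D a) R (Q k)"
    "\<And>a. a < m \<Longrightarrow> j_free scale R \<eta> k (restrict_to (Q k) (D a))"
proof -
  have "\<exists>(m::nat) (D :: nat \<Rightarrow> 'm set set). internal_direct_sum (Q k) D {..<m} \<and>
      (\<forall>a<m. graded_submodule R (Q k) (D a) \<and> j_free scale R \<eta> k (restrict_to (Q k) (D a)))"
    using filtration assms by (simp add: free_rank_filtration_def Let_def)
  thus ?thesis
    by (elim exE conjE) (rule that, assumption, simp_all add: graded_submodule_def)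
qed

lemma F_props:
  assumes "k \<le> Suc len"
  shows "F k \<subseteq> carrier L" "\<zero>\<^bsub>L\<^esub> \<in> F k" "\<lbrakk>x \<in> F k; y \<in> F k\<rbrakk> \<Longrightarrow> x \<oplus>\<^bsub>L\<^esub> y \<in> F k" "x \<in> F k \<Longrightarrow> \<ominus>\<^bsub>L\<^esub> x \<in> F k"
    "\<lbrakk>a \<in> carrier R; x \<in> F k\<rbrakk> \<Longrightarrow> a \<odot>\<^bsub>L\<^esub> x \<in> F k" "additive_subgroup (F k) L"
  using submodule_props[OF F_submodule[OF assms]] by blast+

lemma quotient_group_Q: "k \<le> len \<Longrightarrow> quotient_group (restrict_to L (F k)) (F (Suc k))"
  using F_props(6) F_decreasing M.abelian_group_axioms
  by (intro quotient_group.intro quotient_group_axioms.intro abelian_group_restrict_to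
      additive_subgroup_restrict_to) auto

definition cls :: "nat \<Rightarrow> 'm \<Rightarrow> 'm set" where
  "cls k x = a_r_coset (restrict_to L (F k)) (F (Suc k)) x"

lemma cls_props:
  assumes k: "k \<le> len"
  shows "carrier (Q k) = cls k ` F k" "\<lbrakk>x \<in> F k; y \<in> F k\<rbrakk> \<Longrightarrow> cls k (x \<oplus>\<^bsub>L\<^esub> y) = cls k x \<oplus>\<^bsub>Q k\<^esub> cls k y"
    "x \<in> F k \<Longrightarrow> cls k x = \<zero>\<^bsub>Q k\<^esub> \<longleftrightarrow> x \<in> F (Suc k)" "abelian_group (Q k)"
    "\<lbrakk>a \<in> carrier R; x \<in> F k\<rbrakk> \<Longrightarrow> a \<odot>\<^bsub>Q k\<^esub> cls k x = cls k (a \<odot>\<^bsub>L\<^esub> x)"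
proof -
  interpret q: quotient_group "restrict_to L (F k)" "F (Suc k)"
    by (rule quotient_group_Q[OF k])
  show "carrier (Q k) = cls k ` F k"
    using q.carrier_Q by (auto simp: cls_def)
  show "cls k (x \<oplus>\<^bsub>L\<^esub> y) = cls k x \<oplus>\<^bsub>Q k\<^esub> cls k y" if "x \<in> F k" "y \<in> F k"
    using q.cls_add[of x y] that by (simp add: cls_def)
  show "cls k x = \<zero>\<^bsub>Q k\<^esub> \<longleftrightarrow> x \<in> F (Suc k)" if "x \<in> F k"
    using q.cls_eq_zero_iff[of x] that by (simp add: cls_def)
  show "abelian_group (Q k)"
    by (rule q.abelian_group_Q)
  show "a \<odot>\<^bsub>Q k\<^esub> cls k x = cls k (a \<odot>\<^bsub>L\<^esub> x)" if "a \<in> carrier R" "x \<in> F k"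
  proof -
    have "a \<odot>\<^bsub>Q k\<^esub> cls k x = q.cls (a \<odot>\<^bsub>restrict_to L (F k)\<^esub> x)"
      unfolding cls_def
    proof (rule q.cls_smult)
      show "a \<odot>\<^bsub>restrict_to L (F k)\<^esub> h \<in> F (Suc k)" if "h \<in> F (Suc k)" for h
        using that \<open>a \<in> carrier R\<close> F_props(5)[of "Suc k"] k by simp
      show "a \<odot>\<^bsub>restrict_to L (F k)\<^esub> h \<in> carrier (restrict_to L (F k))" if "h \<in> carrier (restrict_to L (F k))" for h
        using that \<open>a \<in> carrier R\<close> F_props(5)[of k] k by simp
      show "a \<odot>\<^bsub>restrict_to L (F k)\<^esub> (x \<oplus>\<^bsub>restrict_to L (F k)\<^esub> y) =
          a \<odot>\<^bsub>restrict_to L (F k)\<^esub> x \<oplus>\<^bsub>restrict_to L (F k)\<^esub> a \<odot>\<^bsub>restrict_to L (F k)\<^esub> y"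
        if "x \<in> carrier (restrict_to L (F k))" "y \<in> carrier (restrict_to L (F k))" for x y
        using that \<open>a \<in> carrier R\<close> subsetD[OF F_props(1)[of k]] k by (simp add: smult_r_distr)
    qed (use that in simp)
    thus ?thesis by (simp add: cls_def)
  qed
qed

lemma Q_smult:
  assumes k: "k \<le> len"
  shows "\<lbrakk>a \<in> carrier R; x \<in> carrier (Q k)\<rbrakk> \<Longrightarrow> a \<odot>\<^bsub>Q k\<^esub> x \<in> carrier (Q k)"
    "\<lbrakk>a \<in> carrier R; x \<in> carrier (Q k); y \<in> carrier (Q k)\<rbrakk> \<Longrightarrow> a \<odot>\<^bsub>Q k\<^esub> (x \<oplus>\<^bsub>Q k\<^esub> y) = a \<odot>\<^bsub>Q k\<^esub> x \<oplus>\<^bsub>Q k\<^esub> a \<odot>\<^bsub>Q k\<^esub> y"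
    "\<lbrakk>a \<in> carrier R; b \<in> carrier R; x \<in> carrier (Q k)\<rbrakk> \<Longrightarrow> (a \<otimes>\<^bsub>R\<^esub> b) \<odot>\<^bsub>Q k\<^esub> x = a \<odot>\<^bsub>Q k\<^esub> (b \<odot>\<^bsub>Q k\<^esub> x)"
proof -
  have k': "k \<le> Suc len" using k by simp
  note F = F_props[OF k'] and C = cls_props[OF k]
  have Fc: "x \<in> carrier L" if "x \<in> F k" for x using that F(1) by blast
  show "a \<odot>\<^bsub>Q k\<^esub> x \<in> carrier (Q k)" if "a \<in> carrier R" "x \<in> carrier (Q k)"
    using that F(5) by (auto simp: C(1,5))
  show "a \<odot>\<^bsub>Q k\<^esub> (x \<oplus>\<^bsub>Q k\<^esub> y) = a \<odot>\<^bsub>Q k\<^esub> x \<oplus>\<^bsub>Q k\<^esub> a \<odot>\<^bsub>Q k\<^esub> y"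
    if "a \<in> carrier R" "x \<in> carrier (Q k)" "y \<in> carrier (Q k)"
    using that F(3,5) by (auto simp: C(1,5) smult_r_distr Fc simp flip: C(2))
  show "(a \<otimes>\<^bsub>R\<^esub> b) \<odot>\<^bsub>Q k\<^esub> x = a \<odot>\<^bsub>Q k\<^esub> (b \<odot>\<^bsub>Q k\<^esub> x)"
    if "a \<in> carrier R" "b \<in> carrier R" "x \<in> carrier (Q k)"
    using that F(5) by (auto simp: C(1,5) smult_assoc1 Fc)
qed

section \<open>Krull dimension\<close>

text \<open>
  For each of the finitely many summands there is an element outside \<open>P\<close> that annihilates it; as \<open>P\<close> is prime, the
  product is still outside \<open>P\<close>, and it annihilates the whole quotient.
\<close>

lemma prime_annihilates_summand:
  fixes D :: "nat \<Rightarrow> 'm set set"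
  assumes k: "k \<le> len" and P: "is_prime_ideal R P"
    and D: "internal_direct_sum (Q k) D {..<m}" "\<And>a. a < m \<Longrightarrow> submodule (D a) R (Q k)"
    and none: "\<And>a. a < m \<Longrightarrow> \<not> annihilator R (restrict_to (Q k) (D a)) \<subseteq> P"
  shows "\<exists>r\<in>carrier R - P. \<forall>x\<in>F k. r \<odot>\<^bsub>L\<^esub> x \<in> F (Suc k)"
proof -
  interpret Qk: abelian_group "Q k" by (rule cls_props(4)[OF k])
  interpret ds: finite_direct_sum "Q k" D m
    by unfold_locales (rule D(1))
  have "a \<le> m \<Longrightarrow> \<exists>r\<in>carrier R - P. \<forall>i<a. \<forall>x\<in>D i. r \<odot>\<^bsub>Q k\<^esub> x = \<zero>\<^bsub>Q k\<^esub>" for a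
  proof (induction a)
    case 0
    have "\<one>\<^bsub>R\<^esub> \<notin> P"
      using P ideal.one_imp_carrier[of P R] by (auto simp: is_prime_ideal_def)
    thus ?case by (intro bexI[of _ "\<one>\<^bsub>R\<^esub>"]) auto
  next
    case (Suc a)
    then obtain r where r: "r \<in> carrier R - P" "\<forall>i<a. \<forall>x\<in>D i. r \<odot>\<^bsub>Q k\<^esub> x = \<zero>\<^bsub>Q k\<^esub>"
      by auto
    obtain r' where r': "r' \<in> carrier R - P" "\<forall>x\<in>D a. r' \<odot>\<^bsub>Q k\<^esub> x = \<zero>\<^bsub>Q k\<^esub>"
      using none[of a] Suc by (auto simp: annihilator_def)
    have "r \<otimes>\<^bsub>R\<^esub> r' \<in> carrier R - P"
      using r r' P by (auto simp: is_prime_ideal_def)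
    moreover have "(r \<otimes>\<^bsub>R\<^esub> r') \<odot>\<^bsub>Q k\<^esub> x = \<zero>\<^bsub>Q k\<^esub>" if "i < Suc a" "x \<in> D i" for i x
    proof -
      have xc: "x \<in> carrier (Q k)"
        using that Suc ds.summand_closed(1)[of i] by auto
      have eq: "(r \<otimes>\<^bsub>R\<^esub> r') \<odot>\<^bsub>Q k\<^esub> x = r \<odot>\<^bsub>Q k\<^esub> (r' \<odot>\<^bsub>Q k\<^esub> x)"
        using r r' xc by (intro Q_smult(3)[OF k]) auto
      show ?thesis
      proof (cases "i = a")
        case True
        have "r \<odot>\<^bsub>Q k\<^esub> \<zero>\<^bsub>Q k\<^esub> \<oplus>\<^bsub>Q k\<^esub> r \<odot>\<^bsub>Q k\<^esub> \<zero>\<^bsub>Q k\<^esub> = r \<odot>\<^bsub>Q k\<^esub> \<zero>\<^bsub>Q k\<^esub>"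
          using Q_smult(2)[OF k, of r "\<zero>\<^bsub>Q k\<^esub>" "\<zero>\<^bsub>Q k\<^esub>"] r by simp
        hence "r \<odot>\<^bsub>Q k\<^esub> \<zero>\<^bsub>Q k\<^esub> = \<zero>\<^bsub>Q k\<^esub>"
          using Q_smult(1)[OF k, of r "\<zero>\<^bsub>Q k\<^esub>"] r by (simp add: Qk.add.l_cancel_one')
        thus ?thesis using True r' that eq by simp
      next
        case False
        hence "r' \<odot>\<^bsub>Q k\<^esub> x \<in> D i"
          using that r' Suc Module.submodule.smult_closed[OF D(2)[of i]] by auto
        moreover have "i < a" using False that by simp
        ultimately show ?thesis unfolding eq using r(2) by blast
      qed
    qed
    ultimately show ?case by blast
  qed
  then obtain r where r: "r \<in> carrier R - P" "\<forall>i<m. \<forall>x\<in>D i. r \<odot>\<^bsub>Q k\<^esub> x = \<zero>\<^bsub>Q k\<^esub>"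
    by blast
  have zero: "r \<odot>\<^bsub>Q k\<^esub> \<zero>\<^bsub>Q k\<^esub> = \<zero>\<^bsub>Q k\<^esub>"
  proof -
    have "r \<odot>\<^bsub>Q k\<^esub> \<zero>\<^bsub>Q k\<^esub> \<oplus>\<^bsub>Q k\<^esub> r \<odot>\<^bsub>Q k\<^esub> \<zero>\<^bsub>Q k\<^esub> = r \<odot>\<^bsub>Q k\<^esub> \<zero>\<^bsub>Q k\<^esub>"
      using Q_smult(2)[OF k, of r "\<zero>\<^bsub>Q k\<^esub>" "\<zero>\<^bsub>Q k\<^esub>"] r by simp
    thus ?thesis
      using Q_smult(1)[OF k, of r "\<zero>\<^bsub>Q k\<^esub>"] r by (simp add: Qk.add.l_cancel_one')
  qed
  have all: "r \<odot>\<^bsub>Q k\<^esub> x = \<zero>\<^bsub>Q k\<^esub>" if "x \<in> carrier (Q k)" for x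
    using that
  proof (induction rule: ds.direct_sum_induct)
    case (add x y)
    thus ?case using Q_smult(2)[OF k, of r x y] r by simp
  qed (use r zero in auto)
  have "r \<odot>\<^bsub>L\<^esub> x \<in> F (Suc k)" if x: "x \<in> F k" for x
  proof -
    have "cls k (r \<odot>\<^bsub>L\<^esub> x) = \<zero>\<^bsub>Q k\<^esub>"
      using all[of "cls k x"] x r cls_props(1,5)[OF k] by auto
    thus ?thesis
      using cls_props(3)[OF k, of "r \<odot>\<^bsub>L\<^esub> x"] F_props(5)[of k r x] x r k by auto
  qed
  thus ?thesis using r by blast
qed

lemma submodule_abelian_group:
  assumes k: "k \<le> len" and D: "submodule D R (Q k)"
  shows "abelian_group (restrict_to (Q k) D)" "\<lbrakk>r \<in> carrier R; x \<in> D\<rbrakk> \<Longrightarrow> r \<odot>\<^bsub>Q k\<^esub> x \<in> D"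
proof -
  have "additive_subgroup D (Q k)"
    using Module.submodule.axioms(1)[OF D] by (rule additive_subgroup.intro)
  thus "abelian_group (restrict_to (Q k) D)"
    by (rule abelian_group_restrict_to[OF cls_props(4)[OF k]])
qed (rule Module.submodule.smult_closed[OF D])

text \<open>
  Were \<open>m \<ge> s\<close>, no summand of the quotients \<open>Q k\<close> with \<open>k < s\<close> could have its annihilator in \<open>P 0\<close>, by the bound \<open>k\<close>
  on the length of chains.  Then multiplying elements outside \<open>P 0\<close> that move \<open>F k\<close> into \<open>F (k + 1)\<close> gives an
  element outside \<open>P 0\<close> that annihilates \<open>L / F s\<close>.
\<close>

lemma prime_chain_quotient:
  assumes s: "s \<le> Suc len"
    and prime: "\<And>k. k \<le> m \<Longrightarrow> is_prime_ideal R (P k)"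
    and chain: "\<And>k. k < m \<Longrightarrow> P k \<subset> P (Suc k)"
    and ann: "annihilator R (graded_quotient L (F s)) \<subseteq> P 0"
  shows "m < s"
proof (rule ccontr)
  assume ms: "\<not> m < s"
  have P0: "is_prime_ideal R (P 0)" using prime by simp
  have step: "\<exists>r\<in>carrier R - P 0. \<forall>x\<in>F k. r \<odot>\<^bsub>L\<^esub> x \<in> F (Suc k)" if "k < s" for k
  proof -
    have k: "k \<le> len" using that s by simp
    obtain m' :: nat and D :: "nat \<Rightarrow> 'm set set" where D: "internal_direct_sum (Q k) D {..<m'}" "\<And>a. a < m' \<Longrightarrow> submodule (D a) R (Q k)"
      "\<And>a. a < m' \<Longrightarrow> j_free scale R \<eta> k (restrict_to (Q k) (D a))"
      by (rule Q_decomposition[OF k]) (rule that, assumption, simp_all)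
    show ?thesis
    proof (rule prime_annihilates_summand[OF k P0 D(1,2)])
      fix a assume a: "a < m'"
      show "\<not> annihilator R (restrict_to (Q k) (D a)) \<subseteq> P 0"
      proof
        assume "annihilator R (restrict_to (Q k) (D a)) \<subseteq> P 0"
        hence "m \<le> k"
          using submodule_abelian_group[OF k D(2)[OF a]]
          by (intro j_free_prime_chain[where P = P and m = m, OF R.graded_commutative_algebra_axioms eta D(3)[OF a]])
            (simp_all add: prime chain)
        thus False using that ms by simp
      qed
    qed
  qed
  have "k \<le> s \<Longrightarrow> \<exists>r\<in>carrier R - P 0. \<forall>x\<in>carrier L. r \<odot>\<^bsub>L\<^esub> x \<in> F k" for k
  proof (induction k)
    case 0
    have "\<one>\<^bsub>R\<^esub> \<notin> P 0"
      using P0 ideal.one_imp_carrier[of "P 0" R] by (auto simp: is_prime_ideal_def)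
    thus ?case by (intro bexI[of _ "\<one>\<^bsub>R\<^esub>"]) (auto simp: F_0 smult_one)
  next
    case (Suc k)
    then obtain r where r: "r \<in> carrier R - P 0" "\<forall>x\<in>carrier L. r \<odot>\<^bsub>L\<^esub> x \<in> F k"
      by auto
    obtain r' where r': "r' \<in> carrier R - P 0" "\<forall>x\<in>F k. r' \<odot>\<^bsub>L\<^esub> x \<in> F (Suc k)"
      using step[of k] Suc by auto
    have "r' \<otimes>\<^bsub>R\<^esub> r \<in> carrier R - P 0"
      using r r' P0 by (auto simp: is_prime_ideal_def)
    moreover have "(r' \<otimes>\<^bsub>R\<^esub> r) \<odot>\<^bsub>L\<^esub> x \<in> F (Suc k)" if "x \<in> carrier L" for x
      using that r r' by (simp add: smult_assoc1)
    ultimately show ?case by blast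
  qed
  then obtain r where r: "r \<in> carrier R - P 0" "\<forall>x\<in>carrier L. r \<odot>\<^bsub>L\<^esub> x \<in> F s"
    by blast
  interpret q: quotient_group L "F s"
    using F_props(6)[OF s] M.abelian_group_axioms by (intro quotient_group.intro quotient_group_axioms.intro)
  have "r \<odot>\<^bsub>graded_quotient L (F s)\<^esub> C = \<zero>\<^bsub>graded_quotient L (F s)\<^esub>" if C: "C \<in> carrier (graded_quotient L (F s))" for C
  proof -
    obtain x where x: "x \<in> carrier L" "C = q.cls x"
      using C by (auto simp: q.carrier_Q)
    have "r \<odot>\<^bsub>graded_quotient L (F s)\<^esub> C = q.cls (r \<odot>\<^bsub>L\<^esub> x)"
      unfolding x(2) by (rule q.cls_smult[OF x(1)]) (use r F_props(5)[OF s] smult_closed smult_r_distr in auto)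
    thus ?thesis
      using q.cls_eq_zero_iff[of "r \<odot>\<^bsub>L\<^esub> x"] r x smult_closed by auto
  qed
  hence "r \<in> annihilator R (graded_quotient L (F s))"
    using r by (simp add: annihilator_def)
  thus False using ann r by blast
qed

theorem krull_dimension_quotient:
  assumes s: "s \<le> Suc len"
  shows "krull_dimension R (graded_quotient L (F s)) < ereal (real s)"
proof -
  have "krull_dimension R (graded_quotient L (F s)) \<le> ereal (real s - 1)"
    unfolding krull_dimension_def
  proof (rule Sup_least, elim CollectE exE conjE)
    fix x m P
    assume x: "x = ereal (real m)" "\<forall>i\<le>m. is_prime_ideal R (P i) \<and> annihilator R (graded_quotient L (F s)) \<subseteq> P i"
      "\<forall>i<m. P i \<subset> P (Suc i)"
    have "m < s"
      by (rule prime_chain_quotient[OF s, of m P]) (use x in auto)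
    thus "x \<le> ereal (real s - 1)"
      by (simp add: x(1))
  qed
  also have "\<dots> < ereal (real s)" by simp
  finally show ?thesis .
qed

end

section \<open>Depth\<close>

context filtered_module
begin

abbreviation act :: "nat \<Rightarrow> 'm \<Rightarrow> 'm" where
  "act i m \<equiv> dickson_elt \<eta> i \<odot>\<^bsub>L\<^esub> m"

lemma dickson_elt_gpart:
  assumes "i < n"
  shows "\<exists>d>0. (CARD('p) = 2 \<or> even d) \<and> dickson_elt \<eta> i \<in> gpart R d"
proof -
  from dickson_lift_gpart[OF assms] obtain d :: int
    where d: "d > 0" "CARD('p) = 2 \<or> even d" "W.SA.cls (dickson_lift i) \<in> gpart PW d"
    by blast
  have "\<eta> ` gpart PW d \<subseteq> gpart R d"
    using eta by (simp add: graded_algebra_hom_def)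
  hence "dickson_elt \<eta> i \<in> gpart R d"
    unfolding dickson_elt_def using d(3) by blast
  thus ?thesis using d(1,2) by blast
qed

lemma dickson_elt_closed: "i < n \<Longrightarrow> dickson_elt \<eta> i \<in> carrier R"
  using dickson_elt_gpart R.gp_closed(1) by blast

lemma dickson_elt_central:
  assumes "i < n" "r \<in> carrier R"
  shows "dickson_elt \<eta> i \<otimes>\<^bsub>R\<^esub> r = r \<otimes>\<^bsub>R\<^esub> dickson_elt \<eta> i"
proof -
  obtain d where d: "CARD('p) = 2 \<or> even d" "dickson_elt \<eta> i \<in> gpart R d"
    using dickson_elt_gpart[OF assms(1)] by blast
  have "(2 :: 'p mod_ring) = 0" if "CARD('p) = 2"
    using that of_nat_card_eq_0[where ?'a = 'p] by simp
  thus ?thesis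
    using d assms(2) by (intro R.homogeneous_central) auto
qed

lemma act_swap:
  assumes "i < n" "r \<in> carrier R" "m \<in> carrier L"
  shows "r \<odot>\<^bsub>L\<^esub> act i m = act i (r \<odot>\<^bsub>L\<^esub> m)"
  using assms by (simp add: dickson_elt_closed dickson_elt_central flip: smult_assoc1)

lemma commuting_act: "s \<le> n \<Longrightarrow> commuting_operators L s act"
proof unfold_locales
  fix i l x assume *: "s \<le> n" "i < s" "l < s" "x \<in> carrier L"
  show "act i (act l x) = act l (act i x)"
    by (rule act_swap) (use * dickson_elt_closed in auto)
qed (simp_all add: smult_closed smult_r_distr dickson_elt_closed)

lemma stable_F:
  assumes "s \<le> n" "k \<le> Suc len"
  shows "commuting_operators.stable_subgroup L s act (F k)"
proof -
  interpret commuting_operators L s act by (rule commuting_act[OF assms(1)])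
  show ?thesis
    using F_props[OF assms(2)] assms(1) by (intro stable_subgroupI) (auto simp: dickson_elt_closed)
qed

lemma commuting_Q:
  assumes k: "k \<le> len" and s: "s \<le> n"
  shows "commuting_operators (Q k) s (\<lambda>i C. dickson_elt \<eta> i \<odot>\<^bsub>Q k\<^esub> C)"
proof -
  interpret q: abelian_group "Q k" by (rule cls_props(4)[OF k])
  show ?thesis
  proof
    fix i x y assume *: "i < s" "x \<in> carrier (Q k)" "y \<in> carrier (Q k)"
    show "dickson_elt \<eta> i \<odot>\<^bsub>Q k\<^esub> (x \<oplus>\<^bsub>Q k\<^esub> y) =
        dickson_elt \<eta> i \<odot>\<^bsub>Q k\<^esub> x \<oplus>\<^bsub>Q k\<^esub> dickson_elt \<eta> i \<odot>\<^bsub>Q k\<^esub> y"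
      using * s by (intro Q_smult(2)[OF k] dickson_elt_closed) auto
  next
    fix i l C assume *: "i < s" "l < s" "C \<in> carrier (Q k)"
    have c: "dickson_elt \<eta> i \<in> carrier R" "dickson_elt \<eta> l \<in> carrier R"
      using * s by (auto intro: dickson_elt_closed)
    have "dickson_elt \<eta> i \<otimes>\<^bsub>R\<^esub> dickson_elt \<eta> l = dickson_elt \<eta> l \<otimes>\<^bsub>R\<^esub> dickson_elt \<eta> i"
      using * s c by (intro dickson_elt_central) auto
    thus "dickson_elt \<eta> i \<odot>\<^bsub>Q k\<^esub> (dickson_elt \<eta> l \<odot>\<^bsub>Q k\<^esub> C) = dickson_elt \<eta> l \<odot>\<^bsub>Q k\<^esub> (dickson_elt \<eta> i \<odot>\<^bsub>Q k\<^esub> C)"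
      using Q_smult(3)[OF k c *(3)] Q_smult(3)[OF k c(2,1) *(3)] by simp
  qed (use s in \<open>auto intro!: Q_smult(1)[OF k] dickson_elt_closed\<close>)
qed

lemma regular_Q:
  assumes k: "k \<le> len" and s: "s \<le> n" "s \<le> k"
  shows "weakly_regular (Q k) s (\<lambda>i C. dickson_elt \<eta> i \<odot>\<^bsub>Q k\<^esub> C) (carrier (Q k)) {\<zero>\<^bsub>Q k\<^esub>}"
    and "carrier (Q k) \<noteq> {\<zero>\<^bsub>Q k\<^esub>} \<Longrightarrow>
      op_multiples (Q k) (\<lambda>i C. dickson_elt \<eta> i \<odot>\<^bsub>Q k\<^esub> C) (carrier (Q k)) {\<zero>\<^bsub>Q k\<^esub>} s \<noteq> carrier (Q k)"
proof -
  let ?f = "\<lambda>i C. dickson_elt \<eta> i \<odot>\<^bsub>Q k\<^esub> C"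
  obtain m :: nat and D :: "nat \<Rightarrow> 'm set set" where D: "internal_direct_sum (Q k) D {..<m}"
    "\<And>a. a < m \<Longrightarrow> submodule (D a) R (Q k)"
    "\<And>a. a < m \<Longrightarrow> j_free scale R \<eta> k (restrict_to (Q k) (D a))"
    by (rule Q_decomposition[OF k]) (rule that, assumption, simp_all)
  interpret C: commuting_operators "Q k" s ?f by (rule commuting_Q[OF k s(1)])
  interpret ds: finite_direct_sum "Q k" D m
    by unfold_locales (rule D(1))
  have st: "C.stable_subgroup (D a)" if "a < m" for a
    unfolding C.stable_subgroup_def
    using ds.summand_subgroup[OF that] Module.submodule.smult_closed[OF D(2)[OF that]] s dickson_elt_closed by auto
  have reg: "weakly_regular (Q k) s ?f (D a) {\<zero>\<^bsub>Q k\<^esub>} \<and> op_multiples (Q k) ?f (D a) {\<zero>\<^bsub>Q k\<^esub>} s \<noteq> D a \<and> k \<le> n"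
    if "a < m" for a
    by (rule j_free_regular[OF R.graded_commutative_algebra_axioms eta D(3)[OF that] s(2)
          C.commuting_operators_axioms st[OF that]]) simp_all
  interpret dso: direct_sum_operators "Q k" D m s ?f
    by unfold_locales (use st reg in auto)
  show "weakly_regular (Q k) s ?f (carrier (Q k)) {\<zero>\<^bsub>Q k\<^esub>}"
    by (rule dso.regular_direct_sum)
  assume nz: "carrier (Q k) \<noteq> {\<zero>\<^bsub>Q k\<^esub>}"
  have "m \<noteq> 0"
  proof
    assume "m = 0"
    hence "carrier (Q k) = {\<zero>\<^bsub>Q k\<^esub>}"
      using ds.partial_sum_n ds.partial_sum_0 by simp
    thus False using nz by simp
  qed
  then obtain a where a: "m = Suc a" by (cases m) auto
  show "op_multiples (Q k) ?f (carrier (Q k)) {\<zero>\<^bsub>Q k\<^esub>} s \<noteq> carrier (Q k)"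
    by (rule dso.proper_direct_sum[OF a]) (use reg[of a] a in simp)
qed

lemma Q_nonzero:
  assumes "k \<le> len" "F (Suc k) \<noteq> F k"
  shows "carrier (Q k) \<noteq> {\<zero>\<^bsub>Q k\<^esub>}"
proof
  assume "carrier (Q k) = {\<zero>\<^bsub>Q k\<^esub>}"
  hence "cls k ` F k = {\<zero>\<^bsub>Q k\<^esub>}"
    by (simp only: cls_props(1)[OF assms(1)])
  hence "x \<in> F (Suc k)" if "x \<in> F k" for x
    using cls_props(3)[OF assms(1) that] that by blast
  hence "F k \<subseteq> F (Suc k)" by (rule subsetI)
  thus False using assms F_decreasing[of k] by auto
qed

text \<open>A nonzero quotient has a summand, and the subspace belonging to it has dimension \<open>k\<close>.\<close>

lemma nonzero_quotient_dim:
  assumes k: "k \<le> len" and ne: "F (Suc k) \<noteq> F k"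
  shows "k \<le> n"
proof -
  obtain m :: nat and D :: "nat \<Rightarrow> 'm set set" where D: "internal_direct_sum (Q k) D {..<m}"
    "\<And>a. a < m \<Longrightarrow> submodule (D a) R (Q k)"
    "\<And>a. a < m \<Longrightarrow> j_free scale R \<eta> k (restrict_to (Q k) (D a))"
    by (rule Q_decomposition[OF k]) (rule that, assumption, simp_all)
  interpret q: abelian_group "Q k" by (rule cls_props(4)[OF k])
  interpret ds: finite_direct_sum "Q k" D m
    by unfold_locales (rule D(1))
  have "m \<noteq> 0"
  proof
    assume "m = 0"
    hence "carrier (Q k) = {\<zero>\<^bsub>Q k\<^esub>}"
      using ds.partial_sum_n ds.partial_sum_0 by simp
    thus False using Q_nonzero[OF k ne] by simp
  qed
  hence m: "0 < m" by simp
  \<comment> \<open>The bound does not involve the operators, so the empty sequence will do.\<close>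
  interpret C: commuting_operators "Q k" 0 "\<lambda>i C. dickson_elt \<eta> i \<odot>\<^bsub>Q k\<^esub> C"
    by (rule commuting_Q[OF k]) simp
  have st: "C.stable_subgroup (D 0)"
    unfolding C.stable_subgroup_def using ds.summand_subgroup[OF m] by simp
  have "weakly_regular (Q k) 0 (\<lambda>i C. dickson_elt \<eta> i \<odot>\<^bsub>Q k\<^esub> C) (D 0) {\<zero>\<^bsub>Q k\<^esub>} \<and>
      op_multiples (Q k) (\<lambda>i C. dickson_elt \<eta> i \<odot>\<^bsub>Q k\<^esub> C) (D 0) {\<zero>\<^bsub>Q k\<^esub>} 0 \<noteq> D 0 \<and> k \<le> n"
    by (rule j_free_regular[OF R.graded_commutative_algebra_axioms eta D(3)[OF m] _
          C.commuting_operators_axioms st]) simp_all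
  thus ?thesis by blast
qed

lemma regular_step:
  assumes k: "k \<le> len" and s: "s \<le> n" "s \<le> k"
  shows "weakly_regular L s act (F k) (F (Suc k))"
    and "F (Suc k) \<noteq> F k \<Longrightarrow> op_multiples L act (F k) (F (Suc k)) s \<noteq> F k"
proof -
  let ?f = "\<lambda>i C. dickson_elt \<eta> i \<odot>\<^bsub>Q k\<^esub> C"
  have k': "k \<le> Suc len" "Suc k \<le> Suc len" using k by auto
  note G = commuting_act[OF s(1)] and G' = commuting_Q[OF k s(1)]
  interpret L: commuting_operators L s act by (rule G)
  interpret C: commuting_operators "Q k" s ?f by (rule G')
  have st: "C.stable_subgroup (carrier (Q k))" "C.stable_subgroup {\<zero>\<^bsub>Q k\<^esub>}"
    by (rule C.stable_subgroupI, auto simp: C.op_closed C.op_zero C.minus_equality)+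
  have K: "F (Suc k) = {x \<in> F k. cls k x \<in> {\<zero>\<^bsub>Q k\<^esub>}}"
    using cls_props(3)[OF k] F_decreasing[OF k] by blast
  have op: "cls k (act i x) = ?f i (cls k x)" if "i < s" "x \<in> F k" for i x
    using that s cls_props(5)[OF k, of "dickson_elt \<eta> i" x] by (simp add: dickson_elt_closed)
  have sub: "{\<zero>\<^bsub>Q k\<^esub>} \<subseteq> carrier (Q k)" by simp
  show "weakly_regular L s act (F k) (F (Suc k))"
    by (rule weakly_regular_preimage[where \<gamma> = "cls k", OF G G' stable_F[OF s(1) k'(1)] st(1) _ _ op K sub st(2)
          regular_Q(1)[OF k s]])
      (use cls_props(1,2)[OF k] in auto)
  have eq: "op_multiples L act (F k) (F (Suc k)) s =
      {x \<in> F k. cls k x \<in> op_multiples (Q k) ?f (carrier (Q k)) {\<zero>\<^bsub>Q k\<^esub>} s}"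
    by (rule op_multiples_preimage[where \<gamma> = "cls k", OF G G' stable_F[OF s(1) k'(1)] st(1) _ _ op K sub st(2) order.refl])
      (use cls_props(1,2)[OF k] in auto)
  assume ne: "F (Suc k) \<noteq> F k"
  show "op_multiples L act (F k) (F (Suc k)) s \<noteq> F k"
  proof
    assume "op_multiples L act (F k) (F (Suc k)) s = F k"
    hence "carrier (Q k) \<subseteq> op_multiples (Q k) ?f (carrier (Q k)) {\<zero>\<^bsub>Q k\<^esub>} s"
      unfolding cls_props(1)[OF k] eq by blast
    thus False
      using regular_Q(2)[OF k s Q_nonzero[OF k ne]] C.stable_op_multiples[OF st sub order.refl] by blast
  qed
qed

text \<open>
  By descending induction on \<open>k\<close>, since the sequence is regular on all quotients \<open>F k / F (k + 1)\<close> with \<open>k \<ge> s\<close>.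
\<close>

lemma regular_F:
  assumes s: "s \<le> n" and k: "s \<le> k" "k \<le> Suc len"
  shows "weakly_regular L s act (F k) {\<zero>\<^bsub>L\<^esub>}"
  using k(2,1)
proof (induction rule: inc_induct)
  interpret L: commuting_operators L s act by (rule commuting_act[OF s])
  case base
  have st: "L.stable_subgroup {\<zero>\<^bsub>L\<^esub>}"
    using stable_F[OF s order.refl] by (simp add: F_top)
  have "{\<zero>\<^bsub>L\<^esub>} \<subseteq> op_multiples L act {\<zero>\<^bsub>L\<^esub>} {\<zero>\<^bsub>L\<^esub>} i" if "i < s" for i
    using L.stable_op_multiples[OF st st order.refl, of i] that by simp
  thus ?case by (auto simp: weakly_regular_def F_top)
next
  interpret L: commuting_operators L s act by (rule commuting_act[OF s])
  case (step k)
  have k: "k \<le> len" using step by simp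
  have "L.stable_subgroup {\<zero>\<^bsub>L\<^esub>}"
    using stable_F[OF s order.refl] by (simp add: F_top)
  thus ?case
    using step k s F_props(2)[of "Suc k"] F_decreasing[OF k]
    by (intro L.weakly_regular_extension[of "F k" "{\<zero>\<^bsub>L\<^esub>}" "F (Suc k)"] stable_F regular_step(1)) auto
qed

text \<open>
  The Dickson invariants are central in \<open>R\<close>, so the sums of their multiples are already submodules.
\<close>

lemma multiples_submodule_act:
  assumes j: "j \<le> Suc len" and s: "s \<le> n" and k: "k \<le> s"
  shows "multiples_submodule R (restrict_to L (F j)) (dickson_elt \<eta> ` {..<k}) = op_multiples L act (F j) {\<zero>\<^bsub>L\<^esub>} k"
    (is "?M = ?E k")
proof (intro equalityI subsetI)
  interpret L: commuting_operators L s act by (rule commuting_act[OF s])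
  let ?Fj = "restrict_to L (F j)"
  note F = F_props[OF j]
  have Fc: "x \<in> carrier L" if "x \<in> F j" for x using that F(1) by blast
  have st0: "L.stable_subgroup {\<zero>\<^bsub>L\<^esub>}"
    using stable_F[OF s order.refl] by (simp add: F_top)
  have sub0: "{\<zero>\<^bsub>L\<^esub>} \<subseteq> F j" using F(2) by simp
  have E: "L.stable_subgroup (?E i)" "?E i \<subseteq> F j" if "i \<le> s" for i
    using L.stable_op_multiples[OF stable_F[OF s j] st0 sub0 that] by auto
  have smult: "i \<le> s \<Longrightarrow> r \<odot>\<^bsub>L\<^esub> x \<in> ?E i" if "r \<in> carrier R" "x \<in> ?E i" for i r x
    using that(2)
  proof (induction i arbitrary: x)
    case 0
    have "r \<odot>\<^bsub>L\<^esub> \<zero>\<^bsub>L\<^esub> \<in> F (Suc len)"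
      using that(1) by (intro F_props(5)) (auto simp: F_top)
    thus ?case using 0 by (simp add: F_top)
  next
    case (Suc i)
    then obtain u h where x: "u \<in> ?E i" "h \<in> F j" "x = u \<oplus>\<^bsub>L\<^esub> act i h" by auto
    have i: "i \<le> s" "i < n" using Suc s by auto
    have c: "u \<in> carrier L" "h \<in> carrier L" "act i h \<in> carrier L"
      using x E(2)[OF i(1)] Fc i dickson_elt_closed smult_closed by auto
    have "r \<odot>\<^bsub>L\<^esub> x = r \<odot>\<^bsub>L\<^esub> u \<oplus>\<^bsub>L\<^esub> act i (r \<odot>\<^bsub>L\<^esub> h)"
      using c that(1) i by (simp add: x smult_r_distr act_swap)
    moreover have "r \<odot>\<^bsub>L\<^esub> u \<oplus>\<^bsub>L\<^esub> act i (r \<odot>\<^bsub>L\<^esub> h) \<in> ?E (Suc i)"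
      by (rule op_multiples_SucI) (use Suc.IH[OF i(1) x(1)] F(5) that(1) x(2) in auto)
    ultimately show ?case by (simp only:)
  qed
  have gen: "i < l \<Longrightarrow> l \<le> s \<Longrightarrow> act i m \<in> ?E l" if m: "m \<in> F j" for i l m
  proof (induction l)
    case (Suc l)
    have l: "l \<le> s" "l < s" "l < n" using Suc s by auto
    show ?case
    proof (cases "i = l")
      case True
      have "\<zero>\<^bsub>L\<^esub> \<oplus>\<^bsub>L\<^esub> act l m \<in> ?E (Suc l)"
        by (rule op_multiples_SucI) (use L.stable_subgroupD(2)[OF E(1)[OF l(1)]] m in auto)
      thus ?thesis using True l m Fc by (simp add: smult_closed dickson_elt_closed)
    next
      case False
      hence il: "i < l" using Suc by simp
      have "act i m \<oplus>\<^bsub>L\<^esub> act l \<zero>\<^bsub>L\<^esub> \<in> ?E (Suc l)"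
        by (rule op_multiples_SucI) (use Suc.IH[OF il l(1)] F(2) in auto)
      moreover have "act i m \<in> carrier L"
        using il l m Fc by (intro smult_closed dickson_elt_closed) auto
      ultimately show ?thesis
        using L.op_zero[OF l(2)] by simp
    qed
  qed simp
  have sub: "submodule (?E k) R ?Fj"
  proof -
    have "additive_subgroup (?E k) ?Fj"
      using E[OF k] F(6) M.abelian_group_axioms
      by (intro additive_subgroup_restrict_to) (auto simp: L.stable_subgroup_def)
    thus ?thesis
      using smult[OF _ _ k]
      by (intro Module.submodule.intro Module.submodule_axioms.intro additive_subgroup.a_subgroup) auto
  qed
  show "x \<in> ?E k" if "x \<in> ?M" for x
  proof -
    have "{y \<odot>\<^bsub>?Fj\<^esub> m | y m. y \<in> dickson_elt \<eta> ` {..<k} \<and> m \<in> carrier ?Fj} \<subseteq> ?E k"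
      using gen k by auto
    thus ?thesis
      using that sub unfolding multiples_submodule_def by blast
  qed
  show "x \<in> ?M" if "x \<in> ?E k" for x
    unfolding multiples_submodule_def
  proof (rule InterI, elim CollectE conjE)
    fix H assume H: "submodule H R ?Fj"
      "{y \<odot>\<^bsub>?Fj\<^esub> m | y m. y \<in> dickson_elt \<eta> ` {..<k} \<and> m \<in> carrier ?Fj} \<subseteq> H"
    have Ha: "additive_subgroup H ?Fj"
      using Module.submodule.axioms(1)[OF H(1)] by (rule additive_subgroup.intro)
    have "i \<le> k \<Longrightarrow> ?E i \<subseteq> H" for i
    proof (induction i)
      case 0
      thus ?case using additive_subgroup.zero_closed[OF Ha] by simp
    next
      case (Suc i)
      show ?case
      proof
        fix x assume "x \<in> ?E (Suc i)"
        then obtain u h where x: "u \<in> ?E i" "h \<in> F j" "x = u \<oplus>\<^bsub>L\<^esub> act i h" by auto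
        have "act i h \<in> {y \<odot>\<^bsub>?Fj\<^esub> m | y m. y \<in> dickson_elt \<eta> ` {..<k} \<and> m \<in> carrier ?Fj}"
          by (intro CollectI exI[of _ "dickson_elt \<eta> i"] exI[of _ h]) (use x(2) Suc.prems in auto)
        hence "act i h \<in> H" using H(2) by blast
        moreover have "u \<in> H" using Suc x(1) by auto
        ultimately show "x \<in> H"
          using additive_subgroup.a_closed[OF Ha, of u "act i h"] x(3) by simp
      qed
    qed
    thus "x \<in> H" using that by blast
  qed
qed

text \<open>
  The first \<open>s\<close> Dickson invariants are a regular sequence on \<open>F s\<close>.  They do not generate \<open>F s\<close> since they do not
  generate its quotient \<open>F s / F (s + 1)\<close>.
\<close>

theorem depth_filtration:
  assumes s: "s \<le> len" and ne: "F (Suc s) \<noteq> F s"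
  shows "enat s \<le> depth R (restrict_to L (F s))"
proof -
  let ?xs = "map (dickson_elt \<eta>) [0..<s]"
  have sn: "s \<le> n" by (rule nonzero_quotient_dim[OF s ne])
  have s': "s \<le> Suc len" using s by simp
  have take: "multiples_submodule R (restrict_to L (F s)) (set (take k ?xs)) = op_multiples L act (F s) {\<zero>\<^bsub>L\<^esub>} k"
    if "k \<le> s" for k
  proof -
    have "set (take k ?xs) = dickson_elt \<eta> ` {..<k}"
      using that by (simp add: take_map atLeast0LessThan)
    thus ?thesis
      using multiples_submodule_act[OF s' sn that] by simp
  qed
  interpret L: commuting_operators L s act by (rule commuting_act[OF sn])
  have "op_multiples L act (F s) {\<zero>\<^bsub>L\<^esub>} s \<subseteq> op_multiples L act (F s) (F (Suc s)) s"
    using F_props(2)[of "Suc s"] s by (intro L.op_multiples_mono) auto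
  moreover have "op_multiples L act (F s) (F (Suc s)) s \<subseteq> F s"
    using L.stable_op_multiples[OF stable_F[OF sn s'] stable_F[OF sn, of "Suc s"] F_decreasing[OF s] order.refl] s
    by simp
  ultimately have proper: "op_multiples L act (F s) {\<zero>\<^bsub>L\<^esub>} s \<noteq> F s"
    using regular_step(2)[OF s sn order.refl ne] by blast
  have "regular_sequence R (restrict_to L (F s)) ?xs"
    unfolding regular_sequence_def
  proof (intro conjI allI impI ballI)
    show "multiples_submodule R (restrict_to L (F s)) (set ?xs) \<noteq> carrier (restrict_to L (F s))"
      using take[of s] proper by simp
  next
    fix i m assume i: "i < length ?xs" and m: "m \<in> carrier (restrict_to L (F s))"
      and mem: "?xs ! i \<odot>\<^bsub>restrict_to L (F s)\<^esub> m \<in> multiples_submodule R (restrict_to L (F s)) (set (take i ?xs))"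
    have "i < s" using i by simp
    moreover have "m \<in> F s" using m by simp
    moreover have "act i m \<in> op_multiples L act (F s) {\<zero>\<^bsub>L\<^esub>} i"
      using mem take[of i] \<open>i < s\<close> by simp
    ultimately have "m \<in> op_multiples L act (F s) {\<zero>\<^bsub>L\<^esub>} i"
      using regular_F[OF sn order.refl s'] by (simp add: weakly_regular_def)
    thus "m \<in> multiples_submodule R (restrict_to L (F s)) (set (take i ?xs))"
      using take[of i] \<open>i < s\<close> by simp
  qed
  moreover have "set ?xs \<subseteq> (\<Union>d\<in>{d. d > 0}. gpart R d)"
  proof
    fix y assume "y \<in> set ?xs"
    then obtain i where "i < s" "y = dickson_elt \<eta> i" by auto
    hence "i < n" "y = dickson_elt \<eta> i" using sn by auto
    thus "y \<in> (\<Union>d\<in>{d. d > 0}. gpart R d)"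
      using dickson_elt_gpart[of i] by blast
  qed
  ultimately have "enat (length ?xs) \<le> depth R (restrict_to L (F s))"
    unfolding depth_def by (intro Sup_upper) blast
  thus ?thesis by simp
qed

end

theorem proposition2p4:
  fixes scale :: "'p::prime_card mod_ring \<Rightarrow> 'w::ab_group_add \<Rightarrow> 'w"
    and Basis :: "'w set"
    and R :: "('p mod_ring, 'r) graded"
    and \<eta> :: "(('w \<Rightarrow> 'p mod_ring) multiset \<Rightarrow>\<^sub>0 'p mod_ring) set \<Rightarrow> 'r"
    and L :: "('r, 'm) graded"
    and F :: "nat \<Rightarrow> 'm set"
    and i :: nat
  assumes "finite_dimensional_vector_space scale Basis"
    and "finite_PW_algebra scale R \<eta>"
    and "graded_module R L"
    and "free_rank_filtration scale R \<eta> L i F"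
  shows "(\<forall>s\<le>i + 1. krull_dimension R (graded_quotient L (F s)) < ereal (real s)) \<and>
         (connected_algebra R \<longrightarrow>
            (\<forall>s\<le>i. F (s + 1) \<noteq> F s \<longrightarrow> enat s \<le> depth R (restrict_to L (F s))))"
proof -
  interpret filtered_module scale Basis R L \<eta> F i
    using assms
    by (intro filtered_module.intro filtered_module_axioms.intro ambient.intro)
      (auto simp: finite_PW_algebra_def)
  have "krull_dimension R (graded_quotient L (F s)) < ereal (real s)" if "s \<le> i + 1" for s
    by (rule krull_dimension_quotient) (use that in simp)
  moreover have "enat s \<le> depth R (restrict_to L (F s))" if "s \<le> i" "F (s + 1) \<noteq> F s" for s
    by (rule depth_filtration) (use that in simp_all)
  ultimately show ?thesis by blast
qed

end
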